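(* Let $G=\mathrm{GU}_4(F)$ for the unramified quadratic extension $E/F$ and $H=\mathrm{GU}_2(F)\times_{\mathrm{sim}}\mathrm{GU}_2(F)$, with $\widetilde G$, $\widetilde\iota$, $U$, $\widetilde K$, $\widetilde L$, $\widetilde{\mathfrak H}_c$ as in the context, let $M_{H,\mathcal O}$ be the trivial functor and $x_U=1_{\mathcal O}\in M_{H,\mathcal O}(U)=\mathcal O$. If $2\in\mathscr O_F^\times$, then there exists a zeta element for $(x_U,\widetilde{\mathfrak H}_c,\widetilde L)$ for all $c\in\mathbb Z\setminus2\mathbb Z$.
   Context: $F$ is a non-archimedean local field of characteristic zero with ring of integers $\mathscr O_F$, uniformizer $\varpi$, residue cardinality $q$; $E/F$ is the unramified quadratic extension with nontrivial automorphism $\gamma$ and ring of integers $\mathscr O_E$. $\mathcal O$ is an integral domain containing $\mathbb Z[q^{-1}]$; $\Phi$ is a field containing $\mathcal O$. **Groups.** $J=\begin{pmatrix}&1_2\\1_2&\end{pmatrix}$, $G=\mathrm{GU}_4(F)=\{g\in\mathrm{GL}_4(E):\gamma({}^tg)Jg=\mathrm{sim}(g)J,\ \mathrm{sim}(g)\in F^\times\}$, $K=G\cap\mathrm{GL}_4(\mathscr O_E)$. $\mathrm{GU}_2(F)$ is defined in the same way using $J_2=\begin{pmatrix}&1\\1&\end{pmatrix}$; $H=\{(h_1,h_2)\in\mathrm{GU}_2(F)^2:\mathrm{sim}(h_1)=\mathrm{sim}(h_2)\}$ is embedded by $$\iota\left(\begin{pmatrix}a&b\\c&d\end{pmatrix},\begin{pmatrix}a_1&b_1\\c_1&d_1\end{pmatrix}\right)=\begin{pmatrix}a&&b&\\&a_1&&b_1\\c&&d&\\&c_1&&d_1\end{pmatrix},$$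 and $U=H\cap K$. $T=C=\{z\in E^\times:z\gamma(z)=1\}$, $D=\{z/\gamma(z):z\in\mathscr O_F^\times+\varpi\mathscr O_E\}$ (of index $q+1$ in $C$), $\nu:H\to T$, $(h_1,h_2)\mapsto\det h_2/\det h_1$. $\widetilde G=G\times T$, $\widetilde\iota=\iota\times\nu$ (through which $H$ is a subgroup of $\widetilde G$), $\widetilde K=K\times C$, $\widetilde L=K\times D$. **Hecke polynomial.** $\Lambda=\mathbb Z\phi_0\oplus\mathbb Z\phi_1\oplus\mathbb Z\phi_2$; for $\lambda=(a_0,a_1,a_2)=a_0\phi_0+a_1\phi_1+a_2\phi_2$ put $\varpi^\lambda=\mathrm{diag}(\varpi^{a_1},\varpi^{a_2},\varpi^{a_0-a_1},\varpi^{a_0-a_2})\in G$, $\langle\lambda,\delta\rangle=-2a_0+3a_1+a_2$, $e^\lambda$ the group-algebra element, $y_i=e^{\phi_i}$. The relative Weyl group $W$ is generated by $s_1:\phi_1\leftrightarrow\phi_2$ (fixing $\phi_0$) and $s_2:\phi_0\mapsto\phi_0+\phi_2,\ \phi_1\mapsto\phi_1,\ \phi_2\mapsto-\phi_2$. Let $\mathcal N\subset G$ be the unipotent subgroup of block matrices $\begin{pmatrix}A&B\\0&D\end{pmatrix}$ ($2\times2$ blocks) with $A$ upper triangular unipotent and $D$ lower triangular unipotent. With $\mathcal R=\mathbb Z[q^{\pm1/2}]$, the Satake transform $\mathscr S:\mathcal H_{\mathcal R}(K\backslash G/K)\to\mathcal R[\Lambda]^W$ (Haar measure with $K$ of volume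 1) is the $\mathcal R$-algebra isomorphism sending $\mathrm{ch}(K\sigma K)$ to $\sum q^{-\langle\lambda,\delta\rangle}e^\lambda$, the sum over left cosets $\varpi^\lambda uK\subset K\sigma K$ ($\lambda\in\Lambda,u\in\mathcal N$). $\mathfrak H_{\mathrm{bc},c}(X)$ is the polynomial with $\mathscr S(\mathfrak H_{\mathrm{bc},c}(X))=\mathfrak S_{\mathrm{bc}}(q^{-c}X)$, where $\mathfrak S_{\mathrm{bc}}(X)=(1-yy_1X)(1-yy_1^{-1}X)(1-yy_2X)(1-yy_2^{-1}X)$, $y=y_0^2y_1y_2$; its coefficients lie in $\mathcal H_{\mathbb Z[q^{-1}]}(K\backslash G/K)$. $\widetilde{\mathfrak H}_c=\mathfrak H_{\mathrm{bc},c}(\mathrm{Frob})$ with $\mathrm{Frob}=\mathrm{ch}(C)$, i.e. each term $\mathrm{ch}(K\sigma K)X^k$ is replaced by the function $\mathrm{ch}(K\sigma K\times C)$ on $\widetilde G$. **Zeta elements (trivial functor).** The trivial functor assigns $M_{H,\mathcal O}(V)=\mathcal O$ to every compact open $V\subset H$, with restriction and conjugation maps the identity and the pushforward for $V\subset W$ equal to multiplication by $[W:V]$; its inductive completion over $\Phi$ is $\Phi$ with trivial $H$-action. For compact open $V_1,V_2\subset H$ put $[V_1:V_2]=\mu_H(V_1)/\mu_H(V_2)$ for a Haar measure $\mu_H$. Let $\mathcal C(\widetilde G/\widetilde K,\Phi)$ be the space of right $\widetilde K$-invariant compactly supported functions $\xi:\widetilde G\to\Phi$, with $H$-action $(h\xi)(g)=\xi(h^{-1}g)$.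 A zeta element for $(x_U,\widetilde{\mathfrak H}_c,\widetilde L)$ is a $\zeta\in\mathcal C(\widetilde G/\widetilde K,\Phi)$ such that (i) for each $g\in\widetilde G$, $\zeta(g)$ is a finite sum $\sum_i[U:V_i]\,x_i$ with $V_i\subset H\cap g\widetilde Lg^{-1}$ compact open in $H$ and $x_i\in\mathcal O$; (ii) $\zeta$ and the function $x_U\otimes\widetilde{\mathfrak H}_c:g\mapsto\widetilde{\mathfrak H}_c(g)\,x_U$ have the same image in the $H$-coinvariants $\mathcal C(\widetilde G/\widetilde K,\Phi)_H$. *)

theory Defs
  imports
    "HOL-Analysis.Analysis"
    "HOL-Algebra.Coset"
    "HOL-Computational_Algebra.Polynomial"
    "HOL-Library.Poly_Mapping"
    "HOL-Library.Function_Algebras"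
begin

text \<open>The integer valuation \<^term>\<open>v\<close> is only meaningful at nonzero arguments; the
  conventional value at \<open>0\<close> is infinite, so \<open>0\<close> is treated separately throughout.\<close>

definition val_ring :: "'e::field set \<Rightarrow> ('e \<Rightarrow> int) \<Rightarrow> 'e set" where
  "val_ring L v = {x \<in> L. x = 0 \<or> 0 \<le> v x}"

definition val_units :: "'e::field set \<Rightarrow> ('e \<Rightarrow> int) \<Rightarrow> 'e set" where
  "val_units L v = {x \<in> val_ring L v. x \<noteq> 0 \<and> inverse x \<in> val_ring L v}"

definition max_ideal :: "'e::field set \<Rightarrow> ('e \<Rightarrow> int) \<Rightarrow> 'e set" where
  "max_ideal L v = {x \<in> L. x = 0 \<or> 1 \<le> v x}"

definition residue_classes :: "'e::field set \<Rightarrow> ('e \<Rightarrow> int) \<Rightarrow> 'e set set" where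
  "residue_classes L v =
     (\<lambda>x. {y \<in> val_ring L v. y - x \<in> max_ideal L v}) ` val_ring L v"

text \<open>The base \<open>2\<close> is immaterial: any base greater than \<open>1\<close> yields the same topology and
  the same Cauchy sequences.\<close>

definition val_dist :: "('e::field \<Rightarrow> int) \<Rightarrow> 'e \<Rightarrow> 'e \<Rightarrow> real" where
  "val_dist v x y = (if x = y then 0 else 2 powi (- v (x - y)))"

text \<open>A subfield \<open>L\<close> of the ambient field which is a local field with normalized
  discrete valuation \<open>v\<close>; the ambient field has characteristic zero.\<close>

locale nonarch_local_field =
  fixes L :: "'e::field_char_0 set" and v :: "'e \<Rightarrow> int"
  assumes one_closed: "1 \<in> L"
    and diff_closed: "\<lbrakk>x \<in> L; y \<in> L\<rbrakk> \<Longrightarrow> x - y \<in> L"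
    and mult_closed: "\<lbrakk>x \<in> L; y \<in> L\<rbrakk> \<Longrightarrow> x * y \<in> L"
    and inverse_closed: "x \<in> L \<Longrightarrow> inverse x \<in> L"
    and val_mult: "\<lbrakk>x \<in> L; y \<in> L; x \<noteq> 0; y \<noteq> 0\<rbrakk> \<Longrightarrow> v (x * y) = v x + v y"
    and val_add: "\<lbrakk>x \<in> L; y \<in> L; x \<noteq> 0; y \<noteq> 0; x + y \<noteq> 0\<rbrakk> \<Longrightarrow> min (v x) (v y) \<le> v (x + y)"
    and val_normalized: "\<exists>x\<in>L. x \<noteq> 0 \<and> v x = 1"
    and finite_residue_field: "finite (residue_classes L v)"
    and complete: "Metric_space.mcomplete L (val_dist v)"

text \<open>No regularity condition is imposed: it is automatic on the second countable locally
  compact groups to which this is applied.\<close>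

definition left_haar_measure :: "'a topology \<Rightarrow> ('a, 'b) monoid_scheme \<Rightarrow> 'a measure \<Rightarrow> bool" where
  "left_haar_measure X \<G> \<mu> \<longleftrightarrow>
     space \<mu> = carrier \<G> \<and>
     sets \<mu> = sigma_sets (carrier \<G>) {S. openin X S} \<and>
     (\<forall>g\<in>carrier \<G>. \<forall>A\<in>sets \<mu>. emeasure \<mu> (g <#\<^bsub>\<G>\<^esub> A) = emeasure \<mu> A) \<and>
     (\<forall>S. compactin X S \<longrightarrow> emeasure \<mu> S < \<infinity>) \<and>
     (\<forall>S. openin X S \<and> S \<noteq> {} \<longrightarrow> 0 < emeasure \<mu> S)"

text \<open>Functions on a subset of a type are represented by functions on the type that vanish
  off the subset.\<close>

definition compactly_supported :: "'a topology \<Rightarrow> ('a \<Rightarrow> 'c::zero) \<Rightarrow> bool" where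
  "compactly_supported X f \<longleftrightarrow>
     (\<forall>x. x \<notin> topspace X \<longrightarrow> f x = 0) \<and> compactin X (X closure_of {x. f x \<noteq> 0})"

text \<open>The image in a field of characteristic zero of a real number that happens to be
  rational.  It is applied only to such numbers.\<close>

definition rat_image :: "real \<Rightarrow> 'p::field_char_0" where
  "rat_image x = of_rat (the_inv real_of_rat x)"

definition map_entries :: "('e \<Rightarrow> 'f) \<Rightarrow> 'e^'n^'m \<Rightarrow> 'f^'n^'m" where
  "map_entries f A = (\<chi> i j. f (A $ i $ j))"

definition J2 :: "'e::field^2^2" where
  "J2 = vector [vector [0, 1], vector [1, 0]]"

definition J4 :: "'e::field^4^4" where
  "J4 = vector [vector [0, 0, 1, 0],
                vector [0, 0, 0, 1],
                vector [1, 0, 0, 0],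
                vector [0, 1, 0, 0]]"

definition \<iota> :: "('e::field^2^2) \<times> ('e^2^2) \<Rightarrow> 'e^4^4" where
  "\<iota> = (\<lambda>(h, k).
     vector [vector [h$1$1, 0,     h$1$2, 0    ],
             vector [0,     k$1$1, 0,     k$1$2],
             vector [h$2$1, 0,     h$2$2, 0    ],
             vector [0,     k$2$1, 0,     k$2$2]])"

text \<open>\<open>(a\<^sub>0, a\<^sub>1, a\<^sub>2)\<close> stands for \<open>a\<^sub>0 \<phi>\<^sub>0 + a\<^sub>1 \<phi>\<^sub>1 + a\<^sub>2 \<phi>\<^sub>2\<close>.  Finitely supported
  maps out of the lattice carry the convolution product.\<close>

type_synonym lattice3 = "int \<times> int \<times> int"
type_synonym group_alg = "lattice3 \<Rightarrow>\<^sub>0 real"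

abbreviation e_pow :: "lattice3 \<Rightarrow> group_alg" where
  "e_pow l \<equiv> Poly_Mapping.single l 1"

definition pair_delta :: "lattice3 \<Rightarrow> int" where
  "pair_delta = (\<lambda>(a0, a1, a2). - 2 * a0 + 3 * a1 + a2)"

definition S_bc :: "group_alg poly" where
  "S_bc =
    (let y0 = e_pow (1, 0, 0); y1 = e_pow (0, 1, 0); y2 = e_pow (0, 0, 1);
         y1i = e_pow (0, - 1, 0); y2i = e_pow (0, 0, - 1);
         y = y0 ^ 2 * y1 * y2
     in [:1, - (y * y1):] * [:1, - (y * y1i):] * [:1, - (y * y2):] * [:1, - (y * y2i):])"

text \<open>\<open>E\<close> is the whole type, \<open>F\<close> a subset of it.\<close>

locale gu4_data =
  fixes F :: "'e::field_char_0 set" and v :: "'e \<Rightarrow> int"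
    and \<gamma> :: "'e \<Rightarrow> 'e" and \<pi> :: 'e
begin

abbreviation OE :: "'e set" where "OE \<equiv> val_ring UNIV v"

definition q :: nat where
  "q = card (residue_classes F v)"

definition field_top :: "'e topology" where
  "field_top = Metric_space.mtopology UNIV (val_dist v)"

text \<open>Inversion on \<open>GL\<^sub>n\<close> of a topological field is continuous, so the topology of
  matrix groups is the one induced from the space of all matrices.\<close>

definition mat_top :: "('e^'n^'m) topology" where
  "mat_top = pullback_topology UNIV (\<lambda>A (i, j). A $ i $ j) (product_topology (\<lambda>_. field_top) UNIV)"

definition is_sim :: "'e^'n^'n \<Rightarrow> 'e^'n^'n \<Rightarrow> 'e \<Rightarrow> bool" where
  "is_sim J g s \<longleftrightarrow>
     s \<in> F \<and> s \<noteq> 0 \<and> map_entries \<gamma> (transpose g) ** J ** g = mat s ** J"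

definition sim :: "'e^'n^'n \<Rightarrow> 'e^'n^'n \<Rightarrow> 'e" where
  "sim J g = (THE s. is_sim J g s)"

definition GU :: "'e^'n^'n \<Rightarrow> ('e^'n^'n) monoid" where
  "GU J = \<lparr>carrier = {g. invertible g \<and> (\<exists>s. is_sim J g s)}, monoid.mult = (**), one = mat 1\<rparr>"

abbreviation G :: "('e^4^4) monoid" where "G \<equiv> GU J4"

definition K :: "('e^4^4) set" where
  "K = {g \<in> carrier G. \<forall>i j. g $ i $ j \<in> OE \<and> matrix_inv g $ i $ j \<in> OE}"

definition G_top :: "('e^4^4) topology" where
  "G_top = subtopology mat_top (carrier G)"

definition H :: "(('e^2^2) \<times> ('e^2^2)) monoid" where
  "H = \<lparr>carrier = {(h, k). h \<in> carrier (GU J2) \<and> k \<in> carrier (GU J2) \<and> sim J2 h = sim J2 k},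
        monoid.mult = (\<lambda>(h, k) (h', k'). (h ** h', k ** k')), one = (mat 1, mat 1)\<rparr>"

definition H_top :: "(('e^2^2) \<times> ('e^2^2)) topology" where
  "H_top = subtopology (prod_topology mat_top mat_top) (carrier H)"

definition U :: "(('e^2^2) \<times> ('e^2^2)) set" where
  "U = {h \<in> carrier H. \<iota> h \<in> K}"

definition C :: "'e set" where
  "C = {z. z \<noteq> 0 \<and> z * \<gamma> z = 1}"

definition D :: "'e set" where
  "D = {z / \<gamma> z | z. \<exists>a\<in>val_units F v. \<exists>b\<in>OE. z = a + \<pi> * b}"

definition T :: "'e monoid" where
  "T = \<lparr>carrier = C, monoid.mult = (*), one = 1\<rparr>"

definition \<nu> :: "('e^2^2) \<times> ('e^2^2) \<Rightarrow> 'e" where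
  "\<nu> = (\<lambda>(h, k). det k / det h)"

definition Gt :: "(('e^4^4) \<times> 'e) monoid" where
  "Gt = G \<times>\<times> T"

definition Gt_top :: "(('e^4^4) \<times> 'e) topology" where
  "Gt_top = prod_topology G_top (subtopology field_top C)"

definition \<iota>t :: "('e^2^2) \<times> ('e^2^2) \<Rightarrow> ('e^4^4) \<times> 'e" where
  "\<iota>t h = (\<iota> h, \<nu> h)"

definition Kt :: "(('e^4^4) \<times> 'e) set" where "Kt = K \<times> C"

definition Lt :: "(('e^4^4) \<times> 'e) set" where "Lt = K \<times> D"

text \<open>The ring \<open>\<int>[q\<^sup>1\<^sup>/\<^sup>2, q\<^sup>-\<^sup>1\<^sup>/\<^sup>2]\<close> inside the reals.\<close>

definition sqrt_q_ring :: "real set" where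
  "sqrt_q_ring = {poly (map_poly real_of_int p) (sqrt (real q)) / sqrt (real q) ^ n | p n. True}"

definition hecke_algebra :: "('e^4^4 \<Rightarrow> real) set" where
  "hecke_algebra = {f. range f \<subseteq> sqrt_q_ring \<and> compactly_supported G_top f \<and>
     (\<forall>g\<in>carrier G. \<forall>k\<in>K. \<forall>k'\<in>K. f (k ** g ** k') = f g)}"

definition pi_pow :: "lattice3 \<Rightarrow> 'e^4^4" where
  "pi_pow = (\<lambda>(a0, a1, a2). \<chi> i j. if i = j
     then vector [\<pi> powi a1, \<pi> powi a2, \<pi> powi (a0 - a1), \<pi> powi (a0 - a2)] $ i else 0)"

definition N :: "('e^4^4) set" where
  "N = {u \<in> carrier G. (\<forall>i. u $ i $ i = 1) \<and>
     u $ 2 $ 1 = 0 \<and> u $ 3 $ 4 = 0 \<and>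
     u $ 3 $ 1 = 0 \<and> u $ 3 $ 2 = 0 \<and> u $ 4 $ 1 = 0 \<and> u $ 4 $ 2 = 0}"

definition double_coset :: "'e^4^4 \<Rightarrow> ('e^4^4) set" where
  "double_coset \<sigma> = K <#>\<^bsub>G\<^esub> (\<sigma> <#\<^bsub>G\<^esub> K)"

text \<open>\<open>satake_ch B\<close> is the family of coefficients of the transform of the characteristic
  function of the double coset \<open>B\<close>, and \<open>satake\<close> is its linear extension.\<close>

definition satake_ch :: "('e^4^4) set \<Rightarrow> lattice3 \<Rightarrow> real" where
  "satake_ch B l = real q powi (- pair_delta l) *
     real (card {A. A \<subseteq> B \<and> (\<exists>u\<in>N. A = (pi_pow l ** u) <#\<^bsub>G\<^esub> K)})"

definition satake :: "('e^4^4 \<Rightarrow> real) \<Rightarrow> lattice3 \<Rightarrow> real" where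
  "satake f l =
     (\<Sum>B \<in> {double_coset \<sigma> | \<sigma>. \<sigma> \<in> carrier G \<and> f \<sigma> \<noteq> 0}. f (SOME \<sigma>. \<sigma> \<in> B) * satake_ch B l)"

text \<open>\<open>hecke_poly c k\<close> is the coefficient of \<open>X\<^sup>k\<close> in the Hecke polynomial.\<close>

definition hecke_poly :: "int \<Rightarrow> nat \<Rightarrow> 'e^4^4 \<Rightarrow> real" where
  "hecke_poly c k = (THE f. f \<in> hecke_algebra \<and>
     satake f = Poly_Mapping.lookup
       (coeff (pcompose S_bc [:0, Poly_Mapping.single 0 (real q powi (- c)):]) k))"

definition hecke_tilde :: "int \<Rightarrow> ('e^4^4) \<times> 'e \<Rightarrow> 'p::field_char_0" where
  "hecke_tilde c = (\<lambda>(g, t). if t \<in> C then \<Sum>k\<le>degree S_bc. rat_image (hecke_poly c k g) else 0)"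

text \<open>An integral domain containing \<open>\<int>[q\<^sup>-\<^sup>1]\<close>, as a subring of the field \<open>'p\<close>.\<close>

definition coefficient_ring :: "'p::field_char_0 set \<Rightarrow> bool" where
  "coefficient_ring R \<longleftrightarrow> 1 \<in> R \<and> (\<forall>x\<in>R. \<forall>y\<in>R. x - y \<in> R \<and> x * y \<in> R) \<and>
     inverse (of_nat q) \<in> R"

definition inv_functions :: "(('e^4^4) \<times> 'e \<Rightarrow> 'p::field_char_0) set" where
  "inv_functions = {\<xi>. compactly_supported Gt_top \<xi> \<and>
     (\<forall>g\<in>carrier Gt. \<forall>k\<in>Kt. \<xi> (g \<otimes>\<^bsub>Gt\<^esub> k) = \<xi> g)}"

definition H_act ::
    "('e^2^2) \<times> ('e^2^2) \<Rightarrow> (('e^4^4) \<times> 'e \<Rightarrow> 'p::field_char_0) \<Rightarrow> ('e^4^4) \<times> 'e \<Rightarrow> 'p" where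
  "H_act h \<xi> = (\<lambda>g. if g \<in> carrier Gt then \<xi> (\<iota>t (inv\<^bsub>H\<^esub> h) \<otimes>\<^bsub>Gt\<^esub> g) else 0)"

text \<open>The kernel of the projection of \<open>inv_functions\<close> onto its \<open>H\<close>-coinvariants.\<close>

definition coinv_kernel :: "(('e^4^4) \<times> 'e \<Rightarrow> 'p::field_char_0) set" where
  "coinv_kernel = module.span (\<lambda>a \<xi> g. a * \<xi> g)
     {H_act h \<xi> - \<xi> | h \<xi>. h \<in> carrier H \<and> \<xi> \<in> inv_functions}"

definition compact_open_subgroup :: "(('e^2^2) \<times> ('e^2^2)) set \<Rightarrow> bool" where
  "compact_open_subgroup V \<longleftrightarrow> subgroup V H \<and> compactin H_top V \<and> openin H_top V"

text \<open>\<open>zeta_element \<mu> R x f L \<zeta>\<close>: \<open>\<zeta>\<close> is a zeta element for the triple \<open>(x, f, L)\<close>, where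
  \<open>x \<in> R\<close> is an element of the value at \<open>U\<close> of the trivial functor with coefficients in
  \<open>R\<close>, and \<open>\<mu>\<close> is a Haar measure on \<open>H\<close>.\<close>

definition zeta_element ::
    "(('e^2^2) \<times> ('e^2^2)) measure \<Rightarrow> 'p::field_char_0 set \<Rightarrow> 'p \<Rightarrow> (('e^4^4) \<times> 'e \<Rightarrow> 'p)
      \<Rightarrow> (('e^4^4) \<times> 'e) set \<Rightarrow> (('e^4^4) \<times> 'e \<Rightarrow> 'p) \<Rightarrow> bool" where
  "zeta_element \<mu> R x f L \<zeta> \<longleftrightarrow>
     \<zeta> \<in> inv_functions \<and>
     (\<forall>g\<in>carrier Gt. \<exists>Vxs.
        (\<forall>(V, y)\<in>set Vxs. compact_open_subgroup V \<and>
           \<iota>t ` V \<subseteq> (g <#\<^bsub>Gt\<^esub> L) #>\<^bsub>Gt\<^esub> inv\<^bsub>Gt\<^esub> g \<and> y \<in> R) \<and>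
        \<zeta> g = (\<Sum>(V, y)\<leftarrow>Vxs. rat_image (measure \<mu> U / measure \<mu> V) * y)) \<and>
     \<zeta> - (\<lambda>g. f g * x) \<in> coinv_kernel"

end

text \<open>Since a single function \<open>v\<close> is the normalized valuation both of \<open>F\<close> and of \<open>E\<close>, the
  ramification index is \<open>1\<close>; the residue fields being finite, \<open>E/F\<close> is unramified.\<close>

locale unramified_quadratic_extension =
  gu4_data F v \<gamma> \<pi> + F: nonarch_local_field F v + E: nonarch_local_field UNIV v
  for F :: "'e::field_char_0 set" and v and \<gamma> and \<pi> +
  assumes degree_two: "\<exists>\<theta>. \<forall>z. \<exists>!(a, b). a \<in> F \<and> b \<in> F \<and> z = a + b * \<theta>"
    and gamma_bij: "bij \<gamma>"
    and gamma_add: "\<gamma> (x + y) = \<gamma> x + \<gamma> y"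
    and gamma_mult: "\<gamma> (x * y) = \<gamma> x * \<gamma> y"
    and gamma_fixes: "a \<in> F \<Longrightarrow> \<gamma> a = a"
    and gamma_nontrivial: "\<gamma> \<noteq> id"
    and uniformizer: "\<pi> \<in> F" "\<pi> \<noteq> 0" "v \<pi> = 1"

end

theory Submission
  imports Defs
begin

text \<open>Summing the Hecke polynomial over its degree gives a bi-\<open>K\<close>-invariant function \<open>f\<close> on \<open>G\<close>, and
  \<open>\<zeta>\<close> is obtained by moving the values of \<open>f\<close> on all cosets \<open>gK\<close> in one \<open>H\<close>-orbit to a single
  coset \<open>rK\<close>; the coinvariants do not change, and the claim is that the sum \<open>deg r\<close> of \<open>f\<close> over the
  orbit is an element of \<open>\<int>[1/q]\<close> times \<open>\<mu>(U) / \<mu>(V)\<close>, with \<open>V\<close> the subgroup of the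
  stabilizer \<open>H\<^sub>r\<close> of \<open>rK\<close> on which \<open>\<nu>\<close> takes values in \<open>D\<close>.  Integrating \<open>h \<mapsto> f (h r)\<close> over
  the unimodular group \<open>H\<close> in two ways gives \<open>deg r * \<mu>(H\<^sub>r) = \<mu>(U) * (\<Sum> f (h r))\<close>, the sum over
  \<open>U\<setminus>H\<close>.  This settles the case \<open>\<nu>(H\<^sub>r) \<subseteq> D\<close>.  Otherwise \<open>\<mu>(H\<^sub>r) = (q + 1) * \<mu>(V)\<close>
  and the lattice \<open>r O\<^sup>4\<close> contains, in each of the two hyperbolic planes defining \<open>H\<close>, a vector whose norm
  generates the norms of the lattice.  The rank one projections onto these vectors define two tori,
  isomorphic to \<open>C\<close>, in \<open>H\<^sub>r\<close>, which act on \<open>U\<setminus>H\<close> from the right.  Orbits on which stabilizers lie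
  in \<open>D\<close> contribute multiples of \<open>q + 1\<close>.  On the remaining points both projections become integral, which
  leaves one orbit of the centre, consisting of elements at which \<open>f\<close> is given by the first two
  elementary divisor types.  There the explicit Satake transform shows that the sum of \<open>f\<close> over the
  centre is divisible by \<open>q + 1\<close> when \<open>c\<close> is odd.\<close>

text \<open>The obstacle is one factor: \<open>D\<close> has index \<open>q + 1\<close> in
  \<open>C\<close>, and shrinking the stabilizer to its part with \<open>\<nu>\<close> in
  \<open>D\<close> may cost exactly that. As \<open>q\<close> is invertible, it may be replaced by
  -1 modulo \<open>q + 1\<close>. For odd \<open>c\<close> the values of \<open>f\<close> along the
  centre then become 1, -4, 6, -4, 1 on the first elementary divisor type and -1, 2, -1 on the
  second, the coefficients of (1 - X)^4 and -X (1 - X)^2; both vanish at X = 1. The third type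
  carries one coefficient, congruent to 1, and would spoil this, so it has to be excluded on the
  last orbit.

  The two vectors exist for this reason: if a plane contains none, its part of the lattice reduces
  to a maximal isotropic subspace. A stabilizing similitude acts on it and on the quotient dually,
  up to conjugation and the similitude factor, so the two determinants are congruent and
  \<open>\<nu>\<close> lies in \<open>D\<close>.

  That 2 is a unit is used to split O_E by a skew unit, to polarize the hermitian form, and in the
  Cayley parametrization of \<open>C\<close>.\<close>

locale odd_unramified_extension = unramified_quadratic_extension F v \<gamma> \<pi>
  for F :: "'e::field_char_0 set" and v and \<gamma> and \<pi> +
  assumes two_unit: "2 \<in> val_units F v"
begin

section \<open>Valuation ideals and the conjugation of E over F\<close>

definition idl :: "int \<Rightarrow> 'e set" where
  "idl n = {x. x = 0 \<or> n \<le> v x}"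

lemma v_mult: "x \<noteq> 0 \<Longrightarrow> y \<noteq> 0 \<Longrightarrow> v (x * y) = v x + v y"
  using E.val_mult by auto

lemma v_one [simp]: "v 1 = 0"
  using v_mult[of 1 1] by simp

lemma v_minus_one: "v (-1) = 0"
  using v_mult[of "-1" "-1"] by simp

lemma v_minus [simp]: "v (- x) = v x"
  by (cases "x = 0") (use v_mult[of "-1" x] v_minus_one in auto)

lemma v_inverse: "x \<noteq> 0 \<Longrightarrow> v (inverse x) = - v x"
  using v_mult[of x "inverse x"] by simp

lemma v_divide: "x \<noteq> 0 \<Longrightarrow> y \<noteq> 0 \<Longrightarrow> v (x / y) = v x - v y"
  by (simp add: divide_inverse v_mult v_inverse)

lemma v_power: "x \<noteq> 0 \<Longrightarrow> v (x ^ n) = int n * v x"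
  by (induction n) (auto simp: v_mult algebra_simps)

lemma v_powi: "x \<noteq> 0 \<Longrightarrow> v (x powi k) = k * v x"
  by (auto simp: power_int_def v_power v_inverse)

lemma pi_nonzero [simp]: "\<pi> \<noteq> 0" and v_pi [simp]: "v \<pi> = 1" and pi_in_F [simp]: "\<pi> \<in> F"
  using uniformizer by auto

lemma v_pi_powi [simp]: "v (\<pi> powi k) = k"
  by (simp add: v_powi)

lemma v_add: "x + y \<noteq> 0 \<Longrightarrow> x \<noteq> 0 \<Longrightarrow> y \<noteq> 0 \<Longrightarrow> min (v x) (v y) \<le> v (x + y)"
  using E.val_add by auto

lemma idl_zero [simp]: "0 \<in> idl n"
  by (simp add: idl_def)

lemma idl_add: "x \<in> idl n \<Longrightarrow> y \<in> idl n \<Longrightarrow> x + y \<in> idl n"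
  unfolding idl_def using v_add[of x y] by (cases "x = 0"; cases "y = 0"; cases "x + y = 0") auto

lemma idl_minus_iff [simp]: "- x \<in> idl n \<longleftrightarrow> x \<in> idl n"
  by (simp add: idl_def)

lemma idl_diff: "x \<in> idl n \<Longrightarrow> y \<in> idl n \<Longrightarrow> x - y \<in> idl n"
  using idl_add[of x n "-y"] by simp

lemma idl_mult: "x \<in> idl m \<Longrightarrow> y \<in> idl n \<Longrightarrow> x * y \<in> idl (m + n)"
  by (cases "x = 0 \<or> y = 0") (auto simp: idl_def v_mult)

lemma idl_mono: "x \<in> idl n \<Longrightarrow> m \<le> n \<Longrightarrow> x \<in> idl m"
  by (auto simp: idl_def)

lemma idl_mult0: "x \<in> idl 0 \<Longrightarrow> y \<in> idl n \<Longrightarrow> x * y \<in> idl n"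
  using idl_mult[of x 0 y n] by simp

lemma idl_mult0': "x \<in> idl n \<Longrightarrow> y \<in> idl 0 \<Longrightarrow> x * y \<in> idl n"
  using idl_mult[of x n y 0] by simp

lemma idl_sum: "(\<And>i. i \<in> A \<Longrightarrow> f i \<in> idl n) \<Longrightarrow> sum f A \<in> idl n"
  by (induction A rule: infinite_finite_induct) (auto intro: idl_add)

lemma idl_mult_iff: "c \<noteq> 0 \<Longrightarrow> c * x \<in> idl n \<longleftrightarrow> x \<in> idl (n - v c)"
  by (cases "x = 0") (auto simp: idl_def v_mult)

lemma idl_mult_iff': "c \<noteq> 0 \<Longrightarrow> x * c \<in> idl n \<longleftrightarrow> x \<in> idl (n - v c)"
  by (cases "x = 0") (auto simp: idl_def v_mult)

lemma idl_divide_iff: "c \<noteq> 0 \<Longrightarrow> x / c \<in> idl n \<longleftrightarrow> x \<in> idl (n + v c)"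
  by (cases "x = 0") (auto simp: idl_def v_divide)

lemma idl_self: "v x = n \<Longrightarrow> x \<in> idl n"
  by (simp add: idl_def)

lemma idl_one [simp]: "1 \<in> idl 0"
  by (simp add: idl_def)

lemma idl_all_zero: "(\<And>n. x \<in> idl n) \<Longrightarrow> x = 0"
  by (rule ccontr) (use idl_def[of "v x + 1"] in force)

lemma idl_commute: "x - y \<in> idl n \<longleftrightarrow> y - x \<in> idl n"
  using idl_minus_iff[of "x - y"] by simp

lemma idl_cong_trans: "x - y \<in> idl n \<Longrightarrow> y - z \<in> idl n \<Longrightarrow> x - z \<in> idl n"
  using idl_add[of "x - y" n "y - z"] by simp

lemma idl_cong_mem: "x - y \<in> idl n \<Longrightarrow> x \<in> idl n \<longleftrightarrow> y \<in> idl n"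
  using idl_add[of "x - y" n y] idl_diff[of x n "x - y"] by auto

lemma idl_cong_mult:
  assumes "x - x' \<in> idl n" "y - y' \<in> idl n" "x' \<in> idl 0" "y \<in> idl 0"
  shows "x * y - x' * y' \<in> idl n"
proof -
  have "x * y - x' * y' = (x - x') * y + x' * (y - y')" by (simp add: algebra_simps)
  then show ?thesis using idl_add[OF idl_mult0'[OF assms(1,4)] idl_mult0[OF assms(3,2)]] by simp
qed

text \<open>Ultrametric principle: a perturbation smaller than \<open>y\<close> affects neither
  nonvanishing nor valuation. Mostly used with \<open>n = 1\<close>, to carry units along residue
  classes.\<close>

lemma v_cong: "x - y \<in> idl n \<Longrightarrow> y \<noteq> 0 \<Longrightarrow> v y < n \<Longrightarrow> x \<noteq> 0 \<and> v x = v y"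
proof -
  assume a: "x - y \<in> idl n" "y \<noteq> 0" "v y < n"
  have x0: "x \<noteq> 0" using a by (auto simp: idl_def)
  have "x \<in> idl (v y)" using a idl_cong_mem idl_mono[of "x - y" n "v y"] idl_self[of y "v y"] by auto
  moreover have "\<not> x \<in> idl (v y + 1)"
    using a idl_cong_mem[of x y "v y + 1"] idl_mono[of "x - y" n "v y + 1"] by (auto simp: idl_def)
  ultimately show ?thesis using x0 by (auto simp: idl_def)
qed

lemma OE_eq: "OE = idl 0"
  by (auto simp: val_ring_def idl_def)

lemma F_zero [simp]: "0 \<in> F" and F_one [simp]: "1 \<in> F"
  using F.diff_closed[OF F.one_closed F.one_closed] F.one_closed by auto

lemma F_diff: "x \<in> F \<Longrightarrow> y \<in> F \<Longrightarrow> x - y \<in> F"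
  using F.diff_closed .

lemma F_minus: "x \<in> F \<Longrightarrow> - x \<in> F"
  using F.diff_closed[of 0 x] by simp

lemma F_add: "x \<in> F \<Longrightarrow> y \<in> F \<Longrightarrow> x + y \<in> F"
  using F.diff_closed[of x "-y"] F_minus by simp

lemma F_mult: "x \<in> F \<Longrightarrow> y \<in> F \<Longrightarrow> x * y \<in> F"
  using F.mult_closed .

lemma F_inverse: "x \<in> F \<Longrightarrow> inverse x \<in> F"
  using F.inverse_closed .

lemma F_divide: "x \<in> F \<Longrightarrow> y \<in> F \<Longrightarrow> x / y \<in> F"
  by (simp add: divide_inverse F_mult F_inverse)

lemma F_power: "x \<in> F \<Longrightarrow> x ^ n \<in> F"
  by (induction n) (auto simp: F_mult)

lemma F_powi: "x \<in> F \<Longrightarrow> x powi n \<in> F"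
  by (auto simp: power_int_def F_power F_inverse)

lemma two_in_F [simp]: "2 \<in> F" and v_two [simp]: "v 2 = 0"
  using two_unit v_inverse[of 2] by (auto simp: val_units_def val_ring_def)

lemma idl_two_iff [simp]: "2 * x \<in> idl n \<longleftrightarrow> x \<in> idl n" "x * 2 \<in> idl n \<longleftrightarrow> x \<in> idl n"
  "x / 2 \<in> idl n \<longleftrightarrow> x \<in> idl n"
  by (simp_all add: idl_mult_iff idl_mult_iff' idl_divide_iff)

lemma gamma_zero [simp]: "\<gamma> 0 = 0" and gamma_one [simp]: "\<gamma> 1 = 1"
  and gamma_pi [simp]: "\<gamma> \<pi> = \<pi>" and gamma_two [simp]: "\<gamma> 2 = 2"
  using gamma_fixes by auto

lemma gamma_minus: "\<gamma> (- x) = - \<gamma> x"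
  using gamma_add[of x "-x"] by (simp add: eq_neg_iff_add_eq_0 add.commute)

lemma gamma_diff: "\<gamma> (x - y) = \<gamma> x - \<gamma> y"
  using gamma_add[of x "-y"] by (simp add: gamma_minus)

lemma gamma_eq_0 [simp]: "\<gamma> x = 0 \<longleftrightarrow> x = 0"
  using gamma_bij gamma_zero by (metis bij_pointE)

lemma gamma_inverse: "\<gamma> (inverse x) = inverse (\<gamma> x)"
proof (cases "x = 0")
  case False
  then show ?thesis using gamma_mult[of x "inverse x"]
    by (simp add: inverse_unique)
qed auto

lemma gamma_divide: "\<gamma> (x / y) = \<gamma> x / \<gamma> y"
  by (simp add: divide_inverse gamma_mult gamma_inverse)

lemma gamma_power: "\<gamma> (x ^ n) = \<gamma> x ^ n"
  by (induction n) (auto simp: gamma_mult)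

lemma gamma_powi: "\<gamma> (x powi n) = \<gamma> x powi n"
  by (auto simp: power_int_def gamma_power gamma_inverse)

lemma gamma_sum: "\<gamma> (sum f A) = (\<Sum>i\<in>A. \<gamma> (f i))"
  by (induction A rule: infinite_finite_induct) (auto simp: gamma_add)

text \<open>The assumptions give a nontrivial automorphism fixing \<open>F\<close>, but neither its
  order nor its fixed field. Both come from the quadratic equation of a generator, whose conjugate
  must be the other root \<open>b - \<theta>\<close>.\<close>

lemma gamma_invol [simp]: "\<gamma> (\<gamma> x) = x" and gamma_fixed_in_F: "\<gamma> x = x \<Longrightarrow> x \<in> F"
proof -
  obtain \<theta> where \<theta>: "\<And>z. \<exists>!(a, b). a \<in> F \<and> b \<in> F \<and> z = a + b * \<theta>"
    using degree_two by blast
  have ex: "\<exists>a b. a \<in> F \<and> b \<in> F \<and> z = a + b * \<theta>" for z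
    using ex1_implies_ex[OF \<theta>[of z]] by auto
  have g: "\<gamma> (a + b * \<theta>) = a + b * \<gamma> \<theta>" if "a \<in> F" "b \<in> F" for a b
    using that by (simp add: gamma_add gamma_mult gamma_fixes)
  have ne: "\<gamma> \<theta> \<noteq> \<theta>"
  proof
    assume "\<gamma> \<theta> = \<theta>"
    then have "\<gamma> z = z" for z using ex[of z] g by auto
    then show False using gamma_nontrivial by auto
  qed
  obtain a b where ab: "a \<in> F" "b \<in> F" "\<theta> * \<theta> = a + b * \<theta>" using ex by blast
  have "\<gamma> \<theta> * \<gamma> \<theta> = a + b * \<gamma> \<theta>"
    using ab g gamma_mult by metis
  with ab have "(\<gamma> \<theta> - \<theta>) * (\<gamma> \<theta> + \<theta> - b) = 0" by (simp add: algebra_simps)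
  with ne have "\<gamma> \<theta> + \<theta> - b = 0" by simp
  then have gt: "\<gamma> \<theta> = b - \<theta>" by (simp add: algebra_simps)
  have tt: "\<gamma> (\<gamma> \<theta>) = \<theta>" using gt ab by (simp add: gamma_diff gamma_fixes)
  show "\<gamma> (\<gamma> x) = x"
  proof -
    obtain a b where "a \<in> F" "b \<in> F" "x = a + b * \<theta>" using ex by blast
    then show ?thesis by (simp add: gamma_add gamma_mult gamma_fixes tt)
  qed
  show "x \<in> F" if "\<gamma> x = x"
  proof -
    obtain a b where "a \<in> F" "b \<in> F" "x = a + b * \<theta>" using ex by blast
    then have "b * (\<gamma> \<theta> - \<theta>) = 0" using that g[of a b] by (simp add: right_diff_distrib)
    then show ?thesis using ne \<open>x = a + b * \<theta>\<close> \<open>a \<in> F\<close> by auto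
  qed
qed

lemma gamma_in_F_iff: "x \<in> F \<longleftrightarrow> \<gamma> x = x"
  using gamma_fixes gamma_fixed_in_F by auto

lemma norm_in_F: "x * \<gamma> x \<in> F" and trace_in_F: "x + \<gamma> x \<in> F"
  by (simp_all add: gamma_in_F_iff gamma_mult gamma_add ac_simps)

lemma Metric_E: "Metric_space UNIV (val_dist v)"
proof
  fix x y z :: 'e
  show "0 \<le> val_dist v x y" by (simp add: val_dist_def)
  show "val_dist v x y = val_dist v y x"
    using v_minus[of "x - y"] by (auto simp: val_dist_def)
  show "(val_dist v x y = 0) = (x = y)" by (simp add: val_dist_def)
  show "val_dist v x z \<le> val_dist v x y + val_dist v y z"
  proof (cases "x = y \<or> y = z \<or> x = z")
    case False
    then have "min (v (x - y)) (v (y - z)) \<le> v (x - z)"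
      using v_add[of "x - y" "y - z"] by auto
    then have "- v (x - z) \<le> - v (x - y) \<or> - v (x - z) \<le> - v (y - z)" by auto
    then have "2 powi (- v (x - z)) \<le> (2 powi (- v (x - y)) :: real) \<or>
        2 powi (- v (x - z)) \<le> (2 powi (- v (y - z)) :: real)"
      by (meson one_le_numeral power_int_increasing)
    moreover have "0 < (2 powi (- v (y - z)) :: real)" "0 < (2 powi (- v (x - y)) :: real)"
      by (auto intro!: zero_less_power_int)
    ultimately have "2 powi (- v (x - z)) \<le> (2 powi (- v (x - y)) + 2 powi (- v (y - z)) :: real)"
      by linarith
    then show ?thesis using False
      by (simp add: val_dist_def)
  qed (auto simp: val_dist_def intro!: add_nonneg_nonneg)
qed

lemma Metric_F: "Metric_space F (val_dist v)"
  using Metric_space.subspace[OF Metric_E] by auto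

lemma val_dist_less_iff: "val_dist v x y < 2 powi (- n) \<longleftrightarrow> x - y \<in> idl (n + 1)"
proof (cases "x = y")
  case True
  then show ?thesis by (simp add: val_dist_def zero_less_power_int)
next
  case False
  have "(2::real) powi (- v (x - y)) < 2 powi (- n) \<longleftrightarrow> - v (x - y) < - n"
    by (metis linorder_neqE not_less_iff_gr_or_eq one_less_numeral_iff power_int_strict_increasing semiring_norm(76))
  then show ?thesis using False by (auto simp: val_dist_def idl_def)
qed

lemma ex_powi_less: "0 < (e::real) \<Longrightarrow> \<exists>n::nat. 2 powi (- int n) < e"
proof -
  assume "0 < e"
  then obtain n where "(1/2) ^ n < e" using real_arch_pow_inv[of e "1/2"] by auto
  then show ?thesis by (intro exI[of _ n]) (simp add: power_int_minus power_one_over inverse_eq_divide)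
qed

text \<open>\<open>F\<close> is closed in \<open>E\<close>, being complete.\<close>

lemma F_far:
  assumes "t \<notin> F" obtains c where "\<And>a. a \<in> F \<Longrightarrow> v (t - a) \<le> c"
proof (rule ccontr)
  assume "\<not> thesis"
  with that have "\<forall>n::nat. \<exists>a\<in>F. v (t - a) > int n" by (meson not_le)
  then obtain a where a: "\<And>n::nat. a n \<in> F" "\<And>n. v (t - a n) > int n" by metis
  interpret M: Metric_space F "val_dist v" by (rule Metric_F)
  have ta: "t - a n \<in> idl (int m + 1)" if "m \<le> n" for n m
    using a(2)[of n] that by (simp add: idl_def)
  have "M.MCauchy a"
    unfolding M.MCauchy_def
  proof (intro conjI allI impI)
    show "range a \<subseteq> F" using a by auto
    fix e :: real assume "0 < e"
    then obtain n :: nat where n: "2 powi (- int n) < e" using ex_powi_less by blast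
    show "\<exists>N. \<forall>m m'. N \<le> m \<longrightarrow> N \<le> m' \<longrightarrow> val_dist v (a m) (a m') < e"
    proof (intro exI[of _ n] allI impI)
      fix m m' assume "n \<le> m" "n \<le> m'"
      then have "a m - a m' \<in> idl (int n + 1)"
        using ta[of n m] ta[of n m'] idl_commute idl_cong_trans by blast
      then show "val_dist v (a m) (a m') < e"
        using n val_dist_less_iff by (meson less_trans)
    qed
  qed
  then obtain l where l: "limitin M.mtopology a l sequentially"
    using F.complete M.mcomplete_def by blast
  then have lF: "l \<in> F" by (metis M.limitin_mspace)
  have "t - l \<in> idl n" for n
  proof -
    have "\<exists>N. \<forall>m\<ge>N. a m \<in> F \<and> val_dist v (a m) l < 2 powi (- n)"
      using l unfolding M.limit_metric_sequentially by (auto simp: zero_less_power_int)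
    then obtain N where N: "\<And>m. m \<ge> N \<Longrightarrow> val_dist v (a m) l < 2 powi (- n)" by blast
    define m where "m = max N (nat n)"
    have "a m - l \<in> idl n" using N[of m] val_dist_less_iff idl_mono by (force simp: m_def)
    moreover have "t - a m \<in> idl n"
      using ta[of m m] idl_mono[of "t - a m" "int m + 1" n] by (auto simp: m_def)
    ultimately show ?thesis using idl_cong_trans by blast
  qed
  then have "t - l = 0" using idl_all_zero by blast
  then show False using lF assms by simp
qed

definition th :: 'e where "th = (SOME t. t \<noteq> 0 \<and> \<gamma> t = - t \<and> v t = 0)"

text \<open>Any \<open>x - \<gamma> x\<close> is skew, and a nonzero one becomes a unit on division
  by a power of \<open>\<pi>\<close>, which keeps it skew because the uniformizer of
  \<open>E\<close> lies in \<open>F\<close>.\<close>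

lemma th: "th \<noteq> 0" "\<gamma> th = - th" "v th = 0"
proof -
  obtain x where x: "\<gamma> x \<noteq> x" using gamma_nontrivial by (auto simp: fun_eq_iff)
  define t where "t = (x - \<gamma> x) / \<pi> powi (v (x - \<gamma> x))"
  have "\<exists>t. t \<noteq> 0 \<and> \<gamma> t = - t \<and> v t = 0"
    using x by (intro exI[of _ t])
      (auto simp: t_def gamma_divide gamma_diff gamma_powi v_divide divide_simps)
  from someI_ex[OF this] show "th \<noteq> 0" "\<gamma> th = - th" "v th = 0" by (auto simp: th_def)
qed

declare th [simp]

lemma skew_F: "\<gamma> z = - z \<longleftrightarrow> z / th \<in> F"
  by (auto simp: gamma_in_F_iff gamma_divide divide_simps) (metis minus_minus)+

lemma E_decomp: obtains a b where "a \<in> F" "b \<in> F" "z = a + b * th"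
proof
  show "(z + \<gamma> z) / 2 \<in> F" by (simp add: F_divide trace_in_F)
  show "((z - \<gamma> z) / 2) / th \<in> F" by (subst skew_F[symmetric]) (simp add: gamma_divide gamma_diff divide_simps)
  show "z = (z + \<gamma> z) / 2 + ((z - \<gamma> z) / 2) / th * th" by (simp add: field_simps)
qed

lemma th_notin_F: "th \<notin> F"
  by (simp add: gamma_in_F_iff)

text \<open>Invariance of \<open>v\<close> is not among the assumptions. Since \<open>F\<close> is
  closed, \<open>th\<close> stays away from it, so conjugation lowers valuations by at most a
  constant; applying this to powers of \<open>x\<close> removes the constant.\<close>

lemma v_gamma_ge: "x \<noteq> 0 \<Longrightarrow> v x \<le> v (\<gamma> x)"
proof -
  assume x0: "x \<noteq> 0"
  obtain c where c: "\<And>a. a \<in> F \<Longrightarrow> v (th - a) \<le> c" using F_far th_notin_F by blast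
  have bd: "v z - max c 0 \<le> v (\<gamma> z)" if "z \<noteq> 0" for z
  proof -
    obtain a b where ab: "a \<in> F" "b \<in> F" "z = a + b * th" using E_decomp by blast
    have gz: "\<gamma> z = z - 2 * b * th" using ab by (simp add: gamma_add gamma_mult gamma_fixes algebra_simps)
    show ?thesis
    proof (cases "b = 0")
      case False
      have "v z = v b + v (th - (- a / b))"
      proof -
        have "z = b * (th - (- a / b))" using ab False by (simp add: field_simps)
        then show ?thesis using that v_mult by (metis mult_eq_0_iff)
      qed
      also have "\<dots> \<le> v b + c" using c[of "- a / b"] ab F_divide F_minus by simp
      finally have "2 * b * th \<in> idl (v z - max c 0)" using False by (auto simp: idl_def v_mult)
      moreover have "z \<in> idl (v z - max c 0)" by (auto simp: idl_def)
      ultimately have "\<gamma> z \<in> idl (v z - max c 0)" using gz idl_diff by simp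
      then show ?thesis using that by (auto simp: idl_def)
    qed (use gz in auto)
  qed
  show ?thesis
  proof (rule ccontr)
    assume "\<not> ?thesis"
    then have l: "v (\<gamma> x) + 1 \<le> v x" by simp
    \<comment> \<open>A loss of at least 1 in \<open>v x\<close> becomes a loss of at least
      \<open>n\<close> for the power, more than the constant permits.\<close>
    define n where "n = nat (max c 0) + 1"
    have "int n * v x - max c 0 \<le> int n * v (\<gamma> x)"
      using bd[of "x ^ n"] x0 by (simp add: gamma_power v_power)
    moreover have "int n * (v (\<gamma> x) + 1) \<le> int n * v x" using l by (intro mult_left_mono) auto
    ultimately show False by (simp add: n_def algebra_simps split: if_splits)
  qed
qed

lemma v_gamma [simp]: "v (\<gamma> x) = v x"
  using v_gamma_ge[of x] v_gamma_ge[of "\<gamma> x"] by (cases "x = 0") auto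

lemma idl_gamma [simp]: "\<gamma> x \<in> idl n \<longleftrightarrow> x \<in> idl n"
  by (simp add: idl_def)

text \<open>The trace and the skew part recover the two coordinates up to the factor 2, a unit. So
  O_E is free over O_F on 1 and \<open>th\<close>.\<close>

lemma F_th_idl_iff:
  assumes ab: "a \<in> F" "b \<in> F"
  shows "a + b * th \<in> idl n \<longleftrightarrow> a \<in> idl n \<and> b \<in> idl n"
proof (intro iffI conjI)
  define z where "z = a + b * th"
  have g: "\<gamma> z = a - b * th" using ab by (simp add: z_def gamma_add gamma_mult gamma_fixes)
  have a2: "z + \<gamma> z = 2 * a" and b2: "z - \<gamma> z = 2 * (b * th)"
    unfolding g unfolding z_def by simp_all
  assume "a + b * th \<in> idl n"
  then have z: "z \<in> idl n" "\<gamma> z \<in> idl n" by (simp_all add: z_def)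
  show "a \<in> idl n" using idl_add[OF z] unfolding a2 by simp
  have "b * th \<in> idl n" using idl_diff[OF z] unfolding b2 by simp
  then show "b \<in> idl n" by (simp add: idl_mult_iff')
next
  assume "a \<in> idl n \<and> b \<in> idl n"
  then show "a + b * th \<in> idl n" by (intro idl_add) (simp_all add: idl_mult_iff')
qed

end

section \<open>Matrix algebra and the unitary similitude groups\<close>

lemma mat_mult_left [simp]: "(mat c ** A) $ i $ j = (c::'a::comm_ring_1) * A $ i $ j"
  by (simp add: matrix_matrix_mult_def mat_def if_distrib[where f = "\<lambda>x. x * _"] cong: if_cong)

lemma mat_mult_right [simp]: "(A ** mat c) $ i $ j = (c::'a::comm_ring_1) * A $ i $ j"
  by (simp add: matrix_matrix_mult_def mat_def if_distrib[where f = "\<lambda>x. _ * x"] cong: if_cong)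

lemma mat_central: "A ** mat (c::'a::comm_ring_1) = mat c ** A"
  by (simp add: vec_eq_iff)

lemma mat_mult_mat: "mat a ** mat b = (mat (a * b) :: 'a::comm_ring_1^'n^'n)"
  by (simp add: vec_eq_iff) (simp add: mat_def)

lemma mat_mult_mat_assoc: "mat a ** (mat b ** A) = (mat (a * b) ** A :: 'a::comm_ring_1^'n^'n)"
  by (simp add: vec_eq_iff)

lemma mat_left_commute: "A ** (mat (c::'a::comm_ring_1) ** B) = mat c ** (A ** B)"
  by (simp add: matrix_mul_assoc mat_central)

lemma mult_entry: "(A ** B) $ i $ j = (\<Sum>k\<in>UNIV. A $ i $ k * B $ k $ j)"
  by (simp add: matrix_matrix_mult_def)

lemma mat_one_mult [simp]: "mat 1 ** A = (A :: 'a::comm_ring_1^'n^'n)" "A ** mat 1 = (A :: 'a::comm_ring_1^'n^'n)"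
  by (simp_all add: matrix_mul_lid matrix_mul_rid)

lemma vector_4_nth [simp]:
  "(vector [a, b, c, d] :: 'a::zero^4) $ 1 = a" "(vector [a, b, c, d] :: 'a::zero^4) $ 2 = b"
  "(vector [a, b, c, d] :: 'a::zero^4) $ 3 = c" "(vector [a, b, c, d] :: 'a::zero^4) $ 4 = d"
  by (simp_all add: vector_def)

lemma mat2_cases: "(A :: 'a^2^2) = B \<longleftrightarrow> A$1$1 = B$1$1 \<and> A$1$2 = B$1$2 \<and> A$2$1 = B$2$1 \<and> A$2$2 = B$2$2"
  by (auto simp: vec_eq_iff forall_2)

lemma matrix_inv_unique:
  assumes "A ** B = mat 1" shows "matrix_inv A = (B :: 'a::field^'n^'n)"
proof -
  have BA: "B ** A = mat 1" using assms matrix_left_right_inverse by blast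
  then have "invertible A" using assms by (auto simp: invertible_def)
  then have "matrix_inv A ** A = mat 1" unfolding matrix_inv_def invertible_def by (rule someI2_ex) simp
  then have "matrix_inv A ** (A ** B) = B" by (simp add: matrix_mul_assoc)
  then show ?thesis using assms by simp
qed

context odd_unramified_extension
begin

definition adj :: "'e^'n^'m \<Rightarrow> 'e^'m^'n" where "adj A = map_entries \<gamma> (transpose A)"

lemma is_sim_iff: "is_sim J g s \<longleftrightarrow> s \<in> F \<and> s \<noteq> 0 \<and> adj g ** J ** g = mat s ** J"
  by (simp add: is_sim_def adj_def)

lemma adj_entry [simp]: "adj A $ i $ j = \<gamma> (A $ j $ i)"
  by (simp add: adj_def map_entries_def transpose_def)

lemma adj_mult: "adj (A ** B) = adj B ** adj A"
  by (simp add: vec_eq_iff mult_entry gamma_sum gamma_mult mult.commute)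

lemma adj_adj [simp]: "adj (adj A) = A"
  by (simp add: vec_eq_iff)

lemma adj_mat [simp]: "adj (mat c) = mat (\<gamma> c)"
  by (simp add: vec_eq_iff mat_def)

text \<open>The two properties of \<open>J2\<close> and \<open>J4\<close> on which the group theory
  rests, isolated so that sizes 2 and 4 are treated together.\<close>

definition herm :: "'e^'n^'n \<Rightarrow> bool" where
  "herm J \<longleftrightarrow> J ** J = mat 1 \<and> adj J = J"

lemma herm_J2 [simp]: "herm J2" and herm_J4 [simp]: "herm J4"
  unfolding herm_def by (simp_all add: vec_eq_iff forall_2 forall_4 mult_entry sum_2 sum_4 J2_def J4_def mat_def)

lemma hermD: "herm J \<Longrightarrow> J ** J = mat 1" "herm J \<Longrightarrow> adj J = J"
  by (simp_all add: herm_def)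

lemma herm_mat_inj:
  fixes J :: "'e^'n^'n"
  assumes "herm J" "mat s ** J = mat s' ** J" shows "s = s'"
proof -
  have "mat s ** (J ** J) = mat s' ** (J ** J)" by (simp add: matrix_mul_assoc assms(2))
  then have "(mat s :: 'e^'n^'n) = mat s'" by (simp only: hermD(1)[OF assms(1)] mat_one_mult)
  then have "(mat s :: 'e^'n^'n) $ undefined $ undefined = (mat s' :: 'e^'n^'n) $ undefined $ undefined" by (simp only:)
  then show ?thesis by (simp add: mat_def)
qed

lemma is_simD: "is_sim J g s \<Longrightarrow> s \<in> F \<and> s \<noteq> 0 \<and> adj g ** J ** g = mat s ** J"
  by (simp add: is_sim_iff)

lemma is_sim_unique: "herm J \<Longrightarrow> is_sim J g s \<Longrightarrow> is_sim J g s' \<Longrightarrow> s = s'"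
  using herm_mat_inj by (metis is_simD)

lemma sim_eq: "herm J \<Longrightarrow> is_sim J g s \<Longrightarrow> sim J g = s"
  unfolding sim_def using is_sim_unique by blast

lemma is_sim_inverse:
  assumes "herm J" "is_sim J g s"
  shows "(mat (inverse s) ** J ** adj g ** J) ** g = mat 1" "g ** (mat (inverse s) ** J ** adj g ** J) = mat 1"
proof -
  have "(mat (inverse s) ** J ** adj g ** J) ** g = mat (inverse s) ** (J ** (adj g ** J ** g))"
    by (simp add: matrix_mul_assoc)
  also have "\<dots> = mat (inverse s) ** (mat s ** (J ** J))" 
    using is_simD[OF assms(2)] by (simp add: mat_left_commute[of J])
  also have "\<dots> = mat 1" using is_simD[OF assms(2)] hermD[OF assms(1)] by (simp add: mat_mult_mat)
  finally show "(mat (inverse s) ** J ** adj g ** J) ** g = mat 1" .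
  then show "g ** (mat (inverse s) ** J ** adj g ** J) = mat 1"
    using matrix_left_right_inverse by blast
qed

lemma is_sim_right:
  assumes "herm J" "is_sim J g s"
  shows "g ** J ** adj g = mat s ** J"
proof -
  have s: "s \<noteq> 0" using is_simD[OF assms(2)] by simp
  have "g ** (mat (inverse s) ** (J ** adj g ** J)) = mat 1"
    using is_sim_inverse(2)[OF assms] by (simp add: matrix_mul_assoc)
  then have "mat s ** (mat (inverse s) ** (g ** (J ** adj g ** J))) = mat s ** mat 1"
    by (simp add: mat_left_commute[of g])
  then have *: "g ** (J ** adj g ** J) = mat s"
    using s by (simp only: mat_mult_mat_assoc) simp
  have "g ** J ** adj g = g ** (J ** adj g) ** (J ** J)" using hermD(1)[OF assms(1)] by (simp add: matrix_mul_assoc)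
  also have "\<dots> = (g ** (J ** adj g ** J)) ** J" by (simp only: matrix_mul_assoc)
  finally show ?thesis by (simp only: *)
qed

lemma GU_iff: "herm J \<Longrightarrow> g \<in> carrier (GU J) \<longleftrightarrow> (\<exists>s. is_sim J g s)"
  unfolding GU_def invertible_def using is_sim_inverse by simp blast

lemma GU_mult [simp]: "g \<otimes>\<^bsub>GU J\<^esub> h = g ** h" and GU_one [simp]: "\<one>\<^bsub>GU J\<^esub> = mat 1"
  by (simp_all add: GU_def)

lemma GU_sim:
  assumes "herm J" "g \<in> carrier (GU J)"
  shows "is_sim J g (sim J g)"
  using assms by (auto simp: GU_iff sim_eq)

lemma GU_I: "herm J \<Longrightarrow> is_sim J g s \<Longrightarrow> g \<in> carrier (GU J)"
  using GU_iff by blast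

lemma is_sim_mult:
  assumes "is_sim J g s" "is_sim J h t" shows "is_sim J (g ** h) (s * t)"
proof -
  have "adj (g ** h) ** J ** (g ** h) = adj h ** (adj g ** J ** g) ** h"
    by (simp add: adj_mult matrix_mul_assoc)
  also have "\<dots> = mat s ** (adj h ** J ** h)"
    using is_simD[OF assms(1)] by (simp add: matrix_mul_assoc mat_central)
  also have "\<dots> = mat (s * t) ** J" using is_simD[OF assms(2)] by (simp add: mat_mult_mat_assoc)
  finally show ?thesis using is_simD[OF assms(1)] is_simD[OF assms(2)] F_mult by (simp add: is_sim_iff)
qed

lemma is_sim_one [simp]: "is_sim J (mat 1) 1"
  by (simp add: is_sim_iff)

lemma is_sim_mat: "c \<in> F \<Longrightarrow> c \<noteq> 0 \<Longrightarrow> is_sim J (mat c) (c * c)"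
  unfolding is_sim_iff by (simp add: F_mult gamma_fixes mat_mult_mat_assoc mat_central)

lemma is_sim_adj:
  assumes "herm J" "is_sim J g s" shows "is_sim J (adj g) s"
  using is_sim_right[OF assms] is_simD[OF assms(2)] by (simp add: is_sim_iff)

lemma is_sim_J: "herm J \<Longrightarrow> is_sim J J 1"
  by (simp add: is_sim_iff hermD flip: matrix_mul_assoc)

lemma is_sim_inv:
  assumes "herm J" "is_sim J g s"
  shows "is_sim J (matrix_inv g) (inverse s)"
    and "matrix_inv g = mat (inverse s) ** J ** adj g ** J"
    and "matrix_inv g ** g = mat 1" "g ** matrix_inv g = mat 1"
proof -
  show *: "matrix_inv g = mat (inverse s) ** J ** adj g ** J"
    using is_sim_inverse[OF assms] matrix_inv_unique by blast
  show "matrix_inv g ** g = mat 1" "g ** matrix_inv g = mat 1"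
    unfolding * using is_sim_inverse[OF assms] by auto
  have s: "s \<in> F" "s \<noteq> 0" using is_simD[OF assms(2)] by auto
  have "is_sim J (mat (inverse s)) (inverse s * inverse s)"
    using s by (intro is_sim_mat F_inverse) auto
  then have "is_sim J (mat (inverse s) ** J ** adj g ** J) (inverse s * inverse s * 1 * s * 1)"
    using assms by (intro is_sim_mult is_sim_adj is_sim_J)
  moreover have "inverse s * inverse s * 1 * s * 1 = inverse s" using s by simp
  ultimately show "is_sim J (matrix_inv g) (inverse s)" unfolding * by (simp only:)
qed

lemma GU_mult_closed: "herm J \<Longrightarrow> g \<in> carrier (GU J) \<Longrightarrow> h \<in> carrier (GU J) \<Longrightarrow> g ** h \<in> carrier (GU J)"
  by (auto simp: GU_iff intro: is_sim_mult)

lemma sim_mult: "herm J \<Longrightarrow> g \<in> carrier (GU J) \<Longrightarrow> h \<in> carrier (GU J) \<Longrightarrow> sim J (g ** h) = sim J g * sim J h"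
  by (simp add: GU_sim is_sim_mult sim_eq)

lemma GU_group: assumes J: "herm J" shows "group (GU J)"
proof (rule groupI)
  show "\<one>\<^bsub>GU J\<^esub> \<in> carrier (GU J)" using J by (auto simp: GU_iff intro: is_sim_one)
next
  fix x y z assume x: "x \<in> carrier (GU J)"
  show "\<one>\<^bsub>GU J\<^esub> \<otimes>\<^bsub>GU J\<^esub> x = x" by simp
  show "\<exists>y\<in>carrier (GU J). y \<otimes>\<^bsub>GU J\<^esub> x = \<one>\<^bsub>GU J\<^esub>"
    using is_sim_inv(1,3)[OF J GU_sim[OF J x]] GU_iff[OF J] by (auto intro!: bexI[of _ "matrix_inv x"])
  show "x \<otimes>\<^bsub>GU J\<^esub> y \<otimes>\<^bsub>GU J\<^esub> z = x \<otimes>\<^bsub>GU J\<^esub> (y \<otimes>\<^bsub>GU J\<^esub> z)" by (simp add: matrix_mul_assoc)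
  assume y: "y \<in> carrier (GU J)"
  show "x \<otimes>\<^bsub>GU J\<^esub> y \<in> carrier (GU J)" using x y J GU_mult_closed by simp
qed

lemma GU_inv_closed: "herm J \<Longrightarrow> g \<in> carrier (GU J) \<Longrightarrow> matrix_inv g \<in> carrier (GU J)"
  and sim_inv: "herm J \<Longrightarrow> g \<in> carrier (GU J) \<Longrightarrow> sim J (matrix_inv g) = inverse (sim J g)"
  and GU_inv_cancel: "herm J \<Longrightarrow> g \<in> carrier (GU J) \<Longrightarrow> matrix_inv g ** g = mat 1"
    "herm J \<Longrightarrow> g \<in> carrier (GU J) \<Longrightarrow> g ** matrix_inv g = mat 1"
  using is_sim_inv[of J g "sim J g"] GU_sim[of J g] sim_eq[of J "matrix_inv g" "inverse (sim J g)"] GU_I[of J "matrix_inv g"]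
  by auto

lemma sim_nonzero: "herm J \<Longrightarrow> g \<in> carrier (GU J) \<Longrightarrow> sim J g \<noteq> 0"
  and sim_in_F: "herm J \<Longrightarrow> g \<in> carrier (GU J) \<Longrightarrow> sim J g \<in> F"
  using GU_sim is_simD by blast+

lemma sim_adj: "herm J \<Longrightarrow> g \<in> carrier (GU J) \<Longrightarrow> adj g \<in> carrier (GU J) \<and> sim J (adj g) = sim J g"
  using is_sim_adj GU_I sim_eq GU_sim by metis

lemma GU_mat: "herm J \<Longrightarrow> c \<in> F \<Longrightarrow> c \<noteq> 0 \<Longrightarrow> mat c \<in> carrier (GU J) \<and> sim J (mat c) = c * c"
  using is_sim_mat GU_I sim_eq by metis

lemma GU_one_closed: "herm J \<Longrightarrow> mat 1 \<in> carrier (GU J) \<and> sim J (mat 1) = 1"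
  using GU_mat[of J 1] by simp

definition intmat :: "int \<Rightarrow> 'e^'n^'m \<Rightarrow> bool" where
  "intmat n A \<longleftrightarrow> (\<forall>i j. A $ i $ j \<in> idl n)"

lemma intmatD: "intmat n A \<Longrightarrow> A $ i $ j \<in> idl n"
  by (simp add: intmat_def)

lemma intmat_mult: "intmat m A \<Longrightarrow> intmat n B \<Longrightarrow> intmat (m + n) (A ** B)"
  unfolding intmat_def mult_entry by (auto intro!: idl_sum idl_mult)

lemma intmat_mult0: "intmat 0 A \<Longrightarrow> intmat n B \<Longrightarrow> intmat n (A ** B)"
  using intmat_mult[of 0 A n B] by simp

lemma intmat_mult0': "intmat n A \<Longrightarrow> intmat 0 B \<Longrightarrow> intmat n (A ** B)"
  using intmat_mult[of n A 0 B] by simp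

lemma intmat_adj [simp]: "intmat n (adj A) \<longleftrightarrow> intmat n A"
  by (auto simp: intmat_def)

lemma intmat_mono: "intmat n A \<Longrightarrow> m \<le> n \<Longrightarrow> intmat m A"
  unfolding intmat_def using idl_mono by blast

lemma intmat_one [simp]: "intmat 0 (mat 1 :: 'e^'n^'n)"
  by (simp add: intmat_def mat_def)

lemma intmat_mat: "c \<noteq> 0 \<Longrightarrow> intmat n (mat c ** A) \<longleftrightarrow> intmat (n - v c) A"
  by (simp add: intmat_def idl_mult_iff)

lemma intmat_diff: "intmat n A \<Longrightarrow> intmat n B \<Longrightarrow> intmat n (A - B)"
  by (simp add: intmat_def idl_diff)

lemma intmat_add: "intmat n A \<Longrightarrow> intmat n B \<Longrightarrow> intmat n (A + B)"
  by (simp add: intmat_def idl_add)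

lemma intmat_J [simp]: "intmat 0 J2" "intmat 0 J4"
  by (simp_all add: intmat_def J2_def J4_def forall_2 forall_4)

lemma intmat_ex: "\<exists>n. intmat n (A :: 'e^'n^'m)"
proof -
  define h where "h = (\<lambda>p. v (A $ fst p $ snd p))"
  have "Min (range h) \<le> h (i, j)" for i j by (intro Min_le) auto
  then have "A $ i $ j \<in> idl (Min (range h))" for i j
    unfolding idl_def h_def by auto
  then show ?thesis by (auto simp: intmat_def)
qed

text \<open>The inverse is \<open>s^-1 J adj g J\<close> with \<open>J\<close> integral, so its
  denominators are controlled by those of \<open>g\<close> and by the similitude factor
  alone.\<close>

lemma GU_intmat_inv:
  assumes "herm J" "intmat 0 J" "g \<in> carrier (GU J)" "intmat n g"
  shows "intmat (n - v (sim J g)) (matrix_inv g)"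
proof -
  have i: "is_sim J g (sim J g)" using assms GU_sim by blast
  have "intmat n (J ** adj g ** J)"
    using assms by (simp add: intmat_mult0 intmat_mult0')
  then have "intmat (n - v (sim J g)) (mat (inverse (sim J g)) ** (J ** adj g ** J))"
    using is_simD[OF i] by (simp add: intmat_mat v_inverse)
  then show ?thesis using is_sim_inv(2)[OF assms(1) i] by (simp add: matrix_mul_assoc)
qed

lemma intmat_sim:
  fixes J :: "'e^'n^'n"
  assumes "herm J" "intmat 0 J" "g \<in> carrier (GU J)" "intmat n g"
  shows "2 * n \<le> v (sim J g)"
proof -
  have s: "adj g ** J ** g = mat (sim J g) ** J" "sim J g \<noteq> 0" using assms GU_sim is_simD by blast+
  have "intmat (n + n) (adj g ** J ** g)"
    using assms by (intro intmat_mult intmat_mult0') auto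
  then have "intmat (2 * n) (mat (sim J g) ** J)" using s by simp
  from intmat_mult0'[OF this assms(2)] have "intmat (2 * n) (mat (sim J g) ** (J ** J))"
    by (simp only: matrix_mul_assoc)
  then have "intmat (2 * n) (mat (sim J g) :: 'e^'n^'n)" by (simp only: hermD(1)[OF assms(1)] mat_one_mult)
  then have "(mat (sim J g) :: 'e^'n^'n) $ undefined $ undefined \<in> idl (2 * n)" by (rule intmatD)
  then show ?thesis using s by (simp add: mat_def idl_def)
qed

definition KK :: "'e^'n^'n \<Rightarrow> ('e^'n^'n) set" where
  "KK J = {g \<in> carrier (GU J). intmat 0 g \<and> v (sim J g) = 0}"

text \<open>For an integral similitude, integrality of the inverse is equivalent to the similitude
  factor being a unit. This trades the condition on \<open>matrix_inv g\<close> for one on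
  \<open>sim\<close>.\<close>

lemma K_eq: "K = KK J4"
proof -
  have "intmat 0 (matrix_inv g) \<longleftrightarrow> v (sim J4 g) = 0" if "g \<in> carrier G" "intmat 0 g" for g
  proof
    assume "v (sim J4 g) = 0"
    then show "intmat 0 (matrix_inv g)" using GU_intmat_inv[of J4 g 0] that by simp
  next
    assume "intmat 0 (matrix_inv g)"
    then have "0 \<le> v (inverse (sim J4 g))" 
      using intmat_sim[of J4 "matrix_inv g" 0] GU_inv_closed[of J4 g] sim_inv[of J4 g] that by simp
    moreover have "0 \<le> v (sim J4 g)" using intmat_sim[of J4 g 0] that by simp
    ultimately show "v (sim J4 g) = 0" using sim_nonzero[of J4 g] that by (simp add: v_inverse)
  qed
  then show ?thesis unfolding K_def KK_def OE_eq intmat_def by blast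
qed

lemma KK_D: "g \<in> KK J \<Longrightarrow> g \<in> carrier (GU J)" "g \<in> KK J \<Longrightarrow> intmat 0 g" "g \<in> KK J \<Longrightarrow> v (sim J g) = 0"
  by (auto simp: KK_def)

lemma KK_mult: "herm J \<Longrightarrow> g \<in> KK J \<Longrightarrow> h \<in> KK J \<Longrightarrow> g ** h \<in> KK J"
  by (auto simp: KK_def GU_mult_closed sim_mult intmat_mult0 v_mult sim_nonzero)

lemma KK_inv: "herm J \<Longrightarrow> intmat 0 J \<Longrightarrow> g \<in> KK J \<Longrightarrow> matrix_inv g \<in> KK J"
  using GU_intmat_inv[of J g 0] by (auto simp: KK_def GU_inv_closed sim_inv v_inverse sim_nonzero)

lemma KK_adj: "herm J \<Longrightarrow> g \<in> KK J \<Longrightarrow> adj g \<in> KK J"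
  by (auto simp: KK_def sim_adj)

lemma KK_one: "herm J \<Longrightarrow> mat 1 \<in> KK J"
  by (auto simp: KK_def GU_one_closed)

text \<open>Integral invertible matrices without any hermitian condition; later column and row
  operations do not respect \<open>J4\<close>.\<close>

definition GLO :: "('e^'n^'n) set" where
  "GLO = {k. intmat 0 k \<and> (\<exists>k'. intmat 0 k' \<and> k ** k' = mat 1)}"

lemma GLO_mult: "a \<in> GLO \<Longrightarrow> b \<in> GLO \<Longrightarrow> a ** b \<in> GLO"
proof -
  assume "a \<in> GLO" "b \<in> GLO"
  then obtain a' b' where *: "intmat 0 a" "intmat 0 b" "intmat 0 a'" "intmat 0 b'" "a ** a' = mat 1" "b ** b' = mat 1"
    by (auto simp: GLO_def)
  have "(a ** b) ** (b' ** a') = a ** (b ** b') ** a'" by (simp only: matrix_mul_assoc)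
  then have "(a ** b) ** (b' ** a') = mat 1" using * by simp
  then show ?thesis unfolding GLO_def using * intmat_mult0[of a 0 b] intmat_mult0[of b' 0 a'] by blast
qed

lemma GLO_inv: "a \<in> GLO \<Longrightarrow> matrix_inv a \<in> GLO \<and> a ** matrix_inv a = mat 1 \<and> matrix_inv a ** a = mat 1"
proof -
  assume "a \<in> GLO"
  then obtain a' where *: "intmat 0 a" "intmat 0 a'" "a ** a' = mat 1"
    by (auto simp: GLO_def)
  have "matrix_inv a = a'" using * matrix_inv_unique by blast
  moreover have "a' ** a = mat 1" using * matrix_left_right_inverse by blast
  ultimately show ?thesis using * by (auto simp: GLO_def)
qed

lemma KK_GLO: "herm J \<Longrightarrow> intmat 0 J \<Longrightarrow> g \<in> KK J \<Longrightarrow> g \<in> GLO"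
  using KK_inv[of J g] GU_inv_cancel[of J g] by (auto simp: GLO_def KK_def)

lemma iota_entry:
  "\<iota> (h, k) $ 1 $ 1 = h$1$1" "\<iota> (h, k) $ 1 $ 2 = 0" "\<iota> (h, k) $ 1 $ 3 = h$1$2" "\<iota> (h, k) $ 1 $ 4 = 0"
  "\<iota> (h, k) $ 2 $ 1 = 0" "\<iota> (h, k) $ 2 $ 2 = k$1$1" "\<iota> (h, k) $ 2 $ 3 = 0" "\<iota> (h, k) $ 2 $ 4 = k$1$2"
  "\<iota> (h, k) $ 3 $ 1 = h$2$1" "\<iota> (h, k) $ 3 $ 2 = 0" "\<iota> (h, k) $ 3 $ 3 = h$2$2" "\<iota> (h, k) $ 3 $ 4 = 0"
  "\<iota> (h, k) $ 4 $ 1 = 0" "\<iota> (h, k) $ 4 $ 2 = k$2$1" "\<iota> (h, k) $ 4 $ 3 = 0" "\<iota> (h, k) $ 4 $ 4 = k$2$2"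
  by (simp_all add: \<iota>_def)

lemma J4_iota: "J4 = \<iota> (J2, J2)"
  by (simp add: vec_eq_iff forall_4 iota_entry J2_def) (simp add: J4_def)

lemma iota_mult: "\<iota> (h, k) ** \<iota> (h', k') = \<iota> (h ** h', k ** k')"
  by (simp add: vec_eq_iff forall_4 mult_entry sum_4 sum_2 iota_entry)

lemma iota_adj: "adj (\<iota> (h, k)) = \<iota> (adj h, adj k)"
  by (simp add: vec_eq_iff forall_4 iota_entry)

lemma iota_mat: "\<iota> (mat c, mat c) = mat c"
  by (simp add: vec_eq_iff forall_4 iota_entry) (simp add: mat_def)

lemma iota_inj: "\<iota> x = \<iota> y \<longleftrightarrow> x = y"
  by (cases x; cases y) (auto simp: vec_eq_iff forall_4 forall_2 iota_entry)

lemma iota_inj_pair: "\<iota> (a, b) = \<iota> (c, d) \<longleftrightarrow> a = c \<and> b = d"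
  by (simp add: iota_inj)

lemma intmat_iota: "intmat n (\<iota> (h, k)) \<longleftrightarrow> intmat n h \<and> intmat n k"
  by (auto simp: intmat_def forall_4 forall_2 iota_entry)

lemma is_sim_iota: "is_sim J4 (\<iota> (h, k)) s \<longleftrightarrow> is_sim J2 h s \<and> is_sim J2 k s"
  unfolding is_sim_iff iota_adj J4_iota
  by (simp add: iota_mult iota_inj_pair flip: iota_mat) auto

lemma H_iff: "(h, k) \<in> carrier H \<longleftrightarrow> (\<exists>s. is_sim J2 h s \<and> is_sim J2 k s)"
  unfolding H_def using sim_eq[OF herm_J2] GU_iff[OF herm_J2] by auto

lemma H_iff_iota: "h \<in> carrier H \<longleftrightarrow> \<iota> h \<in> carrier G"
  by (cases h) (simp add: H_iff GU_iff is_sim_iota)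

lemma sim_iota: "(h, k) \<in> carrier H \<Longrightarrow> sim J4 (\<iota> (h, k)) = sim J2 h \<and> sim J4 (\<iota> (h, k)) = sim J2 k"
  unfolding H_iff by (metis herm_J2 herm_J4 is_sim_iota sim_eq)

lemma H_D: "(h, k) \<in> carrier H \<Longrightarrow> h \<in> carrier (GU J2) \<and> k \<in> carrier (GU J2) \<and> sim J2 h = sim J2 k"
  by (simp add: H_def)

lemma H_mult: "x \<otimes>\<^bsub>H\<^esub> y = (fst x ** fst y, snd x ** snd y)" and H_one: "\<one>\<^bsub>H\<^esub> = (mat 1, mat 1)"
  by (simp_all add: H_def case_prod_beta)

lemma iota_hom: "\<iota> (x \<otimes>\<^bsub>H\<^esub> y) = \<iota> x ** \<iota> y"
  by (cases x; cases y) (simp add: H_mult iota_mult)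

lemma iota_one: "\<iota> \<one>\<^bsub>H\<^esub> = mat 1"
  by (simp add: H_one iota_mat)

lemma iota_matrix_inv: "(h, k) \<in> carrier H \<Longrightarrow> \<iota> (matrix_inv h, matrix_inv k) = matrix_inv (\<iota> (h, k))"
proof -
  assume "(h, k) \<in> carrier H"
  then have "\<iota> (h, k) ** \<iota> (matrix_inv h, matrix_inv k) = mat 1"
    using H_D[of h k] by (simp add: iota_mult iota_mat GU_inv_cancel(2)[OF herm_J2])
  then show ?thesis using matrix_inv_unique by metis
qed

lemma H_group: "group H"
proof (rule groupI)
  show "\<one>\<^bsub>H\<^esub> \<in> carrier H" by (simp add: H_iff_iota iota_one GU_one_closed)
next
  fix x y z assume x: "x \<in> carrier H"
  show "\<one>\<^bsub>H\<^esub> \<otimes>\<^bsub>H\<^esub> x = x" by (simp add: H_mult H_one)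
  show "x \<otimes>\<^bsub>H\<^esub> y \<otimes>\<^bsub>H\<^esub> z = x \<otimes>\<^bsub>H\<^esub> (y \<otimes>\<^bsub>H\<^esub> z)" by (simp add: H_mult matrix_mul_assoc)
  show "\<exists>y\<in>carrier H. y \<otimes>\<^bsub>H\<^esub> x = \<one>\<^bsub>H\<^esub>"
  proof (intro bexI[of _ "(matrix_inv (fst x), matrix_inv (snd x))"])
    obtain h k where hk: "x = (h, k)" by (cases x)
    show "(matrix_inv (fst x), matrix_inv (snd x)) \<otimes>\<^bsub>H\<^esub> x = \<one>\<^bsub>H\<^esub>"
      using x hk H_D[of h k] GU_inv_cancel(1)[OF herm_J2] by (simp add: H_mult H_one)
    show "(matrix_inv (fst x), matrix_inv (snd x)) \<in> carrier H"
      using x hk iota_matrix_inv[of h k] GU_inv_closed[OF herm_J4] by (simp add: H_iff_iota)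
  qed
  assume y: "y \<in> carrier H"
  show "x \<otimes>\<^bsub>H\<^esub> y \<in> carrier H" using x y by (simp add: H_iff_iota iota_hom GU_mult_closed)
qed

lemma H_inv: "x \<in> carrier H \<Longrightarrow> inv\<^bsub>H\<^esub> x = (matrix_inv (fst x), matrix_inv (snd x))"
proof -
  assume x: "x \<in> carrier H"
  interpret H: group H by (rule H_group)
  have "x \<otimes>\<^bsub>H\<^esub> (matrix_inv (fst x), matrix_inv (snd x)) = \<one>\<^bsub>H\<^esub>"
    using x H_D[of "fst x" "snd x"] GU_inv_cancel(2)[OF herm_J2] by (simp add: H_mult H_one)
  moreover have "(matrix_inv (fst x), matrix_inv (snd x)) \<in> carrier H"
    using x iota_matrix_inv[of "fst x" "snd x"] GU_inv_closed[OF herm_J4] by (simp add: H_iff_iota)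
  ultimately show ?thesis using x H.inv_equality[of "(matrix_inv (fst x), matrix_inv (snd x))" x] H.inv_comm by blast
qed

lemma iota_inv: "x \<in> carrier H \<Longrightarrow> \<iota> (inv\<^bsub>H\<^esub> x) = matrix_inv (\<iota> x)"
  using iota_matrix_inv[of "fst x" "snd x"] by (simp add: H_inv)

lemma det_mat_2: "det (mat c :: 'e^2^2) = c * c"
  by (simp add: det_2 mat_def)

lemma det_adj_2: "det (adj (h :: 'e^2^2)) = \<gamma> (det h)"
  by (simp add: det_2 gamma_diff gamma_mult mult.commute)

lemma det_norm:
  assumes "h \<in> carrier (GU J2)"
  shows "\<gamma> (det h) * det h = sim J2 h * sim J2 h" "det h \<noteq> 0"
proof -
  have s: "adj h ** J2 ** h = mat (sim J2 h) ** J2" "sim J2 h \<noteq> 0" using assms GU_sim is_simD herm_J2 by blast+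
  have d: "det J2 = (-1 :: 'e)" by (simp add: det_2 J2_def)
  have "det (adj h ** J2 ** h) = det (mat (sim J2 h) ** J2)" using s by simp
  then show *: "\<gamma> (det h) * det h = sim J2 h * sim J2 h"
    by (simp only: det_mul d det_mat_2 det_adj_2) simp
  show "det h \<noteq> 0" using * s by auto
qed

text \<open>Both determinants have the same norm, the square of the common similitude
  factor.\<close>

lemma nu_in_C: "x \<in> carrier H \<Longrightarrow> \<nu> x \<in> C"
proof -
  assume x: "x \<in> carrier H"
  obtain h k where hk: "x = (h, k)" by (cases x)
  have "h \<in> carrier (GU J2)" "k \<in> carrier (GU J2)" "sim J2 h = sim J2 k" using x hk H_D by auto
  then show ?thesis using det_norm[of h] det_norm[of k]
    by (auto simp: hk \<nu>_def C_def gamma_divide divide_simps ac_simps) 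
qed

lemma nu_mult: "\<nu> (x \<otimes>\<^bsub>H\<^esub> y) = \<nu> x * \<nu> y"
  by (simp add: \<nu>_def H_mult det_mul case_prod_beta)

lemma C_I: "t * \<gamma> t = 1 \<Longrightarrow> t \<in> C"
  by (auto simp: C_def)

lemma C_D: "t \<in> C \<Longrightarrow> t \<noteq> 0" "t \<in> C \<Longrightarrow> t * \<gamma> t = 1" "t \<in> C \<Longrightarrow> v t = 0" "t \<in> C \<Longrightarrow> inverse t = \<gamma> t"
proof -
  assume t: "t \<in> C"
  then show *: "t \<noteq> 0" "t * \<gamma> t = 1" by (auto simp: C_def)
  then have "v t + v (\<gamma> t) = v 1" using v_mult[of t "\<gamma> t"] by simp
  then show "v t = 0" by simp
  show "inverse t = \<gamma> t" using * inverse_unique by blast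
qed

lemma C_mult: "s \<in> C \<Longrightarrow> t \<in> C \<Longrightarrow> s * t \<in> C"
  unfolding C_def by (simp add: gamma_mult) (simp add: ac_simps flip: mult.assoc)

lemma C_one [simp]: "1 \<in> C"
  by (simp add: C_def)

lemma C_inverse: "t \<in> C \<Longrightarrow> inverse t \<in> C"
  unfolding C_def by (simp add: gamma_inverse flip: inverse_mult_distrib)

lemma T_group: "comm_group T"
  by (rule comm_groupI) (auto simp: T_def C_mult ac_simps intro: C_inverse dest: C_D intro!: bexI[of _ "inverse _"])

text \<open>An element \<open>a + \<pi> b\<close> is congruent to its conjugate; conversely
  \<open>t\<close> is the quotient of \<open>1 + t\<close> by its conjugate, and here
  \<open>1 + t\<close> is congruent to the unit 2. All later arguments use this description of
  \<open>D\<close>.\<close>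

lemma D_eq: "D = {t \<in> C. t - 1 \<in> idl 1}"
proof (intro equalityI subsetI)
  fix t assume "t \<in> D"
  then obtain a b where ab: "a \<in> F" "v a = 0" "a \<noteq> 0" "b \<in> idl 0" "t = (a + \<pi> * b) / \<gamma> (a + \<pi> * b)"
    unfolding D_def OE_eq using v_inverse by (auto simp: val_units_def val_ring_def)
  define z where "z = a + \<pi> * b"
  have pb: "\<pi> * b \<in> idl 1" using ab by (simp add: idl_mult_iff)
  then have vz: "z \<noteq> 0" "v z = 0" using v_cong[of z a 1] ab by (auto simp: z_def)
  have "z - \<gamma> z = \<pi> * (b - \<gamma> b)" using ab by (simp add: z_def gamma_add gamma_mult gamma_fixes algebra_simps)
  also have "\<dots> \<in> idl 1" using ab by (simp add: idl_mult_iff idl_diff)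
  finally have "z - \<gamma> z \<in> idl 1" .
  moreover have "t - 1 = (z - \<gamma> z) / \<gamma> z" using vz ab by (simp add: z_def diff_divide_distrib)
  ultimately have "t - 1 \<in> idl 1" using vz by (simp add: idl_divide_iff)
  moreover have "t \<in> C" using vz ab unfolding z_def[symmetric] by (auto simp: C_def gamma_divide)
  ultimately show "t \<in> {t \<in> C. t - 1 \<in> idl 1}" by simp
next
  fix t assume t: "t \<in> {t \<in> C. t - 1 \<in> idl 1}"
  \<comment> \<open>Halving brings \<open>1 + t\<close> into the residue class of 1, so that it has
    the required form \<open>a + \<pi> b\<close> with \<open>a = 1\<close>.\<close>
  define b where "b = (t - 1) / (2 * \<pi>)"
  have b: "b \<in> idl 0" using t by (simp add: b_def idl_divide_iff v_mult)
  have z: "1 + \<pi> * b = (1 + t) / 2" by (simp add: b_def field_simps)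
  have "1 + t - 2 \<in> idl 1" using t by simp
  then have nz: "1 + t \<noteq> 0" using v_cong[of "1 + t" 2 1] by simp
  have "\<gamma> t = inverse t" using t C_D by simp
  then have "\<gamma> (1 + t) = (1 + t) / t" using t C_D(1) by (simp add: gamma_add field_simps)
  then have "t = (1 + \<pi> * b) / \<gamma> (1 + \<pi> * b)" unfolding z using nz t C_D(1)
    by (simp add: gamma_divide)
  moreover have "1 \<in> val_units F v" by (simp add: val_units_def val_ring_def)
  ultimately show "t \<in> D" unfolding D_def OE_eq using b by blast
qed

end

section \<open>Minors, elimination and the Cartan decomposition\<close>

context odd_unramified_extension
begin

definition minor :: "'e^'n^'m \<Rightarrow> 'm \<Rightarrow> 'm \<Rightarrow> 'n \<Rightarrow> 'n \<Rightarrow> 'e" where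
  "minor A i i' j j' = A$i$j * A$i'$j' - A$i$j' * A$i'$j"

text \<open>Together with \<open>intmat\<close> this bounds the first two elementary divisors,
  enough to separate the double cosets that occur. Indices may coincide, such minors being
  0.\<close>

definition intmin :: "int \<Rightarrow> 'e^'n^'m \<Rightarrow> bool" where
  "intmin n A \<longleftrightarrow> (\<forall>i i' j j'. minor A i i' j j' \<in> idl n)"

lemma minor_mult_left:
  "minor (k ** A) i i' j j' = (\<Sum>a\<in>UNIV. \<Sum>b\<in>UNIV. k$i$a * k$i'$b * minor A a b j j')"
proof -
  have "minor (k ** A) i i' j j' =
      (\<Sum>a\<in>UNIV. \<Sum>b\<in>UNIV. (k$i$a * A$a$j) * (k$i'$b * A$b$j')) -
      (\<Sum>a\<in>UNIV. \<Sum>b\<in>UNIV. (k$i$a * A$a$j') * (k$i'$b * A$b$j))"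
    by (simp only: minor_def mult_entry sum_product)
  also have "\<dots> = (\<Sum>a\<in>UNIV. \<Sum>b\<in>UNIV. (k$i$a * A$a$j) * (k$i'$b * A$b$j') - (k$i$a * A$a$j') * (k$i'$b * A$b$j))"
    by (simp only: sum_subtractf)
  also have "\<dots> = (\<Sum>a\<in>UNIV. \<Sum>b\<in>UNIV. k$i$a * k$i'$b * minor A a b j j')"
    by (intro sum.cong refl) (simp add: minor_def algebra_simps)
  finally show ?thesis .
qed

lemma minor_mult_right:
  "minor (A ** k) i i' j j' = (\<Sum>a\<in>UNIV. \<Sum>b\<in>UNIV. k$a$j * k$b$j' * minor A i i' a b)"
proof -
  have "minor (A ** k) i i' j j' =
      (\<Sum>a\<in>UNIV. \<Sum>b\<in>UNIV. (A$i$a * k$a$j) * (A$i'$b * k$b$j')) -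
      (\<Sum>a\<in>UNIV. \<Sum>b\<in>UNIV. (A$i$a * k$a$j') * (A$i'$b * k$b$j))"
    by (simp only: minor_def mult_entry sum_product)
  also have "(\<Sum>a\<in>UNIV. \<Sum>b\<in>UNIV. (A$i$a * k$a$j') * (A$i'$b * k$b$j))
      = (\<Sum>a\<in>UNIV. \<Sum>b\<in>UNIV. (A$i$b * k$b$j') * (A$i'$a * k$a$j))"
    by (rule sum.swap)
  also have "(\<Sum>a\<in>UNIV. \<Sum>b\<in>UNIV. (A$i$a * k$a$j) * (A$i'$b * k$b$j')) - \<dots> =
     (\<Sum>a\<in>UNIV. \<Sum>b\<in>UNIV. (A$i$a * k$a$j) * (A$i'$b * k$b$j') - (A$i$b * k$b$j') * (A$i'$a * k$a$j))"
    by (simp only: sum_subtractf)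
  also have "\<dots> = (\<Sum>a\<in>UNIV. \<Sum>b\<in>UNIV. k$a$j * k$b$j' * minor A i i' a b)"
    by (intro sum.cong refl) (simp add: minor_def algebra_simps)
  finally show ?thesis .
qed

lemma intmin_mult_left: "intmat 0 k \<Longrightarrow> intmin n A \<Longrightarrow> intmin n (k ** A)"
  unfolding intmin_def minor_mult_left by (auto intro!: idl_sum idl_mult0 simp: intmatD)

lemma intmin_mult_right: "intmat 0 k \<Longrightarrow> intmin n A \<Longrightarrow> intmin n (A ** k)"
  unfolding intmin_def minor_mult_right by (auto intro!: idl_sum idl_mult0 simp: intmatD)

lemma GLO_left_iff:
  fixes P :: "'e^'m^'n \<Rightarrow> bool"
  assumes "\<And>k A. intmat 0 k \<Longrightarrow> P A \<Longrightarrow> P (k ** A)" and k: "k \<in> GLO"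
  shows "P (k ** A) \<longleftrightarrow> P A"
proof
  have i: "intmat 0 k" "intmat 0 (matrix_inv k)" "matrix_inv k ** k = mat 1"
    using k GLO_inv[OF k] by (auto simp: GLO_def)
  show "P A \<Longrightarrow> P (k ** A)" using assms(1) i by blast
  assume "P (k ** A)"
  then have "P (matrix_inv k ** (k ** A))" using assms(1) i by blast
  then show "P A" by (simp add: matrix_mul_assoc i)
qed

lemma GLO_right_iff:
  fixes P :: "'e^'m^'n \<Rightarrow> bool"
  assumes "\<And>k A. intmat 0 k \<Longrightarrow> P A \<Longrightarrow> P (A ** k)" and k: "k \<in> GLO"
  shows "P (A ** k) \<longleftrightarrow> P A"
proof
  have i: "intmat 0 k" "intmat 0 (matrix_inv k)" "k ** matrix_inv k = mat 1"
    using k GLO_inv[OF k] by (auto simp: GLO_def)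
  show "P A \<Longrightarrow> P (A ** k)" using assms(1) i by blast
  assume "P (A ** k)"
  then have "P ((A ** k) ** matrix_inv k)" using assms(1) i by blast
  then show "P A" by (simp add: i flip: matrix_mul_assoc)
qed

lemmas intmat_GLO_left = GLO_left_iff[where P = "intmat n" for n, OF intmat_mult0]
lemmas intmat_GLO_right = GLO_right_iff[where P = "intmat n" for n, OF intmat_mult0']
lemmas intmin_GLO_left = GLO_left_iff[where P = "intmin n" for n, OF intmin_mult_left]
lemmas intmin_GLO_right = GLO_right_iff[where P = "intmin n" for n, OF intmin_mult_right]

lemma K_GLO: "k \<in> K \<Longrightarrow> k \<in> GLO"
  using KK_GLO[of J4] by (simp add: K_eq)

lemma pi_pow_entry:
  "pi_pow (a0, a1, a2) $ i $ j = (if i = j then vector [\<pi> powi a1, \<pi> powi a2, \<pi> powi (a0 - a1), \<pi> powi (a0 - a2)] $ i else 0)"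
  by (simp add: pi_pow_def)

lemma is_sim_pi_pow: "is_sim J4 (pi_pow (a0, a1, a2)) (\<pi> powi a0)"
  unfolding is_sim_iff
  by (simp add: vec_eq_iff forall_4 mult_entry sum_4 pi_pow_entry J4_def F_powi gamma_powi power_int_diff)
     (simp add: mat_def gamma_divide gamma_powi)

lemma pi_pow_G: "pi_pow (a0, a1, a2) \<in> carrier G" and sim_pi_pow: "sim J4 (pi_pow (a0, a1, a2)) = \<pi> powi a0"
  using is_sim_pi_pow GU_I sim_eq herm_J4 by blast+

lemma pi_pow_mult: "pi_pow (a0, a1, a2) ** pi_pow (b0, b1, b2) = pi_pow (a0 + b0, a1 + b1, a2 + b2)"
  by (simp add: vec_eq_iff forall_4 mult_entry sum_4 pi_pow_entry)
     (simp flip: power_int_add add: algebra_simps)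

lemma pi_pow_0: "pi_pow (0, 0, 0) = mat 1"
  by (simp add: vec_eq_iff forall_4 pi_pow_entry mat_def)

lemma pi_pow_scalar: "pi_pow (2 * k, k, k) = mat (\<pi> powi k)"
  by (simp add: vec_eq_iff forall_4 pi_pow_entry mat_def)

definition dg :: "'e \<Rightarrow> 'e \<Rightarrow> 'e^2^2" where "dg a b = vector [vector [a, 0], vector [0, b]]"

lemma dg_entry [simp]: "dg a b $ 1 $ 1 = a" "dg a b $ 1 $ 2 = 0" "dg a b $ 2 $ 1 = 0" "dg a b $ 2 $ 2 = b"
  by (simp_all add: dg_def)

definition low2 :: "'e \<Rightarrow> 'e^2^2" where "low2 z = vector [vector [1, 0], vector [z, 1]]"

lemma low2_entry [simp]: "low2 z $ 1 $ 1 = 1" "low2 z $ 1 $ 2 = 0" "low2 z $ 2 $ 1 = z" "low2 z $ 2 $ 2 = 1"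
  by (simp_all add: low2_def)

lemma J2_entry [simp]: "J2 $ 1 $ 1 = (0::'e)" "J2 $ 1 $ 2 = (1::'e)" "J2 $ 2 $ 1 = (1::'e)" "J2 $ 2 $ 2 = (0::'e)"
  by (simp_all add: J2_def)

text \<open>Restricting to isometries keeps the similitude factor unchanged under multiplication
  from both sides.\<close>

definition U1 :: "('e^2^2) set" where "U1 = {k. is_sim J2 k 1 \<and> intmat 0 k}"

lemma U1_mult: "a \<in> U1 \<Longrightarrow> b \<in> U1 \<Longrightarrow> a ** b \<in> U1"
  using is_sim_mult[of J2 a 1 b 1] by (simp add: U1_def intmat_mult0)

lemma U1_one: "mat 1 \<in> U1" and U1_J2: "J2 \<in> U1"
  by (simp_all add: U1_def is_sim_J)

lemma U1_low2: "\<gamma> z = - z \<Longrightarrow> z \<in> idl 0 \<Longrightarrow> low2 z \<in> U1"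
  unfolding U1_def is_sim_iff by (simp add: mat2_cases mult_entry sum_2 intmat_def forall_2)

lemma U1_adj: "a \<in> U1 \<Longrightarrow> adj a \<in> U1"
  using is_sim_adj[OF herm_J2] by (simp add: U1_def)

lemma U1_dg: "e \<noteq> 0 \<Longrightarrow> v e = 0 \<Longrightarrow> dg (inverse e) (\<gamma> e) \<in> U1"
  unfolding U1_def is_sim_iff
  by (simp add: mat2_cases mult_entry sum_2 intmat_def forall_2 gamma_inverse idl_def v_inverse)

text \<open>Gaussian elimination inside the isometry group. An entry of least valuation is moved to
  the corner by \<open>J2\<close>; the similitude equation forces its ratios with the neighbouring
  entries to be skew, which is just what \<open>low2\<close> and its adjoint need to clear them, and
  it determines the last entry.\<close>

lemma cartan_GU2:
  assumes h: "is_sim J2 h s"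
  obtains k k' m where "k \<in> U1" "k' \<in> U1" "k ** h ** k' = dg (\<pi> powi m) (s / \<pi> powi m)" "2 * m \<le> v s"
    "intmat m h"
proof -
  have s: "s \<in> F" "s \<noteq> 0" using is_simD[OF h] by auto
  have nz: "\<exists>i j. h $ i $ j \<noteq> 0"
  proof (rule ccontr)
    assume "\<not> ?thesis"
    then have "(adj h ** J2 ** h) $ 1 $ 2 = 0" by (simp add: mult_entry)
    then show False using is_simD[OF h] by simp
  qed
  obtain i j where ij: "h $ i $ j \<noteq> 0" "intmat (v (h $ i $ j)) h"
  proof -
    define S where "S = {p :: 2 \<times> 2. h $ fst p $ snd p \<noteq> 0}"
    have "finite S" "S \<noteq> {}" using nz by (auto simp: S_def)
    then obtain p where p: "p \<in> S" "\<And>q. q \<in> S \<Longrightarrow> v (h $ fst p $ snd p) \<le> v (h $ fst q $ snd q)"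
      using ex_min_if_finite[of "(\<lambda>p. v (h $ fst p $ snd p)) ` S"] by (auto simp: not_less)
    then show ?thesis
      by (intro that[of "fst p" "snd p"]) (force simp: S_def intmat_def idl_def)+
  qed
  define w where "w = (\<lambda>i::2. if i = 1 then mat 1 else J2 :: 'e^2^2)"
  have w: "w i \<in> U1" for i by (simp add: w_def U1_one U1_J2)
  have w1: "(w i ** A) $ 1 $ j = A $ i $ j" for i j A
    using exhaust_2[of i] by (auto simp: w_def mult_entry sum_2 mat_def)
  have w2: "(A ** w j) $ i $ 1 = A $ i $ j" for i j A
    using exhaust_2[of j] by (auto simp: w_def mult_entry sum_2 mat_def)
  define h1 where "h1 = w i ** h ** w j"
  have h1s: "is_sim J2 h1 s" 
    using is_sim_mult[OF is_sim_mult[of J2 "w i" 1 h s] , of "w j" 1] w h by (simp add: h1_def U1_def)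
  define d where "d = h1 $ 1 $ 1"
  have d: "d = h $ i $ j" by (simp add: d_def h1_def w1 w2)
  have d0: "d \<noteq> 0" using ij d by simp
  have int1: "intmat (v d) h1" using ij w d by (simp add: h1_def U1_def intmat_mult0 intmat_mult0')
  define z where "z = h1 $ 2 $ 1 / d"
  have zi: "- z \<in> idl 0" using int1 d0 intmatD[OF int1, of 2 1] by (simp add: z_def idl_divide_iff)
  have "(adj h1 ** J2 ** h1) $ 1 $ 1 = 0" using is_simD[OF h1s] by simp
  then have "\<gamma> d * (h1 $ 2 $ 1) + \<gamma> (h1 $ 2 $ 1) * d = 0" by (simp add: mult_entry sum_2 d_def add.commute)
  then have zs: "\<gamma> (- z) = - (- z)" using d0 by (simp add: z_def gamma_divide gamma_minus field_simps add_eq_0_iff)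
  define h2 where "h2 = low2 (- z) ** h1"
  have lz: "low2 (- z) \<in> U1" by (rule U1_low2[OF zs zi])
  have h2s: "is_sim J2 h2 s" 
    using is_sim_mult[of J2 "low2 (- z)" 1 h1 s] lz h1s by (simp add: h2_def U1_def)
  have int2: "intmat (v d) h2" using int1 lz by (simp add: h2_def U1_def intmat_mult0)
  have h2e: "h2 $ 1 $ 1 = d" "h2 $ 2 $ 1 = 0" using d0 by (simp_all add: h2_def mult_entry sum_2 z_def d_def)
  define e where "e = h2 $ 1 $ 2 / d"
  have "(h2 ** J2 ** adj h2) $ 1 $ 1 = 0" using is_sim_right[OF herm_J2 h2s] by simp
  then have "d * \<gamma> (h2 $ 1 $ 2) + (h2 $ 1 $ 2) * \<gamma> d = 0" using h2e by (simp add: mult_entry sum_2 add.commute)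
  then have es: "\<gamma> e = - e" using d0 by (simp add: e_def gamma_divide gamma_minus field_simps add_eq_0_iff)
  have ei: "e \<in> idl 0" using intmatD[OF int2, of 1 2] d0 by (simp add: e_def idl_divide_iff)
  have le: "adj (low2 e) \<in> U1" by (rule U1_adj[OF U1_low2[OF es ei]])
  define h3 where "h3 = h2 ** adj (low2 e)"
  have h3s: "is_sim J2 h3 s" 
    using is_sim_mult[of J2 h2 s "adj (low2 e)" 1] le h2s by (simp add: h3_def U1_def)
  have int3: "intmat (v d) h3" using int2 le by (simp add: h3_def U1_def intmat_mult0')
  have h3e: "h3 $ 1 $ 1 = d" "h3 $ 2 $ 1 = 0" "h3 $ 1 $ 2 = 0" "h3 $ 2 $ 2 = h2 $ 2 $ 2"
    using h2e es d0 by (simp_all add: h3_def mult_entry sum_2) (simp add: e_def)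
  have "(adj h3 ** J2 ** h3) $ 1 $ 2 = s" using is_simD[OF h3s] by simp
  then have h3d: "\<gamma> d * h3 $ 2 $ 2 = s" using h3e by (simp add: mult_entry sum_2)
  \<comment> \<open>The unit part of the pivot; the isometry
    \<open>dg (inverse \<epsilon>) (\<gamma> \<epsilon>)\<close> removes it.\<close>
  define \<epsilon> where "\<epsilon> = d / \<pi> powi (v d)"
  have \<epsilon>: "\<epsilon> \<noteq> 0" "v \<epsilon> = 0" using d0 by (auto simp: \<epsilon>_def v_divide)
  have eu: "dg (inverse \<epsilon>) (\<gamma> \<epsilon>) \<in> U1" using \<epsilon> U1_dg by blast
  have "h3 = dg d (s / \<gamma> d)" using h3e h3d d0 by (simp add: mat2_cases field_simps)
  then have fin: "dg (inverse \<epsilon>) (\<gamma> \<epsilon>) ** h3 = dg (\<pi> powi (v d)) (s / \<pi> powi (v d))"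
    using d0 by (simp add: mat2_cases mult_entry sum_2 \<epsilon>_def gamma_divide gamma_powi)
  have vd: "2 * v d \<le> v s"
  proof -
    have "v s = v d + v (h3 $ 2 $ 2)" using h3d s d0 v_mult[of "\<gamma> d" "h3 $ 2 $ 2"] by auto
    moreover have "v d \<le> v (h3 $ 2 $ 2)" using intmatD[OF int3, of 2 2] h3d s by (auto simp: idl_def)
    ultimately show ?thesis by simp
  qed
  show ?thesis
  proof (rule that)
    show "dg (inverse \<epsilon>) (\<gamma> \<epsilon>) ** low2 (- z) ** w i \<in> U1" "w j ** adj (low2 e) \<in> U1"
      using eu lz w le U1_mult by blast+
    show "dg (inverse \<epsilon>) (\<gamma> \<epsilon>) ** low2 (- z) ** w i ** h ** (w j ** adj (low2 e)) = dg (\<pi> powi (v d)) (s / \<pi> powi (v d))"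
      unfolding fin[symmetric] h3_def h2_def h1_def by (simp only: matrix_mul_assoc)
    show "2 * v d \<le> v s" by (rule vd)
    show "intmat (v d) h" using ij d by simp
  qed
qed

lemma U1_inv: "k \<in> U1 \<Longrightarrow> matrix_inv k \<in> U1 \<and> matrix_inv k ** k = mat 1 \<and> k ** matrix_inv k = mat 1"
proof -
  assume k: "k \<in> U1"
  then have s: "is_sim J2 k 1" by (simp add: U1_def)
  have e: "matrix_inv k = J2 ** adj k ** J2" using is_sim_inv(2)[OF herm_J2 s] by simp
  have "matrix_inv k \<in> U1" unfolding e using k by (intro U1_mult U1_J2 U1_adj)
  then show ?thesis using is_sim_inv(3,4)[OF herm_J2 s] by simp
qed

text \<open>Inversion in \<open>GU\<^sub>2\<close> is, up to the centre, multiplication on both sides by one element of the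
  maximal compact subgroup; this is the source of unimodularity.\<close>

lemma GU2_inverse:
  assumes h: "is_sim J2 h s"
  obtains w where "w \<in> U1" "matrix_inv h = mat (inverse s) ** (w ** h ** w)"
proof -
  obtain k k' m where k: "k \<in> U1" "k' \<in> U1" "k ** h ** k' = dg (\<pi> powi m) (s / \<pi> powi m)"
    using cartan_GU2[OF h] by metis
  define a where "a = dg (\<pi> powi m) (s / \<pi> powi m)"
  have s: "s \<noteq> 0" using is_simD[OF h] by auto
  \<comment> \<open>Conjugation by \<open>J2\<close> exchanges the diagonal entries, whose product
    is \<open>s\<close>.\<close>
  have aa: "a ** (J2 ** a ** J2) = mat s"
    by (simp add: mat2_cases a_def mult_entry sum_2) (simp add: mat_def)
  have ka: "k ** h ** k' = a" using k a_def by simp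
  define w where "w = k' ** J2 ** k"
  have "k ** (h ** (w ** h ** w)) = (k ** h ** k') ** J2 ** (k ** h ** k') ** J2 ** k"
    unfolding w_def by (simp only: matrix_mul_assoc)
  also have "\<dots> = a ** (J2 ** a ** J2) ** k" unfolding ka by (simp only: matrix_mul_assoc)
  also have "\<dots> = k ** mat s" unfolding aa by (simp add: mat_central)
  finally have "matrix_inv k ** (k ** (h ** (w ** h ** w))) = matrix_inv k ** (k ** mat s)" by simp
  then have "h ** (w ** h ** w) = mat s" using U1_inv[OF k(1)] by (simp add: matrix_mul_assoc)
  then have "h ** (mat (inverse s) ** (w ** h ** w)) = mat 1"
    using s by (simp add: mat_left_commute[of h] mat_mult_mat)
  then have "matrix_inv h = mat (inverse s) ** (w ** h ** w)" by (rule matrix_inv_unique)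
  moreover have "w \<in> U1" unfolding w_def using k U1_mult U1_J2 by blast
  ultimately show ?thesis using that by blast
qed

text \<open>A unipotent fixing the third basis vector. Its first column \<open>(1, x, z, y)\<close>
  is a vector with leading entry 1, and the condition in \<open>is_sim_lowK\<close> says that this
  vector is isotropic.\<close>

definition lowK :: "'e \<Rightarrow> 'e \<Rightarrow> 'e \<Rightarrow> 'e^4^4" where
  "lowK x z y = vector [vector [1, 0, 0, 0], vector [x, 1, 0, 0],
     vector [z, - \<gamma> y, 1, - \<gamma> x], vector [y, 0, 0, 1]]"

lemma is_sim_lowK:
  assumes "z + \<gamma> z + \<gamma> x * y + x * \<gamma> y = 0"
  shows "is_sim J4 (lowK x z y) 1"
proof -
  have "\<gamma> z + \<gamma> x * y + z + \<gamma> y * x = 0" using assms by (simp add: ac_simps)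
  then show ?thesis
    unfolding is_sim_iff
    by (simp add: vec_eq_iff forall_4 mult_entry sum_4 lowK_def J4_def gamma_minus ac_simps)
qed

lemma intmat_lowK: "x \<in> idl 0 \<Longrightarrow> z \<in> idl 0 \<Longrightarrow> y \<in> idl 0 \<Longrightarrow> intmat 0 (lowK x z y)"
  by (simp add: intmat_def forall_4 lowK_def)

lemma K_I: "is_sim J4 g s \<Longrightarrow> v s = 0 \<Longrightarrow> intmat 0 g \<Longrightarrow> g \<in> K"
  unfolding K_eq KK_def using GU_I sim_eq herm_J4 by blast

lemma K_mult: "a \<in> K \<Longrightarrow> b \<in> K \<Longrightarrow> a ** b \<in> K"
  using KK_mult[OF herm_J4] by (simp add: K_eq)

lemma K_inv: "a \<in> K \<Longrightarrow> matrix_inv a \<in> K \<and> matrix_inv a ** a = mat 1 \<and> a ** matrix_inv a = mat 1"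
  using KK_inv[OF herm_J4] KK_D(1) GU_inv_cancel[OF herm_J4] by (simp add: K_eq) blast

lemma K_one: "mat 1 \<in> K"
  using KK_one[OF herm_J4] by (simp add: K_eq)

lemma K_adj: "a \<in> K \<Longrightarrow> adj a \<in> K"
  using KK_adj[OF herm_J4] by (simp add: K_eq)

lemma K_G: "a \<in> K \<Longrightarrow> a \<in> carrier G" and K_int: "a \<in> K \<Longrightarrow> intmat 0 a" and K_sim: "a \<in> K \<Longrightarrow> v (sim J4 a) = 0"
  using KK_D by (auto simp: K_eq)

lemma G_mult: "a \<in> carrier G \<Longrightarrow> b \<in> carrier G \<Longrightarrow> a ** b \<in> carrier G"
  by (simp add: GU_mult_closed)

lemma K_iota: "a \<in> U1 \<Longrightarrow> b \<in> U1 \<Longrightarrow> \<iota> (a, b) \<in> K"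
  by (rule K_I[of _ 1]) (auto simp: is_sim_iota intmat_iota U1_def)

text \<open>A column of a similitude is isotropic. Divided by its pivot of least valuation, the
  first column is integral, hence the first column of some \<open>lowK\<close> in \<open>K\<close>;
  the inverse of that element clears it and does not touch the first row.\<close>

lemma column_clear:
  assumes g: "is_sim J4 g s" "intmat (v (g $ 1 $ 1)) g" "g $ 1 $ 1 \<noteq> 0"
  obtains k where "k \<in> K" "\<And>j. (k ** g) $ 1 $ j = g $ 1 $ j" "\<And>i. i \<noteq> 1 \<Longrightarrow> (k ** g) $ i $ 1 = 0"
proof -
  define c where "c = g $ 1 $ 1"
  define x y z where "x = g $ 2 $ 1 / c" "y = g $ 4 $ 1 / c" "z = g $ 3 $ 1 / c"
  have c: "c \<noteq> 0" using g c_def by simp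
  have ints: "x \<in> idl 0" "y \<in> idl 0" "z \<in> idl 0"
    using g c intmatD[OF g(2)] by (simp_all add: x_y_z_def idl_divide_iff flip: c_def)
  have "(adj g ** J4 ** g) $ 1 $ 1 = 0" using is_simD[OF g(1)] by (simp add: J4_def)
  then have e: "\<gamma> (g$3$1) * c + \<gamma> (g$4$1) * g$2$1 + \<gamma> c * g$3$1 + \<gamma> (g$2$1) * g$4$1 = 0"
    by (simp add: mult_entry sum_4 J4_def c_def)
  have "(z + \<gamma> z + \<gamma> x * y + x * \<gamma> y) * (c * \<gamma> c) =
      \<gamma> (g$3$1) * c + \<gamma> (g$4$1) * g$2$1 + \<gamma> c * g$3$1 + \<gamma> (g$2$1) * g$4$1"
    using c by (simp add: x_y_z_def gamma_divide field_simps)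
  then have "(z + \<gamma> z + \<gamma> x * y + x * \<gamma> y) * (c * \<gamma> c) = 0" using e by simp
  then have "z + \<gamma> z + \<gamma> x * y + x * \<gamma> y = 0" using c by simp
  then have sk: "is_sim J4 (lowK x z y) 1" by (rule is_sim_lowK)
  then have kK: "lowK x z y \<in> K" using K_I ints intmat_lowK by simp
  define k where "k = lowK x z y"
  have kk: "matrix_inv k ** k = mat 1" "k ** matrix_inv k = mat 1" "matrix_inv k \<in> K"
    using K_inv kK k_def by auto
  show ?thesis
  proof (rule that[OF kk(3)])
    have r1: "k $ 1 $ i = (if i = 1 then 1 else 0)" for i
      using exhaust_4[of i] by (auto simp: k_def lowK_def)
    have "(k ** A) $ 1 $ j = A $ 1 $ j" for A j
      by (simp add: mult_entry r1 if_distrib[where f = "\<lambda>x. x * _"] cong: if_cong)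
    from this[of "matrix_inv k ** g"] show "(matrix_inv k ** g) $ 1 $ j = g $ 1 $ j" for j
      by (simp add: matrix_mul_assoc kk)
    have "g $ j $ 1 = c * k $ j $ 1" for j
      using exhaust_4[of j] c by (auto simp: k_def lowK_def x_y_z_def c_def)
    then have "(matrix_inv k ** g) $ i $ 1 = c * (matrix_inv k ** k) $ i $ 1" for i
      by (simp add: mult_entry sum_distrib_left ac_simps)
    then show "(matrix_inv k ** g) $ i $ 1 = 0" if "i \<noteq> 1" for i
      using that by (simp add: kk mat_def)
  qed
qed

definition P12 :: "'e^4^4" where
  "P12 = vector [vector [0, 1, 0, 0], vector [1, 0, 0, 0], vector [0, 0, 0, 1], vector [0, 0, 1, 0]]"

lemma P12_K: "P12 \<in> K"
  by (rule K_I[of _ 1]) (auto simp: is_sim_iff vec_eq_iff forall_4 mult_entry sum_4 P12_def J4_def intmat_def)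

lemma pivot_perm: "\<exists>w\<in>K. \<forall>(A :: 'e^4^4) j. (w ** A) $ 1 $ j = A $ i $ j"
proof -
  let ?t = "\<iota> (J2, mat 1)"
  have t: "?t \<in> K" using K_iota U1_J2 U1_one by blast
  have tA: "(?t ** A) $ 1 $ j = A $ 3 $ j" "(P12 ** A) $ 1 $ j = A $ 2 $ j" "(P12 ** A) $ 3 $ j = A $ 4 $ j" for A :: "'e^4^4" and j
    by (simp_all add: mult_entry sum_4 iota_entry P12_def)
  consider "i = 1" | "i = 2" | "i = 3" | "i = 4" using exhaust_4 by blast
  then show ?thesis
  proof cases
    case 1 then show ?thesis using K_one by (auto intro!: bexI[of _ "mat 1"])
  next
    case 2 then show ?thesis using P12_K tA by blast
  next
    case 3 then show ?thesis using t tA by blast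
  next
    case 4 then show ?thesis using K_mult[OF t P12_K] tA by (intro bexI[of _ "?t ** P12"]) (simp_all flip: matrix_mul_assoc)
  qed
qed

lemma G_nonzero:
  assumes "is_sim J4 g s"
  obtains i j where "g $ i $ j \<noteq> 0" "intmat (v (g $ i $ j)) g"
proof -
  have nz: "\<exists>i j. g $ i $ j \<noteq> 0"
  proof (rule ccontr)
    assume "\<not> ?thesis"
    then have "(adj g ** J4 ** g) $ 1 $ 3 = 0" by (simp add: mult_entry)
    then show False using is_simD[OF assms] by (simp add: J4_def)
  qed
  define S where "S = {p :: 4 \<times> 4. g $ fst p $ snd p \<noteq> 0}"
  have "finite S" "S \<noteq> {}" using nz by (auto simp: S_def)
  then obtain p where p: "p \<in> S" "\<And>q. q \<in> S \<Longrightarrow> v (g $ fst p $ snd p) \<le> v (g $ fst q $ snd q)"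
    using ex_min_if_finite[of "(\<lambda>p. v (g $ fst p $ snd p)) ` S"] by (auto simp: not_less)
  then show ?thesis
    by (intro that[of "fst p" "snd p"]) (force simp: S_def intmat_def idl_def)+
qed

text \<open>After clearing the first column and, through the adjoint, the first row, the similitude
  equation splits off index 3 as well. What remains is a 2 by 2 similitude, handled by
  \<open>cartan_GU2\<close>. Minimality of the pivot gives \<open>a1 \<le> a2\<close>.\<close>

theorem cartan_decomposition:
  assumes g: "g \<in> carrier G"
  obtains k k' a0 a1 a2 where "k \<in> K" "k' \<in> K" "g = k ** pi_pow (a0, a1, a2) ** k'" "a1 \<le> a2" "2 * a2 \<le> a0"
proof -
  define s where "s = sim J4 g"
  have gs: "is_sim J4 g s" using g GU_sim s_def herm_J4 by blast
  have s: "s \<noteq> 0" using is_simD[OF gs] by auto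
  obtain i j where ij: "g $ i $ j \<noteq> 0" "intmat (v (g $ i $ j)) g" using G_nonzero[OF gs] by blast
  obtain w where w: "w \<in> K" "\<And>(A :: 'e^4^4) j. (w ** A) $ 1 $ j = A $ i $ j"
    using pivot_perm[of i] by auto
  obtain u where u: "u \<in> K" "\<And>(A :: 'e^4^4) i. (u ** A) $ 1 $ i = A $ j $ i"
    using pivot_perm[of j] by auto
  have u': "(A ** adj u) $ i $ 1 = A $ i $ j" for A :: "'e^4^4" and i
  proof -
    have "\<gamma> ((A ** adj u) $ i $ 1) = (adj (A ** adj u)) $ 1 $ i" by simp
    also have "\<dots> = \<gamma> (A $ i $ j)" by (simp only: adj_mult adj_adj u(2) adj_entry)
    finally show ?thesis by (metis gamma_invol)
  qed
  have sK: "is_sim J4 a (sim J4 a)" "v (sim J4 a) = 0" "sim J4 a \<noteq> 0" if "a \<in> K" for a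
    using that K_G GU_sim[OF herm_J4] K_sim sim_nonzero[OF herm_J4] by auto
  define g1 where "g1 = w ** g ** adj u"
  have g1G: "g1 \<in> carrier G" using g K_G w(1) K_adj[OF u(1)] G_mult by (simp add: g1_def)
  define c where "c = g $ i $ j"
  have c: "g1 $ 1 $ 1 = c" "c \<noteq> 0" using w u' ij by (auto simp: g1_def c_def)
  have int1: "intmat (v c) g1"
    using intmat_mult0'[OF intmat_mult0[OF K_int[OF w(1)] ij(2)] K_int[OF K_adj[OF u(1)]]]
    by (simp add: g1_def c_def)
  obtain k1 where k1: "k1 \<in> K" "\<And>j. (k1 ** g1) $ 1 $ j = g1 $ 1 $ j" "\<And>i. i \<noteq> 1 \<Longrightarrow> (k1 ** g1) $ i $ 1 = 0"
    using column_clear[OF GU_sim[OF herm_J4 g1G]] int1 c by metis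
  \<comment> \<open>Passing to the adjoint turns the first row into a column, so
    \<open>column_clear\<close> applies a second time.\<close>
  define g2 where "g2 = adj (k1 ** g1)"
  have g2G: "g2 \<in> carrier G" using g1G k1 K_G G_mult sim_adj[OF herm_J4] by (simp add: g2_def)
  have c2: "g2 $ 1 $ 1 = \<gamma> c" "\<And>j. j \<noteq> 1 \<Longrightarrow> g2 $ 1 $ j = 0" using k1 c by (auto simp: g2_def)
  have int2: "intmat (v c) g2" using int1 k1(1) K_int by (simp add: g2_def intmat_mult0)
  obtain k2 where k2: "k2 \<in> K" "\<And>j. (k2 ** g2) $ 1 $ j = g2 $ 1 $ j" "\<And>i. i \<noteq> 1 \<Longrightarrow> (k2 ** g2) $ i $ 1 = 0"
    using column_clear[OF GU_sim[OF herm_J4 g2G]] int2 c c2 by (metis gamma_eq_0 v_gamma)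
  define g3 where "g3 = adj (k2 ** g2)"
  have g3: "g3 = k1 ** w ** g ** (adj u ** adj k2)"
    by (simp add: g3_def g2_def g1_def adj_mult matrix_mul_assoc)
  have g3G: "g3 \<in> carrier G" using g2G k2 K_G G_mult sim_adj[OF herm_J4] by (simp add: g3_def)
  have int3: "intmat (v c) g3" using int2 k2(1) K_int by (simp add: g3_def intmat_mult0)
  have c3: "g3 $ 1 $ 1 = c" "\<And>j. j \<noteq> 1 \<Longrightarrow> g3 $ j $ 1 = 0" "\<And>j. j \<noteq> 1 \<Longrightarrow> g3 $ 1 $ j = 0"
    using k2 c2 by (auto simp: g3_def)
  define t where "t = sim J4 g3"
  have g3s: "is_sim J4 g3 t" using g3G GU_sim t_def herm_J4 by blast
  have t: "t \<noteq> 0" using is_simD[OF g3s] by auto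
  have "(adj g3 ** J4 ** g3) $ 1 $ j = t * J4 $ 1 $ j" for j using is_simD[OF g3s] by simp
  then have row3: "\<gamma> c * g3 $ 3 $ j = t * J4 $ 1 $ j" for j
    using c3 by (simp add: mult_entry sum_4 J4_def)
  have "(g3 ** J4 ** adj g3) $ j $ 1 = t * J4 $ j $ 1" for j using is_sim_right[OF herm_J4 g3s] by simp
  then have col3: "g3 $ j $ 3 * \<gamma> c = t * J4 $ j $ 1" for j
    using c3 by (simp add: mult_entry sum_4 J4_def)
  have r3: "g3 $ 3 $ 1 = 0" "g3 $ 3 $ 2 = 0" "g3 $ 3 $ 4 = 0" "g3 $ 1 $ 3 = 0" "g3 $ 2 $ 3 = 0" "g3 $ 4 $ 3 = 0"
    "\<gamma> c * g3 $ 3 $ 3 = t"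
    using row3[of 1] row3[of 2] row3[of 4] row3[of 3] col3[of 1] col3[of 2] col3[of 4] c by (simp_all add: J4_def)
  define b where "b = (vector [vector [g3 $ 2 $ 2, g3 $ 2 $ 4], vector [g3 $ 4 $ 2, g3 $ 4 $ 4]] :: 'e^2^2)"
  have g3i: "g3 = \<iota> (dg c (g3 $ 3 $ 3), b)"
    using c3 r3 by (simp add: vec_eq_iff forall_4 iota_entry b_def)
  have bs: "is_sim J2 b t" using g3s g3i is_sim_iota by metis
  obtain l l' m where l: "l \<in> U1" "l' \<in> U1" "l ** b ** l' = dg (\<pi> powi m) (t / \<pi> powi m)" "2 * m \<le> v t"
    using cartan_GU2[OF bs] by metis
  define g4 where "g4 = \<iota> (mat 1, l) ** g3 ** \<iota> (mat 1, l')"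
  have lK: "\<iota> (mat 1, l) \<in> K" "\<iota> (mat 1, l') \<in> K" using l K_iota U1_one by blast+
  have g4G: "g4 \<in> carrier G" using lK g3G K_G G_mult by (simp add: g4_def)
  have g4i: "g4 = \<iota> (dg c (g3 $ 3 $ 3), dg (\<pi> powi m) (t / \<pi> powi m))"
    unfolding g4_def by (subst g3i) (simp add: iota_mult l)
  have int4: "intmat (v c) g4" 
    unfolding g4_def by (rule intmat_mult0'[OF intmat_mult0[OF K_int[OF lK(1)] int3] K_int[OF lK(2)]])
  then have cm: "v c \<le> m" using intmatD[OF int4, of 2 2] by (simp add: g4i iota_entry idl_def)
  define L where "L = pi_pow (v t, v c, m)"
  have LG: "L \<in> carrier G" by (simp add: L_def pi_pow_G)
  \<comment> \<open>\<open>g4\<close> is already diagonal with the right valuations; only units are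
    left over, and they are absorbed into \<open>K\<close>.\<close>
  define \<kappa> where "\<kappa> = pi_pow (- v t, - v c, - m) ** g4"
  have "L ** pi_pow (- v t, - v c, - m) = mat 1" by (simp add: L_def pi_pow_mult pi_pow_0)
  then have "L ** \<kappa> = g4" unfolding \<kappa>_def by (simp only: matrix_mul_assoc mat_one_mult)
  moreover have "\<kappa> \<in> K"
  proof -
    have "is_sim J4 g4 t"
      using is_sim_mult[OF is_sim_mult[of J4 "\<iota> (mat 1, l)" 1 g3 t], of "\<iota> (mat 1, l')" 1] l g3s
      by (simp add: g4_def is_sim_iota U1_def)
    then have "is_sim J4 \<kappa> (\<pi> powi (- v t) * t)" unfolding \<kappa>_def by (rule is_sim_mult[OF is_sim_pi_pow])
    moreover have "v (\<pi> powi (- v t) * t) = 0" using t by (simp add: v_mult)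
    moreover have "intmat 0 \<kappa>"
    proof -
      have v3: "v t = v c + v (g3 $ 3 $ 3)" "g3 $ 3 $ 3 \<noteq> 0"
        using r3(7) t c v_mult[of "\<gamma> c" "g3 $ 3 $ 3"] by auto
      show ?thesis
        unfolding \<kappa>_def g4i using c t v3
        by (simp add: intmat_def forall_4 mult_entry sum_4 pi_pow_entry iota_entry)
           (simp add: idl_def v_mult v_divide)
    qed
    ultimately show ?thesis using K_I by blast
  qed
  ultimately have g4L: "g4 = L ** \<kappa>" "\<kappa> \<in> K" by simp_all
  define A B where "A = \<iota> (mat 1, l) ** k1 ** w" "B = adj u ** adj k2 ** \<iota> (mat 1, l')"
  have AB: "A \<in> K" "B \<in> K" unfolding A_B_def by (intro K_mult K_adj lK k1(1) k2(1) w(1) u(1))+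
  have "A ** g ** B = g4" unfolding A_B_def g4_def g3 by (simp only: matrix_mul_assoc)
  then have "matrix_inv A ** (A ** g ** B) ** matrix_inv B = matrix_inv A ** L ** (\<kappa> ** matrix_inv B)"
    using g4L by (simp add: matrix_mul_assoc)
  moreover have "matrix_inv A ** (A ** g ** B) ** matrix_inv B = (matrix_inv A ** A) ** g ** (B ** matrix_inv B)"
    by (simp only: matrix_mul_assoc)
  ultimately have "g = matrix_inv A ** pi_pow (v t, v c, m) ** (\<kappa> ** matrix_inv B)"
    using K_inv[OF AB(1)] K_inv[OF AB(2)] by (simp add: L_def)
  moreover have "matrix_inv A \<in> K" "\<kappa> ** matrix_inv B \<in> K" using K_inv AB g4L K_mult by blast+
  ultimately show ?thesis using that cm l(4) by blast
qed

end

section \<open>Topology: bounded sets, cosets and compact supports\<close>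

context odd_unramified_extension
begin

lemma openin_field: "openin field_top S \<longleftrightarrow> (\<forall>x\<in>S. \<exists>n. \<forall>y. y - x \<in> idl n \<longrightarrow> y \<in> S)"
proof -
  interpret M: Metric_space UNIV "val_dist v" by (rule Metric_E)
  have "(\<exists>r>0. M.mball x r \<subseteq> S) \<longleftrightarrow> (\<exists>n. \<forall>y. y - x \<in> idl n \<longrightarrow> y \<in> S)" for x
  proof
    assume "\<exists>r>0. M.mball x r \<subseteq> S"
    then obtain r where r: "r > 0" "M.mball x r \<subseteq> S" by blast
    then obtain n :: nat where n: "2 powi (- int n) < r" using ex_powi_less by blast
    show "\<exists>n. \<forall>y. y - x \<in> idl n \<longrightarrow> y \<in> S"
    proof (intro exI[of _ "int n + 1"] allI impI)
      fix y assume "y - x \<in> idl (int n + 1)"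
      then have "val_dist v x y < 2 powi (- int n)" using val_dist_less_iff idl_commute by blast
      then show "y \<in> S" using r n by auto
    qed
  next
    assume "\<exists>n. \<forall>y. y - x \<in> idl n \<longrightarrow> y \<in> S"
    then obtain n where n: "\<And>y. y - x \<in> idl n \<Longrightarrow> y \<in> S" by blast
    show "\<exists>r>0. M.mball x r \<subseteq> S"
    proof (intro exI[of _ "2 powi (- (n - 1))"] conjI subsetI)
      fix y assume "y \<in> M.mball x (2 powi (- (n - 1)))"
      then have "val_dist v x y < 2 powi (- (n - 1))" by simp
      then show "y \<in> S" using n val_dist_less_iff[of x y "n - 1"] idl_commute by force
    qed (simp add: zero_less_power_int)
  qed
  then show ?thesis unfolding field_top_def M.openin_mtopology by blast
qed

lemma topspace_field [simp]: "topspace field_top = UNIV"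
proof -
  have "openin field_top UNIV" by (simp add: openin_field)
  then show ?thesis using openin_subset by blast
qed

lemma closedin_field:
  assumes "\<And>x. (\<And>n. \<exists>y\<in>S. y - x \<in> idl n) \<Longrightarrow> x \<in> S"
  shows "closedin field_top S"
  unfolding closedin_def using assms by (auto simp: openin_field) blast

lemma finite_reps: obtains R where "finite R" "\<And>x. x \<in> idl 0 \<Longrightarrow> \<exists>r\<in>R. x - r \<in> idl 1" "R \<subseteq> idl 0"
proof -
  have fin: "finite (residue_classes UNIV v)" by (rule E.finite_residue_field)
  define cl where "cl = (\<lambda>x. {y \<in> OE. y - x \<in> max_ideal UNIV v})"
  have mi: "max_ideal UNIV v = idl 1" by (auto simp: max_ideal_def idl_def)
  have "finite (cl ` OE)" using fin by (simp add: residue_classes_def cl_def)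
  then obtain R where R: "R \<subseteq> OE" "finite R" "cl ` OE = cl ` R"
    by (metis finite_subset_image order_refl)
  show ?thesis
  proof (rule that[OF R(2)])
    fix x assume x: "x \<in> idl 0"
    then have "cl x \<in> cl ` R" using R(3) by (auto simp: OE_eq)
    then obtain r where "r \<in> R" "cl x = cl r" by blast
    moreover have "x \<in> cl x" using x by (simp add: cl_def OE_eq mi)
    ultimately show "\<exists>r\<in>R. x - r \<in> idl 1" by (auto simp: cl_def mi)
  qed (use R OE_eq in auto)
qed

lemma idl_finite_cover: "\<exists>R. finite R \<and> R \<subseteq> idl n \<and> (\<forall>x\<in>idl n. \<exists>r\<in>R. x - r \<in> idl (n + int m))"
proof (induction m)
  case 0
  then show ?case by (intro exI[of _ "{0}"]) auto
next
  case (Suc m)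
  then obtain R where R: "finite R" "R \<subseteq> idl n" "\<And>x. x \<in> idl n \<Longrightarrow> \<exists>r\<in>R. x - r \<in> idl (n + int m)" by blast
  obtain Q where Q: "finite Q" "\<And>x. x \<in> idl 0 \<Longrightarrow> \<exists>r\<in>Q. x - r \<in> idl 1" "Q \<subseteq> idl 0" using finite_reps by blast
  define c where "c = \<pi> powi (n + int m)"
  have c: "c \<noteq> 0" "v c = n + int m" by (simp_all add: c_def)
  let ?R = "(\<lambda>(r, s). r + c * s) ` (R \<times> Q)"
  show ?case
  proof (intro exI[of _ ?R] conjI ballI)
    show "finite ?R" using R Q by simp
    show "?R \<subseteq> idl n"
    proof clarify
      fix r s assume "r \<in> R" "s \<in> Q"
      then have "r \<in> idl n" "c * s \<in> idl n" using R Q c idl_mono[of s 0 "n - v c"] by (auto simp: idl_mult_iff)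
      then show "r + c * s \<in> idl n" by (rule idl_add)
    qed
    fix x assume "x \<in> idl n"
    then obtain r where r: "r \<in> R" "x - r \<in> idl (n + int m)" using R by blast
    then have "(x - r) / c \<in> idl 0" using c by (simp add: idl_divide_iff)
    then obtain s where s: "s \<in> Q" "(x - r) / c - s \<in> idl 1" using Q by blast
    have "x - (r + c * s) = c * ((x - r) / c - s)" using c by (simp add: field_simps)
    moreover have "c * ((x - r) / c - s) \<in> idl (n + int (Suc m))"
      by (subst idl_mult_iff[OF c(1)]) (use s c in simp)
    ultimately have "x - (r + c * s) \<in> idl (n + int (Suc m))" by simp
    then show "\<exists>t\<in>?R. x - t \<in> idl (n + int (Suc m))" using r s by force
  qed
qed

text \<open>A closed and totally bounded subset of the complete field \<open>E\<close>; total
  boundedness is the finiteness of the residue field, iterated digit by digit in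
  \<open>idl_finite_cover\<close>.\<close>

lemma compactin_idl: "compactin field_top (idl n)"
proof -
  interpret M: Metric_space UNIV "val_dist v" by (rule Metric_E)
  have "M.mtotally_bounded (idl n)"
    unfolding M.mtotally_bounded_def
  proof (intro allI impI)
    fix e :: real assume "e > 0"
    then obtain k :: nat where k: "2 powi (- int k) < e" using ex_powi_less by blast
    obtain R where R: "finite R" "R \<subseteq> idl n" "\<And>x. x \<in> idl n \<Longrightarrow> \<exists>r\<in>R. x - r \<in> idl (n + int (nat (int k + 1 - n)))"
      using idl_finite_cover[of n "nat (int k + 1 - n)"] by auto
    show "\<exists>K. finite K \<and> K \<subseteq> idl n \<and> idl n \<subseteq> (\<Union>x\<in>K. M.mball x e)"
    proof (intro exI[of _ R] conjI subsetI)
      fix x assume "x \<in> idl n"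
      then obtain r where r: "r \<in> R" "x - r \<in> idl (n + int (nat (int k + 1 - n)))" using R by blast
      then have "r - x \<in> idl (int k + 1)" using idl_mono[of "x - r" _ "int k + 1"] idl_commute by force
      then have "val_dist v r x < e" using k val_dist_less_iff by (meson less_trans)
      then show "x \<in> (\<Union>x\<in>R. M.mball x e)" using r by auto
    qed (use R in auto)
  qed
  then have "compactin M.mtopology (M.mtopology closure_of (idl n))"
    using M.mtotally_bounded_eq_compact_closure_of[OF E.complete] by blast
  moreover have "closedin field_top (idl n)"
    by (rule closedin_field) (metis idl_cong_mem)
  ultimately show ?thesis by (simp add: field_top_def closure_of_closedin)
qed

lemma openin_mat:
  fixes S :: "('e^'b^'a) set"
  shows "openin mat_top S \<longleftrightarrow> (\<forall>A\<in>S. \<exists>n. \<forall>B. intmat n (B - A) \<longrightarrow> B \<in> S)" (is "?l \<longleftrightarrow> ?r")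
proof -
  define f where "f = (\<lambda>(A::'e^'b^'a) (i, j). A $ i $ j)"
  let ?P = "product_topology (\<lambda>_. field_top) (UNIV :: ('a \<times> 'b) set)"
  have finj: "f A = f B \<Longrightarrow> A = B" for A B
    by (simp add: f_def fun_eq_iff vec_eq_iff)
  have fsurj: "f (\<chi> i j. h (i, j)) = h" for h by (simp add: f_def fun_eq_iff)
  have op: "openin mat_top S \<longleftrightarrow> (\<exists>U. openin ?P U \<and> S = f -` U)"
    unfolding mat_top_def openin_pullback_topology f_def by simp
  show ?thesis
  proof
    assume ?l
    then obtain W where W: "openin ?P W" "S = f -` W" using op by blast
    show ?r
    proof
      fix A assume "A \<in> S"
      then have "f A \<in> W" using W by simp
      then obtain U where U: "\<And>i. openin field_top (U i)" "f A \<in> Pi\<^sub>E UNIV U" "Pi\<^sub>E UNIV U \<subseteq> W"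
        using W(1)[unfolded openin_product_topology_alt, rule_format, of "f A"] by auto
      have "\<exists>n. \<forall>y. y - f A p \<in> idl n \<longrightarrow> y \<in> U p" for p
        using U(1)[of p] U(2) unfolding openin_field by blast
      then obtain n where n: "\<And>p y. y - f A p \<in> idl (n p) \<Longrightarrow> y \<in> U p" by metis
      show "\<exists>n. \<forall>B. intmat n (B - A) \<longrightarrow> B \<in> S"
      proof (intro exI[of _ "Max (range n)"] allI impI)
        fix B assume B: "intmat (Max (range n)) (B - A)"
        have "f B p \<in> U p" for p
        proof (rule n)
          have "n p \<le> Max (range n)" by simp
          moreover have "f B p - f A p \<in> idl (Max (range n))"
            using intmatD[OF B, of "fst p" "snd p"] by (simp add: f_def case_prod_beta)
          ultimately show "f B p - f A p \<in> idl (n p)" using idl_mono by blast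
        qed
        then have "f B \<in> W" using U(3) by blast
        then show "B \<in> S" using W by simp
      qed
    qed
  next
    assume r: ?r
    have "openin ?P (f ` S)"
      unfolding openin_product_topology_alt
    proof
      fix x assume "x \<in> f ` S"
      then obtain A where A: "A \<in> S" "x = f A" by blast
      then obtain n where n: "\<And>B. intmat n (B - A) \<Longrightarrow> B \<in> S" using r by blast
      let ?U = "\<lambda>p. {y. y - x p \<in> idl n}"
      have "Pi\<^sub>E UNIV ?U \<subseteq> f ` S"
      proof
        fix h assume h: "h \<in> Pi\<^sub>E UNIV ?U"
        have "intmat n ((\<chi> i j. h (i, j)) - A)"
          using h[THEN PiE_mem] A by (fastforce simp: intmat_def f_def)
        then have "(\<chi> i j. h (i, j)) \<in> S" by (rule n)
        then show "h \<in> f ` S" using fsurj by (metis imageI)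
      qed
      moreover have "openin field_top (?U p)" for p
        unfolding openin_field
      proof
        fix y assume "y \<in> ?U p"
        then show "\<exists>n. \<forall>z. z - y \<in> idl n \<longrightarrow> z \<in> ?U p"
          by (intro exI[of _ n]) (metis idl_cong_trans mem_Collect_eq)
      qed
      ultimately show "\<exists>U. finite {i \<in> UNIV. U i \<noteq> topspace field_top} \<and> (\<forall>i\<in>UNIV. openin field_top (U i)) \<and> x \<in> Pi\<^sub>E UNIV U \<and> Pi\<^sub>E UNIV U \<subseteq> f ` S"
        by (intro exI[of _ ?U]) auto
    qed
    moreover have "S = f -` (f ` S)" using finj by auto
    ultimately show ?l using op by blast
  qed
qed

lemma topspace_mat [simp]: "topspace mat_top = UNIV"
proof -
  have "openin mat_top UNIV" by (simp add: openin_mat)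
  then show ?thesis using openin_subset by blast
qed

lemma closedin_mat:
  assumes "\<And>A. (\<And>n. \<exists>B\<in>S. intmat n (B - A)) \<Longrightarrow> A \<in> S"
  shows "closedin mat_top S"
  unfolding closedin_def using assms by (auto simp: openin_mat) blast

lemma compactin_intmat: "compactin mat_top {A :: 'e^'n^'m. intmat n A}"
proof -
  let ?P = "product_topology (\<lambda>_. field_top) (UNIV :: ('m \<times> 'n) set)"
  define g where "g = (\<lambda>h. (\<chi> i j. h (i, j)) :: 'e^'n^'m)"
  have "continuous_map ?P mat_top g"
    unfolding continuous_map_def
  proof (intro conjI allI impI)
    fix S :: "('e^'n^'m) set" assume "openin mat_top S"
    then obtain U where U: "openin ?P U" "S = (\<lambda>A (i, j). A $ i $ j) -` U"
      unfolding mat_top_def openin_pullback_topology by auto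
    have "(\<lambda>(i, j). g x $ i $ j) = x" for x by (simp add: g_def fun_eq_iff)
    then have "{x \<in> topspace ?P. g x \<in> S} = U"
      using U openin_subset[OF U(1)] by auto
    then show "openin ?P {x \<in> topspace ?P. g x \<in> S}" using U by simp
  qed auto
  moreover have "compactin ?P (Pi\<^sub>E UNIV (\<lambda>_. idl n))"
    unfolding compactin_PiE using compactin_idl by blast
  ultimately have "compactin mat_top (g ` Pi\<^sub>E UNIV (\<lambda>_. idl n))" by (rule image_compactin[rotated])
  moreover have "g ` Pi\<^sub>E UNIV (\<lambda>_. idl n) = {A. intmat n A}"
  proof (intro equalityI subsetI)
    fix A :: "'e^'n^'m" assume "A \<in> {A. intmat n A}"
    then have "A = g (\<lambda>(i, j). A $ i $ j)" "(\<lambda>(i, j). A $ i $ j) \<in> Pi\<^sub>E UNIV (\<lambda>_. idl n)"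
      by (auto simp: g_def vec_eq_iff intmat_def)
    then show "A \<in> g ` Pi\<^sub>E UNIV (\<lambda>_. idl n)" by blast
  qed (auto simp: g_def intmat_def)
  ultimately show ?thesis by simp
qed

lemma intmat_cong_mult':
  assumes "intmat n (A - A')" "intmat n (B - B')" "intmat m A'" "intmat m B"
  shows "intmat (n + m) (A ** B - A' ** B')"
proof -
  have "A ** B - A' ** B' = (A - A') ** B + A' ** (B - B')"
    by (simp add: vec_eq_iff mult_entry algebra_simps sum_subtractf sum.distrib)
  then show ?thesis
    using intmat_add[OF intmat_mult[OF assms(1,4)], of "A' ** (B - B')"] intmat_mult[OF assms(3,2)] by (simp add: add.commute)
qed

lemma intmat_cong_mem: "intmat n (A - B) \<Longrightarrow> intmat n A \<longleftrightarrow> intmat n B"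
  using idl_cong_mem by (simp add: intmat_def) blast

lemma adj_diff: "adj (A - B) = adj A - adj B"
  by (simp add: vec_eq_iff gamma_diff)

lemma mat_diff_right: "(A - B) ** X = A ** X - B ** (X :: 'e^'n^'m)"
  by (simp add: vec_eq_iff mult_entry algebra_simps sum_subtractf)

lemma mat_diff_left: "A ** (B - X) = A ** B - A ** (X :: 'e^'n^'m)"
  by (simp add: vec_eq_iff mult_entry algebra_simps sum_subtractf)

text \<open>Fixing \<open>v (sim J B)\<close> keeps the limit from degenerating: the matrices
  \<open>adj B ** J ** B ** J\<close> are scalars converging to that of \<open>A\<close>, which is
  therefore a scalar, fixed by \<open>\<gamma>\<close> and of the same valuation.\<close>

lemma GU_limit:
  fixes J :: "'e^'n^'n"
  assumes J: "herm J" "intmat 0 J"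
    and lim: "\<And>n. \<exists>B\<in>carrier (GU J). intmat m B \<and> v (sim J B) = j \<and> intmat n (B - A)"
  shows "A \<in> carrier (GU J) \<and> intmat m A \<and> v (sim J A) = j"
proof -
  have Am: "intmat m A" using lim[of m] intmat_cong_mem by blast
  define M where "M = adj A ** J ** A ** J"
  have M: "\<exists>s\<in>F. s \<noteq> 0 \<and> v s = j \<and> intmat n (mat s - M)" for n
  proof -
    obtain B where B: "B \<in> carrier (GU J)" "intmat m B" "v (sim J B) = j" "intmat (n - m) (B - A)"
      using lim by blast
    have s: "adj B ** J ** B = mat (sim J B) ** J" "sim J B \<noteq> 0" "sim J B \<in> F"
      using is_simD[OF GU_sim[OF J(1) B(1)]] by auto
    have "intmat (n - m) (adj B - adj A)" using B(4) by (simp flip: adj_diff)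
    then have "intmat (n - m) (adj B ** J - adj A ** J)"
      using intmat_mult0'[of "n - m" "adj B - adj A" J] J by (simp add: mat_diff_right)
    then have "intmat (n - m + m) (adj B ** J ** B - adj A ** J ** A)"
      using B Am J by (intro intmat_cong_mult') (auto intro: intmat_mult0')
    then have "intmat n ((adj B ** J ** B - adj A ** J ** A) ** J)" using J intmat_mult0' by simp
    then have "intmat n (adj B ** J ** B ** J - M)" by (simp add: M_def mat_diff_right)
    moreover have "adj B ** J ** B ** J = mat (sim J B)" 
      unfolding s(1) using hermD(1)[OF J(1)] by (simp flip: matrix_mul_assoc)
    ultimately show ?thesis using s B by auto
  qed
  \<comment> \<open>The limit of the similitude factors, read off from one diagonal entry;
    \<open>undefined\<close> is merely some index of the finite type.\<close>
  define \<sigma> where "\<sigma> = M $ undefined $ undefined"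
  have e: "M $ i $ k = (if i = k then \<sigma> else 0)" for i k
  proof -
    have "M $ i $ k - (if i = k then \<sigma> else 0) \<in> idl n" for n
    proof -
      obtain s where s: "intmat n (mat s - M)" using M by blast
      have "s - \<sigma> \<in> idl n" using intmatD[OF s, of undefined undefined] by (simp add: mat_def \<sigma>_def)
      moreover have "(if i = k then s else 0) - M $ i $ k \<in> idl n" using intmatD[OF s, of i k] by (simp add: mat_def)
      ultimately show ?thesis
        using idl_diff[of "s - \<sigma>" n "s - M $ i $ k"] by (cases "i = k") auto
    qed
    then show ?thesis using idl_all_zero by (metis eq_iff_diff_eq_0)
  qed
  then have Ms: "M = mat \<sigma>" by (simp add: vec_eq_iff mat_def)
  have s\<sigma>: "\<exists>s\<in>F. s \<noteq> 0 \<and> v s = j \<and> \<sigma> - s \<in> idl n" for n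
    
  proof -
    obtain s where s: "s \<in> F" "s \<noteq> 0" "v s = j" "intmat n (mat s - M)" using M by blast
    then have "s - \<sigma> \<in> idl n" using intmatD[OF s(4), of undefined undefined] by (simp add: Ms mat_def)
    then show ?thesis using s idl_commute by blast
  qed
  have "\<gamma> \<sigma> - \<sigma> \<in> idl n" for n
  proof -
    obtain s where s: "s \<in> F" "\<sigma> - s \<in> idl n" using s\<sigma> by blast
    have "\<gamma> (\<sigma> - s) \<in> idl n" using s by (simp del: idl_gamma add: idl_gamma)
    then have "\<gamma> \<sigma> - s \<in> idl n" using s by (simp add: gamma_diff gamma_fixes)
    then show ?thesis using s idl_commute idl_cong_trans by blast
  qed
  then have "\<sigma> \<in> F" using idl_all_zero gamma_fixed_in_F by (metis eq_iff_diff_eq_0)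
  moreover have "\<sigma> \<noteq> 0 \<and> v \<sigma> = j" using s\<sigma>[of "j + 1"] v_cong by force
  moreover have "adj A ** J ** A = mat \<sigma> ** J"
  proof -
    have "adj A ** J ** A = M ** J" using hermD(1)[OF J(1)] by (simp add: M_def flip: matrix_mul_assoc)
    then show ?thesis using Ms by simp
  qed
  ultimately have "is_sim J A \<sigma>" by (simp add: is_sim_iff)
  then show ?thesis using GU_I[OF J(1)] sim_eq[OF J(1)] Am \<open>\<sigma> \<noteq> 0 \<and> v \<sigma> = j\<close> by auto
qed

text \<open>The bounded pieces of \<open>G\<close>. They are compact, hence finite unions of cosets
  of \<open>K\<close>, and \<open>Xb 0 0\<close> is \<open>K\<close> itself.\<close>

definition Xb :: "int \<Rightarrow> int \<Rightarrow> ('e^4^4) set" where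
  "Xb m j = {g \<in> carrier G. intmat m g \<and> v (sim J4 g) = j}"

lemma Xb_closed: "closedin mat_top (Xb m j)"
proof (rule closedin_mat)
  fix A assume "\<And>n. \<exists>B\<in>Xb m j. intmat n (B - A)"
  then have "\<exists>B\<in>carrier G. intmat m B \<and> v (sim J4 B) = j \<and> intmat n (B - A)" for n
    by (fastforce simp: Xb_def)
  then show "A \<in> Xb m j" using GU_limit[of J4 m j A] by (simp add: Xb_def)
qed

lemma topspace_G [simp]: "topspace G_top = carrier G"
  by (simp add: G_top_def)

lemma Xb_compact: "compactin G_top (Xb m j)"
  unfolding G_top_def compactin_subtopology
  using closed_compactin[OF compactin_intmat[of m] _ Xb_closed[of m j]] by (auto simp: Xb_def)

text \<open>The similitude factor is an entry of \<open>adj x ** J4 ** x\<close> up to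
  \<open>J4\<close>, so it moves only within its residue class and stays a unit. This is the
  openness of \<open>K\<close>.\<close>

lemma K_near:
  assumes "x \<in> carrier G" "k \<in> K" "intmat 1 (x - k)"
  shows "x \<in> K"
proof -
  have x0: "intmat 0 x" 
    using intmat_cong_mem[of 0 x k] intmat_mono[OF assms(3), of 0] K_int[OF assms(2)] by simp
  have "intmat 1 (adj x - adj k)" using assms(3) by (simp flip: adj_diff)
  then have "intmat 1 (adj x ** J4 - adj k ** J4)"
    using intmat_mult0'[of 1 "adj x - adj k" J4] by (simp add: mat_diff_right)
  then have "intmat 1 (adj x ** J4 ** x - adj k ** J4 ** k)"
    using intmat_cong_mult'[of 1 "adj x ** J4" "adj k ** J4" x k 0] assms(3) x0
      intmat_mult0'[of 0 "adj k" J4] K_int[OF assms(2)] by simp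
  then have "intmat 1 (mat (sim J4 x) ** J4 - mat (sim J4 k) ** J4)"
    using is_simD[OF GU_sim[OF herm_J4 assms(1)]] is_simD[OF GU_sim[OF herm_J4 K_G[OF assms(2)]]] by simp
  then have "sim J4 x - sim J4 k \<in> idl 1"
    using intmatD[of 1 _ 1 3] by (fastforce simp: J4_def)
  then have "v (sim J4 x) = 0"
    using v_cong[of "sim J4 x" "sim J4 k" 1] K_sim[OF assms(2)] sim_nonzero[OF herm_J4 K_G[OF assms(2)]] by simp
  then show ?thesis using x0 assms(1) by (simp add: K_eq KK_def)
qed

definition lc :: "'e^4^4 \<Rightarrow> ('e^4^4) set" where "lc g = (\<lambda>k. g ** k) ` K"

lemma l_coset_G: "g <#\<^bsub>G\<^esub> K = lc g"
  by (auto simp: l_coset_def lc_def)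

lemma lc_self: "g \<in> lc g"
  unfolding lc_def using K_one by (intro image_eqI[of _ _ "mat 1"]) auto

lemma lc_mem_iff: "g \<in> carrier G \<Longrightarrow> x \<in> lc g \<longleftrightarrow> matrix_inv g ** x \<in> K"
proof -
  assume g: "g \<in> carrier G"
  have *: "matrix_inv g ** g = mat 1" "g ** matrix_inv g = mat 1" using GU_inv_cancel[OF herm_J4 g] by auto
  show ?thesis
  proof
    assume "matrix_inv g ** x \<in> K"
    moreover have "x = g ** (matrix_inv g ** x)" by (simp add: matrix_mul_assoc *)
    ultimately show "x \<in> lc g" unfolding lc_def by blast
  qed (auto simp: lc_def matrix_mul_assoc *)
qed

lemma lc_sub_G: "g \<in> carrier G \<Longrightarrow> lc g \<subseteq> carrier G"
  unfolding lc_def using K_G G_mult by blast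

lemma lc_eq: "x \<in> lc g \<Longrightarrow> lc x = lc g"
proof -
  assume "x \<in> lc g"
  then obtain k where k: "x = g ** k" "k \<in> K" by (auto simp: lc_def)
  have "g ** l = x ** (matrix_inv k ** l)" for l
  proof -
    have "x ** (matrix_inv k ** l) = g ** (k ** matrix_inv k) ** l" unfolding k(1) by (simp only: matrix_mul_assoc)
    then show ?thesis using K_inv[OF k(2)] by simp
  qed
  moreover have "x ** l = g ** (k ** l)" for l by (simp add: k matrix_mul_assoc)
  ultimately show ?thesis unfolding lc_def using K_mult K_inv k(2) by (auto intro!: image_eqI)
qed

lemma lc_mult: "h \<in> carrier G \<Longrightarrow> (\<lambda>x. h ** x) ` lc g = lc (h ** g)"
  by (simp add: lc_def image_image matrix_mul_assoc)

lemma lc_eq_iff: "lc x = lc g \<longleftrightarrow> x \<in> lc g"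
  using lc_eq lc_self by blast

lemma lc_open: 
  assumes g: "g \<in> carrier G" shows "openin G_top (lc g)"
proof -
  define T where "T = {B. \<exists>k\<in>K. intmat 1 (matrix_inv g ** B - k)}"
  obtain m where m: "intmat m (matrix_inv g)" using intmat_ex by blast
  have "openin mat_top T"
    unfolding openin_mat
  proof
    fix A assume "A \<in> T"
    then obtain k where k: "k \<in> K" "intmat 1 (matrix_inv g ** A - k)" by (auto simp: T_def)
    show "\<exists>n. \<forall>B. intmat n (B - A) \<longrightarrow> B \<in> T"
    proof (intro exI[of _ "1 - m"] allI impI)
      fix B assume "intmat (1 - m) (B - A)"
      then have "intmat 1 (matrix_inv g ** (B - A))" using intmat_mult[OF m] by fastforce
      moreover have "matrix_inv g ** B - k = matrix_inv g ** (B - A) + (matrix_inv g ** A - k)"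
        by (simp add: mat_diff_left)
      ultimately have "intmat 1 (matrix_inv g ** B - k)"
        using intmat_add[OF _ k(2), of "matrix_inv g ** (B - A)"] by (simp only:)
      then show "B \<in> T" using k by (auto simp: T_def)
    qed
  qed
  moreover have "lc g = T \<inter> carrier G"
  proof (intro equalityI subsetI)
    fix x assume "x \<in> lc g"
    then show "x \<in> T \<inter> carrier G" using lc_mem_iff[OF g] lc_sub_G[OF g]
      by (auto simp: T_def intmat_def intro!: bexI[of _ "matrix_inv g ** x"])
  next
    fix x assume "x \<in> T \<inter> carrier G"
    then obtain k where "x \<in> carrier G" "k \<in> K" "intmat 1 (matrix_inv g ** x - k)" by (auto simp: T_def)
    then have "matrix_inv g ** x \<in> K"
      using K_near[OF G_mult[OF GU_inv_closed[OF herm_J4 g]]] by simp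
    then show "x \<in> lc g" using lc_mem_iff[OF g] by simp
  qed
  ultimately show ?thesis unfolding G_top_def openin_subtopology by blast
qed

lemma rinv_clopen:
  assumes "S \<subseteq> carrier G" "\<And>g. g \<in> S \<Longrightarrow> lc g \<subseteq> S"
  shows "openin G_top S" "closedin G_top S"
proof -
  have op: "openin G_top T" if "T \<subseteq> carrier G" "\<And>g. g \<in> T \<Longrightarrow> lc g \<subseteq> T" for T
  proof -
    have "T = \<Union> (lc ` T)" using that lc_self by auto
    moreover have "openin G_top (\<Union> (lc ` T))" using that lc_open by (intro openin_Union) auto
    ultimately show ?thesis by simp
  qed
  show "openin G_top S" using op assms by blast
  have "openin G_top (carrier G - S)"
  proof (rule op)
    fix g assume g: "g \<in> carrier G - S"
    show "lc g \<subseteq> carrier G - S"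
    proof
      fix x assume x: "x \<in> lc g"
      then have "x \<in> S \<Longrightarrow> g \<in> S" using lc_eq[OF x] lc_self assms(2)[of x] by auto
      then show "x \<in> carrier G - S" using x g lc_sub_G by blast
    qed
  qed simp
  then show "closedin G_top S" using assms by (simp add: closedin_def)
qed

lemma compact_finite_cosets:
  assumes "compactin G_top S" shows "finite (lc ` S)"
proof -
  have S: "S \<subseteq> carrier G" using compactin_subset_topspace[OF assms] by simp
  have "\<exists>\<F>. finite \<F> \<and> \<F> \<subseteq> lc ` S \<and> S \<subseteq> \<Union>\<F>"
    using assms S lc_open lc_self unfolding compactin_def by (auto elim!: allE[of _ "lc ` S"])
  then obtain \<F> where \<F>: "finite \<F>" "\<F> \<subseteq> lc ` S" "S \<subseteq> \<Union>\<F>" by blast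
  have "lc ` S \<subseteq> \<F>"
  proof clarify
    fix g assume "g \<in> S"
    then obtain A where A: "A \<in> \<F>" "g \<in> A" using \<F> by blast
    then obtain x where "A = lc x" using \<F>(2) by blast
    then show "lc g \<in> \<F>" using A lc_eq[of g x] by simp
  qed
  then show ?thesis using \<F>(1) by (rule finite_subset)
qed

lemma finite_Xb: "finite (lc ` Xb m j)"
  using compact_finite_cosets Xb_compact by blast

lemma lc_compact: 
  assumes "g \<in> carrier G" shows "compactin G_top (lc g)"
proof -
  obtain m where m: "intmat m g" using intmat_ex by blast
  have "lc g \<subseteq> Xb m (v (sim J4 g))"
    unfolding lc_def Xb_def
    using assms intmat_mult0'[OF m K_int] K_G K_sim G_mult sim_mult[OF herm_J4] sim_nonzero[OF herm_J4]
    by (auto simp: v_mult)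
  moreover have "closedin G_top (lc g)" using assms lc_sub_G lc_eq by (intro rinv_clopen) auto
  ultimately show ?thesis using closed_compactin[OF Xb_compact] by blast
qed

lemma finite_cosets_compact:
  assumes "S \<subseteq> carrier G" "\<And>g. g \<in> S \<Longrightarrow> lc g \<subseteq> S" "finite (lc ` S)"
  shows "compactin G_top S"
proof -
  have "S = \<Union> (lc ` S)" using assms lc_self by auto
  moreover have "compactin G_top (\<Union> (lc ` S))"
    using assms lc_compact by (intro compactin_Union) auto
  ultimately show ?thesis by simp
qed

text \<open>The support of a right invariant function is a union of cosets, hence clopen, so compact
  support is the same as finitely many cosets. Functions on \<open>G\<close> are handled through
  such finite sets from here on.\<close>

lemma rinv_support:
  assumes inv: "\<And>g k. g \<in> carrier G \<Longrightarrow> k \<in> K \<Longrightarrow> f (g ** k) = f g"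
  shows "compactly_supported G_top f \<longleftrightarrow> (\<forall>x. x \<notin> carrier G \<longrightarrow> f x = 0) \<and> finite (lc ` {x. f x \<noteq> 0})"
proof (cases "\<forall>x. x \<notin> carrier G \<longrightarrow> f x = 0")
  case True
  let ?S = "{x. f x \<noteq> 0}"
  have S: "?S \<subseteq> carrier G" using True by auto
  moreover have l: "lc g \<subseteq> ?S" if "g \<in> ?S" for g using that S inv by (auto simp: lc_def)
  ultimately have "closedin G_top ?S" using rinv_clopen by blast
  then have "compactly_supported G_top f \<longleftrightarrow> compactin G_top ?S"
    using True by (simp add: compactly_supported_def closure_of_closedin)
  then show ?thesis using True compact_finite_cosets finite_cosets_compact[OF S l] by blast
qed (auto simp: compactly_supported_def)

lemma C_compact: "compactin field_top C"
proof (rule closed_compactin[OF compactin_idl[of 0]])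
  show "C \<subseteq> idl 0" using C_D(3) by (auto simp: idl_def)
  show "closedin field_top C"
  proof (rule closedin_field)
    fix x assume lim: "\<And>n. \<exists>y\<in>C. y - x \<in> idl n"
    have x0: "x \<in> idl 0" using lim[of 0] idl_cong_mem C_D(3) idl_self by blast
    have "x * \<gamma> x - 1 \<in> idl n" for n
    proof -
      obtain y where y: "y \<in> C" "y - x \<in> idl n" using lim by blast
      have "\<gamma> (x - y) \<in> idl n" using y(2) idl_commute[of y x] by (simp only: idl_gamma)
      then have "\<gamma> x - \<gamma> y \<in> idl n" by (simp add: gamma_diff)
      moreover have "x - y \<in> idl n" "y \<in> idl 0" using y idl_commute C_D(3) idl_self by blast+
      ultimately have "x * \<gamma> x - y * \<gamma> y \<in> idl n" using x0 by (intro idl_cong_mult) auto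
      then show ?thesis using C_D(2)[OF y(1)] by simp
    qed
    then have "x * \<gamma> x - 1 = 0" using idl_all_zero by blast
    then show "x \<in> C" by (intro C_I) simp
  qed
qed

lemma Gt_carrier: "carrier Gt = carrier G \<times> C"
  by (simp add: Gt_def T_def DirProd_def)

lemma Gt_mult: "(g, s) \<otimes>\<^bsub>Gt\<^esub> (h, t) = (g ** h, s * t)"
  by (simp add: Gt_def T_def DirProd_def)

text \<open>\<open>Kt\<close> contains the whole second factor, so right invariant functions on
  \<open>Gt\<close> do not depend on it. All functions needed arise from functions on
  \<open>G\<close> in this way.\<close>

definition ext_C :: "('e^4^4 \<Rightarrow> 'p) \<Rightarrow> ('e^4^4) \<times> 'e \<Rightarrow> 'p::field_char_0" where
  "ext_C z = (\<lambda>(g, t). if g \<in> carrier G \<and> t \<in> C then z g else 0)"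

lemma ext_C_inv_functions:
  assumes inv: "\<And>g k. g \<in> carrier G \<Longrightarrow> k \<in> K \<Longrightarrow> z (g ** k) = z g"
    and fin: "finite (lc ` {g \<in> carrier G. z g \<noteq> 0})"
  shows "ext_C z \<in> inv_functions"
proof -
  let ?S = "{g \<in> carrier G. z g \<noteq> 0}"
  have sup: "{x. ext_C z x \<noteq> 0} = ?S \<times> C" by (auto simp: ext_C_def split: if_splits)
  have l: "lc g \<subseteq> ?S" if "g \<in> ?S" for g using that inv K_G G_mult by (auto simp: lc_def)
  have top: "topspace Gt_top = carrier G \<times> C" by (simp add: Gt_top_def)
  have "compactin G_top ?S" by (rule finite_cosets_compact) (use l fin in auto)
  moreover have "compactin (subtopology field_top C) C" using C_compact by (simp add: compactin_subtopology)
  ultimately have "compactin Gt_top (?S \<times> C)" by (simp add: Gt_top_def compactin_Times)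
  moreover have "closedin Gt_top (?S \<times> C)"
  proof -
    have "closedin G_top ?S" by (rule rinv_clopen(2)) (use l in auto)
    moreover have "closedin (subtopology field_top C) C"
      by (metis closedin_topspace topspace_subtopology topspace_field inf_top_left)
    ultimately show ?thesis by (simp add: Gt_top_def closedin_prod_Times_iff)
  qed
  ultimately have "compactly_supported Gt_top (ext_C z)"
    unfolding compactly_supported_def sup top by (auto simp: closure_of_closedin ext_C_def split: if_splits)
  moreover have "\<forall>g\<in>carrier Gt. \<forall>k\<in>Kt. ext_C z (g \<otimes>\<^bsub>Gt\<^esub> k) = ext_C z g"
    using inv K_G G_mult C_mult by (auto simp: Gt_carrier Kt_def Gt_mult ext_C_def)
  ultimately show ?thesis by (simp add: inv_functions_def)
qed

end

section \<open>Representatives for the unipotent group modulo its integral points\<close>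

context odd_unramified_extension
begin

lemma residue_reps: obtains R where "finite R" "card R = q" "R \<subseteq> F \<inter> idl 0"
  "\<And>x. x \<in> F \<Longrightarrow> x \<in> idl 0 \<Longrightarrow> \<exists>r\<in>R. x - r \<in> idl 1"
  "\<And>r s. r \<in> R \<Longrightarrow> s \<in> R \<Longrightarrow> r - s \<in> idl 1 \<Longrightarrow> r = s"
proof -
  define cl where "cl = (\<lambda>x. {y \<in> val_ring F v. y - x \<in> max_ideal F v})"
  have vr: "val_ring F v = F \<inter> idl 0" by (auto simp: val_ring_def idl_def)
  have mi: "max_ideal F v = F \<inter> idl 1" by (auto simp: max_ideal_def idl_def)
  have rc: "residue_classes F v = cl ` (F \<inter> idl 0)" by (simp add: residue_classes_def cl_def vr)
  have fin: "finite (cl ` (F \<inter> idl 0))" using F.finite_residue_field by (simp add: rc)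
  obtain R where R: "R \<subseteq> F \<inter> idl 0" "inj_on cl R" "cl ` R = cl ` (F \<inter> idl 0)"
    using subset_image_inj[of "cl ` (F \<inter> idl 0)" cl "F \<inter> idl 0"] by auto
  have cleq: "cl x = cl y" if "x \<in> F" "y \<in> F" "x - y \<in> idl 1" for x y
  proof -
    have "z - x \<in> idl 1 \<longleftrightarrow> z - y \<in> idl 1" for z
      using that(3) idl_commute[of x y] idl_cong_trans[of z x 1 y] idl_cong_trans[of z y 1 x] by blast
    moreover have "z - x \<in> F" "z - y \<in> F" if "z \<in> F" for z using that \<open>x \<in> F\<close> \<open>y \<in> F\<close> F_diff by auto
    ultimately show ?thesis unfolding cl_def mi vr by auto
  qed
  show ?thesis
  proof (rule that)
    show "finite R" using R fin finite_imageD[of cl R] by simp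
    show "card R = q" unfolding q_def rc R(3)[symmetric] by (rule card_image[OF R(2), symmetric])
    show "R \<subseteq> F \<inter> idl 0" by (rule R)
    fix x assume x: "x \<in> F" "x \<in> idl 0"
    then have "cl x \<in> cl ` R" using R(3) by blast
    then obtain r where r: "r \<in> R" "cl x = cl r" by blast
    moreover have "x \<in> cl x" using x by (simp add: cl_def vr mi)
    ultimately show "\<exists>r\<in>R. x - r \<in> idl 1" by (auto simp: cl_def mi)
  next
    fix r s assume "r \<in> R" "s \<in> R" "r - s \<in> idl 1"
    then show "r = s" using cleq R(1,2) by (meson IntD1 inj_onD subsetD)
  qed
qed

lemma q_pos: "q > 0"
proof -
  obtain R where R: "finite R" "card R = q" "\<And>x. x \<in> F \<Longrightarrow> x \<in> idl 0 \<Longrightarrow> \<exists>r\<in>R. x - r \<in> idl 1"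
    using residue_reps by metis
  have "R \<noteq> {}" using R(3)[of 0] by auto
  then show ?thesis using R by (metis card_gt_0_iff)
qed

text \<open>A section of the projection from \<open>F\<close> to \<open>F\<close> modulo O_F. The
  integral class is represented by 0 itself, so that for representatives integral means
  zero.\<close>

definition \<rho> :: "'e \<Rightarrow> 'e" where
  "\<rho> x = (if x \<in> idl 0 then 0 else (SOME y. y \<in> F \<and> y - x \<in> idl 0))"

definition \<Upsilon> :: "'e set" where "\<Upsilon> = \<rho> ` F"

lemma rho: "x \<in> F \<Longrightarrow> \<rho> x \<in> F \<and> \<rho> x - x \<in> idl 0"
proof -
  assume x: "x \<in> F"
  then have "\<exists>y. y \<in> F \<and> y - x \<in> idl 0" by (intro exI[of _ x]) simp
  from someI_ex[OF this] show ?thesis by (auto simp: \<rho>_def)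
qed

lemma rho_eq: "x - y \<in> idl 0 \<Longrightarrow> \<rho> x = \<rho> y"
proof -
  assume a: "x - y \<in> idl 0"
  then have "z - x \<in> idl 0 \<longleftrightarrow> z - y \<in> idl 0" for z using idl_cong_trans idl_commute by blast
  moreover have "x \<in> idl 0 \<longleftrightarrow> y \<in> idl 0" using a idl_cong_mem by blast
  ultimately show ?thesis by (simp add: \<rho>_def)
qed

lemma Ups_F: "b \<in> \<Upsilon> \<Longrightarrow> b \<in> F"
  using rho by (auto simp: \<Upsilon>_def)

lemma Ups_rho: "b \<in> \<Upsilon> \<Longrightarrow> \<rho> b = b"
  using rho rho_eq by (auto simp: \<Upsilon>_def)

lemma Ups_eq: "b \<in> \<Upsilon> \<Longrightarrow> c \<in> \<Upsilon> \<Longrightarrow> b - c \<in> idl 0 \<Longrightarrow> b = c"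
  using Ups_rho rho_eq by metis

lemma Ups_zero: "0 \<in> \<Upsilon>"
  unfolding \<Upsilon>_def by (intro image_eqI[of _ _ 0]) (auto simp: \<rho>_def)

lemma Ups_int: "b \<in> \<Upsilon> \<Longrightarrow> b \<in> idl 0 \<longleftrightarrow> b = 0"
  using Ups_eq[of b 0] Ups_zero by auto

text \<open>Induction on \<open>j\<close>: a ball of the next larger radius splits into
  \<open>q\<close> balls, one for each residue class.\<close>

lemma card_Ups_near:
  assumes c: "c \<in> F"
  shows "finite {b \<in> \<Upsilon>. b - c \<in> idl (- int j)}" "card {b \<in> \<Upsilon>. b - c \<in> idl (- int j)} = q ^ j"
proof -
  obtain R where R: "finite R" "card R = q" "R \<subseteq> F \<inter> idl 0"
    "\<And>x. x \<in> F \<Longrightarrow> x \<in> idl 0 \<Longrightarrow> \<exists>r\<in>R. x - r \<in> idl 1"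
    "\<And>r s. r \<in> R \<Longrightarrow> s \<in> R \<Longrightarrow> r - s \<in> idl 1 \<Longrightarrow> r = s"
    by (rule residue_reps) blast
  have "finite {b \<in> \<Upsilon>. b - c \<in> idl (- int j)} \<and> card {b \<in> \<Upsilon>. b - c \<in> idl (- int j)} = q ^ j"
    using c
  proof (induction j arbitrary: c)
    case 0
    have c': "\<rho> c \<in> \<Upsilon>" "\<rho> c - c \<in> idl 0" using 0 rho by (auto simp: \<Upsilon>_def)
    have "b = \<rho> c" if "b \<in> \<Upsilon>" "b - c \<in> idl 0" for b
      using Ups_eq[OF that(1) c'(1)] idl_cong_trans[OF that(2)] c'(2) idl_commute[of c "\<rho> c"] by blast
    then have "{b \<in> \<Upsilon>. b - c \<in> idl 0} = {\<rho> c}" using c' by blast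
    then show ?case by simp
  next
    case (Suc j)
    define p where "p = \<pi> powi (- int (Suc j))"
    have p: "p \<noteq> 0" "v p = - int (Suc j)" "p \<in> F" by (simp_all add: p_def F_powi)
    let ?A = "\<lambda>r. {b \<in> \<Upsilon>. b - (c + p * r) \<in> idl (- int j)}"
    have rF: "c + p * r \<in> F" if "r \<in> R" for r using that R Suc.prems p F_add F_mult by blast
    have eq: "{b \<in> \<Upsilon>. b - c \<in> idl (- int (Suc j))} = (\<Union>r\<in>R. ?A r)"
    proof (intro equalityI subsetI)
      fix b assume "b \<in> {b \<in> \<Upsilon>. b - c \<in> idl (- int (Suc j))}"
      then have b: "b \<in> \<Upsilon>" "b - c \<in> idl (- int (Suc j))" by auto
      have "(b - c) / p \<in> F" using Ups_F[OF b(1)] Suc.prems p F_divide F_diff by blast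
      moreover have "(b - c) / p \<in> idl 0" using b p by (simp add: idl_divide_iff)
      ultimately obtain r where r: "r \<in> R" "(b - c) / p - r \<in> idl 1" using R by blast
      have "b - (c + p * r) = p * ((b - c) / p - r)" using p by (simp add: field_simps)
      also have "\<dots> \<in> idl (- int j)" by (subst idl_mult_iff[OF p(1)]) (use r p in simp)
      finally show "b \<in> (\<Union>r\<in>R. ?A r)" using r b by blast
    next
      fix b assume "b \<in> (\<Union>r\<in>R. ?A r)"
      then obtain r where r: "r \<in> R" "b \<in> \<Upsilon>" "b - (c + p * r) \<in> idl (- int j)" by blast
      have "p * r \<in> idl (- int (Suc j))" using r R p by (auto simp: idl_mult_iff)
      moreover have "b - (c + p * r) \<in> idl (- int (Suc j))" using r idl_mono by force
      ultimately have "b - (c + p * r) + p * r \<in> idl (- int (Suc j))" by (intro idl_add)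
      then show "b \<in> {b \<in> \<Upsilon>. b - c \<in> idl (- int (Suc j))}" using r by simp
    qed
    have "card (\<Union>r\<in>R. ?A r) = (\<Sum>r\<in>R. card (?A r))"
    proof (rule card_UN_disjoint[OF R(1)])
      show "\<forall>r\<in>R. finite (?A r)" using Suc.IH rF by blast
      show "\<forall>r\<in>R. \<forall>s\<in>R. r \<noteq> s \<longrightarrow> ?A r \<inter> ?A s = {}"
      proof (intro ballI impI)
        fix r s assume rs: "r \<in> R" "s \<in> R" "r \<noteq> s"
        show "?A r \<inter> ?A s = {}"
        proof (rule ccontr)
          assume "?A r \<inter> ?A s \<noteq> {}"
          then obtain b where b: "b - (c + p * r) \<in> idl (- int j)" "b - (c + p * s) \<in> idl (- int j)" by blast
          have "(b - (c + p * s)) - (b - (c + p * r)) \<in> idl (- int j)" by (rule idl_diff[OF b(2,1)])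
          then have "p * (r - s) \<in> idl (- int j)" by (simp add: algebra_simps)
          then have "r - s \<in> idl 1" using p by (simp add: idl_mult_iff)
          then show False using R(5) rs by blast
        qed
      qed
    qed
    also have "\<dots> = (\<Sum>r\<in>R. q ^ j)" using Suc.IH rF by (intro sum.cong) auto
    also have "\<dots> = q ^ Suc j" using R by simp
    finally show ?case unfolding eq using R(1) Suc.IH rF by simp
  qed
  then show "finite {b \<in> \<Upsilon>. b - c \<in> idl (- int j)}" "card {b \<in> \<Upsilon>. b - c \<in> idl (- int j)} = q ^ j" by auto
qed

definition \<Xi> :: "'e set" where "\<Xi> = (\<lambda>(a, b). a + b * th) ` (\<Upsilon> \<times> \<Upsilon>)"

lemma F_th_eq: "a \<in> F \<Longrightarrow> b \<in> F \<Longrightarrow> a' \<in> F \<Longrightarrow> b' \<in> F \<Longrightarrow> a + b * th = a' + b' * th \<Longrightarrow> a = a' \<and> b = b'"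
proof -
  assume F: "a \<in> F" "b \<in> F" "a' \<in> F" "b' \<in> F" and e: "a + b * th = a' + b' * th"
  have "(a - a') + (b - b') * th \<in> idl n" for n using e by (simp add: algebra_simps)
  then have "a - a' \<in> idl n \<and> b - b' \<in> idl n" for n using F_th_idl_iff[of "a - a'" "b - b'"] F F_diff by blast
  then show ?thesis using idl_all_zero by (metis eq_iff_diff_eq_0)
qed

lemma card_Xi_near: "finite {x \<in> \<Xi>. x - c \<in> idl (- int j)}" "card {x \<in> \<Xi>. x - c \<in> idl (- int j)} = q ^ (2 * j)"
proof -
  obtain a b where ab: "a \<in> F" "b \<in> F" "c = a + b * th" using E_decomp by blast
  define S where "S = {x \<in> \<Upsilon>. x - a \<in> idl (- int j)} \<times> {x \<in> \<Upsilon>. x - b \<in> idl (- int j)}"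
  have *: "x + y * th - c \<in> idl (- int j) \<longleftrightarrow> x - a \<in> idl (- int j) \<and> y - b \<in> idl (- int j)"
    if "x \<in> \<Upsilon>" "y \<in> \<Upsilon>" for x y
  proof -
    have "x + y * th - c = (x - a) + (y - b) * th" using ab by (simp add: algebra_simps)
    then show ?thesis unfolding \<open>x + y * th - c = _\<close> using that Ups_F ab by (intro F_th_idl_iff F_diff) auto
  qed
  have eq: "{x \<in> \<Xi>. x - c \<in> idl (- int j)} = (\<lambda>(a, b). a + b * th) ` S"
    unfolding \<Xi>_def S_def using * by auto
  have inj: "inj_on (\<lambda>(a, b). a + b * th) S"
    unfolding S_def inj_on_def by clarsimp (use F_th_eq Ups_F in blast)
  have S: "finite S" "card S = q ^ (2 * j)"
    unfolding S_def using card_Ups_near ab by (simp_all add: card_cartesian_product mult_2 power_add)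
  show "finite {x \<in> \<Xi>. x - c \<in> idl (- int j)}" "card {x \<in> \<Xi>. x - c \<in> idl (- int j)} = q ^ (2 * j)"
    unfolding eq using S card_image[OF inj] by auto
qed

lemma Xi_zero: "0 \<in> \<Xi>"
  unfolding \<Xi>_def using Ups_zero by (force intro: image_eqI[of _ _ "(0, 0)"])

lemma Xi_eq: "x \<in> \<Xi> \<Longrightarrow> y \<in> \<Xi> \<Longrightarrow> x - y \<in> idl 0 \<Longrightarrow> x = y"
proof -
  assume xy: "x \<in> \<Xi>" "y \<in> \<Xi>" "x - y \<in> idl 0"
  have "card {z \<in> \<Xi>. z - y \<in> idl (- int 0)} = 1" using card_Xi_near(2)[of y 0] by simp
  then obtain w where w: "{z \<in> \<Xi>. z - y \<in> idl (- int 0)} = {w}" by (rule card_1_singletonE)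
  have "x \<in> {z \<in> \<Xi>. z - y \<in> idl (- int 0)}" "y \<in> {z \<in> \<Xi>. z - y \<in> idl (- int 0)}" using xy by auto
  then show "x = y" unfolding w by blast
qed

lemma Xi_int: "x \<in> \<Xi> \<Longrightarrow> x \<in> idl 0 \<longleftrightarrow> x = 0"
  using Xi_eq[of x 0] Xi_zero by auto

lemma Xi_ex: obtains y where "y \<in> \<Xi>" "y - x \<in> idl 0"
proof -
  have "card {z \<in> \<Xi>. z - x \<in> idl (- int 0)} = 1" using card_Xi_near(2)[of x 0] by simp
  then show ?thesis using that by (metis (no_types, lifting) card_1_singletonE mem_Collect_eq singletonI of_nat_0 minus_zero)
qed

lemma Ups_ex: assumes "x \<in> F" obtains y where "y \<in> \<Upsilon>" "y - x \<in> idl 0"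
  using rho[OF assms] assms that by (auto simp: \<Upsilon>_def)

text \<open>The product of the block diagonal unipotent with parameter \<open>x\<close> and the
  block unipotent with upper right block \<open>(s1, z; - \<gamma> z, s2)\<close>. In these
  coordinates the hermitian condition says only that \<open>s1\<close> and \<open>s2\<close> are
  skew.\<close>

definition nm :: "'e \<Rightarrow> 'e \<Rightarrow> 'e \<Rightarrow> 'e \<Rightarrow> 'e^4^4" where
  "nm x z s1 s2 = vector [vector [1, x, s1 - x * \<gamma> z, z + x * s2], vector [0, 1, - \<gamma> z, s2],
     vector [0, 0, 1, 0], vector [0, 0, - \<gamma> x, 1]]"

lemma nm_entry [simp]:
  "nm x z s1 s2 $ 1 $ 1 = 1" "nm x z s1 s2 $ 1 $ 2 = x" "nm x z s1 s2 $ 1 $ 3 = s1 - x * \<gamma> z" "nm x z s1 s2 $ 1 $ 4 = z + x * s2"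
  "nm x z s1 s2 $ 2 $ 1 = 0" "nm x z s1 s2 $ 2 $ 2 = 1" "nm x z s1 s2 $ 2 $ 3 = - \<gamma> z" "nm x z s1 s2 $ 2 $ 4 = s2"
  "nm x z s1 s2 $ 3 $ 1 = 0" "nm x z s1 s2 $ 3 $ 2 = 0" "nm x z s1 s2 $ 3 $ 3 = 1" "nm x z s1 s2 $ 3 $ 4 = 0"
  "nm x z s1 s2 $ 4 $ 1 = 0" "nm x z s1 s2 $ 4 $ 2 = 0" "nm x z s1 s2 $ 4 $ 3 = - \<gamma> x" "nm x z s1 s2 $ 4 $ 4 = 1"
  by (simp_all add: nm_def)

lemma is_sim_nm: "\<gamma> s1 = - s1 \<Longrightarrow> \<gamma> s2 = - s2 \<Longrightarrow> is_sim J4 (nm x z s1 s2) 1"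
  unfolding is_sim_iff
  by (simp add: vec_eq_iff forall_4 mult_entry sum_4 J4_def gamma_minus gamma_diff gamma_add gamma_mult algebra_simps)

lemma nm_mult:
  assumes "\<gamma> s2 = - s2"
  shows "nm x z s1 s2 ** nm x' z' s1' s2' =
     nm (x + x') (z - x' * s2 + z') (s1 + x' * \<gamma> z - \<gamma> x' * (z - x' * s2) + s1') (s2 + s2')"
  by (simp add: vec_eq_iff forall_4 mult_entry sum_4 gamma_diff gamma_add gamma_mult assms algebra_simps)

lemma nm_K: 
  assumes "\<gamma> s1 = - s1" "\<gamma> s2 = - s2"
  shows "nm x z s1 s2 \<in> K \<longleftrightarrow> x \<in> idl 0 \<and> z \<in> idl 0 \<and> s1 \<in> idl 0 \<and> s2 \<in> idl 0"
proof
  assume "nm x z s1 s2 \<in> K"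
  then have i: "intmat 0 (nm x z s1 s2)" by (rule K_int)
  have x: "x \<in> idl 0" "z \<in> idl 0" "s2 \<in> idl 0" "s1 - x * \<gamma> z \<in> idl 0"
    using intmatD[OF i, of 1 2] intmatD[OF i, of 2 3] intmatD[OF i, of 2 4] intmatD[OF i, of 1 3] by simp_all
  then show "x \<in> idl 0 \<and> z \<in> idl 0 \<and> s1 \<in> idl 0 \<and> s2 \<in> idl 0"
    using idl_add[OF x(4), of "x * \<gamma> z"] idl_mult0[of x "\<gamma> z" 0] by simp
next
  assume "x \<in> idl 0 \<and> z \<in> idl 0 \<and> s1 \<in> idl 0 \<and> s2 \<in> idl 0"
  then have "intmat 0 (nm x z s1 s2)"
    by (auto simp: intmat_def forall_4 intro!: idl_diff idl_add idl_mult0)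
  then show "nm x z s1 s2 \<in> K" using K_I[OF is_sim_nm[OF assms]] by simp
qed

lemma N_iff: "u \<in> N \<longleftrightarrow> (\<exists>x z s1 s2. \<gamma> s1 = - s1 \<and> \<gamma> s2 = - s2 \<and> u = nm x z s1 s2)"
proof
  assume u: "u \<in> N"
  define s where "s = sim J4 u"
  have s: "is_sim J4 u s" unfolding s_def by (rule GU_sim[OF herm_J4]) (use u in \<open>simp add: N_def\<close>)
  have d: "u$1$1 = 1" "u$2$2 = 1" "u$3$3 = 1" "u$4$4 = 1" "u$2$1 = 0" "u$3$4 = 0" "u$3$1 = 0" "u$3$2 = 0" "u$4$1 = 0" "u$4$2 = 0"
    using u by (auto simp: N_def)
  have "(adj u ** J4 ** u) $ i $ j = s * J4 $ i $ j" for i j using is_simD[OF s] by simp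
  from this[of 1 3] this[of 2 3] this[of 3 3] this[of 4 4] this[of 3 4]
  have e: "s = 1" "u $ 4 $ 3 = - \<gamma> (u $ 1 $ 2)" "u $ 1 $ 3 + \<gamma> (u $ 4 $ 3) * u $ 2 $ 3 + \<gamma> (u $ 1 $ 3) + \<gamma> (u $ 2 $ 3) * u $ 4 $ 3 = 0"
    "u $ 2 $ 4 + \<gamma> (u $ 2 $ 4) = 0" "u $ 1 $ 4 + \<gamma> (u $ 4 $ 3) * u $ 2 $ 4 + \<gamma> (u $ 2 $ 3) = 0"
    by (simp_all add: mult_entry sum_4 J4_def d ac_simps eq_neg_iff_add_eq_0)
  define x z s2 s1 where "x = u $ 1 $ 2" "z = - \<gamma> (u $ 2 $ 3)" "s2 = u $ 2 $ 4" "s1 = u $ 1 $ 3 + x * \<gamma> z"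
  have g2: "\<gamma> s2 = - s2" using e(4) by (simp add: x_z_s2_s1_def add_eq_0_iff)
  have g1: "\<gamma> s1 = - s1"
  proof -
    have "u $ 1 $ 3 + (- x) * u $ 2 $ 3 + \<gamma> (u $ 1 $ 3) + \<gamma> (u $ 2 $ 3) * (- \<gamma> x) = 0"
      using e(3) by (simp add: e(2) x_z_s2_s1_def gamma_minus)
    then show ?thesis
      by (simp add: x_z_s2_s1_def gamma_add gamma_diff gamma_mult gamma_minus eq_neg_iff_add_eq_0 algebra_simps)
  qed
  have "u $ 1 $ 4 + (- x) * s2 - z = 0" using e(5) by (simp add: e(2) x_z_s2_s1_def gamma_minus)
  then have u14: "u $ 1 $ 4 = z + x * s2" by (simp add: algebra_simps)
  have "u = nm x z s1 s2"
    unfolding vec_eq_iff forall_4 by (simp add: u14 d e(2)) (simp add: x_z_s2_s1_def gamma_minus)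
  then show "\<exists>x z s1 s2. \<gamma> s1 = - s1 \<and> \<gamma> s2 = - s2 \<and> u = nm x z s1 s2" using g1 g2 by blast
next
  assume "\<exists>x z s1 s2. \<gamma> s1 = - s1 \<and> \<gamma> s2 = - s2 \<and> u = nm x z s1 s2"
  then show "u \<in> N" using GU_I[OF herm_J4 is_sim_nm] by (auto simp: N_def forall_4)
qed

lemma skew_mult: "b \<in> F \<Longrightarrow> \<gamma> (b * th) = - (b * th)"
  by (simp add: gamma_mult gamma_fixes)

lemma skew_ex: "\<gamma> s = - s \<Longrightarrow> \<exists>b\<in>F. s = b * th"
  using skew_F[of s] by (intro bexI[of _ "s / th"]) auto

definition nmp :: "'e \<times> 'e \<times> 'e \<times> 'e \<Rightarrow> 'e^4^4" where
  "nmp = (\<lambda>(x, z, b1, b2). nm x z (b1 * th) (b2 * th))"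

definition params :: "('e \<times> 'e \<times> 'e \<times> 'e) set" where "params = \<Xi> \<times> \<Xi> \<times> \<Upsilon> \<times> \<Upsilon>"

lemma nmp_sim: "p \<in> params \<Longrightarrow> is_sim J4 (nmp p) 1"
  using is_sim_nm skew_mult Ups_F by (auto simp: params_def nmp_def)

lemma nmp_N: "p \<in> params \<Longrightarrow> nmp p \<in> N"
  unfolding N_iff nmp_def params_def using skew_mult Ups_F by (auto, blast)

lemma N_param: assumes "u \<in> N" obtains p where "p \<in> params" "lc u = lc (nmp p)"
proof -
  obtain x z s1 s2 where u: "\<gamma> s1 = - s1" "\<gamma> s2 = - s2" "u = nm x z s1 s2" using assms N_iff by blast
  obtain x' where x': "x' \<in> \<Xi>" "x' - x \<in> idl 0" using Xi_ex by blast
  \<comment> \<open>Rounding \<open>x\<close> to \<open>x'\<close> shifts the other coordinates by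
    the group law \<open>nm_mult\<close>; these are the shifted values, to be rounded next.\<close>
  define z1 s1' where "z1 = z - (x' - x) * s2" "s1' = s1 + (x' - x) * \<gamma> z - \<gamma> (x' - x) * (z - (x' - x) * s2)"
  obtain z' where z': "z' \<in> \<Xi>" "z' - z1 \<in> idl 0" using Xi_ex by blast
  have g1: "\<gamma> s1' = - s1'"
    using u by (simp add: z1_s1'_def gamma_add gamma_diff gamma_mult algebra_simps)
  obtain b1 where b1: "b1 \<in> F" "s1' = b1 * th" using skew_ex[OF g1] by blast
  obtain b2 where b2: "b2 \<in> F" "s2 = b2 * th" using skew_ex[OF u(2)] by blast
  obtain c1 where c1: "c1 \<in> \<Upsilon>" "c1 - b1 \<in> idl 0" using Ups_ex b1 by blast
  obtain c2 where c2: "c2 \<in> \<Upsilon>" "c2 - b2 \<in> idl 0" using Ups_ex b2 by blast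
  define k where "k = nm (x' - x) (z' - z1) ((c1 - b1) * th) ((c2 - b2) * th)"
  have "k \<in> K"
    unfolding k_def using nm_K[of "(c1 - b1) * th" "(c2 - b2) * th" "x' - x" "z' - z1"] skew_mult Ups_F b1 b2 c1 c2 F_diff x' z'
    by (simp add: idl_mult_iff')
  moreover have "u ** k = nm x' z' (c1 * th) (c2 * th)"
  proof -
    have "s1 + (x' - x) * \<gamma> z - \<gamma> (x' - x) * (z - (x' - x) * s2) + (c1 - b1) * th = c1 * th"
      using b1(2) by (simp add: z1_s1'_def left_diff_distrib)
    moreover have "z - (x' - x) * s2 + (z' - z1) = z'" by (simp add: z1_s1'_def)
    moreover have "s2 + (c2 - b2) * th = c2 * th" using b2(2) by (simp add: left_diff_distrib)
    ultimately show ?thesis unfolding k_def u(3) nm_mult[OF u(2)] by (simp only:) simp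
  qed
  ultimately have "nm x' z' (c1 * th) (c2 * th) \<in> lc u" unfolding lc_def by (metis imageI)
  then have "lc u = lc (nmp (x', z', c1, c2))" using lc_eq by (simp add: nmp_def)
  moreover have "(x', z', c1, c2) \<in> params" using x' z' c1 c2 by (simp add: params_def)
  ultimately show ?thesis using that by blast
qed

text \<open>The quotient of the two representatives, computed in coordinates, must be integral. Its
  \<open>x\<close>-coordinate gives equality there, after which the remaining shifts disappear and
  the other coordinates follow.\<close>

lemma nmp_inj:
  assumes p: "p \<in> params" "p' \<in> params" and k: "k \<in> K" "nmp p' = nmp p ** k"
  shows "p = p'"
proof -
  obtain x z b1 b2 where pe: "p = (x, z, b1, b2)" by (cases p)
  obtain x' z' c1 c2 where pe': "p' = (x', z', c1, c2)" by (cases p')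
  have P: "x \<in> \<Xi>" "z \<in> \<Xi>" "b1 \<in> \<Upsilon>" "b2 \<in> \<Upsilon>" "x' \<in> \<Xi>" "z' \<in> \<Xi>" "c1 \<in> \<Upsilon>" "c2 \<in> \<Upsilon>"
    using p by (auto simp: pe pe' params_def)
  define w t where "w = z' - (z - (x' - x) * (b2 * th))"
    "t = c1 * th - (b1 * th + (x' - x) * \<gamma> z - \<gamma> (x' - x) * (z - (x' - x) * (b2 * th)))"
  have sk: "\<gamma> (b1 * th) = - (b1 * th)" "\<gamma> (b2 * th) = - (b2 * th)" "\<gamma> (c1 * th) = - (c1 * th)" "\<gamma> (c2 * th) = - (c2 * th)"
    using P Ups_F skew_mult by blast+
  define l where "l = nm (x' - x) w t ((c2 - b2) * th)"
  have "nmp p ** l = nmp p'"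
    unfolding l_def pe pe' nmp_def prod.case nm_mult[OF sk(2)] by (simp add: w_t_def algebra_simps)
  then have "nmp p ** l = nmp p ** k" using k by simp
  then have "matrix_inv (nmp p) ** (nmp p ** l) = matrix_inv (nmp p) ** (nmp p ** k)" by simp
  then have "l = k" using is_sim_inv(3)[OF herm_J4 nmp_sim[OF p(1)]] by (simp add: matrix_mul_assoc)
  then have "l \<in> K" using k by simp
  moreover have "\<gamma> t = - t"
  proof -
    have "\<gamma> (a - (b + y * \<gamma> z - \<gamma> y * (z - y * c))) = - (a - (b + y * \<gamma> z - \<gamma> y * (z - y * c)))"
      if "\<gamma> a = - a" "\<gamma> b = - b" "\<gamma> c = - c" for a b c y
      using that by (simp add: gamma_add gamma_diff gamma_mult algebra_simps)
    from this[OF sk(3,1,2)] show ?thesis unfolding w_t_def .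
  qed
  moreover have "\<gamma> ((c2 - b2) * th) = - ((c2 - b2) * th)" using P Ups_F F_diff skew_mult by blast
  ultimately have i: "x' - x \<in> idl 0" "w \<in> idl 0" "t \<in> idl 0" "(c2 - b2) * th \<in> idl 0"
    unfolding l_def using nm_K by blast+
  have "x = x'" using i(1) Xi_eq P by (metis idl_commute)
  then have "z' - z \<in> idl 0" "(c1 - b1) * th \<in> idl 0" using i by (simp_all add: w_t_def algebra_simps)
  then have "z = z'" "b1 = c1" "b2 = c2"
    using i Xi_eq Ups_eq P by (simp_all add: idl_mult_iff') (metis idl_commute)+
  then show ?thesis using \<open>x = x'\<close> by (simp add: pe pe')
qed

definition cnt :: "('e^4^4) set \<Rightarrow> lattice3 \<Rightarrow> nat" where
  "cnt X l = card {p \<in> params. pi_pow l ** nmp p \<in> X}"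

lemma pi_pow_sim: "is_sim J4 (pi_pow l) (\<pi> powi (fst l))"
  using is_sim_pi_pow by (cases l) simp

text \<open>For fixed \<open>l\<close> the cosets \<open>\<pi>^l u K\<close> are indexed by
  \<open>params\<close> without repetition, so the Satake coefficients become counts of
  representatives subject to integrality conditions.\<close>

lemma satake_ch_cnt:
  assumes X: "X \<subseteq> carrier G" "\<And>g. g \<in> X \<Longrightarrow> lc g \<subseteq> X"
  shows "satake_ch X l = real q powi (- pair_delta l) * real (cnt X l)"
proof -
  let ?P = "{p \<in> params. pi_pow l ** nmp p \<in> X}"
  let ?f = "\<lambda>p. lc (pi_pow l ** nmp p)"
  have NG: "u \<in> carrier G" if "u \<in> N" for u using that by (simp add: N_def)
  have lG: "pi_pow l \<in> carrier G" using pi_pow_sim GU_I herm_J4 by blast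
  have "{A. A \<subseteq> X \<and> (\<exists>u\<in>N. A = (pi_pow l ** u) <#\<^bsub>G\<^esub> K)} = ?f ` ?P"
  proof (intro equalityI subsetI)
    fix A assume "A \<in> {A. A \<subseteq> X \<and> (\<exists>u\<in>N. A = (pi_pow l ** u) <#\<^bsub>G\<^esub> K)}"
    then obtain u where u: "A \<subseteq> X" "u \<in> N" "A = lc (pi_pow l ** u)" by (auto simp: l_coset_G)
    obtain p where p: "p \<in> params" "lc u = lc (nmp p)" using N_param[OF u(2)] by blast
    have "A = ?f p" using u p lc_mult[OF lG] by metis
    moreover have "pi_pow l ** nmp p \<in> X" using u(1) lc_self unfolding calculation by blast
    ultimately show "A \<in> ?f ` ?P" using p by blast
  next
    fix A assume "A \<in> ?f ` ?P"
    then show "A \<in> {A. A \<subseteq> X \<and> (\<exists>u\<in>N. A = (pi_pow l ** u) <#\<^bsub>G\<^esub> K)}"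
      using X(2) nmp_N by (auto simp: l_coset_G)
  qed
  moreover have "inj_on ?f ?P"
  proof (rule inj_onI)
    fix p p' assume p: "p \<in> ?P" "p' \<in> ?P" "?f p = ?f p'"
    then have "pi_pow l ** nmp p' \<in> ?f p" using lc_self by metis
    then obtain k where k: "k \<in> K" "pi_pow l ** nmp p' = pi_pow l ** nmp p ** k" by (auto simp: lc_def)
    then have "matrix_inv (pi_pow l) ** (pi_pow l ** nmp p') = matrix_inv (pi_pow l) ** (pi_pow l ** (nmp p ** k))"
      by (simp add: matrix_mul_assoc)
    then have "nmp p' = nmp p ** k" using is_sim_inv(3)[OF herm_J4 pi_pow_sim] by (simp add: matrix_mul_assoc)
    then show "p = p'" using nmp_inj p k by blast
  qed
  ultimately show ?thesis by (simp add: satake_ch_def cnt_def card_image)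
qed

end

section \<open>Counting cosets with bounded entries and minors\<close>

context odd_unramified_extension
begin

text \<open>This will be \<open>K\<close> together with the double coset of
  \<open>pi_pow (0, -1, 0)\<close>, while \<open>Xb (-1) 0\<close> adds that of
  \<open>pi_pow (0, -1, -1)\<close>. Bounds on entries and minors are easy to count, so the counts
  are made for this chain and subtracted afterwards.\<close>

definition X1 :: "('e^4^4) set" where "X1 = {g \<in> Xb (-1) 0. intmin (-1) g}"

abbreviation Ups_j :: "nat \<Rightarrow> 'e set" where "Ups_j j \<equiv> {b \<in> \<Upsilon>. b \<in> idl (- int j)}"
abbreviation Xi_j :: "nat \<Rightarrow> 'e set" where "Xi_j j \<equiv> {x \<in> \<Xi>. x \<in> idl (- int j)}"

lemma card_Ups_j: "finite (Ups_j j)" "card (Ups_j j) = q ^ j"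
  using card_Ups_near[of 0 j] by simp_all

lemma card_Xi_j: "finite (Xi_j j)" "card (Xi_j j) = q ^ (2 * j)"
  using card_Xi_near[of 0 j] by simp_all

lemma idl_near: "x - y \<in> idl m \<Longrightarrow> y \<in> idl n \<Longrightarrow> n \<le> m \<Longrightarrow> x \<in> idl n"
  using idl_cong_mem[of x y n] idl_mono[of "x - y" m n] by blast

lemmas card_small = card_Ups_j(2)[of 1, simplified] card_Ups_j(2)[of 2, simplified] card_Xi_j(2)[of 1, simplified]
  card_Ups_j(1)[of 1, simplified] card_Ups_j(1)[of 2, simplified] card_Xi_j(1)[of 1, simplified]

lemma mem_Xb_nm:
  assumes "p \<in> params"
  shows "pi_pow (a0, a1, a2) ** nmp p \<in> Xb m 0 \<longleftrightarrow> a0 = 0 \<and> intmat m (pi_pow (a0, a1, a2) ** nmp p)"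
proof -
  have "is_sim J4 (pi_pow (a0, a1, a2) ** nmp p) (\<pi> powi a0)"
    using is_sim_mult[OF is_sim_pi_pow nmp_sim[OF assms]] by simp
  then show ?thesis
    using GU_I[OF herm_J4] sim_eq[OF herm_J4] by (auto simp: Xb_def)
qed

lemma intmat_nm_iff:
  "intmat m (pi_pow (0, a1, a2) ** nm x z s1 s2) \<longleftrightarrow>
     m \<le> a1 \<and> a1 \<le> - m \<and> m \<le> a2 \<and> a2 \<le> - m \<and> x \<in> idl (m - a1) \<and> x \<in> idl (m + a2)
     \<and> z \<in> idl (m - a2) \<and> s2 \<in> idl (m - a2) \<and> s1 - x * \<gamma> z \<in> idl (m - a1) \<and> z + x * s2 \<in> idl (m - a1)"
proof -
  have p: "\<pi> powi k \<in> idl m \<longleftrightarrow> m \<le> k" for k by (simp add: idl_def)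
  show ?thesis
    by (simp add: intmat_def forall_4 mult_entry sum_4 pi_pow_entry p idl_mult_iff)
       (auto simp: algebra_simps)
qed

lemma one_column_intmin:
  assumes "\<And>i. g $ i $ j0 \<in> idl (-1)" "\<And>i j. j \<noteq> j0 \<Longrightarrow> g $ i $ j \<in> idl 0"
  shows "intmin (-1) g"
  unfolding intmin_def minor_def
proof (intro allI)
  fix i i' j j'
  consider "j = j'" | "j \<noteq> j0" "j' \<noteq> j0" | "j = j0" "j' \<noteq> j0" | "j \<noteq> j0" "j' = j0" by metis
  then show "g $ i $ j * g $ i' $ j' - g $ i $ j' * g $ i' $ j \<in> idl (-1)"
  proof cases
    case 1 then show ?thesis by (simp add: mult.commute)
  next
    case 2
    have w: "g $ i $ j \<in> idl (-1)" for i using assms(2)[OF 2(1)] idl_mono[of _ 0 "-1"] by auto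
    show ?thesis using w assms(2)[OF 2(2)] by (intro idl_diff idl_mult0' idl_mult0) auto
  next
    case 3 then show ?thesis using assms by (intro idl_diff idl_mult0' idl_mult0) auto
  next
    case 4 then show ?thesis using assms by (intro idl_diff idl_mult0' idl_mult0) auto
  qed
qed

text \<open>Norms from \<open>E\<close> have even valuation, so the bound -1 is as good as
  0.\<close>

lemma norm_idl: "x * \<gamma> x \<in> idl (-1) \<longleftrightarrow> x \<in> idl 0"
  by (cases "x = 0") (auto simp: idl_def v_mult)

lemma cnt_eqI: "(\<And>x z b1 b2. x \<in> \<Xi> \<Longrightarrow> z \<in> \<Xi> \<Longrightarrow> b1 \<in> \<Upsilon> \<Longrightarrow> b2 \<in> \<Upsilon> \<Longrightarrow>
    pi_pow l ** nm x z (b1 * th) (b2 * th) \<in> X \<longleftrightarrow> (x, z, b1, b2) \<in> S) \<Longrightarrow> S \<subseteq> params \<Longrightarrow> cnt X l = card S"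
  unfolding cnt_def params_def nmp_def by (rule arg_cong[of _ _ card]) auto

lemma Xb_nm_iff:
  assumes "x \<in> \<Xi>" "z \<in> \<Xi>" "b1 \<in> \<Upsilon>" "b2 \<in> \<Upsilon>"
  shows "pi_pow (a0, a1, a2) ** nm x z (b1 * th) (b2 * th) \<in> Xb m 0 \<longleftrightarrow>
     a0 = 0 \<and> m \<le> a1 \<and> a1 \<le> - m \<and> m \<le> a2 \<and> a2 \<le> - m \<and> x \<in> idl (m - a1) \<and> x \<in> idl (m + a2)
     \<and> z \<in> idl (m - a2) \<and> b2 \<in> idl (m - a2) \<and> b1 * th - x * \<gamma> z \<in> idl (m - a1) \<and> z + x * (b2 * th) \<in> idl (m - a1)"
  using mem_Xb_nm[of "(x, z, b1, b2)" a0 a1 a2 m] assms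
  by (auto simp: params_def nmp_def intmat_nm_iff idl_mult_iff')

lemma cnt_K: "cnt K (a0, a1, a2) = (if (a0, a1, a2) = (0, 0, 0) then 1 else 0)"
proof -
  have K: "K = Xb 0 0" by (auto simp: K_eq KK_def Xb_def)
  show ?thesis
  proof (cases "(a0, a1, a2) = (0, 0, 0)")
    case True
    have "cnt K (a0, a1, a2) = card {(0::'e, 0::'e, 0::'e, 0::'e)}"
    proof (rule cnt_eqI)
      fix x z b1 b2 assume "x \<in> \<Xi>" "z \<in> \<Xi>" "b1 \<in> \<Upsilon>" "b2 \<in> \<Upsilon>"
      then show "pi_pow (a0, a1, a2) ** nm x z (b1 * th) (b2 * th) \<in> K \<longleftrightarrow> (x, z, b1, b2) \<in> {(0, 0, 0, 0)}"
        unfolding K Xb_nm_iff[OF \<open>x \<in> \<Xi>\<close> \<open>z \<in> \<Xi>\<close> \<open>b1 \<in> \<Upsilon>\<close> \<open>b2 \<in> \<Upsilon>\<close>]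
        using True by (auto simp: Xi_int Ups_int idl_mult_iff')
    qed (auto simp: params_def Xi_zero Ups_zero)
    then show ?thesis using True by simp
  next
    case False
    have "cnt K (a0, a1, a2) = card ({} :: ('e \<times> 'e \<times> 'e \<times> 'e) set)"
      by (rule cnt_eqI) (use False in \<open>auto simp: K Xb_nm_iff\<close>)
    then show ?thesis using False by simp
  qed
qed

lemma cnt_X2_out: "a0 \<noteq> 0 \<or> 1 < \<bar>a1\<bar> \<or> 1 < \<bar>a2\<bar> \<Longrightarrow> cnt (Xb (-1) 0) (a0, a1, a2) = 0"
proof -
  assume a: "a0 \<noteq> 0 \<or> 1 < \<bar>a1\<bar> \<or> 1 < \<bar>a2\<bar>"
  have "cnt (Xb (-1) 0) (a0, a1, a2) = card ({} :: ('e \<times> 'e \<times> 'e \<times> 'e) set)"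
    by (rule cnt_eqI) (use a in \<open>auto simp: Xb_nm_iff\<close>)
  then show ?thesis by simp
qed

text \<open>In these cases one of the two bounds on \<open>x\<close> is 0, so \<open>x = 0\<close>,
  and the conditions on the other coordinates decouple.\<close>

lemma cnt_X2_x0:
  assumes "a1 = -1 \<or> a2 = 1" "\<bar>a1\<bar> \<le> 1" "\<bar>a2\<bar> \<le> 1"
  shows "cnt (Xb (-1) 0) (0, a1, a2) = q ^ (2 * nat (1 + min a1 a2)) * q ^ nat (1 + a1) * q ^ nat (1 + a2)"
proof -
  let ?S = "{0::'e} \<times> Xi_j (nat (1 + min a1 a2)) \<times> Ups_j (nat (1 + a1)) \<times> Ups_j (nat (1 + a2))"
  have "cnt (Xb (-1) 0) (0, a1, a2) = card ?S"
  proof (rule cnt_eqI)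
    fix x z b1 b2 assume xz: "x \<in> \<Xi>" "z \<in> \<Xi>" "b1 \<in> \<Upsilon>" "b2 \<in> \<Upsilon>"
    have x0: "x = 0" if "x \<in> idl (-1 - a1)" "x \<in> idl (-1 + a2)"
      using that assms Xi_int[OF xz(1)] by auto
    have n: "- int (nat (1 + min a1 a2)) = -1 - min a1 a2" "- int (nat (1 + a1)) = -1 - a1" "- int (nat (1 + a2)) = -1 - a2"
      using assms by auto
    have z: "z \<in> idl (-1 - min a1 a2) \<longleftrightarrow> z \<in> idl (-1 - a1) \<and> z \<in> idl (-1 - a2)"
      by (auto simp: idl_def)
    show "pi_pow (0, a1, a2) ** nm x z (b1 * th) (b2 * th) \<in> Xb (-1) 0 \<longleftrightarrow> (x, z, b1, b2) \<in> ?S"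
      unfolding Xb_nm_iff[OF xz] mem_Times_iff fst_conv snd_conv mem_Collect_eq n z
      using x0 xz assms by (auto simp: idl_mult_iff')
  qed (auto simp: params_def Xi_zero)
  also have "\<dots> = q ^ (2 * nat (1 + min a1 a2)) * q ^ nat (1 + a1) * q ^ nat (1 + a2)"
    by (simp only: card_cartesian_product card_Xi_j card_Ups_j) simp
  finally show ?thesis .
qed

text \<open>With \<open>a2 = -1\<close> the bounds on \<open>z\<close> and \<open>b2\<close> become
  integrality, so both vanish.\<close>

lemma cnt_X2_m1:
  assumes "a1 = 0 \<or> a1 = 1"
  shows "cnt (Xb (-1) 0) (0, a1, -1) = q ^ (2 * nat (1 + a1)) * q ^ nat (1 + a1)"
proof -
  let ?S = "Xi_j (nat (1 + a1)) \<times> {0::'e} \<times> Ups_j (nat (1 + a1)) \<times> {0::'e}"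
  have "cnt (Xb (-1) 0) (0, a1, -1) = card ?S"
  proof (rule cnt_eqI)
    fix x z b1 b2 assume xz: "x \<in> \<Xi>" "z \<in> \<Xi>" "b1 \<in> \<Upsilon>" "b2 \<in> \<Upsilon>"
    have n: "- int (nat (1 + a1)) = -1 - a1" using assms by auto
    have x: "x \<in> idl (-1 - a1) \<Longrightarrow> x \<in> idl (-2)" using assms idl_mono[of x "-1 - a1" "-2"] by auto
    show "pi_pow (0, a1, -1) ** nm x z (b1 * th) (b2 * th) \<in> Xb (-1) 0 \<longleftrightarrow> (x, z, b1, b2) \<in> ?S"
      unfolding Xb_nm_iff[OF xz] mem_Times_iff fst_conv snd_conv mem_Collect_eq n
      using x xz assms by (auto simp: idl_mult_iff' Xi_int Ups_int)
  qed (auto simp: params_def Xi_zero Ups_zero)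
  also have "\<dots> = q ^ (2 * nat (1 + a1)) * q ^ nat (1 + a1)"
    by (simp only: card_cartesian_product card_Xi_j card_Ups_j) simp
  finally show ?thesis .
qed

text \<open>The products \<open>x * \<gamma> z\<close> and \<open>x * (b2 * th)\<close> have
  valuation at least -2, which the two mixed conditions allow, so the four coordinates
  decouple.\<close>

lemma cnt_X2_10: "cnt (Xb (-1) 0) (0, 1, 0) = q ^ 7"
proof -
  let ?S = "Xi_j 1 \<times> Xi_j 1 \<times> Ups_j 2 \<times> Ups_j 1"
  have "cnt (Xb (-1) 0) (0, 1, 0) = card ?S"
  proof (rule cnt_eqI)
    fix x z b1 b2 assume xz: "x \<in> \<Xi>" "z \<in> \<Xi>" "b1 \<in> \<Upsilon>" "b2 \<in> \<Upsilon>"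
    have "x * \<gamma> z \<in> idl (-2)" "z + x * (b2 * th) \<in> idl (-2)" if "x \<in> idl (-1)" "z \<in> idl (-1)" "b2 \<in> idl (-1)"
      using that idl_mult[of x "-1" "\<gamma> z" "-1"] idl_mult[of x "-1" "b2 * th" "-1"] idl_mono[of z "-1" "-2"]
      by (auto intro!: idl_add simp: idl_mult_iff')
    moreover have "b1 * th - x * \<gamma> z \<in> idl (-2) \<longleftrightarrow> b1 \<in> idl (-2)" if "x * \<gamma> z \<in> idl (-2)"
      using idl_cong_mem[of "b1 * th - x * \<gamma> z" "b1 * th" "-2"] that by (simp add: idl_mult_iff')
    moreover have "x \<in> idl (-2)" if "x \<in> idl (-1)" using that idl_mono by force
    ultimately show "pi_pow (0, 1, 0) ** nm x z (b1 * th) (b2 * th) \<in> Xb (-1) 0 \<longleftrightarrow> (x, z, b1, b2) \<in> ?S"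
      unfolding Xb_nm_iff[OF xz] mem_Times_iff fst_conv snd_conv mem_Collect_eq
      using xz by auto
  qed (auto simp: params_def)
  also have "\<dots> = q ^ 7"
    by (simp add: card_cartesian_product card_small flip: power_add power_Suc power_Suc2)
  finally show ?thesis .
qed

text \<open>The weight at which coordinates interact. For \<open>x = 0\<close> the others are free,
  which gives \<open>q^4\<close>; each of the \<open>q^2 - 1\<close> nonzero \<open>x\<close> forces
  \<open>b2 = 0\<close>, and each of the \<open>q^2\<close> values of \<open>b1\<close> then
  determines \<open>z\<close>.\<close>

lemma cnt_X2_00: "real (cnt (Xb (-1) 0) (0, 0, 0)) = 2 * real q ^ 4 - real q ^ 2"
proof -
  define A where "A = {0::'e} \<times> Xi_j 1 \<times> Ups_j 1 \<times> Ups_j 1"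
  define B where "B = {p \<in> (Xi_j 1 - {0::'e}) \<times> Xi_j 1 \<times> Ups_j 2 \<times> {0::'e}. case p of (x, z, b1, b2) \<Rightarrow> b1 * th - x * \<gamma> z \<in> idl (-1)}"
  have "cnt (Xb (-1) 0) (0, 0, 0) = card (A \<union> B)"
  proof (rule cnt_eqI)
    fix x z b1 b2 assume xz: "x \<in> \<Xi>" "z \<in> \<Xi>" "b1 \<in> \<Upsilon>" "b2 \<in> \<Upsilon>"
    have b2: "z + x * (b2 * th) \<in> idl (-1) \<longleftrightarrow> b2 = 0" if "x \<in> idl (-1)" "x \<noteq> 0" "z \<in> idl (-1)"
    proof -
      have "v x = -1" using that xz Xi_int[of x] by (auto simp: idl_def)
      have "z + x * (b2 * th) \<in> idl (-1) \<longleftrightarrow> x * (b2 * th) \<in> idl (-1)"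
        using idl_cong_mem[of "z + x * (b2 * th)" "x * (b2 * th)" "-1"] that by simp
      also have "\<dots> \<longleftrightarrow> b2 = 0" using that \<open>v x = -1\<close> xz by (simp add: idl_mult_iff idl_mult_iff' Ups_int)
      finally show ?thesis .
    qed
    have b1: "b1 \<in> idl (-2)" if "b1 * th - x * \<gamma> z \<in> idl (-1)" "x \<in> idl (-1)" "z \<in> idl (-1)"
    proof -
      have "x * \<gamma> z \<in> idl (-2)" using that idl_mult[of x "-1" "\<gamma> z" "-1"] by simp
      moreover have "b1 * th - x * \<gamma> z \<in> idl (-2)" using that idl_mono by force
      ultimately have "b1 * th - x * \<gamma> z + x * \<gamma> z \<in> idl (-2)" by (intro idl_add)
      then show ?thesis by (simp add: idl_mult_iff')
    qed
    show "pi_pow (0, 0, 0) ** nm x z (b1 * th) (b2 * th) \<in> Xb (-1) 0 \<longleftrightarrow> (x, z, b1, b2) \<in> A \<union> B"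
    proof (cases "x = 0")
      case True
      then show ?thesis unfolding Xb_nm_iff[OF xz] A_def B_def using xz by (auto simp: idl_mult_iff')
    next
      case False
      then show ?thesis unfolding Xb_nm_iff[OF xz] A_def B_def using xz b1 b2 Ups_zero by auto
    qed
  qed (auto simp: params_def A_def B_def Xi_zero Ups_zero)
  moreover have "card (A \<union> B) = card A + card B" "finite B"
  proof -
    have "B \<subseteq> (Xi_j 1 - {0::'e}) \<times> Xi_j 1 \<times> Ups_j 2 \<times> {0::'e}" by (auto simp: B_def)
    moreover have "finite ((Xi_j 1 - {0::'e}) \<times> Xi_j 1 \<times> Ups_j 2 \<times> {0::'e})" using card_small by (intro finite_cartesian_product) auto
    ultimately show "finite B" using finite_subset by blast
    moreover have "finite A" unfolding A_def using card_small by (intro finite_cartesian_product) auto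
    moreover have "A \<inter> B = {}" by (auto simp: A_def B_def)
    ultimately show "card (A \<union> B) = card A + card B" by (simp add: card_Un_disjoint)
  qed
  moreover have "card A = q ^ 4"
    by (simp add: A_def card_cartesian_product card_small power2_eq_square power4_eq_xxxx)
  moreover have "card B = (q ^ 2 - 1) * q ^ 2"
  proof -
    have z: "\<exists>z. z \<in> \<Xi> \<and> z - \<gamma> (b1 * th / x) \<in> idl 0" for x b1 using Xi_ex by metis
    \<comment> \<open>For \<open>x\<close> with a pole and given \<open>b1\<close>, the congruence
      has exactly one solution \<open>z\<close> among the representatives.\<close>
    define f where "f = (\<lambda>(x, b1). (x, (SOME z. z \<in> \<Xi> \<and> z - \<gamma> (b1 * th / x) \<in> idl 0), b1, 0::'e))"
    have zz: "b1 * th - x * \<gamma> z \<in> idl (-1) \<longleftrightarrow> z - \<gamma> (b1 * th / x) \<in> idl 0" if "x \<in> Xi_j 1 - {0}" for x z b1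
    proof -
      have x: "x \<noteq> 0" "v x = -1" using that Xi_int[of x] by (auto simp: idl_def)
      have "b1 * th - x * \<gamma> z = - (x * (\<gamma> (z - \<gamma> (b1 * th / x))))" using x by (simp add: gamma_diff field_simps)
      then show ?thesis using x by (simp add: idl_mult_iff)
    qed
    have "bij_betw f ((Xi_j 1 - {0}) \<times> Ups_j 2) B"
      unfolding bij_betw_def
    proof
      show "inj_on f ((Xi_j 1 - {0}) \<times> Ups_j 2)" by (auto simp: f_def inj_on_def)
      show "f ` ((Xi_j 1 - {0}) \<times> Ups_j 2) = B"
      proof (intro equalityI subsetI)
        fix p assume "p \<in> f ` ((Xi_j 1 - {0}) \<times> Ups_j 2)"
        then obtain x b1 where xb: "x \<in> Xi_j 1 - {0}" "b1 \<in> Ups_j 2" "p = f (x, b1)" by auto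
        define z where "z = (SOME z. z \<in> \<Xi> \<and> z - \<gamma> (b1 * th / x) \<in> idl 0)"
        have zX: "z \<in> \<Xi>" "z - \<gamma> (b1 * th / x) \<in> idl 0" using someI_ex[OF z[of b1 x]] by (auto simp: z_def)
        have x: "x \<noteq> 0" "v x = -1" using xb Xi_int[of x] by (auto simp: idl_def)
        have "b1 * th / x \<in> idl (-1)" using xb x by (simp add: idl_divide_iff idl_mult_iff')
        then have "\<gamma> (b1 * th / x) \<in> idl (-1)" by simp
        then have "z \<in> idl (-1)" by (rule idl_near[OF zX(2)]) simp
        then show "p \<in> B" using xb zX zz[OF xb(1)] by (simp add: B_def f_def z_def[symmetric])
      next
        fix p assume "p \<in> B"
        then obtain x z' b1 where p: "p = (x, z', b1, 0)" "x \<in> Xi_j 1 - {0}" "z' \<in> Xi_j 1" "b1 \<in> Ups_j 2"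
          "b1 * th - x * \<gamma> z' \<in> idl (-1)" by (auto simp: B_def)
        define z where "z = (SOME z. z \<in> \<Xi> \<and> z - \<gamma> (b1 * th / x) \<in> idl 0)"
        have zX: "z \<in> \<Xi>" "z - \<gamma> (b1 * th / x) \<in> idl 0" using someI_ex[OF z[of b1 x]] by (auto simp: z_def)
        have "z' - \<gamma> (b1 * th / x) \<in> idl 0" using p zz[OF p(2)] by simp
        then have "z = z'" using zX p Xi_eq[of z z'] idl_cong_trans idl_commute by blast
        then have "p = f (x, b1)" by (simp add: p(1) f_def z_def)
        then show "p \<in> f ` ((Xi_j 1 - {0}) \<times> Ups_j 2)" using p by blast
      qed
    qed
    then have "card B = card ((Xi_j 1 - {0}) \<times> Ups_j 2)" by (simp add: bij_betw_same_card)
    also have "\<dots> = (q ^ 2 - 1) * q ^ 2"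
      using card_small Xi_zero by (simp add: card_cartesian_product card_Diff_singleton)
    finally show ?thesis .
  qed
  ultimately have c: "cnt (Xb (-1) 0) (0, 0, 0) = q ^ 4 + (q ^ 2 - 1) * q ^ 2" by simp
  have "1 \<le> q ^ 2" using q_pos by simp
  then have "real (q ^ 2 - 1) = real q ^ 2 - 1" by (simp add: of_nat_diff)
  then have "real (cnt (Xb (-1) 0) (0, 0, 0)) = real q ^ 4 + (real q ^ 2 - 1) * real q ^ 2" unfolding c by simp
  then show ?thesis by (simp add: left_diff_distrib power2_eq_square power4_eq_xxxx)
qed

text \<open>Four of the minors reduce to products of two diagonal entries, because the opposite
  off-diagonal entries vanish for elements of \<open>N\<close>.\<close>

lemma X1_weights:
  assumes "pi_pow (a0, a1, a2) ** nm x z s1 s2 \<in> X1"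
  shows "\<bar>a1 + a2\<bar> \<le> 1 \<and> \<bar>a1 - a2\<bar> \<le> 1"
proof -
  define g where "g = pi_pow (a0, a1, a2) ** nm x z s1 s2"
  have g: "intmin (-1) g" "v (sim J4 g) = 0" "g \<in> carrier G" using assms by (auto simp: X1_def g_def Xb_def)
  have e: "g $ 1 $ 1 = \<pi> powi a1" "g $ 2 $ 2 = \<pi> powi a2" "g $ 3 $ 3 = \<pi> powi (a0 - a1)" "g $ 4 $ 4 = \<pi> powi (a0 - a2)"
    "g $ 2 $ 1 = 0" "g $ 3 $ 4 = 0" "g $ 4 $ 1 = 0" "g $ 3 $ 2 = 0" "g $ 3 $ 1 = 0"
    by (simp_all add: g_def mult_entry sum_4 pi_pow_entry)
  have m: "minor g i i' j j' \<in> idl (-1)" for i i' j j' using g by (simp add: intmin_def)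
  have "(adj g ** J4 ** g) $ 1 $ 3 = sim J4 g" using is_simD[OF GU_sim[OF herm_J4 g(3)]] by (simp add: J4_def)
  then have "\<gamma> (\<pi> powi a1) * \<pi> powi (a0 - a1) = sim J4 g" by (simp add: mult_entry sum_4 J4_def e)
  then have "sim J4 g = \<pi> powi a0" by (simp add: gamma_powi flip: power_int_add)
  then have a0: "a0 = 0" using g by simp
  show ?thesis
    using m[of 1 2 1 2] m[of 3 4 3 4] m[of 1 4 1 4] m[of 2 3 2 3]
    by (simp add: minor_def e a0 flip: power_int_add) (auto simp: idl_def abs_le_iff)
qed

lemma cnt_X1_out:
  assumes "\<not> (a0 = 0 \<and> \<bar>a1\<bar> + \<bar>a2\<bar> \<le> 1)"
  shows "cnt X1 (a0, a1, a2) = 0"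
proof -
  have "cnt X1 (a0, a1, a2) = card ({} :: ('e \<times> 'e \<times> 'e \<times> 'e) set)"
  proof (rule cnt_eqI)
    fix x z b1 b2 assume xz: "x \<in> \<Xi>" "z \<in> \<Xi>" "b1 \<in> \<Upsilon>" "b2 \<in> \<Upsilon>"
    show "pi_pow (a0, a1, a2) ** nm x z (b1 * th) (b2 * th) \<in> X1 \<longleftrightarrow> (x, z, b1, b2) \<in> {}"
    proof
      assume a: "pi_pow (a0, a1, a2) ** nm x z (b1 * th) (b2 * th) \<in> X1"
      then have "pi_pow (a0, a1, a2) ** nm x z (b1 * th) (b2 * th) \<in> Xb (-1) 0" by (simp add: X1_def)
      then have "a0 = 0" unfolding Xb_nm_iff[OF xz] by blast
      then show "(x, z, b1, b2) \<in> {}" using X1_weights[OF a] assms by linarith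
    qed simp
  qed simp
  then show ?thesis by simp
qed

text \<open>Compared with \<open>Xb (-1) 0\<close>, a minor through the entry
  \<open>inverse \<pi>\<close> makes one more coordinate integral, hence zero; conversely all poles
  then sit in one column and \<open>one_column_intmin\<close> applies. The other three weights of
  this orbit go the same way.\<close>

lemma cnt_X1_10: "cnt X1 (0, 1, 0) = q ^ 6"
proof -
  let ?S = "Xi_j 1 \<times> Xi_j 1 \<times> Ups_j 2 \<times> {0::'e}"
  have "cnt X1 (0, 1, 0) = card ?S"
  proof (rule cnt_eqI)
    fix x z b1 b2 assume xz: "x \<in> \<Xi>" "z \<in> \<Xi>" "b1 \<in> \<Upsilon>" "b2 \<in> \<Upsilon>"
    define g where "g = pi_pow (0, 1, 0) ** nm x z (b1 * th) (b2 * th)"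
    have e: "g $ 3 $ 3 = inverse \<pi>" "g $ 2 $ 4 = b2 * th" "g $ 3 $ 4 = 0"
      by (simp_all add: g_def mult_entry sum_4 pi_pow_entry power_int_minus)
    have b2: "b2 = 0" if "g \<in> X1"
    proof -
      have "minor g 2 3 3 4 \<in> idl (-1)" using that by (simp add: X1_def intmin_def)
      then have "b2 \<in> idl 0" by (simp add: minor_def e idl_mult_iff' v_inverse)
      then show ?thesis using xz Ups_int by blast
    qed
    have xz2: "x * \<gamma> z \<in> idl (-2)" if "x \<in> idl (-1)" "z \<in> idl (-1)"
      using that idl_mult[of x "-1" "\<gamma> z" "-1"] by simp
    have cg: "b1 * th - x * \<gamma> z \<in> idl (-2) \<longleftrightarrow> b1 \<in> idl (-2)" if "x * \<gamma> z \<in> idl (-2)"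
      using idl_cong_mem[of "b1 * th - x * \<gamma> z" "b1 * th" "-2"] that by (simp add: idl_mult_iff')
    have w: "y \<in> idl (-2)" if "y \<in> idl (-1)" for y using that idl_mono by force
    have "g \<in> X1 \<longleftrightarrow> (x, z, b1, b2) \<in> ?S"
    proof
      assume a: "g \<in> X1"
      then have "g \<in> Xb (-1) 0" by (simp add: X1_def)
      then show "(x, z, b1, b2) \<in> ?S" using b2[OF a] xz xz2 cg unfolding g_def Xb_nm_iff[OF xz] by auto
    next
      assume a: "(x, z, b1, b2) \<in> ?S"
      then have b: "b2 = 0" "x \<in> idl (-1)" "z \<in> idl (-1)" "b1 \<in> idl (-2)" by auto
      have gX: "g \<in> Xb (-1) 0" unfolding g_def Xb_nm_iff[OF xz] using b xz2 cg w by auto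
      have "intmin (-1) g"
      proof (rule one_column_intmin[of _ 3])
        show "g $ i $ 3 \<in> idl (-1)" for i using gX by (simp add: Xb_def intmat_def)
        have "\<forall>i j. j \<noteq> 3 \<longrightarrow> g $ i $ j \<in> idl 0"
          using b by (simp add: forall_4 g_def mult_entry sum_4 pi_pow_entry idl_mult_iff) (simp add: idl_def)
        then show "j \<noteq> 3 \<Longrightarrow> g $ i $ j \<in> idl 0" for i j by blast
      qed
      then show "g \<in> X1" using gX by (simp add: X1_def)
    qed
    then show "pi_pow (0, 1, 0) ** nm x z (b1 * th) (b2 * th) \<in> X1 \<longleftrightarrow> (x, z, b1, b2) \<in> ?S" by (simp add: g_def)
  qed (auto simp: params_def Ups_zero)
  also have "\<dots> = q ^ 6"
    by (simp add: card_cartesian_product card_small flip: power_add power_Suc power_Suc2)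
  finally show ?thesis .
qed

lemma cnt_X1_m10: "cnt X1 (0, -1, 0) = 1"
proof -
  let ?S = "{(0::'e, 0::'e, 0::'e, 0::'e)}"
  have "cnt X1 (0, -1, 0) = card ?S"
  proof (rule cnt_eqI)
    fix x z b1 b2 assume xz: "x \<in> \<Xi>" "z \<in> \<Xi>" "b1 \<in> \<Upsilon>" "b2 \<in> \<Upsilon>"
    define g where "g = pi_pow (0, -1, 0) ** nm x z (b1 * th) (b2 * th)"
    have e: "g $ 1 $ 1 = inverse \<pi>" "g $ 2 $ 4 = b2 * th" "g $ 2 $ 1 = 0"
      by (simp_all add: g_def mult_entry sum_4 pi_pow_entry power_int_minus)
    have b2: "b2 = 0" if "g \<in> X1"
    proof -
      have "minor g 1 2 1 4 \<in> idl (-1)" using that by (simp add: X1_def intmin_def)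
      then have "b2 \<in> idl 0" by (simp add: minor_def e idl_mult_iff idl_mult_iff' v_inverse)
      then show ?thesis using xz Ups_int by blast
    qed
    have "g \<in> X1 \<longleftrightarrow> (x, z, b1, b2) \<in> ?S"
    proof
      assume a: "g \<in> X1"
      then have "g \<in> Xb (-1) 0" by (simp add: X1_def)
      then show "(x, z, b1, b2) \<in> ?S" using b2[OF a] xz unfolding g_def Xb_nm_iff[OF xz]
        by (auto simp: Xi_int Ups_int idl_mult_iff')
    next
      assume a: "(x, z, b1, b2) \<in> ?S"
      then have b: "b2 = 0" "x = 0" "z = 0" "b1 = 0" by auto
      have gX: "g \<in> Xb (-1) 0" unfolding g_def Xb_nm_iff[OF xz] using b by auto
      have "intmin (-1) g"
      proof (rule one_column_intmin[of _ 1])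
        show "g $ i $ 1 \<in> idl (-1)" for i using gX by (simp add: Xb_def intmat_def)
        have "\<forall>i j. j \<noteq> 1 \<longrightarrow> g $ i $ j \<in> idl 0"
          using b by (simp add: forall_4 g_def mult_entry sum_4 pi_pow_entry) (simp add: idl_def)
        then show "j \<noteq> 1 \<Longrightarrow> g $ i $ j \<in> idl 0" for i j by blast
      qed
      then show "g \<in> X1" using gX by (simp add: X1_def)
    qed
    then show "pi_pow (0, -1, 0) ** nm x z (b1 * th) (b2 * th) \<in> X1 \<longleftrightarrow> (x, z, b1, b2) \<in> ?S" by (simp add: g_def)
  qed (auto simp: params_def Ups_zero Xi_zero)
  then show ?thesis by simp
qed

lemma cnt_X1_01: "cnt X1 (0, 0, 1) = q ^ 4"
proof -
  let ?S = "{0::'e} \<times> Xi_j 1 \<times> {0::'e} \<times> Ups_j 2"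
  have "cnt X1 (0, 0, 1) = card ?S"
  proof (rule cnt_eqI)
    fix x z b1 b2 assume xz: "x \<in> \<Xi>" "z \<in> \<Xi>" "b1 \<in> \<Upsilon>" "b2 \<in> \<Upsilon>"
    define g where "g = pi_pow (0, 0, 1) ** nm x z (b1 * th) (b2 * th)"
    have e: "g $ 4 $ 4 = inverse \<pi>" "g $ 1 $ 3 = b1 * th - x * \<gamma> z" "g $ 4 $ 3 = - (inverse \<pi> * \<gamma> x)"
      by (simp_all add: g_def mult_entry sum_4 pi_pow_entry power_int_minus)
    have x0: "x = 0" if "g \<in> Xb (-1) 0" using that xz unfolding g_def Xb_nm_iff[OF xz] by (auto simp: Xi_int)
    have b1: "b1 = 0" if "g \<in> X1"
    proof -
      have x: "x = 0" using x0 that by (simp add: X1_def)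
      have "minor g 1 4 3 4 \<in> idl (-1)" using that by (simp add: X1_def intmin_def)
      then have "b1 \<in> idl 0" by (simp add: minor_def e x idl_mult_iff idl_mult_iff' v_inverse)
      then show ?thesis using xz Ups_int by blast
    qed
    have w: "y \<in> idl (-2)" if "y \<in> idl (-1)" for y using that idl_mono by force
    have "g \<in> X1 \<longleftrightarrow> (x, z, b1, b2) \<in> ?S"
    proof
      assume a: "g \<in> X1"
      then have "g \<in> Xb (-1) 0" by (simp add: X1_def)
      then show "(x, z, b1, b2) \<in> ?S" using x0 b1[OF a] xz unfolding g_def Xb_nm_iff[OF xz] by auto
    next
      assume a: "(x, z, b1, b2) \<in> ?S"
      then have b: "b1 = 0" "x = 0" "z \<in> idl (-1)" "b2 \<in> idl (-2)" by auto
      have gX: "g \<in> Xb (-1) 0" unfolding g_def Xb_nm_iff[OF xz] using b w by auto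
      have "intmin (-1) g"
      proof (rule one_column_intmin[of _ 4])
        show "g $ i $ 4 \<in> idl (-1)" for i using gX by (simp add: Xb_def intmat_def)
        have "\<forall>i j. j \<noteq> 4 \<longrightarrow> g $ i $ j \<in> idl 0"
          using b by (simp add: forall_4 g_def mult_entry sum_4 pi_pow_entry idl_mult_iff) (simp add: idl_def)
        then show "j \<noteq> 4 \<Longrightarrow> g $ i $ j \<in> idl 0" for i j by blast
      qed
      then show "g \<in> X1" using gX by (simp add: X1_def)
    qed
    then show "pi_pow (0, 0, 1) ** nm x z (b1 * th) (b2 * th) \<in> X1 \<longleftrightarrow> (x, z, b1, b2) \<in> ?S" by (simp add: g_def)
  qed (auto simp: params_def Ups_zero Xi_zero)
  also have "\<dots> = q ^ 4"
    by (simp add: card_cartesian_product card_small flip: power_add power_Suc power_Suc2)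
  finally show ?thesis .
qed

lemma cnt_X1_0m1: "cnt X1 (0, 0, -1) = q ^ 2"
proof -
  let ?S = "Xi_j 1 \<times> {0::'e} \<times> {0::'e} \<times> {0::'e}"
  have "cnt X1 (0, 0, -1) = card ?S"
  proof (rule cnt_eqI)
    fix x z b1 b2 assume xz: "x \<in> \<Xi>" "z \<in> \<Xi>" "b1 \<in> \<Upsilon>" "b2 \<in> \<Upsilon>"
    define g where "g = pi_pow (0, 0, -1) ** nm x z (b1 * th) (b2 * th)"
    have e: "g $ 2 $ 2 = inverse \<pi>" "g $ 1 $ 3 = b1 * th - x * \<gamma> z" "g $ 2 $ 3 = - (inverse \<pi> * \<gamma> z)"
      by (simp_all add: g_def mult_entry sum_4 pi_pow_entry power_int_minus)
    have z0: "z = 0 \<and> b2 = 0" if "g \<in> Xb (-1) 0" using that xz unfolding g_def Xb_nm_iff[OF xz] by (auto simp: Xi_int Ups_int)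
    have b1: "b1 = 0" if "g \<in> X1"
    proof -
      have x: "z = 0" using z0 that by (simp add: X1_def)
      have "minor g 1 2 3 2 \<in> idl (-1)" using that by (simp add: X1_def intmin_def)
      then have "b1 \<in> idl 0" by (simp add: minor_def e x idl_mult_iff idl_mult_iff' v_inverse)
      then show ?thesis using xz Ups_int by blast
    qed
    have w: "y \<in> idl (-2)" if "y \<in> idl (-1)" for y using that idl_mono by force
    have "g \<in> X1 \<longleftrightarrow> (x, z, b1, b2) \<in> ?S"
    proof
      assume a: "g \<in> X1"
      then have "g \<in> Xb (-1) 0" by (simp add: X1_def)
      then show "(x, z, b1, b2) \<in> ?S" using z0 b1[OF a] xz unfolding g_def Xb_nm_iff[OF xz] by auto
    next
      assume a: "(x, z, b1, b2) \<in> ?S"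
      then have b: "b1 = 0" "z = 0" "b2 = 0" "x \<in> idl (-1)" by auto
      have gX: "g \<in> Xb (-1) 0" unfolding g_def Xb_nm_iff[OF xz] using b w by auto
      have "intmin (-1) g"
      proof (rule one_column_intmin[of _ 2])
        show "g $ i $ 2 \<in> idl (-1)" for i using gX by (simp add: Xb_def intmat_def)
        have "\<forall>i j. j \<noteq> 2 \<longrightarrow> g $ i $ j \<in> idl 0"
          using b by (simp add: forall_4 g_def mult_entry sum_4 pi_pow_entry idl_mult_iff) (simp add: idl_def)
        then show "j \<noteq> 2 \<Longrightarrow> g $ i $ j \<in> idl 0" for i j by blast
      qed
      then show "g \<in> X1" using gX by (simp add: X1_def)
    qed
    then show "pi_pow (0, 0, -1) ** nm x z (b1 * th) (b2 * th) \<in> X1 \<longleftrightarrow> (x, z, b1, b2) \<in> ?S" by (simp add: g_def)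
  qed (auto simp: params_def Ups_zero Xi_zero)
  also have "\<dots> = q ^ 2"
    by (simp add: card_cartesian_product card_small flip: power_add power_Suc power_Suc2)
  finally show ?thesis .
qed

text \<open>One minor is the norm of \<open>x\<close>, which forces \<open>x = 0\<close>; then a
  single condition is left, on the upper right block. For \<open>b1 = 0\<close> it gives
  \<open>z = 0\<close> with \<open>q\<close> free values of \<open>b2\<close>; for each nonzero
  \<open>b1\<close> and each of the \<open>q^2\<close> values of \<open>z\<close> it determines
  \<open>b2\<close>.\<close>

lemma cnt_X1_00: "real (cnt X1 (0, 0, 0)) = real q ^ 3 - real q ^ 2 + real q"
proof -
  define A where "A = {p \<in> {0::'e} \<times> Xi_j 1 \<times> (Ups_j 1 - {0}) \<times> Ups_j 1. case p of (x, z, b1, b2) \<Rightarrow>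
     (b1 * th) * (b2 * th) + z * \<gamma> z \<in> idl (-1)}"
  define B where "B = {0::'e} \<times> {0::'e} \<times> {0::'e} \<times> Ups_j 1"
  have "cnt X1 (0, 0, 0) = card (A \<union> B)"
  proof (rule cnt_eqI)
    fix x z b1 b2 assume xz: "x \<in> \<Xi>" "z \<in> \<Xi>" "b1 \<in> \<Upsilon>" "b2 \<in> \<Upsilon>"
    define g where "g = pi_pow (0, 0, 0) ** nm x z (b1 * th) (b2 * th)"
    have ge: "g = nm x z (b1 * th) (b2 * th)" by (simp add: g_def pi_pow_0)
    have m: "minor g i i' j j' \<in> idl (-1)" if "g \<in> X1" for i i' j j' using that by (simp add: X1_def intmin_def)
    have x0: "x = 0" if "g \<in> X1"
    proof -
      have "x * \<gamma> x \<in> idl (-1)" using m[OF that, of 1 4 2 3] by (simp add: minor_def ge)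
      then have "x \<in> idl 0" by (simp add: norm_idl)
      then show ?thesis using xz Xi_int by blast
    qed
    have zn: "z * \<gamma> z \<in> idl (-1) \<longleftrightarrow> z = 0" using Xi_int[OF xz(2)] by (simp add: norm_idl)
    have AB: "(x, z, b1, b2) \<in> A \<union> B \<longleftrightarrow> x = 0 \<and> z \<in> idl (-1) \<and> b1 \<in> idl (-1) \<and> b2 \<in> idl (-1) \<and> (b1 * th) * (b2 * th) + z * \<gamma> z \<in> idl (-1)"
      using xz zn by (auto simp: A_def B_def)
    have "g \<in> X1 \<longleftrightarrow> (x, z, b1, b2) \<in> A \<union> B"
    proof
      assume a: "g \<in> X1"
      then have gX: "g \<in> Xb (-1) 0" by (simp add: X1_def)
      have "(b1 * th) * (b2 * th) + z * \<gamma> z \<in> idl (-1)" using m[OF a, of 1 2 3 4] x0[OF a] by (simp add: minor_def ge)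
      then show "(x, z, b1, b2) \<in> A \<union> B" using x0[OF a] gX xz unfolding AB g_def Xb_nm_iff[OF xz] by (auto simp: idl_mult_iff')
    next
      assume a: "(x, z, b1, b2) \<in> A \<union> B"
      then have b: "x = 0" "z \<in> idl (-1)" "b1 \<in> idl (-1)" "b2 \<in> idl (-1)" "(b1 * th) * (b2 * th) + z * \<gamma> z \<in> idl (-1)"
        unfolding AB by auto
      have gX: "g \<in> Xb (-1) 0" unfolding g_def Xb_nm_iff[OF xz] using b by (auto simp: idl_mult_iff')
      have w: "intmat (-1) g" using gX by (simp add: Xb_def)
      have row: "g $ 3 $ j \<in> idl 0" "g $ 4 $ j \<in> idl 0" for j using exhaust_4[of j] b by (auto simp: ge)
      have col: "g $ i $ 1 \<in> idl 0" "g $ i $ 2 \<in> idl 0" for i using exhaust_4[of i] b by (auto simp: ge)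
      have "minor g i i' j j' \<in> idl (-1)" for i i' j j'
      proof -
        have r: "minor g i i' j j' \<in> idl (-1)" if "\<And>k. g $ i $ k \<in> idl 0" for i i'
          unfolding minor_def using that w by (intro idl_diff idl_mult0) (auto simp: intmat_def)
        have r': "minor g i i' j j' \<in> idl (-1)" if "\<And>k. g $ i' $ k \<in> idl 0" for i i'
          unfolding minor_def using that w by (intro idl_diff idl_mult0') (auto simp: intmat_def)
        have c: "minor g i i' j j' \<in> idl (-1)" if "\<And>k. g $ k $ j \<in> idl 0" for j j'
          unfolding minor_def using that w idl_mult0 idl_mult0' by (intro idl_diff) (auto simp: intmat_def)
        have c': "minor g i i' j j' \<in> idl (-1)" if "\<And>k. g $ k $ j' \<in> idl 0" for j j'
          unfolding minor_def using that w idl_mult0 idl_mult0' by (intro idl_diff) (auto simp: intmat_def)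
        have s: "minor g i i j j' = 0" "minor g i i' j j = 0" for i i' j j' by (simp_all add: minor_def mult.commute)
        have four: "minor g 1 2 3 4 \<in> idl (-1)" "minor g 1 2 4 3 \<in> idl (-1)" "minor g 2 1 3 4 \<in> idl (-1)" "minor g 2 1 4 3 \<in> idl (-1)"
        proof -
          have *: "minor g 1 2 3 4 = (b1 * th) * (b2 * th) + z * \<gamma> z" using b by (simp add: minor_def ge)
          have m: "minor g 1 2 3 4 \<in> idl (-1)" unfolding * by (rule b(5))
          have "minor g 1 2 4 3 = - minor g 1 2 3 4" "minor g 2 1 3 4 = - minor g 1 2 3 4" "minor g 2 1 4 3 = minor g 1 2 3 4"
            by (simp_all add: minor_def algebra_simps)
          then show "minor g 1 2 3 4 \<in> idl (-1)" "minor g 1 2 4 3 \<in> idl (-1)" "minor g 2 1 3 4 \<in> idl (-1)" "minor g 2 1 4 3 \<in> idl (-1)"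
            using m by (simp_all only: idl_minus_iff)
        qed
        consider "i = 3 \<or> i = 4" | "i' = 3 \<or> i' = 4" | "j = 1 \<or> j = 2" | "j' = 1 \<or> j' = 2" | "i = i'" | "j = j'"
          | "(i, i', j, j') \<in> {(1,2,3,4), (1,2,4,3), (2,1,3,4), (2,1,4,3)}"
          using exhaust_4[of i] exhaust_4[of i'] exhaust_4[of j] exhaust_4[of j'] by auto
        then show ?thesis
          by cases (use r r' c c' s four row col in auto)
      qed
      then show "g \<in> X1" using gX by (simp add: X1_def intmin_def)
    qed
    then show "pi_pow (0, 0, 0) ** nm x z (b1 * th) (b2 * th) \<in> X1 \<longleftrightarrow> (x, z, b1, b2) \<in> A \<union> B" by (simp add: g_def)
  qed (auto simp: params_def A_def B_def Ups_zero Xi_zero)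
  moreover have "card (A \<union> B) = card A + card B"
  proof (rule card_Un_disjoint)
    have "A \<subseteq> {0::'e} \<times> Xi_j 1 \<times> (Ups_j 1 - {0}) \<times> Ups_j 1" by (auto simp: A_def)
    moreover have "finite ({0::'e} \<times> Xi_j 1 \<times> (Ups_j 1 - {0}) \<times> Ups_j 1)"
      using card_small by (intro finite_cartesian_product) auto
    ultimately show "finite A" by (rule finite_subset)
    show "finite B" unfolding B_def using card_small by (intro finite_cartesian_product) auto
    show "A \<inter> B = {}" by (auto simp: A_def B_def)
  qed
  moreover have "card B = q" by (simp add: B_def card_cartesian_product card_small)
  moreover have "card A = q ^ 2 * (q - 1)"
  proof -
    \<comment> \<open>The solution of the congruence for \<open>b2\<close>. It lies in
      \<open>F\<close>, since norms and \<open>th * th\<close> do, so \<open>\<rho>\<close> rounds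
      it to a representative.\<close>
    define c where "c = (\<lambda>z b1. - (z * \<gamma> z) / (b1 * (th * th)))"
    have thth: "th * th \<in> F" by (simp add: gamma_in_F_iff gamma_mult)
    have cF: "c z b1 \<in> F" if "b1 \<in> \<Upsilon>" for z b1 
      unfolding c_def by (rule F_divide[OF F_minus[OF norm_in_F] F_mult[OF Ups_F[OF that] thth]])
    define f where "f = (\<lambda>(z, b1). (0::'e, z, b1, \<rho> (c z b1)))"
    have iff: "(b1 * th) * (b2 * th) + z * \<gamma> z \<in> idl (-1) \<longleftrightarrow> b2 - c z b1 \<in> idl 0" if "b1 \<in> Ups_j 1 - {0}" for z b1 b2
    proof -
      have b1: "b1 \<noteq> 0" "v b1 = -1" using that Ups_int[of b1] by (auto simp: idl_def)
      have "(b1 * th) * (b2 * th) + z * \<gamma> z = (b1 * (th * th)) * (b2 - c z b1)"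
        using b1 by (simp add: c_def field_simps)
      then show ?thesis using b1 by (simp add: idl_mult_iff v_mult)
    qed
    have "f ` (Xi_j 1 \<times> (Ups_j 1 - {0})) = A"
    proof (intro equalityI subsetI)
      fix p assume "p \<in> f ` (Xi_j 1 \<times> (Ups_j 1 - {0}))"
      then obtain z b1 where zb: "z \<in> Xi_j 1" "b1 \<in> Ups_j 1 - {0}" "p = f (z, b1)" by auto
      have r: "\<rho> (c z b1) \<in> \<Upsilon>" "\<rho> (c z b1) - c z b1 \<in> idl 0" using rho cF zb by (auto simp: \<Upsilon>_def)
      have b1: "b1 \<noteq> 0" "v b1 = -1" using zb Ups_int[of b1] by (auto simp: idl_def)
      have "z * \<gamma> z \<in> idl (-2)" using zb idl_mult[of z "-1" "\<gamma> z" "-1"] by simp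
      then have "c z b1 \<in> idl (-1)" unfolding c_def using b1 by (simp add: idl_divide_iff v_mult)
      then have "\<rho> (c z b1) \<in> idl (-1)" by (rule idl_near[OF r(2)]) simp
      then show "p \<in> A" using zb r iff[OF zb(2)] by (simp add: A_def f_def)
    next
      fix p assume "p \<in> A"
      then obtain z b1 b2 where p: "p = (0, z, b1, b2)" "z \<in> Xi_j 1" "b1 \<in> Ups_j 1 - {0}" "b2 \<in> Ups_j 1"
        "(b1 * th) * (b2 * th) + z * \<gamma> z \<in> idl (-1)" by (auto simp: A_def)
      have "b2 - c z b1 \<in> idl 0" using iff[OF p(3)] p(5) by simp
      then have "\<rho> (c z b1) = b2" using rho_eq[of b2 "c z b1"] Ups_rho[of b2] p by simp
      then have "p = f (z, b1)" by (simp add: f_def p(1))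
      then show "p \<in> f ` (Xi_j 1 \<times> (Ups_j 1 - {0}))" using p by blast
    qed
    moreover have "inj_on f (Xi_j 1 \<times> (Ups_j 1 - {0}))" by (auto simp: f_def inj_on_def)
    ultimately have "card A = card (Xi_j 1 \<times> (Ups_j 1 - {0}))" using card_image by blast
    also have "\<dots> = q ^ 2 * (q - 1)"
      using card_small Ups_zero by (simp add: card_cartesian_product card_Diff_singleton)
    finally show ?thesis .
  qed
  ultimately have c: "cnt X1 (0, 0, 0) = q ^ 2 * (q - 1) + q" by simp
  have "real (q - 1) = real q - 1" using q_pos by (simp add: of_nat_diff)
  then have "real (cnt X1 (0, 0, 0)) = real q ^ 2 * (real q - 1) + real q" unfolding c by simp
  then show ?thesis by (simp add: right_diff_distrib power2_eq_square power3_eq_cube)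
qed

end

section \<open>Double cosets, the table of Satake transforms, and injectivity\<close>

context odd_unramified_extension
begin

definition dc :: "'e^4^4 \<Rightarrow> ('e^4^4) set" where "dc \<sigma> = {k ** \<sigma> ** k' | k k'. k \<in> K \<and> k' \<in> K}"

lemma double_coset_eq: "double_coset \<sigma> = dc \<sigma>"
  by (auto simp: double_coset_def set_mult_def l_coset_def dc_def matrix_mul_assoc)

lemma dcE: "x \<in> dc \<sigma> \<Longrightarrow> (\<And>k k'. k \<in> K \<Longrightarrow> k' \<in> K \<Longrightarrow> x = k ** \<sigma> ** k' \<Longrightarrow> P) \<Longrightarrow> P"
  by (auto simp: dc_def)

lemma dc_self: "\<sigma> \<in> dc \<sigma>"
proof -
  have "\<sigma> = mat 1 ** \<sigma> ** mat 1" by simp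
  then show ?thesis unfolding dc_def using K_one by blast
qed

lemma dc_eq:
  assumes "x \<in> dc \<sigma>" shows "dc x = dc \<sigma>"
proof -
  obtain k k' where k: "k \<in> K" "k' \<in> K" "x = k ** \<sigma> ** k'" using assms by (rule dcE)
  have x: "a ** x ** b = (a ** k) ** \<sigma> ** (k' ** b)" for a b by (simp add: k matrix_mul_assoc)
  have s: "a ** \<sigma> ** b = (a ** matrix_inv k) ** x ** (matrix_inv k' ** b)" for a b
  proof -
    have "(a ** matrix_inv k) ** x ** (matrix_inv k' ** b) = a ** (matrix_inv k ** k) ** \<sigma> ** (k' ** matrix_inv k') ** b"
      by (simp add: k matrix_mul_assoc)
    then show ?thesis using K_inv[OF k(1)] K_inv[OF k(2)] by simp
  qed
  have "dc x \<subseteq> dc \<sigma>"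
  proof
    fix y assume "y \<in> dc x"
    then obtain a b where "a \<in> K" "b \<in> K" "y = a ** x ** b" by (rule dcE)
    then show "y \<in> dc \<sigma>" unfolding dc_def x using K_mult k by blast
  qed
  moreover have "dc \<sigma> \<subseteq> dc x"
  proof
    fix y assume "y \<in> dc \<sigma>"
    then obtain a b where ab: "a \<in> K" "b \<in> K" "y = a ** \<sigma> ** b" by (rule dcE)
    have "a ** matrix_inv k \<in> K" "matrix_inv k' ** b \<in> K" using K_mult K_inv k ab by blast+
    then show "y \<in> dc x" unfolding dc_def ab(3) s by blast
  qed
  ultimately show ?thesis by blast
qed

lemma dc_G: "\<sigma> \<in> carrier G \<Longrightarrow> dc \<sigma> \<subseteq> carrier G"
  using K_G G_mult by (auto simp: dc_def)

lemma dc_lc: "g \<in> dc \<sigma> \<Longrightarrow> lc g \<subseteq> dc \<sigma>"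
proof
  fix x assume "g \<in> dc \<sigma>" "x \<in> lc g"
  then obtain k where k: "k \<in> K" "x = g ** k" by (auto simp: lc_def)
  then have "x = mat 1 ** g ** k" by simp
  then have "x \<in> dc g" unfolding dc_def using k K_one by blast
  then show "x \<in> dc \<sigma>" using dc_eq[OF \<open>g \<in> dc \<sigma>\<close>] by simp
qed

lemma dc_inv:
  assumes "x \<in> dc \<sigma>" "\<sigma> \<in> carrier G"
  shows "intmat n x \<longleftrightarrow> intmat n \<sigma>" "intmin n x \<longleftrightarrow> intmin n \<sigma>" "v (sim J4 x) = v (sim J4 \<sigma>)"
proof -
  obtain k k' where k: "k \<in> K" "k' \<in> K" "x = k ** \<sigma> ** k'" using assms(1) by (rule dcE)
  have kG: "k \<in> GLO" "k' \<in> GLO" using k K_GLO by auto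
  show "intmat n x \<longleftrightarrow> intmat n \<sigma>" unfolding k(3) by (simp add: intmat_GLO_left kG intmat_GLO_right)
  show "intmin n x \<longleftrightarrow> intmin n \<sigma>" unfolding k(3) by (simp add: intmin_GLO_left kG intmin_GLO_right)
  have "sim J4 x = sim J4 k * sim J4 \<sigma> * sim J4 k'"
    using k assms(2) K_G G_mult by (simp add: sim_mult)
  then show "v (sim J4 x) = v (sim J4 \<sigma>)"
    using k K_sim K_G sim_nonzero[OF herm_J4] assms(2) by (simp add: v_mult)
qed

definition sc :: "int \<Rightarrow> 'e^4^4" where "sc k = mat (\<pi> powi k)"

lemma sc_G: "sc k \<in> carrier G" and sim_sc: "sim J4 (sc k) = \<pi> powi (2 * k)"
proof -
  have "mat (\<pi> powi k) \<in> carrier G \<and> sim J4 (mat (\<pi> powi k)) = \<pi> powi k * \<pi> powi k"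
    by (rule GU_mat[OF herm_J4]) (simp_all add: F_powi)
  moreover have "\<pi> powi (2 * k) = \<pi> powi k * \<pi> powi k"
    by (subst mult_2) (rule power_int_add, simp)
  ultimately show "sc k \<in> carrier G" "sim J4 (sc k) = \<pi> powi (2 * k)"
    by (simp_all add: sc_def)
qed

lemma sc_mult: "sc a ** sc b = sc (a + b)"
  by (simp add: sc_def mat_mult_mat power_int_add)

lemma sc_0: "sc 0 = mat 1"
  by (simp add: sc_def)

lemma sc_central: "A ** sc k = sc k ** A"
  by (simp add: sc_def mat_central)

lemma sc_cancel: "sc k ** (sc (-k) ** A) = A" "sc (-k) ** (sc k ** A) = A"
  by (simp_all add: matrix_mul_assoc sc_mult sc_0)

lemma sc_pi_pow: "sc k ** pi_pow (a0, a1, a2) = pi_pow (2 * k + a0, k + a1, k + a2)"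
  unfolding sc_def pi_pow_scalar[symmetric] by (rule pi_pow_mult)

definition wt :: "nat \<Rightarrow> lattice3" where
  "wt j = (if j = 0 then (0, 0, 0) else if j = 1 then (0, -1, 0) else (0, -1, -1))"

text \<open>The central factor \<open>\<pi>^k\<close> records the degree: the coefficient of
  \<open>X^k\<close> in the Hecke polynomial will be supported on \<open>BB k 0\<close>,
  \<open>BB k 1\<close> and \<open>BB k 2\<close>. As \<open>wt\<close> is constant from 2 on,
  statements are restricted to \<open>j \<le> 2\<close>.\<close>

definition BB :: "int \<Rightarrow> nat \<Rightarrow> ('e^4^4) set" where "BB k j = dc (sc k ** pi_pow (wt j))"

lemma pi_pow_G': "pi_pow l \<in> carrier G"
  by (cases l) (simp add: pi_pow_G)

lemma BB_rep_G: "sc k ** pi_pow (wt j) \<in> carrier G"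
  using G_mult sc_G pi_pow_G' by blast

lemma BB_G: "BB k j \<subseteq> carrier G"
  unfolding BB_def by (rule dc_G[OF BB_rep_G])

lemma BB_shift: "x \<in> BB k j \<longleftrightarrow> sc (- k) ** x \<in> BB 0 j"
proof -
  have e: "sc a ** (l ** y ** l') = l ** (sc a ** y) ** l'" for a l l' and y :: "'e^4^4"
    by (simp add: matrix_mul_assoc sc_central)
  have "sc a ** x \<in> dc (sc a ** y)" if "x \<in> dc y" for a x y
    using that unfolding dc_def by clarsimp (metis e)
  from this[of x _ "-k"] this[of "sc (-k) ** x" _ k] show ?thesis
    unfolding BB_def by (metis sc_cancel sc_0 mat_one_mult(1))
qed

lemma pi_pow_int_facts:
  "intmat 0 (pi_pow (0,0,0))" "\<not> intmat 0 (pi_pow (0,-1,0))" "intmat (-1) (pi_pow (0,-1,0))" "intmin (-1) (pi_pow (0,-1,0))"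
  "intmat (-1) (pi_pow (0,-1,-1))" "\<not> intmin (-1) (pi_pow (0,-1,-1))"
proof -
  show "intmat 0 (pi_pow (0,0,0))" by (simp add: pi_pow_0)
  show "\<not> intmat 0 (pi_pow (0,-1,0))" "intmat (-1) (pi_pow (0,-1,0))" "intmat (-1) (pi_pow (0,-1,-1))"
    by (simp_all add: intmat_def forall_4 pi_pow_entry power_int_minus) (simp_all add: idl_def v_inverse)
  show "intmin (-1) (pi_pow (0,-1,0))"
  proof (rule one_column_intmin[of _ 1])
    show "pi_pow (0,-1,0) $ i $ 1 \<in> idl (-1)" for i
      using exhaust_4[of i] by (auto simp: pi_pow_entry power_int_minus) (simp_all add: idl_def v_inverse)
    show "pi_pow (0,-1,0) $ i $ j \<in> idl 0" if "j \<noteq> 1" for i j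
      using exhaust_4[of i] exhaust_4[of j] that by (auto simp: pi_pow_entry power_int_minus) (simp_all add: idl_def v_inverse)
  qed
  have "minor (pi_pow (0,-1,-1)) 1 2 1 2 \<notin> idl (-1)"
    by (simp add: minor_def pi_pow_entry power_int_minus) (simp add: idl_def v_inverse v_mult)
  then show "\<not> intmin (-1) (pi_pow (0,-1,-1))" by (auto simp: intmin_def)
qed

text \<open>The Cartan exponents of an element of \<open>Xb (-1) 0\<close> satisfy
  \<open>a0 = 0\<close> and \<open>-1 \<le> a1 \<le> a2 \<le> 0\<close>, which leaves the three
  weights \<open>wt\<close>. Integrality of entries and of minors is constant on double cosets and
  tells these apart.\<close>

lemma BB_iff:
  "x \<in> BB 0 0 \<longleftrightarrow> x \<in> Xb 0 0"
  "x \<in> BB 0 1 \<longleftrightarrow> x \<in> X1 \<and> x \<notin> Xb 0 0"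
  "x \<in> BB 0 2 \<longleftrightarrow> x \<in> Xb (-1) 0 \<and> x \<notin> X1"
proof -
  have w: "BB 0 0 = dc (pi_pow (0,0,0))" "BB 0 1 = dc (pi_pow (0,-1,0))" "BB 0 2 = dc (pi_pow (0,-1,-1))"
    by (simp_all add: BB_def wt_def sc_0)
  have s: "v (sim J4 (pi_pow (0,a,b))) = 0" for a b by (simp add: sim_pi_pow)
  have im: "intmat (-1) A" if "intmat 0 A" for A :: "'e^4^4" using that intmat_mono by force
  have fw: "x \<in> BB 0 0 \<Longrightarrow> x \<in> Xb 0 0" "x \<in> BB 0 1 \<Longrightarrow> x \<in> X1 \<and> x \<notin> Xb 0 0" "x \<in> BB 0 2 \<Longrightarrow> x \<in> Xb (-1) 0 \<and> x \<notin> X1"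
    using dc_inv[OF _ pi_pow_G, of x 0 0 0] dc_inv[OF _ pi_pow_G, of x 0 "-1" 0] dc_inv[OF _ pi_pow_G, of x 0 "-1" "-1"]
      pi_pow_int_facts s BB_G[of 0 0] BB_G[of 0 1] BB_G[of 0 2] unfolding w Xb_def X1_def by auto
  have "x \<in> BB 0 0 \<or> x \<in> BB 0 1 \<or> x \<in> BB 0 2" if x: "x \<in> Xb (-1) 0"
  proof -
    have xG: "x \<in> carrier G" "intmat (-1) x" "v (sim J4 x) = 0" using x by (auto simp: Xb_def)
    obtain k k' a0 a1 a2 where k: "k \<in> K" "k' \<in> K" "x = k ** pi_pow (a0, a1, a2) ** k'" "a1 \<le> a2" "2 * a2 \<le> a0"
      using cartan_decomposition[OF xG(1)] by metis
    have xd: "x \<in> dc (pi_pow (a0, a1, a2))" unfolding dc_def using k by blast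
    have a0: "a0 = 0" using dc_inv(3)[OF xd pi_pow_G] xG by (simp add: sim_pi_pow)
    have "intmat (-1) (pi_pow (a0, a1, a2))" using dc_inv(1)[OF xd pi_pow_G] xG by blast
    then have "\<pi> powi a1 \<in> idl (-1)" using intmatD[of "-1" "pi_pow (a0, a1, a2)" 1 1] by (simp add: pi_pow_entry)
    then have "-1 \<le> a1" by (simp add: idl_def)
    then have "(a1, a2) = (0, 0) \<or> (a1, a2) = (-1, 0) \<or> (a1, a2) = (-1, -1)" using k a0 by auto
    then show ?thesis using xd a0 unfolding w by auto
  qed
  moreover have "Xb 0 0 \<subseteq> X1" using fw(1) K_eq im
  proof -
    have "x \<in> X1" if x: "x \<in> Xb 0 0" for x
    proof -
      have "intmat 0 x" using x by (simp add: Xb_def)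
      then have "intmin (-1) x" 
        by (intro one_column_intmin[of _ 1]) (auto simp: intmat_def intro: idl_mono[of _ 0 "-1"])
      then show ?thesis using x im by (simp add: X1_def Xb_def)
    qed
    then show ?thesis by blast
  qed
  moreover have "X1 \<subseteq> Xb (-1) 0" by (auto simp: X1_def)
  ultimately show "x \<in> BB 0 0 \<longleftrightarrow> x \<in> Xb 0 0" "x \<in> BB 0 1 \<longleftrightarrow> x \<in> X1 \<and> x \<notin> Xb 0 0"
    "x \<in> BB 0 2 \<longleftrightarrow> x \<in> Xb (-1) 0 \<and> x \<notin> X1"
    using fw by blast+
qed

lemma X_chain: "Xb 0 0 \<subseteq> X1" "X1 \<subseteq> Xb (-1) 0"
proof -
  show "X1 \<subseteq> Xb (-1) 0" by (auto simp: X1_def)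
  show "Xb 0 0 \<subseteq> X1"
  proof
    fix x assume x: "x \<in> Xb 0 0"
    then have i: "intmat 0 x" by (simp add: Xb_def)
    then have "intmin (-1) x" 
      by (intro one_column_intmin[of _ 1]) (auto simp: intmat_def intro: idl_mono[of _ 0 "-1"])
    moreover have "intmat (-1) x" using i intmat_mono[of 0 x "-1"] by simp
    ultimately show "x \<in> X1" using x by (simp add: X1_def Xb_def)
  qed
qed

lemma BB_disjoint: "x \<in> BB k i \<Longrightarrow> x \<in> BB k j \<Longrightarrow> i \<le> 2 \<Longrightarrow> j \<le> 2 \<Longrightarrow> i = j"
  using BB_iff X_chain unfolding BB_shift[of x k] by (auto simp: numeral_2_eq_2 le_Suc_eq) 

lemma inj_params: "inj_on (\<lambda>p. lc (pi_pow l ** nmp p)) params"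
proof (rule inj_onI)
  fix p p' assume p: "p \<in> params" "p' \<in> params" "lc (pi_pow l ** nmp p) = lc (pi_pow l ** nmp p')"
  then have "pi_pow l ** nmp p' \<in> lc (pi_pow l ** nmp p)" using lc_self by metis
  then obtain k where k: "k \<in> K" "pi_pow l ** nmp p' = pi_pow l ** nmp p ** k" by (auto simp: lc_def)
  then have "matrix_inv (pi_pow l) ** (pi_pow l ** nmp p') = matrix_inv (pi_pow l) ** (pi_pow l ** (nmp p ** k))"
    by (simp add: matrix_mul_assoc)
  then have "nmp p' = nmp p ** k" using is_sim_inv(3)[OF herm_J4 pi_pow_sim] by (simp add: matrix_mul_assoc)
  then show "p = p'" using nmp_inj p k by blast
qed

lemma params_finite: "finite {p \<in> params. pi_pow l ** nmp p \<in> Xb m j}"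
proof (rule finite_imageD)
  show "finite ((\<lambda>p. lc (pi_pow l ** nmp p)) ` {p \<in> params. pi_pow l ** nmp p \<in> Xb m j})"
    by (rule finite_subset[OF _ finite_Xb[of m j]]) auto
  show "inj_on (\<lambda>p. lc (pi_pow l ** nmp p)) {p \<in> params. pi_pow l ** nmp p \<in> Xb m j}"
    by (rule inj_on_subset[OF inj_params]) auto
qed

lemma cnt_Diff:
  assumes "Y \<subseteq> X" "X \<subseteq> Xb m j"
  shows "real (cnt (X - Y) l) = real (cnt X l) - real (cnt Y l)"
proof -
  let ?P = "\<lambda>X. {p \<in> params. pi_pow l ** nmp p \<in> X}"
  have "?P X \<subseteq> ?P (Xb m j)" using assms by auto
  then have fin: "finite (?P X)" using params_finite finite_subset by blast
  have sub: "?P Y \<subseteq> ?P X" using assms by auto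
  have "?P (X - Y) = ?P X - ?P Y" by auto
  then have "cnt (X - Y) l = cnt X l - cnt Y l" unfolding cnt_def using card_Diff_subset[OF finite_subset[OF sub fin] sub] by simp
  moreover have "cnt Y l \<le> cnt X l" unfolding cnt_def using card_mono[OF fin sub] .
  ultimately show ?thesis by simp
qed

lemma cnt_BB:
  "real (cnt (BB 0 0) l) = real (cnt K l)"
  "real (cnt (BB 0 1) l) = real (cnt X1 l) - real (cnt K l)"
  "real (cnt (BB 0 2) l) = real (cnt (Xb (-1) 0) l) - real (cnt X1 l)"
proof -
  have K: "K = Xb 0 0" by (auto simp: K_eq KK_def Xb_def)
  have e: "BB 0 0 = K" "BB 0 1 = X1 - K" "BB 0 2 = Xb (-1) 0 - X1" using BB_iff K by auto
  show "real (cnt (BB 0 0) l) = real (cnt K l)" by (simp add: e)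
  show "real (cnt (BB 0 1) l) = real (cnt X1 l) - real (cnt K l)"
    unfolding e using cnt_Diff[of K X1 "-1" 0 l] X_chain K by simp
  show "real (cnt (BB 0 2) l) = real (cnt (Xb (-1) 0) l) - real (cnt X1 l)"
    unfolding e using cnt_Diff[of X1 "Xb (-1) 0" "-1" 0 l] X_chain by simp
qed

lemma cnt_BB_shift: "cnt (BB k j) (a0, a1, a2) = cnt (BB 0 j) (a0 - 2 * k, a1 - k, a2 - k)"
proof -
  have "pi_pow (a0, a1, a2) ** A \<in> BB k j \<longleftrightarrow> pi_pow (a0 - 2 * k, a1 - k, a2 - k) ** A \<in> BB 0 j" for A
    unfolding BB_shift[of _ k] by (simp add: matrix_mul_assoc sc_pi_pow algebra_simps)
  then show ?thesis by (simp add: cnt_def)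
qed

text \<open>With \<open>e2w\<close> and the zero weight, these are the Weyl orbits that occur: the
  weights \<open>\<plusminus> \<phi>1\<close>, \<open>\<plusminus> \<phi>2\<close> here, their mixed
  sums in \<open>e2w\<close>.\<close>

definition e1w :: "lattice3 \<Rightarrow> bool" where "e1w l \<longleftrightarrow> l \<in> {(0,1,0), (0,-1,0), (0,0,1), (0,0,-1)}"
definition e2w :: "lattice3 \<Rightarrow> bool" where "e2w l \<longleftrightarrow> l \<in> {(0,1,1), (0,1,-1), (0,-1,1), (0,-1,-1)}"

text \<open>The modulus factor makes the raw counts constant on Weyl orbits: for instance
  \<open>q^7\<close>, \<open>q^5\<close>, \<open>q^3\<close>, \<open>q\<close>, the counts in
  \<open>Xb (-1) 0\<close> at the four weights of \<open>e1w\<close>, all become \<open>q^4\<close>.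
  Subtracting the value for the smaller set of the chain gives the entry.\<close>

definition tab :: "nat \<Rightarrow> lattice3 \<Rightarrow> real" where
  "tab j l = (if j = 0 then (if l = (0,0,0) then 1 else 0)
     else if j = 1 then (if e1w l then real q ^ 3 else if l = (0,0,0) then (real q - 1) * (real q ^ 2 + 1) else 0)
     else (if e2w l then real q ^ 4 else if e1w l then real q ^ 4 - real q ^ 3
        else if l = (0,0,0) then 2 * real q ^ 4 - real q ^ 3 - real q else 0))"

lemma weight_cases:
  fixes a0 a1 a2 :: int
  obtains "a0 \<noteq> 0 \<or> 1 < \<bar>a1\<bar> \<or> 1 < \<bar>a2\<bar>" | "a0 = 0" "a1 \<in> {-1,0,1}" "a2 \<in> {-1,0,1}"
proof (cases "a0 \<noteq> 0 \<or> 1 < \<bar>a1\<bar> \<or> 1 < \<bar>a2\<bar>")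
  case False
  then have "a0 = 0" "a1 = -1 \<or> a1 = 0 \<or> a1 = 1" "a2 = -1 \<or> a2 = 0 \<or> a2 = 1" by presburger+
  then show ?thesis by (intro that(2)) auto
qed (rule that(1))

lemma cnt_X1_all:
  "cnt X1 (0, 1, 0) = q ^ 6" "cnt X1 (0, -1, 0) = 1" "cnt X1 (0, 0, 1) = q ^ 4" "cnt X1 (0, 0, -1) = q ^ 2"
  "cnt X1 (0, 1, 1) = 0" "cnt X1 (0, 1, -1) = 0" "cnt X1 (0, -1, 1) = 0" "cnt X1 (0, -1, -1) = 0"
  by (simp_all add: cnt_X1_10 cnt_X1_m10 cnt_X1_01 cnt_X1_0m1 cnt_X1_out)

lemma cnt_X2_all:
  "cnt (Xb (-1) 0) (0, 1, 1) = q ^ 8" "cnt (Xb (-1) 0) (0, 1, 0) = q ^ 7" "cnt (Xb (-1) 0) (0, 1, -1) = q ^ 6"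
  "cnt (Xb (-1) 0) (0, 0, 1) = q ^ 5" "cnt (Xb (-1) 0) (0, 0, -1) = q ^ 3"
  "cnt (Xb (-1) 0) (0, -1, 1) = q ^ 2" "cnt (Xb (-1) 0) (0, -1, 0) = q" "cnt (Xb (-1) 0) (0, -1, -1) = 1"
  using cnt_X2_x0[of 1 1] cnt_X2_10 cnt_X2_m1[of 1] cnt_X2_x0[of 0 1] cnt_X2_m1[of 0] cnt_X2_x0[of "-1" 1]
    cnt_X2_x0[of "-1" 0] cnt_X2_x0[of "-1" "-1"]
  by (simp_all flip: power_add power_Suc power_Suc2)

lemma satake_ch_BB0:
  assumes "j \<le> 2"
  shows "real q powi (- pair_delta l) * real (cnt (BB 0 j) l) = tab j l"
proof -
  obtain a0 a1 a2 where l: "l = (a0, a1, a2)" by (cases l)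
  have q: "real q > 0" using q_pos by simp
  have j: "j = 0 \<or> j = 1 \<or> j = 2" using assms by auto
  consider (out) "a0 \<noteq> 0 \<or> 1 < \<bar>a1\<bar> \<or> 1 < \<bar>a2\<bar>" | (ins) "a0 = 0" "a1 \<in> {-1,0,1}" "a2 \<in> {-1,0,1}"
    by (rule weight_cases)
  then show ?thesis
  proof cases
    case out
    then have "\<not> (a0 = 0 \<and> \<bar>a1\<bar> + \<bar>a2\<bar> \<le> 1)" by linarith
    with out have z: "cnt (Xb (-1) 0) l = 0" "cnt X1 l = 0" "cnt K l = 0"
      using cnt_X2_out[of a0 a1 a2] cnt_X1_out[of a0 a1 a2] cnt_K[of a0 a1 a2] by (auto simp: l)
    have t: "\<not> e1w l" "\<not> e2w l" "l \<noteq> (0,0,0)" using out by (auto simp: l e1w_def e2w_def)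
    show ?thesis using j z t cnt_BB[of l] by (auto simp: tab_def)
  next
    case ins
    have p: "real q powi (-4) = 1 / real q ^ 4" "real q powi (-3) = 1 / real q ^ 3" "real q powi (-2) = 1 / real q ^ 2"
      "real q powi (-1) = 1 / real q"
      by (simp_all add: power_int_minus inverse_eq_divide)
    have m: "real q * real q ^ 2 = real q ^ 3" "real q * real q ^ 3 = real q ^ 4" "real q * real q ^ 4 = real q ^ 5"
      by (simp_all add: power2_eq_square power3_eq_cube power4_eq_xxxx flip: power_Suc) (simp add: eval_nat_numeral)
    note [simp] = tab_def pair_delta_def e1w_def e2w_def cnt_X1_all cnt_X2_all cnt_K p cnt_X2_00 cnt_X1_00
    consider "l = (0,1,1)" | "l = (0,1,0)" | "l = (0,1,-1)" | "l = (0,0,1)" | "l = (0,0,0)" | "l = (0,0,-1)"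
      | "l = (0,-1,1)" | "l = (0,-1,0)" | "l = (0,-1,-1)"
      using ins l by auto
    then have "real q powi (- pair_delta l) * real (cnt (BB 0 0) l) = tab 0 l \<and>
      real q powi (- pair_delta l) * real (cnt (BB 0 1) l) = tab 1 l \<and>
      real q powi (- pair_delta l) * real (cnt (BB 0 2) l) = tab 2 l"
      unfolding cnt_BB using q by cases (simp_all add: field_simps m)
    then show ?thesis using j by auto
  qed
qed

lemma satake_ch_BB:
  assumes "j \<le> 2"
  shows "satake_ch (BB k j) (a0, a1, a2) = tab j (a0 - 2 * k, a1 - k, a2 - k)"
proof -
  have "satake_ch (BB k j) (a0, a1, a2) = real q powi (- pair_delta (a0, a1, a2)) * real (cnt (BB k j) (a0, a1, a2))"
    by (rule satake_ch_cnt[OF BB_G]) (auto simp: BB_def dest: dc_lc)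
  also have "\<dots> = real q powi (- pair_delta (a0 - 2 * k, a1 - k, a2 - k)) * real (cnt (BB 0 j) (a0 - 2 * k, a1 - k, a2 - k))"
    by (simp add: cnt_BB_shift[of k] pair_delta_def algebra_simps)
  finally show ?thesis using satake_ch_BB0[OF assms] by simp
qed

definition biinv :: "('e^4^4 \<Rightarrow> real) \<Rightarrow> bool" where
  "biinv f \<longleftrightarrow> (\<forall>g\<in>carrier G. \<forall>k\<in>K. \<forall>k'\<in>K. f (k ** g ** k') = f g)"

lemma biinv_dc: "biinv f \<Longrightarrow> g \<in> carrier G \<Longrightarrow> x \<in> dc g \<Longrightarrow> f x = f g"
  by (auto simp: biinv_def dc_def)

lemma biinv_some: "biinv f \<Longrightarrow> g \<in> carrier G \<Longrightarrow> f (SOME \<sigma>. \<sigma> \<in> dc g) = f g"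
  using biinv_dc someI[of "\<lambda>\<sigma>. \<sigma> \<in> dc g", OF dc_self] by blast

lemma satake_eq:
  assumes f: "biinv f" and S: "finite S" "S \<subseteq> dc ` carrier G"
    and sup: "\<And>g. g \<in> carrier G \<Longrightarrow> f g \<noteq> 0 \<Longrightarrow> dc g \<in> S"
  shows "satake f l = (\<Sum>B\<in>S. f (SOME \<sigma>. \<sigma> \<in> B) * satake_ch B l)"
proof -
  let ?T = "{double_coset \<sigma> |\<sigma>. \<sigma> \<in> carrier G \<and> f \<sigma> \<noteq> 0}"
  have "satake f l = (\<Sum>B\<in>?T. f (SOME \<sigma>. \<sigma> \<in> B) * satake_ch B l)" by (simp add: satake_def)
  also have "\<dots> = (\<Sum>B\<in>S. f (SOME \<sigma>. \<sigma> \<in> B) * satake_ch B l)"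
  proof (rule sum.mono_neutral_left[OF S(1)])
    show "?T \<subseteq> S" using sup by (auto simp: double_coset_eq)
    show "\<forall>B\<in>S - ?T. f (SOME \<sigma>. \<sigma> \<in> B) * satake_ch B l = 0"
    proof
      fix B assume B: "B \<in> S - ?T"
      then obtain g where g: "g \<in> carrier G" "B = dc g" using S by blast
      then have "f g = 0" using B by (auto simp: double_coset_eq)
      then show "f (SOME \<sigma>. \<sigma> \<in> B) * satake_ch B l = 0" using biinv_some[OF f g(1)] g by simp
    qed
  qed
  finally show ?thesis .
qed

lemma hecke_D:
  assumes "f \<in> hecke_algebra"
  shows "biinv f" "\<And>g. g \<notin> carrier G \<Longrightarrow> f g = 0" "finite (lc ` {g. f g \<noteq> 0})"
proof -
  show b: "biinv f" using assms by (simp add: hecke_algebra_def biinv_def)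
  have r: "f (g ** k) = f g" if "g \<in> carrier G" "k \<in> K" for g k
    using b that K_one unfolding biinv_def by (metis mat_one_mult(1))
  have "compactly_supported G_top f" using assms by (simp add: hecke_algebra_def)
  then show "\<And>g. g \<notin> carrier G \<Longrightarrow> f g = 0" "finite (lc ` {g. f g \<noteq> 0})"
    using rinv_support[OF r] by auto
qed

lemma dc_of_lc: "lc x = lc y \<Longrightarrow> dc x = dc y"
proof -
  assume "lc x = lc y"
  then have "x \<in> lc y" using lc_self by metis
  then show "dc x = dc y" using dc_lc[OF dc_self] dc_eq by blast
qed

lemma finite_dc: assumes "finite (lc ` S)" shows "finite (dc ` S)"
proof -
  have "dc ` S = (\<lambda>A. dc (SOME x. x \<in> S \<and> lc x = A)) ` (lc ` S)"
  proof -
    have "dc (SOME y. y \<in> S \<and> lc y = lc x) = dc x" if "x \<in> S" for x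
      using someI[of "\<lambda>y. y \<in> S \<and> lc y = lc x" x] that dc_of_lc by blast
    then show ?thesis by (auto simp: image_image)
  qed
  then show ?thesis using assms by simp
qed

lemma intmin_pi_pow:
  assumes "a1 \<le> a2" "2 * a2 \<le> a0"
  shows "intmin (a1 + a2) (pi_pow (a0, a1, a2))" "intmat a1 (pi_pow (a0, a1, a2))"
proof -
  define d where "d = (\<lambda>i::4. if i = 1 then a1 else if i = 2 then a2 else if i = 3 then a0 - a1 else a0 - a2)"
  have e: "pi_pow (a0, a1, a2) $ i $ j = (if i = j then \<pi> powi d i else 0)" for i j
    using exhaust_4[of i] by (auto simp: pi_pow_entry d_def)
  have dd: "a1 + a2 \<le> d i + d i'" if "i \<noteq> i'" for i i'
    using exhaust_4[of i] exhaust_4[of i'] that assms by (auto simp: d_def)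
  have *: "\<pi> powi d i * \<pi> powi d i' \<in> idl (a1 + a2)" if "i \<noteq> i'" for i i'
    using dd[OF that] by (simp flip: power_int_add) (simp add: idl_def)
  show "intmin (a1 + a2) (pi_pow (a0, a1, a2))"
    unfolding intmin_def minor_def
  proof (intro allI)
    fix i i' j j'
    show "pi_pow (a0, a1, a2) $ i $ j * pi_pow (a0, a1, a2) $ i' $ j' - pi_pow (a0, a1, a2) $ i $ j' * pi_pow (a0, a1, a2) $ i' $ j \<in> idl (a1 + a2)"
      using *[of i i'] by (cases "i = i'") (auto simp: e mult.commute)
  qed
  show "intmat a1 (pi_pow (a0, a1, a2))"
  proof -
    have "a1 \<le> d i" for i using exhaust_4[of i] assms by (auto simp: d_def)
    then show ?thesis by (simp add: intmat_def e idl_def)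
  qed
qed

text \<open>Triangularity. Among the Cartan exponents at which \<open>f\<close> and
  \<open>f'\<close> differ, one with least \<open>a1\<close> and then least \<open>a2\<close> is
  chosen; at this weight no other double coset on which they differ contributes. The description by
  \<open>THE\<close> in \<open>hecke_poly\<close> depends on this uniqueness.\<close>

theorem satake_inj:
  assumes f: "f \<in> hecke_algebra" "f' \<in> hecke_algebra" and eq: "satake f = satake f'"
  shows "f = f'"
proof (rule ccontr)
  assume ne: "f \<noteq> f'"
  note fD = hecke_D[OF f(1)] and fD' = hecke_D[OF f(2)]
  define S where "S = dc ` ({g. f g \<noteq> 0} \<union> {g. f' g \<noteq> 0})"
  have S: "finite S" "S \<subseteq> dc ` carrier G"
    unfolding S_def using finite_dc fD fD' by (auto simp: image_Un)
  have sf: "satake f l = (\<Sum>B\<in>S. f (SOME \<sigma>. \<sigma> \<in> B) * satake_ch B l)" for l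
    by (rule satake_eq[OF fD(1) S]) (auto simp: S_def)
  have sf': "satake f' l = (\<Sum>B\<in>S. f' (SOME \<sigma>. \<sigma> \<in> B) * satake_ch B l)" for l
    by (rule satake_eq[OF fD'(1) S]) (auto simp: S_def)
  define W where "W = {(a0, a1, a2). a1 \<le> a2 \<and> 2 * a2 \<le> a0 \<and> f (pi_pow (a0, a1, a2)) \<noteq> f' (pi_pow (a0, a1, a2))}"
  have cart: "\<exists>a0 a1 a2. a1 \<le> a2 \<and> 2 * a2 \<le> a0 \<and> dc g = dc (pi_pow (a0, a1, a2))" if gG: "g \<in> carrier G" for g
  proof -
    obtain k k' a0 a1 a2 where "k \<in> K" "k' \<in> K" "g = k ** pi_pow (a0, a1, a2) ** k'" "a1 \<le> a2" "2 * a2 \<le> a0"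
      using cartan_decomposition[OF gG] by metis
    moreover then have "g \<in> dc (pi_pow (a0, a1, a2))" unfolding dc_def by blast
    ultimately show ?thesis using dc_eq by blast
  qed
  obtain g where g: "f g \<noteq> f' g" using ne by auto
  then have gG: "g \<in> carrier G" using fD(2) fD'(2) by metis
  have Wne: "W \<noteq> {}"
  proof -
    obtain a0 a1 a2 where a: "a1 \<le> a2" "2 * a2 \<le> a0" "dc g = dc (pi_pow (a0, a1, a2))" using cart[OF gG] by blast
    then have "g \<in> dc (pi_pow (a0, a1, a2))" using dc_self by metis
    then have "f g = f (pi_pow (a0, a1, a2))" "f' g = f' (pi_pow (a0, a1, a2))"
      using biinv_dc[OF fD(1) pi_pow_G] biinv_dc[OF fD'(1) pi_pow_G] by blast+
    then show ?thesis using g a by (auto simp: W_def)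
  qed
  have inv: "intmat n (pi_pow l) \<longleftrightarrow> intmat n (pi_pow l')" "intmin n (pi_pow l) \<longleftrightarrow> intmin n (pi_pow l')"
    "v (sim J4 (pi_pow l)) = v (sim J4 (pi_pow l'))" if "dc (pi_pow l) = dc (pi_pow l')" for l l' n
    using dc_inv[of "pi_pow l" "pi_pow l'"] that dc_self pi_pow_G' by metis+
  have W_fin: "finite W"
  proof (rule finite_imageD)
    show "finite ((\<lambda>l. dc (pi_pow l)) ` W)"
    proof (rule finite_subset[OF _ S(1)], clarify)
      fix a0 a1 a2 assume "(a0, a1, a2) \<in> W"
      then have "f (pi_pow (a0, a1, a2)) \<noteq> 0 \<or> f' (pi_pow (a0, a1, a2)) \<noteq> 0" by (auto simp: W_def)
      then show "dc (pi_pow (a0, a1, a2)) \<in> S" by (auto simp: S_def)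
    qed
    show "inj_on (\<lambda>l. dc (pi_pow l)) W"
    proof (rule inj_onI)
      fix l l' assume ll: "l \<in> W" "l' \<in> W" "dc (pi_pow l) = dc (pi_pow l')"
      obtain a0 a1 a2 b0 b1 b2 where l: "l = (a0, a1, a2)" "l' = (b0, b1, b2)" by (cases l; cases l') blast
      note a = ll[unfolded l]
      have 0: "a0 = b0" using inv(3)[OF a(3)] by (simp add: sim_pi_pow)
      have le: "a1 \<le> b1 \<and> a1 + a2 \<le> b1 + b2" if "(a0, a1, a2) \<in> W" "dc (pi_pow (a0, a1, a2)) = dc (pi_pow (b0, b1, b2))" for a0 a1 a2 b0 b1 b2
      proof -
        have "intmat a1 (pi_pow (b0, b1, b2))" "intmin (a1 + a2) (pi_pow (b0, b1, b2))"
          using inv[OF that(2)] intmin_pi_pow[of a1 a2 a0] that by (auto simp: W_def)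
        then have "pi_pow (b0, b1, b2) $ 1 $ 1 \<in> idl a1" "minor (pi_pow (b0, b1, b2)) 1 2 1 2 \<in> idl (a1 + a2)"
          by (auto simp: intmat_def intmin_def)
        then show ?thesis by (simp add: minor_def pi_pow_entry flip: power_int_add) (simp add: idl_def)
      qed
      show "l = l'" unfolding l using 0 le[OF a(1,3)] le[OF a(2) a(3)[symmetric]] by auto
    qed
  qed
  define \<phi> where "\<phi> = (\<lambda>(a0::int, a1::int, a2::int). a1)"
  define \<psi> where "\<psi> = (\<lambda>(a0::int, a1::int, a2::int). a2)"
  obtain l0 where l0: "l0 \<in> W" using Wne by blast
  \<comment> \<open>The valuation of \<open>sim\<close> determines \<open>a0\<close>, so weights
    with another \<open>a0\<close> cannot interfere.\<close>
  define W1 where "W1 = {l \<in> W. fst l = fst l0}"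
  have W1: "finite W1" "l0 \<in> W1" using W_fin l0 by (auto simp: W1_def)
  define m1 where "m1 = Min (\<phi> ` W1)"
  have m1: "m1 \<in> \<phi> ` W1" "\<And>l. l \<in> W1 \<Longrightarrow> m1 \<le> \<phi> l" 
  proof -
    show "m1 \<in> \<phi> ` W1" unfolding m1_def by (rule Min_in) (use W1 in auto)
    show "m1 \<le> \<phi> l" if "l \<in> W1" for l unfolding m1_def by (rule Min_le) (use W1 that in auto)
  qed
  define W2 where "W2 = {l \<in> W1. \<phi> l = m1}"
  have W2: "finite W2" "W2 \<noteq> {}" using W1 m1 by (auto simp: W2_def)
  define m2 where "m2 = Min (\<psi> ` W2)"
  have m2: "m2 \<in> \<psi> ` W2" "\<And>l. l \<in> W2 \<Longrightarrow> m2 \<le> \<psi> l" 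
  proof -
    show "m2 \<in> \<psi> ` W2" unfolding m2_def by (rule Min_in) (use W2 in auto)
    show "m2 \<le> \<psi> l" if "l \<in> W2" for l unfolding m2_def by (rule Min_le) (use W2 that in auto)
  qed
  obtain \<mu> where mu: "\<mu> \<in> W2" "\<psi> \<mu> = m2" using m2 by blast
  obtain c0 where mue: "\<mu> = (c0, m1, m2)" using mu by (cases \<mu>) (auto simp: W2_def \<phi>_def \<psi>_def)
  have muW: "(c0, m1, m2) \<in> W" "c0 = fst l0" using mu mue by (auto simp: W2_def W1_def)
  define B0 where "B0 = dc (pi_pow \<mu>)"
  have B0S: "B0 \<in> S" using muW by (auto simp: B0_def mue W_def S_def)
  have zero: "(f (SOME \<sigma>. \<sigma> \<in> B) - f' (SOME \<sigma>. \<sigma> \<in> B)) * satake_ch B \<mu> = 0" if B: "B \<in> S" "B \<noteq> B0" for B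
  proof (cases "f (SOME \<sigma>. \<sigma> \<in> B) = f' (SOME \<sigma>. \<sigma> \<in> B)")
    case False
    obtain h where h: "h \<in> carrier G" "B = dc h" using S B by blast
    obtain b0 b1 b2 where b: "b1 \<le> b2" "2 * b2 \<le> b0" "B = dc (pi_pow (b0, b1, b2))" using cart[OF h(1)] h(2) by blast
    have bW: "(b0, b1, b2) \<in> W"
      using False biinv_some[OF fD(1) pi_pow_G] biinv_some[OF fD'(1) pi_pow_G] b by (simp add: W_def)
    have "{A. A \<subseteq> B \<and> (\<exists>u\<in>N. A = (pi_pow \<mu> ** u) <#\<^bsub>G\<^esub> K)} = {}"
    proof (rule ccontr)
      assume "\<not> ?thesis"
      then obtain u where u: "u \<in> N" "lc (pi_pow \<mu> ** u) \<subseteq> B" by (auto simp: l_coset_G)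
      define x where "x = pi_pow \<mu> ** u"
      have xB: "x \<in> dc (pi_pow (b0, b1, b2))" using u lc_self b by (auto simp: x_def)
      have uG: "is_sim J4 u 1" using u(1) N_iff is_sim_nm by auto
      have xe: "x $ 1 $ 1 = \<pi> powi m1" "x $ 2 $ 2 = \<pi> powi m2" "x $ 2 $ 1 = 0"
        using u(1) by (simp_all add: x_def mue mult_entry sum_4 pi_pow_entry N_def)
      have "is_sim J4 x (\<pi> powi c0 * 1)" unfolding x_def using is_sim_mult[OF pi_pow_sim uG, of \<mu>] by (simp add: mue)
      then have "v (sim J4 x) = c0" using sim_eq[OF herm_J4] by fastforce
      then have b0: "b0 = c0" using dc_inv(3)[OF xB pi_pow_G] by (simp add: sim_pi_pow)
      then have bW1: "(b0, b1, b2) \<in> W1" using bW muW by (simp add: W1_def)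
      have "intmat b1 x" "intmin (b1 + b2) x" using dc_inv[OF xB pi_pow_G] intmin_pi_pow[OF b(1,2)] by auto
      then have "x $ 1 $ 1 \<in> idl b1" "minor x 1 2 1 2 \<in> idl (b1 + b2)" by (auto simp: intmat_def intmin_def)
      \<comment> \<open>The first diagonal entry of \<open>x\<close> and its minor in rows and
        columns 1, 2 have valuations \<open>m1\<close> and \<open>m1 + m2\<close>, while on the
        double coset entries and minors are bounded below by \<open>b1\<close> and
        \<open>b1 + b2\<close>.\<close>
      then have le: "b1 \<le> m1" "b1 + b2 \<le> m1 + m2" by (simp_all add: minor_def xe flip: power_int_add) (simp_all add: idl_def)
      have "b1 = m1" using m1(2)[OF bW1] le by (simp add: \<phi>_def)
      moreover then have "b2 = m2" using m2(2)[of "(b0, b1, b2)"] bW1 le by (simp add: W2_def \<phi>_def \<psi>_def)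
      ultimately show False using B b b0 mue by (simp add: B0_def)
    qed
    then show ?thesis by (simp only: satake_ch_def card.empty)
  qed simp
  have pos: "satake_ch B0 \<mu> \<noteq> 0"
  proof -
    have B0G: "B0 \<subseteq> carrier G" unfolding B0_def by (rule dc_G[OF pi_pow_G'])
    have s: "satake_ch B0 \<mu> = real q powi (- pair_delta \<mu>) * real (cnt B0 \<mu>)"
      by (rule satake_ch_cnt[OF B0G]) (auto simp: B0_def dest: dc_lc)
    obtain m where m: "intmat m (pi_pow \<mu>)" using intmat_ex by blast
    have sub: "B0 \<subseteq> Xb m (v (sim J4 (pi_pow \<mu>)))"
    proof
      fix x assume x: "x \<in> B0"
      then have "x \<in> dc (pi_pow \<mu>)" by (simp add: B0_def)
      note inv = dc_inv(1,3)[OF this pi_pow_G']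
      show "x \<in> Xb m (v (sim J4 (pi_pow \<mu>)))" using inv m x B0G by (auto simp: Xb_def)
    qed
    have "finite {p \<in> params. pi_pow \<mu> ** nmp p \<in> B0}"
      by (rule finite_subset[OF _ params_finite[of \<mu> m "v (sim J4 (pi_pow \<mu>))"]]) (use sub in auto)
    moreover have "(0, 0, 0, 0) \<in> {p \<in> params. pi_pow \<mu> ** nmp p \<in> B0}"
    proof -
      have "nmp (0, 0, 0, 0) = mat 1" by (simp add: nmp_def vec_eq_iff forall_4) (simp add: mat_def)
      then show ?thesis using dc_self by (simp add: params_def Xi_zero Ups_zero B0_def)
    qed
    ultimately have "cnt B0 \<mu> \<noteq> 0" unfolding cnt_def using card_0_eq by blast
    then show ?thesis using s q_pos by simp
  qed
  have "0 = satake f \<mu> - satake f' \<mu>" using eq by simp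
  also have "\<dots> = (\<Sum>B\<in>S. (f (SOME \<sigma>. \<sigma> \<in> B) - f' (SOME \<sigma>. \<sigma> \<in> B)) * satake_ch B \<mu>)"
    unfolding sf sf' by (simp add: left_diff_distrib sum_subtractf)
  also have "\<dots> = (f (SOME \<sigma>. \<sigma> \<in> B0) - f' (SOME \<sigma>. \<sigma> \<in> B0)) * satake_ch B0 \<mu>"
    using sum.remove[OF S(1) B0S, of "\<lambda>B. (f (SOME \<sigma>. \<sigma> \<in> B) - f' (SOME \<sigma>. \<sigma> \<in> B)) * satake_ch B \<mu>"] zero
    by (simp add: sum.neutral)
  also have "\<dots> = (f (pi_pow \<mu>) - f' (pi_pow \<mu>)) * satake_ch B0 \<mu>"
    unfolding B0_def by (simp add: biinv_some[OF fD(1) pi_pow_G'] biinv_some[OF fD'(1) pi_pow_G'])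
  finally show False using pos muW by (simp add: W_def mue)
qed

end

section \<open>The Hecke polynomial and its values modulo q + 1\<close>

context odd_unramified_extension
begin

text \<open>The ring of integers with \<open>q\<close> inverted; its elements have images in every
  admissible coefficient ring.\<close>

definition Zq :: "real set" where "Zq = {x. \<exists>(a::int) n. x = of_int a / real q ^ n}"

lemma q_nonzero [simp]: "real q \<noteq> 0" "q \<noteq> 0"
  using q_pos by auto

lemma ZqI: "x = of_int a / real q ^ n \<Longrightarrow> x \<in> Zq"
  by (auto simp: Zq_def)

lemma Zq_of_int [simp]: "of_int a \<in> Zq"
  by (rule ZqI[of _ a 0]) simp

lemma Zq_numeral [simp]: "numeral w \<in> Zq" "0 \<in> Zq" "1 \<in> Zq" "real n \<in> Zq"
  using Zq_of_int[of "numeral w"] Zq_of_int[of 0] Zq_of_int[of 1] Zq_of_int[of "int n"] by simp_all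

lemma Zq_add: assumes "x \<in> Zq" "y \<in> Zq" shows "x + y \<in> Zq"
proof -
  obtain a m where a: "x = of_int a / real q ^ m" using assms by (auto simp: Zq_def)
  obtain b n where b: "y = of_int b / real q ^ n" using assms by (auto simp: Zq_def)
  have "x + y = of_int (a * int q ^ n + b * int q ^ m) / real q ^ (m + n)"
    unfolding a b by (simp add: field_simps power_add)
  then show ?thesis by (rule ZqI)
qed

lemma Zq_mult: assumes "x \<in> Zq" "y \<in> Zq" shows "x * y \<in> Zq"
proof -
  obtain a m where a: "x = of_int a / real q ^ m" using assms by (auto simp: Zq_def)
  obtain b n where b: "y = of_int b / real q ^ n" using assms by (auto simp: Zq_def)
  have "x * y = of_int (a * b) / real q ^ (m + n)"
    unfolding a b by (simp add: field_simps power_add)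
  then show ?thesis by (rule ZqI)
qed

lemma Zq_minus: "x \<in> Zq \<Longrightarrow> - x \<in> Zq"
  using Zq_mult[OF Zq_of_int[of "-1"], of x] by simp

lemma Zq_diff: "x \<in> Zq \<Longrightarrow> y \<in> Zq \<Longrightarrow> x - y \<in> Zq"
  using Zq_add[of x "-y"] Zq_minus by simp

lemma Zq_power: "x \<in> Zq \<Longrightarrow> x ^ n \<in> Zq"
  by (induction n) (auto simp: Zq_mult)

lemma Zq_inverse_q: "inverse (real q) \<in> Zq"
  by (rule ZqI[of _ 1 1]) (simp add: inverse_eq_divide)

lemma Zq_powi: "real q powi n \<in> Zq"
  by (auto simp: power_int_def intro: Zq_power Zq_inverse_q)

lemma Zq_sum: "(\<And>i. i \<in> A \<Longrightarrow> f i \<in> Zq) \<Longrightarrow> sum f A \<in> Zq"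
  by (induction A rule: infinite_finite_induct) (auto intro: Zq_add)

lemma Zq_Rats: "x \<in> Zq \<Longrightarrow> x \<in> \<rat>"
  by (auto simp: Zq_def)

lemma Zq_sqrt_q_ring: "x \<in> Zq \<Longrightarrow> x \<in> sqrt_q_ring"
proof -
  assume "x \<in> Zq"
  then obtain a n where x: "x = of_int a / real q ^ n" by (auto simp: Zq_def)
  have "sqrt (real q) ^ (2 * n) = real q ^ n" by (simp add: power_mult)
  then have "x = poly (map_poly real_of_int [:a:]) (sqrt (real q)) / sqrt (real q) ^ (2 * n)"
    by (simp add: x map_poly_pCons)
  then show ?thesis unfolding sqrt_q_ring_def by blast
qed

text \<open>Congruence modulo \<open>q + 1\<close> between elements of \<open>Zq\<close>. Both
  \<open>q\<close> and its inverse are congruent to -1.\<close>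

definition ceq :: "real \<Rightarrow> real \<Rightarrow> bool" where
  "ceq x y \<longleftrightarrow> x \<in> Zq \<and> y \<in> Zq \<and> (\<exists>z\<in>Zq. x - y = (real q + 1) * z)"

lemma ceq_refl: "x \<in> Zq \<Longrightarrow> ceq x x"
  unfolding ceq_def by (auto intro!: bexI[of _ 0])

lemma ceq_add: assumes "ceq x x'" "ceq y y'" shows "ceq (x + y) (x' + y')"
proof -
  obtain z w where "z \<in> Zq" "x - x' = (real q + 1) * z" "w \<in> Zq" "y - y' = (real q + 1) * w"
    using assms by (auto simp: ceq_def)
  then have "z + w \<in> Zq" "x + y - (x' + y') = (real q + 1) * (z + w)" by (simp_all add: Zq_add distrib_left)
  then show ?thesis using assms Zq_add by (auto simp: ceq_def)
qed

lemma ceq_mult: assumes "ceq x x'" "ceq y y'" shows "ceq (x * y) (x' * y')"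
proof -
  obtain z w where zw: "z \<in> Zq" "x - x' = (real q + 1) * z" "w \<in> Zq" "y - y' = (real q + 1) * w"
    using assms by (auto simp: ceq_def)
  have "x * y - x' * y' = (x - x') * y + x' * (y - y')" by (simp add: algebra_simps)
  also have "\<dots> = (real q + 1) * (z * y + x' * w)" unfolding zw by (simp add: algebra_simps)
  finally have "x * y - x' * y' = (real q + 1) * (z * y + x' * w)" .
  moreover have "z * y + x' * w \<in> Zq" using zw assms by (auto simp: ceq_def intro!: Zq_add Zq_mult)
  ultimately show ?thesis using assms Zq_mult by (auto simp: ceq_def)
qed

lemma ceq_minus: "ceq x x' \<Longrightarrow> ceq (- x) (- x')"
  using ceq_mult[OF ceq_refl[OF Zq_of_int[of "-1"]], of x x'] by simp

lemma ceq_diff: "ceq x x' \<Longrightarrow> ceq y y' \<Longrightarrow> ceq (x - y) (x' - y')"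
  using ceq_add[of x x' "-y" "-y'"] ceq_minus by simp

lemma ceq_power: "ceq x x' \<Longrightarrow> ceq (x ^ n) (x' ^ n)"
  by (induction n) (auto intro: ceq_mult ceq_refl)

lemma ceq_q: "ceq (real q) (-1)"
proof -
  have "-1 \<in> Zq" using Zq_minus[of 1] by simp
  then show ?thesis unfolding ceq_def by (auto intro!: bexI[of _ 1])
qed

lemma ceq_inverse_q: "ceq (inverse (real q)) (-1)"
proof -
  have "-1 \<in> Zq" using Zq_minus[of 1] by simp
  moreover have "inverse (real q) - (-1) = (real q + 1) * inverse (real q)" by (simp add: distrib_right)
  ultimately show ?thesis unfolding ceq_def using Zq_inverse_q by blast
qed

lemma ceq_q_powi: assumes "odd c" shows "ceq (real q powi (- c)) (-1)"
proof -
  have o: "odd (nat \<bar>c\<bar>)" using assms by (simp add: even_nat_iff)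
  have "ceq (real q ^ nat \<bar>c\<bar>) ((-1) ^ nat \<bar>c\<bar>)" "ceq (inverse (real q) ^ nat \<bar>c\<bar>) ((-1) ^ nat \<bar>c\<bar>)"
    by (intro ceq_power ceq_q ceq_inverse_q)+
  then have "ceq (real q ^ nat \<bar>c\<bar>) (-1)" "ceq (inverse (real q) ^ nat \<bar>c\<bar>) (-1)" using o by simp_all
  then show ?thesis by (cases "c \<le> 0") (auto simp: power_int_def)
qed

definition ftab :: "int \<Rightarrow> (nat \<Rightarrow> real) \<Rightarrow> 'e^4^4 \<Rightarrow> real" where
  "ftab k x g = (if g \<in> BB k 0 then x 0 else if g \<in> BB k 1 then x 1 else if g \<in> BB k 2 then x 2 else 0)"

lemma ftab_BB: "g \<in> BB k j \<Longrightarrow> j \<le> 2 \<Longrightarrow> ftab k x g = x j"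
  using BB_disjoint[of g k] by (auto simp: ftab_def numeral_2_eq_2 le_Suc_eq)

lemma ftab_nonzero: "ftab k x g \<noteq> 0 \<Longrightarrow> \<exists>j\<le>2. g \<in> BB k j \<and> x j \<noteq> 0"
  unfolding ftab_def by (metis le_numeral_extra(3) one_le_numeral order_refl zero_le)

lemma BB_Xb: "j \<le> 2 \<Longrightarrow> g \<in> BB k j \<Longrightarrow> g \<in> Xb (k - 1) (2 * k)"
proof -
  assume j: "j \<le> 2" and g: "g \<in> BB k j"
  then have "sc (-k) ** g \<in> BB 0 j" using BB_shift by blast
  moreover have "BB 0 j \<subseteq> Xb (-1) 0" using j BB_iff X_chain by (auto simp: numeral_2_eq_2 le_Suc_eq)
  ultimately have x: "sc (-k) ** g \<in> Xb (-1) 0" by blast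
  have gG: "g \<in> carrier G" using g BB_G by blast
  have "sim J4 (sc (-k) ** g) = \<pi> powi (2 * - k) * sim J4 g"
    using sim_mult[OF herm_J4 sc_G gG] sim_sc by simp
  then have "v (sim J4 (sc (-k) ** g)) = v (sim J4 g) - 2 * k"
    using sim_nonzero[OF herm_J4 gG] by (simp add: v_mult)
  moreover have "intmat (-1) (sc (-k) ** g) \<longleftrightarrow> intmat (k - 1) g" by (simp add: sc_def intmat_mat algebra_simps)
  ultimately show "g \<in> Xb (k - 1) (2 * k)" using x gG by (simp add: Xb_def)
qed

lemma ftab_hecke:
  assumes "\<And>j. x j \<in> Zq" shows "ftab k x \<in> hecke_algebra"
proof -
  have bi: "ftab k x (l ** g ** l') = ftab k x g" if "l \<in> K" "l' \<in> K" for g l l'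
  proof -
    have "l ** g ** l' \<in> dc g" unfolding dc_def using that by blast
    then have e: "dc (l ** g ** l') = dc g" by (rule dc_eq)
    have "l ** g ** l' \<in> BB k j \<longleftrightarrow> g \<in> BB k j" for j
      unfolding BB_def using e dc_eq dc_self by metis
    then show ?thesis by (simp add: ftab_def)
  qed
  have r: "ftab k x (g ** l) = ftab k x g" if "l \<in> K" for g l
    using bi[OF K_one that, of g] by simp
  have "range (ftab k x) \<subseteq> sqrt_q_ring"
    using assms Zq_sqrt_q_ring Zq_numeral(2) by (auto simp: ftab_def)
  moreover have "compactly_supported G_top (ftab k x)"
  proof -
    have "{g. ftab k x g \<noteq> 0} \<subseteq> Xb (k - 1) (2 * k)" using ftab_nonzero BB_Xb by blast
    then have "finite (lc ` {g. ftab k x g \<noteq> 0})" using finite_Xb finite_subset image_mono by metis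
    moreover have "ftab k x g = 0" if "g \<notin> carrier G" for g using that ftab_nonzero[of k x g] BB_G by blast
    ultimately show ?thesis using rinv_support[of "ftab k x"] r by blast
  qed
  ultimately show ?thesis using bi by (simp add: hecke_algebra_def)
qed

lemma satake_ftab:
  assumes "\<And>j. x j \<in> Zq"
  shows "satake (ftab k x) (a0 + 2 * k, a1 + k, a2 + k) = x 0 * tab 0 (a0, a1, a2) + x 1 * tab 1 (a0, a1, a2) + x 2 * tab 2 (a0, a1, a2)"
proof -
  note bi = hecke_D(1)[OF ftab_hecke[OF assms]]
  have ne: "BB k i \<noteq> BB k j" if "i \<noteq> j" "i \<le> 2" "j \<le> 2" for i j
  proof -
    have "sc k ** pi_pow (wt i) \<in> BB k i" unfolding BB_def by (rule dc_self)
    then show ?thesis using BB_disjoint that by metis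
  qed
  let ?S = "{BB k 0, BB k 1, BB k 2}"
  have val: "ftab k x (SOME \<sigma>. \<sigma> \<in> BB k j) = x j" if "j \<le> 2" for j
  proof -
    have "ftab k x (SOME \<sigma>. \<sigma> \<in> BB k j) = ftab k x (sc k ** pi_pow (wt j))"
      unfolding BB_def by (rule biinv_some[OF bi BB_rep_G])
    also have "\<dots> = x j" by (rule ftab_BB[OF _ that]) (simp add: BB_def dc_self)
    finally show ?thesis .
  qed
  have "satake (ftab k x) l = (\<Sum>B\<in>?S. ftab k x (SOME \<sigma>. \<sigma> \<in> B) * satake_ch B l)" for l
  proof (rule satake_eq[OF bi])
    show "?S \<subseteq> dc ` carrier G" using BB_rep_G by (auto simp: BB_def)
    fix g assume "g \<in> carrier G" "ftab k x g \<noteq> 0"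
    then obtain j where j: "j \<le> 2" "g \<in> BB k j" using ftab_nonzero by blast
    then have "dc g = BB k j" unfolding BB_def by (intro dc_eq)
    then show "dc g \<in> ?S" using j by (auto simp: numeral_2_eq_2 le_Suc_eq)
  qed simp
  also have "(\<Sum>B\<in>?S. ftab k x (SOME \<sigma>. \<sigma> \<in> B) * satake_ch B l) =
     x 0 * satake_ch (BB k 0) l + x 1 * satake_ch (BB k 1) l + x 2 * satake_ch (BB k 2) l" for l
    using ne[of 0 1] ne[of 0 2] ne[of 1 2] val by simp
  finally show ?thesis by (simp add: satake_ch_BB)
qed

text \<open>Obtained by solving the triangular table \<open>tab\<close> backwards. The orbit sum
  over \<open>e1w\<close> is \<open>r^3\<close> times the difference of transform 1 and
  \<open>d\<close>; the one over \<open>e2w\<close> is \<open>r^4\<close> times transform 2 after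
  removal of its two lower parts. The powers of \<open>p\<close> come from substituting
  \<open>q^-c X\<close>.\<close>

definition hq :: "int \<Rightarrow> nat \<Rightarrow> nat \<Rightarrow> real" where
  "hq c k j = (let p = real q powi (- c); r = inverse (real q); d = (real q - 1) * (real q ^ 2 + 1) in
     if k = 0 then (if j = 0 then 1 else 0)
     else if k = 1 then (if j = 0 then p * r ^ 3 * d else if j = 1 then - p * r ^ 3 else 0)
     else if k = 2 then (if j = 0 then p ^ 2 * (2 - r ^ 4 * (2 * real q ^ 4 - real q ^ 3 - real q) + r ^ 4 * (real q ^ 4 - real q ^ 3) * r ^ 3 * d)
        else if j = 1 then - (p ^ 2 * r ^ 4 * (real q ^ 4 - real q ^ 3) * r ^ 3) else p ^ 2 * r ^ 4)
     else if k = 3 then (if j = 0 then p ^ 3 * r ^ 3 * d else if j = 1 then - (p ^ 3) * r ^ 3 else 0)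
     else (if j = 0 then p ^ 4 else 0))"

lemma hq_Zq: "hq c k j \<in> Zq"
proof -
  note [intro!] = Zq_mult Zq_add Zq_diff Zq_minus Zq_power Zq_powi Zq_inverse_q
  show ?thesis unfolding hq_def Let_def by auto
qed

text \<open>Up to the central shift \<open>(2 k, k, k)\<close> the coefficients are 1, minus the
  orbit sum of \<open>e1w\<close>, 2 plus the orbit sum of \<open>e2w\<close>, minus the orbit sum
  of \<open>e1w\<close>, and 1.\<close>

definition S_coeffs :: "group_alg list" where
  "S_coeffs = [1, - (e_pow (2,2,1) + e_pow (2,0,1) + e_pow (2,1,2) + e_pow (2,1,0)),
     2 * e_pow (4,2,2) + e_pow (4,3,3) + e_pow (4,3,1) + e_pow (4,1,3) + e_pow (4,1,1),
     - (e_pow (6,3,4) + e_pow (6,3,2) + e_pow (6,4,3) + e_pow (6,2,3)), e_pow (8,4,4)]"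

lemma S_bc_coeffs: "S_bc = Poly S_coeffs"
proof -
  have gen: "[:1, - a:] * [:1, - b:] * [:1, - c:] * [:1, - d:] =
     [:1, - (a + b + c + d), a * b + c * d + a * c + a * d + b * c + b * d,
       - (a * b * c + a * b * d + a * c * d + b * c * d), a * b * c * d:]" for a b c d :: group_alg
    by (simp add: algebra_simps)
  show ?thesis
    unfolding S_bc_def Let_def gen S_coeffs_def
    by (simp add: power2_eq_square mult_single)
qed

lemma degree_S_bc: "degree S_bc = 4"
proof -
  have "Poly_Mapping.lookup (e_pow (8,4,4)) (8,4,4) \<noteq> (0 :: real)" by simp
  then have "e_pow (8,4,4) \<noteq> (0 :: group_alg)" by fastforce
  then show ?thesis unfolding S_bc_coeffs S_coeffs_def by simp
qed

lemma coeff_S_bc: "k \<le> 4 \<Longrightarrow> coeff S_bc k = S_coeffs ! k"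
  unfolding S_bc_coeffs coeff_Poly_eq by (simp add: nth_default_def) (simp add: S_coeffs_def)

lemma single_zero_power: "(Poly_Mapping.single 0 p :: group_alg) ^ k = Poly_Mapping.single 0 (p ^ k)"
  by (induction k) (simp_all add: mult_single)

lemma hq_tab:
  assumes "k \<le> 4"
  shows "hq c k 0 * tab 0 l + hq c k 1 * tab 1 l + hq c k 2 * tab 2 l =
    (real q powi (- c)) ^ k *
    (if k = 0 \<or> k = 4 then (if l = (0,0,0) then 1 else 0)
     else if k = 2 then (if e2w l then 1 else if l = (0,0,0) then 2 else 0)
     else (if e1w l then - 1 else 0))"
proof -
  define p where "p = real q powi (- c)"
  define r where "r = inverse (real q)"
  have r3: "x * r ^ 3 * real q ^ 3 = x" "x * r ^ 4 * real q ^ 4 = x" for x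
    by (simp_all add: r_def power_inverse)
  have r4: "r ^ 4 * real q ^ 4 = 1" using r3(2)[of 1] by simp
  have ne: "\<not> (e1w l \<and> e2w l)" "\<not> e1w (0,0,0)" "\<not> e2w (0,0,0)" by (auto simp: e1w_def e2w_def)
  consider "k = 0" | "k = 1" | "k = 2" | "k = 3" | "k = 4" using assms by linarith
  then show ?thesis
  proof cases
    case 3
    consider "e2w l" | "e1w l" | "l = (0,0,0)" | "\<not> e2w l" "\<not> e1w l" "l \<noteq> (0,0,0)" by blast
    then show ?thesis
    proof cases
      case 2
      have R: "r ^ 3 * real q ^ 3 = 1" using r3(1)[of 1] by simp
      have "- (p ^ 2 * r ^ 4 * (real q ^ 4 - real q ^ 3) * r ^ 3) * real q ^ 3 + p ^ 2 * r ^ 4 * (real q ^ 4 - real q ^ 3) = 0"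
        using R by algebra
      moreover have "\<not> e2w l" "l \<noteq> (0,0,0)" using 2 ne by auto
      ultimately show ?thesis using 3 2
        unfolding hq_def Let_def p_def[symmetric] r_def[symmetric] tab_def by simp
    qed (use 3 ne in \<open>auto simp: hq_def Let_def tab_def r3 r4 algebra_simps simp flip: p_def r_def\<close>)
  qed (use ne in \<open>auto simp: hq_def Let_def tab_def r3 simp flip: p_def r_def\<close>)
qed

lemma target_lookup:
  assumes "k \<le> 4"
  shows "Poly_Mapping.lookup (coeff (pcompose S_bc [:0, Poly_Mapping.single 0 (real q powi (- c)):]) k) (a0 + 2 * int k, a1 + int k, a2 + int k) =
     hq c k 0 * tab 0 (a0, a1, a2) + hq c k 1 * tab 1 (a0, a1, a2) + hq c k 2 * tab 2 (a0, a1, a2)"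
proof -
  define p where "p = real q powi (- c)"
  have c: "coeff (pcompose S_bc [:0, Poly_Mapping.single 0 p:]) k = Poly_Mapping.single 0 (p ^ k) * (S_coeffs ! k)"
    by (simp add: coeff_pcompose_linear coeff_S_bc[OF assms] single_zero_power)
  have two: "2 * e_pow l = (e_pow l + e_pow l :: group_alg)" for l by (rule mult_2)
  have z: "(0 :: lattice3) = (0, 0, 0)" by (simp add: zero_prod_def)
  have one: "(1 :: group_alg) = e_pow (0,0,0)" unfolding z[symmetric] by (rule single_one[symmetric])
  have scal: "Poly_Mapping.lookup (Poly_Mapping.single 0 a * f) l = a * Poly_Mapping.lookup f l" for a f and l :: lattice3
    unfolding mult_map_scale_conv_mult[symmetric] by (simp add: Poly_Mapping.map.rep_eq when_def)
  define R where "R = (if k = 0 \<or> k = 4 then (if (a0, a1, a2) = (0,0,0) then 1 else 0)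
     else if k = 2 then (if e2w (a0, a1, a2) then 1 else if (a0, a1, a2) = (0,0,0) then 2 else 0)
     else (if e1w (a0, a1, a2) then - 1 else 0) :: real)"
  consider "k = 0" | "k = 1" | "k = 2" | "k = 3" | "k = 4" using assms by linarith
  then have "Poly_Mapping.lookup (S_coeffs ! k) (a0 + 2 * int k, a1 + int k, a2 + int k) = R"
  proof cases
    case 1
    then show ?thesis by (auto simp: R_def S_coeffs_def one lookup_single when_def)
  next
    case 2
    then show ?thesis
      by (simp add: R_def S_coeffs_def lookup_add lookup_minus lookup_single when_def e1w_def)
  next
    case 3
    let ?l = "(a0, a1, a2)" and ?L = "(a0 + 4, a1 + 2, a2 + 2)"
    have eqs: "(4, 2, 2) = ?L \<longleftrightarrow> ?l = (0, 0, 0)" "(4, 3, 3) = ?L \<longleftrightarrow> ?l = (0, 1, 1)" "(4, 3, 1) = ?L \<longleftrightarrow> ?l = (0, 1, -1)"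
      "(4, 1, 3) = ?L \<longleftrightarrow> ?l = (0, -1, 1)" "(4, 1, 1) = ?L \<longleftrightarrow> ?l = (0, -1, -1)" by auto
    have S2: "S_coeffs ! 2 = 2 * e_pow (4,2,2) + e_pow (4,3,3) + e_pow (4,3,1) + e_pow (4,1,3) + e_pow (4,1,1)"
      by (simp add: S_coeffs_def)
    have "Poly_Mapping.lookup (S_coeffs ! 2) ?L = (if ?l = (0, 0, 0) then 2 else 0) + (if ?l = (0, 1, 1) then 1 else 0) +
        (if ?l = (0, 1, -1) then 1 else 0) + (if ?l = (0, -1, 1) then 1 else 0) + (if ?l = (0, -1, -1) then 1 else 0)"
      unfolding S2 two lookup_add lookup_single when_def eqs by (cases "?l = (0, 0, 0)") simp_all
    also have "\<dots> = R"
    proof -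
      have "\<not> e2w (0, 0, 0)" by (simp add: e2w_def)
      consider "?l = (0, 0, 0)" | "?l = (0, 1, 1)" | "?l = (0, 1, -1)" | "?l = (0, -1, 1)" | "?l = (0, -1, -1)"
        | "?l \<noteq> (0, 0, 0)" "?l \<noteq> (0, 1, 1)" "?l \<noteq> (0, 1, -1)" "?l \<noteq> (0, -1, 1)" "?l \<noteq> (0, -1, -1)"
        by blast
      then show ?thesis unfolding R_def e2w_def using 3 by cases simp_all
    qed
    finally show ?thesis using 3 by simp
  next
    case 4
    then show ?thesis
      by (simp add: R_def S_coeffs_def lookup_add lookup_minus lookup_single when_def e1w_def)
  next
    case 5
    then show ?thesis by (auto simp: R_def S_coeffs_def lookup_single when_def)
  qed
  then show ?thesis unfolding p_def[symmetric] c hq_tab[OF assms] scal R_def p_def[symmetric] by (simp only:)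
qed

text \<open>The table exhibits a function with the prescribed transform, and
  \<open>satake_inj\<close> makes it the only one.\<close>

theorem hecke_poly_eq:
  assumes "k \<le> 4"
  shows "hecke_poly c k = ftab (int k) (hq c k)"
  unfolding hecke_poly_def
proof (rule the_equality)
  let ?t = "Poly_Mapping.lookup (coeff (pcompose S_bc [:0, Poly_Mapping.single 0 (real q powi (- c)):]) k)"
  have "satake (ftab (int k) (hq c k)) l = ?t l" for l
  proof -
    obtain a0 a1 a2 where l: "l = (a0, a1, a2)" by (cases l)
    show ?thesis
      using satake_ftab[of "hq c k" "int k" "a0 - 2 * int k" "a1 - int k" "a2 - int k", OF hq_Zq]
        target_lookup[OF assms, of c "a0 - 2 * int k" "a1 - int k" "a2 - int k"] by (simp add: l)
  qed
  then show "ftab (int k) (hq c k) \<in> hecke_algebra \<and> satake (ftab (int k) (hq c k)) = ?t"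
    using ftab_hecke hq_Zq by blast
  then show "f = ftab (int k) (hq c k)" if "f \<in> hecke_algebra \<and> satake f = ?t" for f
    using satake_inj that by metis
qed

text \<open>Replacing X by the characteristic function of \<open>C\<close>, which is constant on the
  second factor, adds up the coefficients of all degrees.\<close>

definition htot :: "int \<Rightarrow> 'e^4^4 \<Rightarrow> real" where
  "htot c g = (\<Sum>k\<le>4. hecke_poly c k g)"

lemma htot_eq: "htot c g = (\<Sum>k\<le>4. ftab (int k) (hq c k) g)"
  unfolding htot_def by (intro sum.cong) (simp_all add: hecke_poly_eq)

lemma htot_Zq: "htot c g \<in> Zq"
  unfolding htot_eq ftab_def using hq_Zq by (intro Zq_sum) auto

lemma htot_biinv: "biinv (htot c)"
  unfolding biinv_def htot_eq using hecke_D(1)[OF ftab_hecke[OF hq_Zq]] by (auto simp: biinv_def intro!: sum.cong)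

lemma htot_outside: "g \<notin> carrier G \<Longrightarrow> htot c g = 0"
  unfolding htot_eq using hecke_D(2)[OF ftab_hecke[OF hq_Zq]] by (intro sum.neutral) auto

lemma htot_finite: "finite (lc ` {g. htot c g \<noteq> 0})"
proof (rule finite_subset)
  show "lc ` {g. htot c g \<noteq> 0} \<subseteq> (\<Union>k\<le>4. lc ` {g. ftab (int k) (hq c k) g \<noteq> 0})"
  proof clarify
    fix g assume "htot c g \<noteq> 0"
    then obtain k where "k \<in> {..4}" "ftab (int k) (hq c k) g \<noteq> 0"
      unfolding htot_eq by (rule sum.not_neutral_contains_not_neutral)
    then show "lc g \<in> (\<Union>k\<le>4. lc ` {g. ftab (int k) (hq c k) g \<noteq> 0})" by blast
  qed
  show "finite (\<Union>k\<le>4. lc ` {g. ftab (int k) (hq c k) g \<noteq> 0})"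
    by (rule finite_UN_I, simp, rule hecke_D(3)[OF ftab_hecke], rule hq_Zq)
qed

text \<open>On the part of degree \<open>k\<close> the similitude factor has valuation
  \<open>2 k\<close>, so a central translate of \<open>g\<close> meets only one degree.\<close>

lemma sc_BB:
  assumes g: "g \<in> carrier G" "v (sim J4 g) = 0" and j: "j \<le> 2"
  shows "sc b ** g \<in> BB k j \<longleftrightarrow> b = k \<and> g \<in> BB 0 j"
proof
  assume a: "sc b ** g \<in> BB k j"
  have "v (sim J4 (sc b ** g)) = 2 * b"
    using sim_mult[OF herm_J4 sc_G g(1)] g sim_nonzero[OF herm_J4 g(1)] by (simp add: sim_sc v_mult)
  then have "b = k" using BB_Xb[OF j a] by (simp add: Xb_def)
  then show "b = k \<and> g \<in> BB 0 j" using a BB_shift[of "sc b ** g" k j] by (simp add: sc_cancel)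
next
  assume "b = k \<and> g \<in> BB 0 j"
  then show "sc b ** g \<in> BB k j" using BB_shift[of "sc b ** g" k j] by (simp add: sc_cancel)
qed

lemma htot_sc_zero:
  assumes g: "g \<in> carrier G" "v (sim J4 g) = 0" and b: "b < 0 \<or> 4 < b"
  shows "htot c (sc b ** g) = 0"
  unfolding htot_eq
proof (rule sum.neutral, rule ballI)
  fix k :: nat assume "k \<in> {..4}"
  then have "b \<noteq> int k" using b by auto
  then show "ftab (int k) (hq c k) (sc b ** g) = 0"
    using sc_BB[OF g, of _ b "int k"] by (simp add: ftab_def)
qed

lemma htot_sc:
  assumes g: "g \<in> carrier G" "v (sim J4 g) = 0" and k: "k \<le> 4"
  shows "htot c (sc (int k) ** g) = ftab 0 (hq c k) g"
proof -
  have "ftab (int i) (hq c i) (sc (int k) ** g) = (if i = k then ftab 0 (hq c k) g else 0)" for i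
    using sc_BB[OF g, of _ "int k" "int i"] by (auto simp: ftab_def)
  then show ?thesis unfolding htot_eq using k by simp
qed

text \<open>The only place where the parity of \<open>c\<close> matters: modulo \<open>q + 1\<close> one may replace \<open>q\<close> by \<open>-1\<close>.\<close>

lemma hq_sum_ceq:
  assumes "odd c" "j \<le> 1"
  shows "ceq (\<Sum>k\<le>4. hq c k j) 0"
proof -
  define p where "p = real q powi (- c)"
  define r where "r = inverse (real q)"
  have p: "ceq p (-1)" and r: "ceq r (-1)" and q: "ceq (real q) (-1)"
    using ceq_q_powi[OF assms(1)] ceq_inverse_q ceq_q by (simp_all add: p_def r_def)
  have 5: "{..4::nat} = {0,1,2,3,4}" by auto
  note n = ceq_refl[OF Zq_numeral(1)] ceq_refl[OF Zq_numeral(3)]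
  show ?thesis
  proof (cases "j = 0")
    case True
    let ?f = "\<lambda>p r q. 1 + p * r ^ 3 * ((q - 1) * (q ^ 2 + 1))
       + p ^ 2 * (2 - r ^ 4 * (2 * q ^ 4 - q ^ 3 - q) + r ^ 4 * (q ^ 4 - q ^ 3) * r ^ 3 * ((q - 1) * (q ^ 2 + 1)))
       + p ^ 3 * r ^ 3 * ((q - 1) * (q ^ 2 + 1)) + p ^ 4 :: real"
    \<comment> \<open>At -1 the five summands are 1, -4, 6, -4, 1.\<close>
    have "ceq (?f p r (real q)) (?f (-1) (-1) (-1))" by (intro ceq_add ceq_mult ceq_diff ceq_power p r q n)
    moreover have "(\<Sum>k\<le>4. hq c k j) = ?f p r (real q)"
      unfolding 5 True by (simp add: hq_def Let_def flip: p_def r_def)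
    ultimately show ?thesis by simp
  next
    case False
    then have j: "j = 1" using assms by simp
    let ?f = "\<lambda>p r q. - p * r ^ 3 - (p ^ 2 * r ^ 4 * (q ^ 4 - q ^ 3) * r ^ 3) + - (p ^ 3) * r ^ 3 :: real"
    \<comment> \<open>At -1 the three summands are -1, 2, -1.\<close>
    have "ceq (?f p r (real q)) (?f (-1) (-1) (-1))" by (intro ceq_add ceq_mult ceq_diff ceq_power ceq_minus p r q n)
    moreover have "(\<Sum>k\<le>4. hq c k j) = ?f p r (real q)"
      unfolding 5 j by (simp add: hq_def Let_def flip: p_def r_def)
    ultimately show ?thesis by simp
  qed
qed

text \<open>Along the centre each degree occurs once, so the sum runs over one column of
  \<open>hq\<close>. On \<open>BB 0 2\<close> it would be the single coefficient
  \<open>p^2 r^4\<close>, congruent to 1; hence the exclusion.\<close>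

lemma htot_centre_sum:
  assumes g: "g \<in> carrier G" "v (sim J4 g) = 0" and X: "g \<notin> BB 0 2" and c: "odd c"
  shows "ceq (\<Sum>k\<le>4. htot c (sc (int k) ** g)) 0"
proof -
  have "(\<Sum>k\<le>4. htot c (sc (int k) ** g)) = (\<Sum>k\<le>4. ftab 0 (hq c k) g)"
    by (intro sum.cong) (simp_all add: htot_sc[OF g])
  also have "ceq \<dots> 0"
  proof -
    consider "g \<in> BB 0 0" | "g \<notin> BB 0 0" "g \<in> BB 0 1" | "g \<notin> BB 0 0" "g \<notin> BB 0 1" by blast
    then show ?thesis
    proof cases
      case 1 then show ?thesis using hq_sum_ceq[OF c, of 0] by (simp add: ftab_def)
    next
      case 2 then show ?thesis using hq_sum_ceq[OF c, of 1] by (simp add: ftab_def)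
    next
      case 3 then show ?thesis using X ceq_refl[of 0] by (simp add: ftab_def)
    qed
  qed
  finally show ?thesis .
qed

end

section \<open>Compact open subgroups of H\<close>

context odd_unramified_extension
begin

interpretation HG: group H by (rule H_group)

lemma iota_G: "h \<in> carrier H \<Longrightarrow> \<iota> h \<in> carrier G"
  by (simp add: H_iff_iota)

lemma iota_diff: "\<iota> x - \<iota> y = \<iota> (fst x - fst y, snd x - snd y)"
  by (cases x; cases y) (simp add: vec_eq_iff forall_4 iota_entry)

lemma intmat_iota_diff: "intmat n (\<iota> x - \<iota> y) \<longleftrightarrow> intmat n (fst x - fst y) \<and> intmat n (snd x - snd y)"
  by (simp add: iota_diff intmat_iota)

lemma ball_open: "openin mat_top {A. intmat n (A - B)}"
  unfolding openin_mat
proof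
  fix A assume A: "A \<in> {A. intmat n (A - B)}"
  have "intmat n (X - B)" if "intmat n (X - A)" for X
  proof -
    have "X - B = (X - A) + (A - B)" by simp
    then show ?thesis using intmat_add[OF that, of "A - B"] A by simp
  qed
  then show "\<exists>m. \<forall>X. intmat m (X - A) \<longrightarrow> X \<in> {A. intmat n (A - B)}" by blast
qed

lemma prod_openI:
  assumes "\<And>p. p \<in> S \<Longrightarrow> \<exists>n. \<forall>p'. intmat n (\<iota> p' - \<iota> p) \<longrightarrow> p' \<in> S"
  shows "openin (prod_topology mat_top mat_top) S"
  unfolding openin_prod_topology_alt
proof (intro allI impI)
  fix x y assume "(x, y) \<in> S"
  then obtain n where n: "\<And>p'. intmat n (\<iota> p' - \<iota> (x, y)) \<Longrightarrow> p' \<in> S" using assms by blast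
  have "{A. intmat n (A - x)} \<times> {A. intmat n (A - y)} \<subseteq> S"
    using n by (auto simp: intmat_iota_diff)
  moreover have "x \<in> {A. intmat n (A - x)}" "y \<in> {A. intmat n (A - y)}" by (simp_all add: intmat_def)
  ultimately show "\<exists>U V. openin mat_top U \<and> openin mat_top V \<and> x \<in> U \<and> y \<in> V \<and> U \<times> V \<subseteq> S"
    using ball_open by blast
qed

lemma H_openI:
  assumes S: "S \<subseteq> carrier H" and loc: "\<And>h. h \<in> S \<Longrightarrow> \<exists>n. \<forall>h'\<in>carrier H. intmat n (\<iota> h' - \<iota> h) \<longrightarrow> h' \<in> S"
  shows "openin H_top S"
proof -
  define T where "T = {p. \<exists>n. (\<forall>h'\<in>carrier H. intmat n (\<iota> h' - \<iota> p) \<longrightarrow> h' \<in> S)}"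
  have "openin (prod_topology mat_top mat_top) T"
  proof (rule prod_openI)
    fix p assume "p \<in> T"
    then obtain n where n: "\<And>h'. h' \<in> carrier H \<Longrightarrow> intmat n (\<iota> h' - \<iota> p) \<Longrightarrow> h' \<in> S" by (auto simp: T_def)
    have "p' \<in> T" if p': "intmat n (\<iota> p' - \<iota> p)" for p'
    proof -
      have "h' \<in> S" if "h' \<in> carrier H" "intmat n (\<iota> h' - \<iota> p')" for h'
      proof -
        have "\<iota> h' - \<iota> p = (\<iota> h' - \<iota> p') + (\<iota> p' - \<iota> p)" by simp
        then show ?thesis using n[OF that(1)] intmat_add[OF that(2) p'] by simp
      qed
      then show ?thesis unfolding T_def by blast
    qed
    then show "\<exists>n. \<forall>p'. intmat n (\<iota> p' - \<iota> p) \<longrightarrow> p' \<in> T" by blast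
  qed
  moreover have "S = T \<inter> carrier H"
  proof (intro equalityI subsetI)
    fix h assume "h \<in> S" then show "h \<in> T \<inter> carrier H" using loc S by (auto simp: T_def)
  next
    fix h assume "h \<in> T \<inter> carrier H"
    moreover have "intmat n (\<iota> h - \<iota> h)" for n by (simp add: intmat_def)
    ultimately show "h \<in> S" by (auto simp: T_def)
  qed
  ultimately show ?thesis unfolding H_top_def openin_subtopology by blast
qed

lemma topspace_H [simp]: "topspace H_top = carrier H"
proof -
  have "topspace (prod_topology mat_top mat_top :: (('e^2^2) \<times> ('e^2^2)) topology) = UNIV" by simp
  then show ?thesis by (simp add: H_top_def)
qed

text \<open>The open subgroups with bounded image; these are the compact open ones.\<close>

definition good :: "(('e^2^2) \<times> ('e^2^2)) set \<Rightarrow> bool" where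
  "good V \<longleftrightarrow> subgroup V H \<and> (\<exists>n. \<forall>h\<in>carrier H. intmat n (\<iota> h - mat 1) \<longrightarrow> h \<in> V) \<and> (\<exists>m. \<forall>h\<in>V. \<iota> h \<in> Xb m 0)"

lemma near_left:
  assumes x: "x \<in> carrier H"
  shows "\<exists>n. \<forall>h\<in>carrier H. intmat n (\<iota> h - \<iota> x) \<longrightarrow> intmat n0 (\<iota> (inv\<^bsub>H\<^esub> x \<otimes>\<^bsub>H\<^esub> h) - mat 1)"
proof -
  obtain m where m: "intmat m (matrix_inv (\<iota> x))" using intmat_ex by blast
  show ?thesis
  proof (intro exI[of _ "n0 - m"] ballI impI)
    fix h assume h: "h \<in> carrier H" "intmat (n0 - m) (\<iota> h - \<iota> x)"
    have "\<iota> (inv\<^bsub>H\<^esub> x \<otimes>\<^bsub>H\<^esub> h) - mat 1 = matrix_inv (\<iota> x) ** (\<iota> h - \<iota> x)"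
      using GU_inv_cancel(1)[OF herm_J4 iota_G[OF x]] by (simp add: iota_hom iota_inv[OF x] mat_diff_left)
    then show "intmat n0 (\<iota> (inv\<^bsub>H\<^esub> x \<otimes>\<^bsub>H\<^esub> h) - mat 1)" using intmat_mult[OF m h(2)] by simp
  qed
qed

lemma goodD: "good V \<Longrightarrow> subgroup V H" "good V \<Longrightarrow> V \<subseteq> carrier H" "good V \<Longrightarrow> \<one>\<^bsub>H\<^esub> \<in> V"
  unfolding good_def by (auto simp: subgroup.mem_carrier subgroup.one_closed)

lemma open_right_inv:
  assumes V: "good V" and S: "S \<subseteq> carrier H" "\<And>s x. s \<in> S \<Longrightarrow> x \<in> V \<Longrightarrow> s \<otimes>\<^bsub>H\<^esub> x \<in> S"
  shows "openin H_top S"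
proof (rule H_openI[OF S(1)])
  fix h assume h: "h \<in> S"
  then have hH: "h \<in> carrier H" using S by blast
  obtain n0 where n0: "\<And>x. x \<in> carrier H \<Longrightarrow> intmat n0 (\<iota> x - mat 1) \<Longrightarrow> x \<in> V" using V by (auto simp: good_def)
  obtain n where n: "\<And>x. x \<in> carrier H \<Longrightarrow> intmat n (\<iota> x - \<iota> h) \<Longrightarrow> intmat n0 (\<iota> (inv\<^bsub>H\<^esub> h \<otimes>\<^bsub>H\<^esub> x) - mat 1)"
    using near_left[OF hH, of n0] by blast
  show "\<exists>n. \<forall>h'\<in>carrier H. intmat n (\<iota> h' - \<iota> h) \<longrightarrow> h' \<in> S"
  proof (intro exI[of _ n] ballI impI)
    fix x assume x: "x \<in> carrier H" "intmat n (\<iota> x - \<iota> h)"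
    then have "inv\<^bsub>H\<^esub> h \<otimes>\<^bsub>H\<^esub> x \<in> V" using n0 n hH by simp
    from S(2)[OF h this] show "x \<in> S" using x(1) hH by (simp add: HG.inv_solve_left' HG.m_assoc[symmetric])
  qed
qed

text \<open>\<open>V\<close> lies in a product of two compact balls, so closedness suffices. Points
  of \<open>H\<close> outside \<open>V\<close> are separated by the open subgroup property, points
  outside \<open>H\<close> because \<open>Xb m 0\<close> is closed.\<close>

lemma good_compact:
  assumes V: "good V" shows "compactin H_top V"
proof -
  obtain m where m: "\<And>h. h \<in> V \<Longrightarrow> \<iota> h \<in> Xb m 0" using V by (auto simp: good_def)
  let ?P = "prod_topology mat_top mat_top :: (('e^2^2) \<times> ('e^2^2)) topology"
  have cp: "compactin ?P ({A. intmat m A} \<times> {A. intmat m A})"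
    unfolding compactin_Times using compactin_intmat by blast
  have sub: "V \<subseteq> {A. intmat m A} \<times> {A. intmat m A}"
    using m by (auto simp: Xb_def intmat_iota)
  have cl: "closedin ?P V"
    unfolding closedin_def
  proof
    show "openin ?P (topspace ?P - V)"
    proof (rule prod_openI)
      fix p assume p: "p \<in> topspace ?P - V"
      show "\<exists>n. \<forall>p'. intmat n (\<iota> p' - \<iota> p) \<longrightarrow> p' \<in> topspace ?P - V"
      proof (cases "p \<in> carrier H")
        case True
        obtain n0 where n0: "\<And>x. x \<in> carrier H \<Longrightarrow> intmat n0 (\<iota> x - mat 1) \<Longrightarrow> x \<in> V" using V by (auto simp: good_def)
        obtain n where n: "\<And>x. x \<in> carrier H \<Longrightarrow> intmat n (\<iota> x - \<iota> p) \<Longrightarrow> intmat n0 (\<iota> (inv\<^bsub>H\<^esub> p \<otimes>\<^bsub>H\<^esub> x) - mat 1)"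
          using near_left[OF True, of n0] by blast
        have "x \<notin> V" if x: "intmat n (\<iota> x - \<iota> p)" for x
        proof
          assume xV: "x \<in> V"
          then have xH: "x \<in> carrier H" using goodD[OF V] by blast
          then have "inv\<^bsub>H\<^esub> p \<otimes>\<^bsub>H\<^esub> x \<in> V" using n0 n x True by simp
          then have "x \<otimes>\<^bsub>H\<^esub> inv\<^bsub>H\<^esub> (inv\<^bsub>H\<^esub> p \<otimes>\<^bsub>H\<^esub> x) \<in> V"
            using xV goodD(1)[OF V] by (simp add: subgroup.m_closed subgroup.m_inv_closed)
          then have "p \<in> V" using xH True by (simp add: HG.inv_mult_group HG.m_assoc[symmetric])
          then show False using p by simp
        qed
        then show ?thesis by auto
      next
        case False
        then have "\<iota> p \<notin> Xb m 0" by (simp add: Xb_def H_iff_iota)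
        moreover have "openin mat_top (UNIV - Xb m 0)" using Xb_closed[of m 0] by (simp add: closedin_def)
        ultimately obtain n where n: "\<And>B. intmat n (B - \<iota> p) \<Longrightarrow> B \<notin> Xb m 0" unfolding openin_mat by blast
        then have "x \<notin> V" if "intmat n (\<iota> x - \<iota> p)" for x using that m by blast
        then show ?thesis by auto
      qed
    qed
  qed simp
  have "compactin ?P V" by (rule closed_compactin[OF cp sub cl])
  then show ?thesis unfolding H_top_def compactin_subtopology using goodD[OF V] by simp
qed

lemma good_open: "good V \<Longrightarrow> openin H_top V"
  using goodD(1,2)[of V] by (intro open_right_inv[of V V]) (simp_all add: subgroup.m_closed)

lemma good_compact_open: "good V \<Longrightarrow> compact_open_subgroup V"
  by (simp add: compact_open_subgroup_def good_compact good_open goodD)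

text \<open>The stabilizer in \<open>H\<close> of the coset \<open>lc r\<close>. Its subgroup
  \<open>HD r\<close> is the one by which the values of the zeta element are justified.\<close>

definition Hs :: "'e^4^4 \<Rightarrow> (('e^2^2) \<times> ('e^2^2)) set" where
  "Hs r = {h \<in> carrier H. matrix_inv r ** \<iota> h ** r \<in> K}"

definition HD :: "'e^4^4 \<Rightarrow> (('e^2^2) \<times> ('e^2^2)) set" where
  "HD r = {h \<in> Hs r. \<nu> h \<in> D}"

lemma conj_mult: "r \<in> carrier G \<Longrightarrow> matrix_inv r ** (a ** b) ** r = (matrix_inv r ** a ** r) ** (matrix_inv r ** b ** r)"
proof -
  assume r: "r \<in> carrier G"
  have "(matrix_inv r ** a ** r) ** (matrix_inv r ** b ** r) = matrix_inv r ** a ** (r ** matrix_inv r) ** b ** r"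
    by (simp only: matrix_mul_assoc)
  then show ?thesis using GU_inv_cancel(2)[OF herm_J4 r] by (simp add: matrix_mul_assoc)
qed

lemma Hs_subgroup:
  assumes r: "r \<in> carrier G" shows "subgroup (Hs r) H"
proof (rule HG.subgroupI)
  show "Hs r \<subseteq> carrier H" by (auto simp: Hs_def)
  have "\<one>\<^bsub>H\<^esub> \<in> Hs r" using GU_inv_cancel(1)[OF herm_J4 r] K_one by (simp add: Hs_def iota_one)
  then show "Hs r \<noteq> {}" by blast
  fix a assume a: "a \<in> Hs r"
  then have aH: "a \<in> carrier H" by (simp add: Hs_def)
  have "(matrix_inv r ** \<iota> a ** r) ** (matrix_inv r ** \<iota> (inv\<^bsub>H\<^esub> a) ** r) = mat 1"
    using conj_mult[OF r, of "\<iota> a" "\<iota> (inv\<^bsub>H\<^esub> a)"] aH GU_inv_cancel(1)[OF herm_J4 r]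
    by (simp add: iota_hom[symmetric] iota_one)
  then have "matrix_inv (matrix_inv r ** \<iota> a ** r) = matrix_inv r ** \<iota> (inv\<^bsub>H\<^esub> a) ** r" by (rule matrix_inv_unique)
  then have "matrix_inv r ** \<iota> (inv\<^bsub>H\<^esub> a) ** r \<in> K" using a K_inv by (metis (no_types, lifting) Hs_def mem_Collect_eq)
  then show "inv\<^bsub>H\<^esub> a \<in> Hs r" using aH by (simp add: Hs_def)
  fix b assume b: "b \<in> Hs r"
  then show "a \<otimes>\<^bsub>H\<^esub> b \<in> Hs r" using a conj_mult[OF r, of "\<iota> a" "\<iota> b"] K_mult by (simp add: Hs_def iota_hom)
qed

lemma det_near: "intmat 1 (h - mat 1) \<Longrightarrow> det (h :: 'e^2^2) - 1 \<in> idl 1"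
proof -
  assume h: "intmat 1 (h - mat 1)"
  have e: "h$1$1 - 1 \<in> idl 1" "h$2$2 - 1 \<in> idl 1" "h$1$2 \<in> idl 1" "h$2$1 \<in> idl 1"
    using intmatD[OF h, of 1 1] intmatD[OF h, of 2 2] intmatD[OF h, of 1 2] intmatD[OF h, of 2 1] by (simp_all add: mat_def)
  have 0: "h$2$2 \<in> idl 0" "h$2$1 \<in> idl 0"
    using idl_near[OF e(2), of 0] idl_near[of "h$2$1" 0 1 0] e by simp_all
  have "h$1$1 * h$2$2 - 1 * 1 \<in> idl 1" using e 0 by (intro idl_cong_mult) auto
  moreover have "h$1$2 * h$2$1 \<in> idl 1" using e 0 by (intro idl_mult0')
  ultimately have "h$1$1 * h$2$2 - 1 * 1 - h$1$2 * h$2$1 \<in> idl 1" by (rule idl_diff)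
  then show ?thesis by (simp add: det_2 algebra_simps)
qed

lemma nu_near:
  assumes "h \<in> carrier H" "intmat 1 (\<iota> h - mat 1)" shows "\<nu> h \<in> D"
proof -
  have m1: "mat 1 = \<iota> (mat 1, mat 1)" by (simp add: iota_mat)
  have "intmat 1 (fst h - mat 1)" "intmat 1 (snd h - mat 1)"
    using assms(2) unfolding m1 intmat_iota_diff by simp_all
  then have d: "det (fst h) - 1 \<in> idl 1" "det (snd h) - 1 \<in> idl 1" using det_near by blast+
  then have "det (fst h) \<noteq> 0" "v (det (fst h)) = 0" using v_cong[of "det (fst h)" 1 1] by simp_all
  moreover have "det (snd h) - det (fst h) \<in> idl 1" using idl_diff[OF d(2,1)] by simp
  moreover have "\<nu> h - 1 = (det (snd h) - det (fst h)) / det (fst h)" using calculation by (simp add: \<nu>_def case_prod_beta diff_divide_distrib)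
  ultimately have "\<nu> h - 1 \<in> idl 1" by (simp add: idl_divide_iff)
  then show ?thesis using nu_in_C[OF assms(1)] by (simp add: D_eq)
qed

lemma Hs_near:
  assumes r: "r \<in> carrier G"
  shows "\<exists>n. \<forall>h\<in>carrier H. intmat n (\<iota> h - mat 1) \<longrightarrow> h \<in> Hs r"
proof -
  obtain a where a: "intmat a r" using intmat_ex by blast
  obtain b where b: "intmat b (matrix_inv r)" using intmat_ex by blast
  show ?thesis
  proof (intro exI[of _ "1 - a - b"] ballI impI)
    fix h assume h: "h \<in> carrier H" "intmat (1 - a - b) (\<iota> h - mat 1)"
    have "intmat (b + (1 - a - b) + a) (matrix_inv r ** (\<iota> h - mat 1) ** r)" using intmat_mult[OF intmat_mult[OF b h(2)] a] .
    moreover have "matrix_inv r ** (\<iota> h - mat 1) ** r = matrix_inv r ** \<iota> h ** r - mat 1"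
      using GU_inv_cancel(1)[OF herm_J4 r] by (simp add: mat_diff_left mat_diff_right)
    ultimately have "intmat 1 (matrix_inv r ** \<iota> h ** r - mat 1)" by simp
    then have "matrix_inv r ** \<iota> h ** r \<in> K"
      using K_near[OF _ K_one] G_mult GU_inv_closed[OF herm_J4 r] iota_G[OF h(1)] r by simp
    then show "h \<in> Hs r" using h by (simp add: Hs_def)
  qed
qed

lemma Hs_bounded:
  assumes r: "r \<in> carrier G" shows "\<exists>m. \<forall>h\<in>Hs r. \<iota> h \<in> Xb m 0"
proof -
  obtain a where a: "intmat a r" using intmat_ex by blast
  obtain b where b: "intmat b (matrix_inv r)" using intmat_ex by blast
  have rr: "r ** matrix_inv r = mat 1" "matrix_inv r \<in> carrier G" using GU_inv_cancel(2)[OF herm_J4 r] GU_inv_closed[OF herm_J4 r] by auto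
  show ?thesis
  proof (intro exI[of _ "a + 0 + b"] ballI)
    fix h assume h: "h \<in> Hs r"
    define k where "k = matrix_inv r ** \<iota> h ** r"
    have k: "k \<in> K" using h by (simp add: Hs_def k_def)
    have "r ** k ** matrix_inv r = (r ** matrix_inv r) ** \<iota> h ** (r ** matrix_inv r)" by (simp only: k_def matrix_mul_assoc)
    then have e: "\<iota> h = r ** k ** matrix_inv r" using rr by simp
    have "intmat (a + 0 + b) (\<iota> h)" unfolding e using intmat_mult[OF intmat_mult[OF a K_int[OF k]] b] .
    moreover have "sim J4 (\<iota> h) = sim J4 r * sim J4 k * inverse (sim J4 r)"
      unfolding e using r rr(2) K_G[OF k] G_mult by (simp add: sim_mult sim_inv)
    then have "sim J4 (\<iota> h) = sim J4 k" using sim_nonzero[OF herm_J4 r] by simp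
    ultimately show "\<iota> h \<in> Xb (a + 0 + b) 0" using h K_sim[OF k] iota_G by (simp add: Xb_def Hs_def)
  qed
qed

lemma good_Hs: "r \<in> carrier G \<Longrightarrow> good (Hs r)"
  unfolding good_def using Hs_subgroup Hs_near Hs_bounded by blast

lemma D_mult: "s \<in> D \<Longrightarrow> t \<in> D \<Longrightarrow> s * t \<in> D"
  and D_inverse: "t \<in> D \<Longrightarrow> inverse t \<in> D" and D_sub_C: "D \<subseteq> C"
proof -
  have 0: "x \<in> idl 0" if "x \<in> C" for x using C_D(3)[OF that] by (rule idl_self)
  show "s * t \<in> D" if "s \<in> D" "t \<in> D"
    using that idl_cong_mult[of s 1 1 t 1] C_mult 0 by (auto simp: D_eq)
  show "inverse t \<in> D" if t: "t \<in> D"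
  proof -
    have "t \<noteq> 0" "v t = 0" using t C_D by (auto simp: D_eq)
    moreover have "inverse t - 1 = (1 - t) / t" using \<open>t \<noteq> 0\<close> by (simp add: field_simps)
    ultimately show ?thesis using t idl_commute[of t 1 1] C_inverse by (auto simp: D_eq idl_divide_iff)
  qed
  show "D \<subseteq> C" by (auto simp: D_eq)
qed

lemma nu_one: "\<nu> \<one>\<^bsub>H\<^esub> = 1"
  by (simp add: \<nu>_def H_one)

lemma nu_inv: "h \<in> carrier H \<Longrightarrow> \<nu> (inv\<^bsub>H\<^esub> h) = inverse (\<nu> h)"
proof -
  assume h: "h \<in> carrier H"
  have "\<nu> h * \<nu> (inv\<^bsub>H\<^esub> h) = 1" using nu_mult[of h "inv\<^bsub>H\<^esub> h"] h by (simp add: nu_one)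
  then show ?thesis by (metis inverse_unique)
qed

lemma good_HD:
  assumes r: "r \<in> carrier G" shows "good (HD r)"
  unfolding good_def
proof (intro conjI)
  note sub = Hs_subgroup[OF r]
  show "subgroup (HD r) H"
  proof (rule HG.subgroupI)
    show "HD r \<subseteq> carrier H" by (auto simp: HD_def Hs_def)
    have "\<one>\<^bsub>H\<^esub> \<in> HD r" using subgroup.one_closed[OF sub] by (simp add: HD_def nu_one D_eq)
    then show "HD r \<noteq> {}" by blast
    fix a assume a: "a \<in> HD r"
    then show "inv\<^bsub>H\<^esub> a \<in> HD r" using subgroup.m_inv_closed[OF sub] D_inverse nu_inv
      by (auto simp: HD_def) (simp add: Hs_def nu_inv D_inverse)
    fix b assume "b \<in> HD r"
    then show "a \<otimes>\<^bsub>H\<^esub> b \<in> HD r" using a subgroup.m_closed[OF sub] D_mult by (simp add: HD_def nu_mult)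
  qed
  show "\<exists>m. \<forall>h\<in>HD r. \<iota> h \<in> Xb m 0" using Hs_bounded[OF r] by (auto simp: HD_def)
  obtain n where n: "\<forall>h\<in>carrier H. intmat n (\<iota> h - mat 1) \<longrightarrow> h \<in> Hs r" using Hs_near[OF r] by blast
  have "h \<in> HD r" if h: "h \<in> carrier H" "intmat (max n 1) (\<iota> h - mat 1)" for h
    using n nu_near[OF h(1)] h intmat_mono[OF h(2), of n] intmat_mono[OF h(2), of 1] by (simp add: HD_def)
  then show "\<exists>n. \<forall>h\<in>carrier H. intmat n (\<iota> h - mat 1) \<longrightarrow> h \<in> HD r" by blast
qed

lemma good_Int: assumes "good V" "good W" shows "good (V \<inter> W)"
  unfolding good_def
proof (intro conjI)
  show "subgroup (V \<inter> W) H" using assms goodD(1) HG.subgroups_Inter_pair by blast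
  show "\<exists>m. \<forall>h\<in>V \<inter> W. \<iota> h \<in> Xb m 0" using assms(1) by (auto simp: good_def)
  obtain n where n: "\<forall>h\<in>carrier H. intmat n (\<iota> h - mat 1) \<longrightarrow> h \<in> V" using assms(1) by (auto simp: good_def)
  obtain m where m: "\<forall>h\<in>carrier H. intmat m (\<iota> h - mat 1) \<longrightarrow> h \<in> W" using assms(2) by (auto simp: good_def)
  have "h \<in> V \<inter> W" if h: "h \<in> carrier H" "intmat (max n m) (\<iota> h - mat 1)" for h
    using n m h intmat_mono[OF h(2), of n] intmat_mono[OF h(2), of m] by simp
  then show "\<exists>n. \<forall>h\<in>carrier H. intmat n (\<iota> h - mat 1) \<longrightarrow> h \<in> V \<inter> W" by blast
qed

lemma U_eq: "U = Hs (mat 1)"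
proof -
  have "matrix_inv (mat 1) = (mat 1 :: 'e^4^4)" by (rule matrix_inv_unique) simp
  then show ?thesis by (simp add: U_def Hs_def)
qed

lemma one_G: "mat 1 \<in> carrier G"
  using GU_one_closed[OF herm_J4] by simp

lemma good_U: "good U"
  unfolding U_eq by (rule good_Hs[OF one_G])

text \<open>The conjugate \<open>h^-1 V h\<close>, written as a preimage; by \<open>cj_Hs\<close> it
  is again a stabilizer when \<open>V\<close> is one.\<close>

definition cj :: "('e^2^2) \<times> ('e^2^2) \<Rightarrow> (('e^2^2) \<times> ('e^2^2)) set \<Rightarrow> (('e^2^2) \<times> ('e^2^2)) set" where
  "cj h V = {x \<in> carrier H. h \<otimes>\<^bsub>H\<^esub> x \<otimes>\<^bsub>H\<^esub> inv\<^bsub>H\<^esub> h \<in> V}"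

lemma cj_Hs:
  assumes "h \<in> carrier H" "r \<in> carrier G"
  shows "cj h (Hs r) = Hs (matrix_inv (\<iota> h) ** r)"
proof -
  have hG: "\<iota> h \<in> carrier G" using assms iota_G by blast
  have "matrix_inv (matrix_inv (\<iota> h) ** r) = matrix_inv r ** \<iota> h"
  proof (rule matrix_inv_unique)
    have "(matrix_inv (\<iota> h) ** r) ** (matrix_inv r ** \<iota> h) = matrix_inv (\<iota> h) ** (r ** matrix_inv r) ** \<iota> h"
      by (simp only: matrix_mul_assoc)
    then show "(matrix_inv (\<iota> h) ** r) ** (matrix_inv r ** \<iota> h) = mat 1"
      using GU_inv_cancel[OF herm_J4 assms(2)] GU_inv_cancel[OF herm_J4 hG] by simp
  qed
  then show ?thesis
    unfolding cj_def Hs_def using assms(1) by (auto simp: iota_hom iota_inv[OF assms(1)] matrix_mul_assoc)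
qed

lemma finite_index:
  assumes "good V" "good W" "W \<subseteq> V"
  shows "finite ((\<lambda>x. x <#\<^bsub>H\<^esub> W) ` V)"
proof -
  have VH: "V \<subseteq> carrier H" and WH: "subgroup W H" using assms goodD by blast+
  have op: "openin H_top (x <#\<^bsub>H\<^esub> W)" if x: "x \<in> V" for x
  proof (rule open_right_inv[OF assms(2)])
    show "x <#\<^bsub>H\<^esub> W \<subseteq> carrier H" using HG.l_coset_subset_G[OF goodD(2)[OF assms(2)], of x] x VH by blast
    fix s w assume "s \<in> x <#\<^bsub>H\<^esub> W" "w \<in> W"
    then obtain w' where w: "w' \<in> W" "s = x \<otimes>\<^bsub>H\<^esub> w'" "w \<in> W" by (auto simp: l_coset_def)
    then have "w' \<in> carrier H" "w \<in> carrier H" "x \<in> carrier H" using x VH goodD(2)[OF assms(2)] by blast+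
    then have "s \<otimes>\<^bsub>H\<^esub> w = x \<otimes>\<^bsub>H\<^esub> (w' \<otimes>\<^bsub>H\<^esub> w)" using w by (simp add: HG.m_assoc)
    then have "\<exists>k\<in>W. s \<otimes>\<^bsub>H\<^esub> w = x \<otimes>\<^bsub>H\<^esub> k" by (rule bexI[OF _ subgroup.m_closed[OF WH w(1,3)]])
    then show "s \<otimes>\<^bsub>H\<^esub> w \<in> x <#\<^bsub>H\<^esub> W" by (simp add: l_coset_def)
  qed
  have self: "x \<in> x <#\<^bsub>H\<^esub> W" if "x \<in> V" for x
    using that VH subgroup.one_closed[OF WH] by (force simp: l_coset_def)
  have "\<exists>\<F>. finite \<F> \<and> \<F> \<subseteq> (\<lambda>x. x <#\<^bsub>H\<^esub> W) ` V \<and> V \<subseteq> \<Union>\<F>"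
  proof -
    let ?\<U> = "(\<lambda>x. x <#\<^bsub>H\<^esub> W) ` V"
    have "Ball ?\<U> (openin H_top)" "V \<subseteq> \<Union>?\<U>" using op self by blast+
    then show ?thesis using good_compact[OF assms(1)] unfolding compactin_def by simp
  qed
  then obtain \<F> where \<F>: "finite \<F>" "\<F> \<subseteq> (\<lambda>x. x <#\<^bsub>H\<^esub> W) ` V" "V \<subseteq> \<Union>\<F>" by blast
  have "(\<lambda>x. x <#\<^bsub>H\<^esub> W) ` V \<subseteq> \<F>"
  proof clarify
    fix x assume x: "x \<in> V"
    then obtain A where A: "A \<in> \<F>" "x \<in> A" using \<F> by blast
    then obtain y where y: "y \<in> V" "A = y <#\<^bsub>H\<^esub> W" using \<F> by blast
    have "y <#\<^bsub>H\<^esub> W = x <#\<^bsub>H\<^esub> W" by (rule HG.l_repr_independence[OF _ _ WH]) (use A y VH in auto)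
    then show "x <#\<^bsub>H\<^esub> W \<in> \<F>" using A y by simp
  qed
  then show ?thesis using \<F>(1) finite_subset by blast
qed

end

section \<open>Haar measure and unimodularity\<close>

locale odd_unramified_haar = odd_unramified_extension F v \<gamma> \<pi>
  for F :: "'e::field_char_0 set" and v and \<gamma> and \<pi> +
  fixes \<mu> :: "(('e^2^2) \<times> ('e^2^2)) measure"
  assumes haar: "left_haar_measure H_top H \<mu>"
begin

interpretation HG: group H by (rule H_group)

lemma open_sets: "openin H_top S \<Longrightarrow> S \<in> sets \<mu>"
  using haar by (auto simp: left_haar_measure_def)

lemma haar_left: "A \<in> sets \<mu> \<Longrightarrow> g \<in> carrier H \<Longrightarrow> emeasure \<mu> (g <#\<^bsub>H\<^esub> A) = emeasure \<mu> A"
  using haar by (auto simp: left_haar_measure_def)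

lemma space_haar: "space \<mu> = carrier H"
  using haar by (auto simp: left_haar_measure_def)

lemma good_sets: "good V \<Longrightarrow> V \<in> sets \<mu>"
  using good_open open_sets by blast

lemma good_finite: "good V \<Longrightarrow> emeasure \<mu> V < \<infinity>"
  using haar good_compact by (auto simp: left_haar_measure_def)

lemma good_measure_pos: "good V \<Longrightarrow> 0 < measure \<mu> V"
proof -
  assume V: "good V"
  have "0 < emeasure \<mu> V" using haar good_open[OF V] goodD(3)[OF V] by (auto simp: left_haar_measure_def)
  then show ?thesis using good_finite[OF V] by (simp add: measure_def enn2real_positive_iff top.not_eq_extremum)
qed

lemma lcoset_open: "good W \<Longrightarrow> x \<in> carrier H \<Longrightarrow> openin H_top (x <#\<^bsub>H\<^esub> W)"
proof (rule open_right_inv[of W])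
  assume W: "good W" and x: "x \<in> carrier H"
  then show "x <#\<^bsub>H\<^esub> W \<subseteq> carrier H" using HG.l_coset_subset_G goodD(2) by blast
  fix s w assume "s \<in> x <#\<^bsub>H\<^esub> W" "w \<in> W"
  then obtain w' where w: "w' \<in> W" "s = x \<otimes>\<^bsub>H\<^esub> w'" "w \<in> W" by (auto simp: l_coset_def)
  then have "w' \<in> carrier H" "w \<in> carrier H" using goodD(2)[OF W] by auto
  then have "s \<otimes>\<^bsub>H\<^esub> w = x \<otimes>\<^bsub>H\<^esub> (w' \<otimes>\<^bsub>H\<^esub> w)" using x w by (simp add: HG.m_assoc)
  then have "\<exists>k\<in>W. s \<otimes>\<^bsub>H\<^esub> w = x \<otimes>\<^bsub>H\<^esub> k" by (rule bexI[OF _ subgroup.m_closed[OF goodD(1)[OF W] w(1,3)]])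
  then show "s \<otimes>\<^bsub>H\<^esub> w \<in> x <#\<^bsub>H\<^esub> W" by (simp add: l_coset_def)
qed

lemma lcoset_measure:
  assumes "good W" "x \<in> carrier H"
  shows "x <#\<^bsub>H\<^esub> W \<in> sets \<mu>" "emeasure \<mu> (x <#\<^bsub>H\<^esub> W) < \<infinity>" "measure \<mu> (x <#\<^bsub>H\<^esub> W) = measure \<mu> W"
  using open_sets[OF lcoset_open[OF assms]] haar_left[OF good_sets[OF assms(1)] assms(2)] good_finite[OF assms(1)]
  by (simp_all add: measure_def)

definition idx :: "(('e^2^2) \<times> ('e^2^2)) set \<Rightarrow> (('e^2^2) \<times> ('e^2^2)) set \<Rightarrow> nat" where
  "idx V W = card ((\<lambda>x. x <#\<^bsub>H\<^esub> W) ` V)"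

lemma lcosets_disjoint:
  assumes "good W" "x \<in> carrier H" "y \<in> carrier H" "x <#\<^bsub>H\<^esub> W \<noteq> y <#\<^bsub>H\<^esub> W"
  shows "(x <#\<^bsub>H\<^esub> W) \<inter> (y <#\<^bsub>H\<^esub> W) = {}"
  using HG.l_repr_independence[OF _ _ goodD(1)[OF assms(1)]] assms by blast

lemma measure_idx:
  assumes V: "good V" and W: "good W" and sub: "W \<subseteq> V"
  shows "measure \<mu> V = real (idx V W) * measure \<mu> W"
proof -
  let ?S = "(\<lambda>x. x <#\<^bsub>H\<^esub> W) ` V"
  have VH: "V \<subseteq> carrier H" using goodD V by blast
  have fin: "finite ?S" by (rule finite_index[OF V W sub])
  have un: "(\<Union>A\<in>?S. A) = V"
  proof (intro equalityI subsetI)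
    fix y assume "y \<in> (\<Union>A\<in>?S. A)"
    then show "y \<in> V" using sub subgroup.m_closed[OF goodD(1)[OF V]] by (auto simp: l_coset_def)
  next
    fix y assume "y \<in> V"
    moreover have "y \<in> y <#\<^bsub>H\<^esub> W" using calculation VH goodD(3)[OF W] by (force simp: l_coset_def)
    ultimately show "y \<in> (\<Union>A\<in>?S. A)" by blast
  qed
  have "measure \<mu> (\<Union>A\<in>?S. A) = (\<Sum>A\<in>?S. measure \<mu> A)"
  proof (rule measure_finite_Union[OF fin])
    show "(\<lambda>A. A) ` ?S \<subseteq> sets \<mu>" using lcoset_measure(1)[OF W] VH by auto
    show "disjoint_family_on (\<lambda>A. A) ?S"
      using lcosets_disjoint[OF W] VH unfolding disjoint_family_on_def by blast
    show "emeasure \<mu> A \<noteq> \<infinity>" if "A \<in> ?S" for A using that lcoset_measure(2)[OF W] VH by (auto simp: less_top)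
  qed
  also have "\<dots> = (\<Sum>A\<in>?S. measure \<mu> W)" using lcoset_measure(3)[OF W] VH by (intro sum.cong) auto
  finally show ?thesis unfolding un by (simp add: idx_def)
qed

lemma cj_inj: "h \<in> carrier H \<Longrightarrow> A \<subseteq> carrier H \<Longrightarrow> B \<subseteq> carrier H \<Longrightarrow> cj h A = cj h B \<Longrightarrow> A = B"
proof -
  assume h: "h \<in> carrier H" and AB: "A \<subseteq> carrier H" "B \<subseteq> carrier H" and e: "cj h A = cj h B"
  have "x \<in> A \<longleftrightarrow> inv\<^bsub>H\<^esub> h \<otimes>\<^bsub>H\<^esub> x \<otimes>\<^bsub>H\<^esub> h \<in> cj h A" if "x \<in> carrier H" for x A
  proof -
    have "h \<otimes>\<^bsub>H\<^esub> (inv\<^bsub>H\<^esub> h \<otimes>\<^bsub>H\<^esub> x \<otimes>\<^bsub>H\<^esub> h) \<otimes>\<^bsub>H\<^esub> inv\<^bsub>H\<^esub> h = x"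
      using that h by (simp add: HG.m_assoc) (simp add: HG.m_assoc[symmetric])
    then show ?thesis using that h by (simp add: cj_def)
  qed
  then show "A = B" using AB unfolding e by (metis (no_types, lifting) subsetD subset_antisym subsetI e)
qed

lemma cj_lcoset:
  assumes h: "h \<in> carrier H" and x: "x \<in> carrier H" and W: "W \<subseteq> carrier H"
  shows "cj h (x <#\<^bsub>H\<^esub> W) = (inv\<^bsub>H\<^esub> h \<otimes>\<^bsub>H\<^esub> x \<otimes>\<^bsub>H\<^esub> h) <#\<^bsub>H\<^esub> cj h W"
proof (intro equalityI subsetI)
  fix y assume "y \<in> cj h (x <#\<^bsub>H\<^esub> W)"
  then obtain w where y: "y \<in> carrier H" "w \<in> W" "h \<otimes>\<^bsub>H\<^esub> y \<otimes>\<^bsub>H\<^esub> inv\<^bsub>H\<^esub> h = x \<otimes>\<^bsub>H\<^esub> w"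
    by (auto simp: cj_def l_coset_def)
  have w: "w \<in> carrier H" using y W by blast
  let ?z = "inv\<^bsub>H\<^esub> h \<otimes>\<^bsub>H\<^esub> w \<otimes>\<^bsub>H\<^esub> h"
  have "h \<otimes>\<^bsub>H\<^esub> ?z \<otimes>\<^bsub>H\<^esub> inv\<^bsub>H\<^esub> h = w" using w h by (simp add: HG.m_assoc) (simp add: HG.m_assoc[symmetric])
  then have "?z \<in> cj h W" using y w h by (simp add: cj_def)
  moreover have "y = (inv\<^bsub>H\<^esub> h \<otimes>\<^bsub>H\<^esub> x \<otimes>\<^bsub>H\<^esub> h) \<otimes>\<^bsub>H\<^esub> ?z"
  proof -
    have "y = inv\<^bsub>H\<^esub> h \<otimes>\<^bsub>H\<^esub> (h \<otimes>\<^bsub>H\<^esub> y \<otimes>\<^bsub>H\<^esub> inv\<^bsub>H\<^esub> h) \<otimes>\<^bsub>H\<^esub> h"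
      using y(1) h by (simp add: HG.m_assoc) (simp add: HG.m_assoc[symmetric])
    also have "\<dots> = inv\<^bsub>H\<^esub> h \<otimes>\<^bsub>H\<^esub> (x \<otimes>\<^bsub>H\<^esub> w) \<otimes>\<^bsub>H\<^esub> h" by (simp only: y(3))
    also have "\<dots> = (inv\<^bsub>H\<^esub> h \<otimes>\<^bsub>H\<^esub> x \<otimes>\<^bsub>H\<^esub> h) \<otimes>\<^bsub>H\<^esub> ?z"
      using x w h by (simp add: HG.m_assoc) (simp add: HG.m_assoc[symmetric])
    finally show ?thesis .
  qed
  ultimately show "y \<in> (inv\<^bsub>H\<^esub> h \<otimes>\<^bsub>H\<^esub> x \<otimes>\<^bsub>H\<^esub> h) <#\<^bsub>H\<^esub> cj h W" by (auto simp: l_coset_def)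
next
  fix y assume "y \<in> (inv\<^bsub>H\<^esub> h \<otimes>\<^bsub>H\<^esub> x \<otimes>\<^bsub>H\<^esub> h) <#\<^bsub>H\<^esub> cj h W"
  then obtain z where z: "z \<in> carrier H" "h \<otimes>\<^bsub>H\<^esub> z \<otimes>\<^bsub>H\<^esub> inv\<^bsub>H\<^esub> h \<in> W" "y = inv\<^bsub>H\<^esub> h \<otimes>\<^bsub>H\<^esub> x \<otimes>\<^bsub>H\<^esub> h \<otimes>\<^bsub>H\<^esub> z"
    by (auto simp: cj_def l_coset_def)
  have "h \<otimes>\<^bsub>H\<^esub> y \<otimes>\<^bsub>H\<^esub> inv\<^bsub>H\<^esub> h = x \<otimes>\<^bsub>H\<^esub> (h \<otimes>\<^bsub>H\<^esub> z \<otimes>\<^bsub>H\<^esub> inv\<^bsub>H\<^esub> h)"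
    using z x h by (simp add: HG.m_assoc) (simp add: HG.m_assoc[symmetric])
  then show "y \<in> cj h (x <#\<^bsub>H\<^esub> W)" using z x h by (auto simp: cj_def l_coset_def)
qed

lemma idx_cj:
  assumes h: "h \<in> carrier H" and V: "V \<subseteq> carrier H" and W: "W \<subseteq> carrier H"
  shows "idx (cj h V) (cj h W) = idx V W"
proof -
  have im: "(\<lambda>x. x <#\<^bsub>H\<^esub> cj h W) ` cj h V = cj h ` ((\<lambda>x. x <#\<^bsub>H\<^esub> W) ` V)"
  proof (intro equalityI subsetI)
    fix A assume "A \<in> (\<lambda>x. x <#\<^bsub>H\<^esub> cj h W) ` cj h V"
    then obtain y where y: "y \<in> carrier H" "h \<otimes>\<^bsub>H\<^esub> y \<otimes>\<^bsub>H\<^esub> inv\<^bsub>H\<^esub> h \<in> V" "A = y <#\<^bsub>H\<^esub> cj h W" by (auto simp: cj_def)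
    have "inv\<^bsub>H\<^esub> h \<otimes>\<^bsub>H\<^esub> (h \<otimes>\<^bsub>H\<^esub> y \<otimes>\<^bsub>H\<^esub> inv\<^bsub>H\<^esub> h) \<otimes>\<^bsub>H\<^esub> h = y"
      using y h by (simp add: HG.m_assoc) (simp add: HG.m_assoc[symmetric])
    then have "A = cj h ((h \<otimes>\<^bsub>H\<^esub> y \<otimes>\<^bsub>H\<^esub> inv\<^bsub>H\<^esub> h) <#\<^bsub>H\<^esub> W)" using cj_lcoset[OF h _ W, of "h \<otimes>\<^bsub>H\<^esub> y \<otimes>\<^bsub>H\<^esub> inv\<^bsub>H\<^esub> h"] y h by simp
    then show "A \<in> cj h ` ((\<lambda>x. x <#\<^bsub>H\<^esub> W) ` V)" using y by blast
  next
    fix A assume "A \<in> cj h ` ((\<lambda>x. x <#\<^bsub>H\<^esub> W) ` V)"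
    then obtain x where x: "x \<in> V" "A = cj h (x <#\<^bsub>H\<^esub> W)" by blast
    have xH: "x \<in> carrier H" using x V by blast
    have "h \<otimes>\<^bsub>H\<^esub> (inv\<^bsub>H\<^esub> h \<otimes>\<^bsub>H\<^esub> x \<otimes>\<^bsub>H\<^esub> h) \<otimes>\<^bsub>H\<^esub> inv\<^bsub>H\<^esub> h = x"
      using xH h by (simp add: HG.m_assoc) (simp add: HG.m_assoc[symmetric])
    then have "inv\<^bsub>H\<^esub> h \<otimes>\<^bsub>H\<^esub> x \<otimes>\<^bsub>H\<^esub> h \<in> cj h V" using x xH h by (simp add: cj_def)
    then show "A \<in> (\<lambda>x. x <#\<^bsub>H\<^esub> cj h W) ` cj h V" using x cj_lcoset[OF h xH W] by blast
  qed
  have "inj_on (cj h) ((\<lambda>x. x <#\<^bsub>H\<^esub> W) ` V)"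
  proof (rule inj_onI)
    fix A B assume "A \<in> (\<lambda>x. x <#\<^bsub>H\<^esub> W) ` V" "B \<in> (\<lambda>x. x <#\<^bsub>H\<^esub> W) ` V" "cj h A = cj h B"
    moreover have "A \<subseteq> carrier H" "B \<subseteq> carrier H" using calculation HG.l_coset_subset_G[OF W] V by blast+
    ultimately show "A = B" using cj_inj h by blast
  qed
  then show ?thesis unfolding idx_def im by (rule card_image)
qed

lemma good_cj_Hs: "h \<in> carrier H \<Longrightarrow> r \<in> carrier G \<Longrightarrow> good (cj h (Hs r))"
  using cj_Hs good_Hs G_mult GU_inv_closed[OF herm_J4] iota_G by simp

text \<open>Conjugation preserves indices. Comparing \<open>Hs r\<close> and \<open>U\<close> with
  their intersection shows that it scales the measures of both by the same factor, which makes
  \<open>modular\<close> multiplicative.\<close>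

lemma cj_ratio:
  assumes h: "h \<in> carrier H" and r: "r \<in> carrier G"
  shows "measure \<mu> (cj h (Hs r)) * measure \<mu> U = measure \<mu> (Hs r) * measure \<mu> (cj h U)"
proof -
  define V W where "V = Hs r" "W = V \<inter> U"
  have g: "good V" "good U" "good W" "good (cj h V)" "good (cj h U)"
    unfolding V_W_def using good_Hs[OF r] good_U good_Int good_cj_Hs[OF h r] good_cj_Hs[OF h one_G] U_eq by auto
  have W: "W \<subseteq> V" "W \<subseteq> U" by (auto simp: V_W_def)
  have cW: "cj h W = cj h V \<inter> cj h U" by (auto simp: cj_def V_W_def)
  then have gW: "good (cj h W)" using g good_Int by simp
  have c: "cj h W \<subseteq> cj h V" "cj h W \<subseteq> cj h U" using cW by auto
  have H: "V \<subseteq> carrier H" "U \<subseteq> carrier H" "W \<subseteq> carrier H" using g goodD by blast+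
  have "measure \<mu> V = idx V W * measure \<mu> W" "measure \<mu> U = idx U W * measure \<mu> W"
    "measure \<mu> (cj h V) = idx V W * measure \<mu> (cj h W)" "measure \<mu> (cj h U) = idx U W * measure \<mu> (cj h W)"
    using measure_idx[OF g(1,3) W(1)] measure_idx[OF g(2,3) W(2)] measure_idx[OF g(4) gW c(1)] measure_idx[OF g(5) gW c(2)]
      idx_cj[OF h H(1,3)] idx_cj[OF h H(2,3)] by simp_all
  then show ?thesis by (simp add: V_W_def(1))
qed

definition modular :: "('e^2^2) \<times> ('e^2^2) \<Rightarrow> real" where
  "modular h = measure \<mu> (cj h U) / measure \<mu> U"

lemma U_pos: "0 < measure \<mu> U"
  by (rule good_measure_pos[OF good_U])

lemma modular_mult:
  assumes "h \<in> carrier H" "h' \<in> carrier H"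
  shows "modular (h \<otimes>\<^bsub>H\<^esub> h') = modular h * modular h'"
proof -
  have c: "cj h U = Hs (matrix_inv (\<iota> h))" unfolding U_eq using cj_Hs[OF assms(1) one_G] by simp
  have G: "matrix_inv (\<iota> h) \<in> carrier G" using assms iota_G GU_inv_closed[OF herm_J4] by blast
  have "cj (h \<otimes>\<^bsub>H\<^esub> h') U = cj h' (cj h U)"
    using assms by (auto simp: cj_def HG.inv_mult_group HG.m_assoc)
  then have "measure \<mu> (cj (h \<otimes>\<^bsub>H\<^esub> h') U) * measure \<mu> U = measure \<mu> (cj h U) * measure \<mu> (cj h' U)"
    using cj_ratio[OF assms(2) G] c by simp
  then show ?thesis using U_pos by (simp add: modular_def field_simps)
qed

lemma modular_U: "u \<in> U \<Longrightarrow> modular u = 1"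
proof -
  assume u: "u \<in> U"
  note sub = goodD(1)[OF good_U]
  have uH: "u \<in> carrier H" using u goodD(2)[OF good_U] by blast
  have "x \<in> cj u U \<longleftrightarrow> x \<in> U" for x
  proof
    assume "x \<in> cj u U"
    then have x: "x \<in> carrier H" "u \<otimes>\<^bsub>H\<^esub> x \<otimes>\<^bsub>H\<^esub> inv\<^bsub>H\<^esub> u \<in> U" by (auto simp: cj_def)
    then have "inv\<^bsub>H\<^esub> u \<otimes>\<^bsub>H\<^esub> (u \<otimes>\<^bsub>H\<^esub> x \<otimes>\<^bsub>H\<^esub> inv\<^bsub>H\<^esub> u) \<otimes>\<^bsub>H\<^esub> u \<in> U"
      using u sub by (simp add: subgroup.m_closed subgroup.m_inv_closed)
    moreover have "inv\<^bsub>H\<^esub> u \<otimes>\<^bsub>H\<^esub> (u \<otimes>\<^bsub>H\<^esub> x \<otimes>\<^bsub>H\<^esub> inv\<^bsub>H\<^esub> u) \<otimes>\<^bsub>H\<^esub> u = x"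
      using x uH by (simp add: HG.m_assoc) (simp add: HG.m_assoc[symmetric])
    ultimately show "x \<in> U" by simp
  next
    assume "x \<in> U"
    then show "x \<in> cj u U" using u sub goodD(2)[OF good_U] by (auto simp: cj_def subgroup.m_closed subgroup.m_inv_closed)
  qed
  then have "cj u U = U" by blast
  then show ?thesis using U_pos by (simp add: modular_def)
qed

lemma centre_H: "c \<in> F \<Longrightarrow> c \<noteq> 0 \<Longrightarrow> (mat c, mat c) \<in> carrier H"
  using is_sim_mat H_iff by blast

lemma modular_centre:
  assumes c: "c \<in> F" "c \<noteq> 0" shows "modular (mat c, mat c) = 1"
proof -
  let ?z = "(mat c, mat c)"
  have z: "?z \<in> carrier H" using centre_H c by blast
  have "?z \<otimes>\<^bsub>H\<^esub> x = x \<otimes>\<^bsub>H\<^esub> ?z" for x by (simp add: H_mult mat_central)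
  then have "?z \<otimes>\<^bsub>H\<^esub> x \<otimes>\<^bsub>H\<^esub> inv\<^bsub>H\<^esub> ?z = x" if "x \<in> carrier H" for x using that z by (simp add: HG.m_assoc)
  then have "cj ?z U = U" using goodD(2)[OF good_U] by (auto simp: cj_def)
  then show ?thesis using U_pos by (simp add: modular_def)
qed

text \<open>By \<open>GU2_inverse\<close> the inverse of \<open>h\<close> is \<open>z w h w\<close>
  with \<open>z\<close> central and \<open>w\<close> in \<open>U\<close>. So \<open>modular\<close>
  takes the same value at \<open>h\<close> and at its inverse; being positive and multiplicative, it
  is 1.\<close>

theorem unimodular: assumes h: "h \<in> carrier H" shows "modular h = 1"
proof -
  obtain a b where ab: "h = (a, b)" by (cases h)
  obtain s where s: "is_sim J2 a s" "is_sim J2 b s" using h ab H_iff by blast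
  obtain w1 where w1: "w1 \<in> U1" "matrix_inv a = mat (inverse s) ** (w1 ** a ** w1)" using GU2_inverse[OF s(1)] by blast
  obtain w2 where w2: "w2 \<in> U1" "matrix_inv b = mat (inverse s) ** (w2 ** b ** w2)" using GU2_inverse[OF s(2)] by blast
  have sF: "inverse s \<in> F" "inverse s \<noteq> 0" using is_simD[OF s(1)] F_inverse by auto
  define w where "w = (w1, w2)"
  define z where "z = (mat (inverse s) :: 'e^2^2, mat (inverse s) :: 'e^2^2)"
  have wU: "w \<in> U" using K_iota[OF w1(1) w2(1)] H_iff_iota K_G by (auto simp: U_def w_def)
  then have wH: "w \<in> carrier H" using goodD(2)[OF good_U] by blast
  have zH: "z \<in> carrier H" unfolding z_def using centre_H sF by blast
  have "inv\<^bsub>H\<^esub> h = z \<otimes>\<^bsub>H\<^esub> (w \<otimes>\<^bsub>H\<^esub> h \<otimes>\<^bsub>H\<^esub> w)"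
    using H_inv[OF h] w1 w2 by (simp add: ab H_mult z_def w_def)
  then have "modular (inv\<^bsub>H\<^esub> h) = modular h"
    using modular_mult zH wH h modular_U[OF wU] modular_centre[OF sF] by (simp add: z_def)
  moreover have "modular (inv\<^bsub>H\<^esub> h) * modular h = 1"
  proof -
    have "modular (inv\<^bsub>H\<^esub> h \<otimes>\<^bsub>H\<^esub> h) = 1" using h modular_U[of "\<one>\<^bsub>H\<^esub>"] goodD(3)[OF good_U] by simp
    then show ?thesis using modular_mult[of "inv\<^bsub>H\<^esub> h" h] h by simp
  qed
  moreover have "0 < modular h"
    using good_measure_pos[OF good_cj_Hs[OF h one_G]] U_pos by (simp add: modular_def U_eq)
  ultimately have "modular h * modular h = 1" "0 < modular h" by simp_all
  then show ?thesis using square_eq_1_iff[of "modular h"] by auto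
qed

text \<open>The right coset is the left translate by \<open>h\<close> of \<open>h^-1 U h\<close>,
  whose measure is that of \<open>U\<close> by unimodularity. The count over right cosets of
  \<open>U\<close> depends on this.\<close>

lemma rcoset_measure:
  assumes h: "h \<in> carrier H"
  shows "U #>\<^bsub>H\<^esub> h \<in> sets \<mu>" "emeasure \<mu> (U #>\<^bsub>H\<^esub> h) < \<infinity>" "measure \<mu> (U #>\<^bsub>H\<^esub> h) = measure \<mu> U"
proof -
  have e: "U #>\<^bsub>H\<^esub> h = h <#\<^bsub>H\<^esub> cj h U"
  proof (intro equalityI subsetI)
    fix y assume "y \<in> U #>\<^bsub>H\<^esub> h"
    then obtain u where u: "u \<in> U" "y = u \<otimes>\<^bsub>H\<^esub> h" by (auto simp: r_coset_def)
    have uH: "u \<in> carrier H" using u goodD(2)[OF good_U] by blast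
    have "h \<otimes>\<^bsub>H\<^esub> (inv\<^bsub>H\<^esub> h \<otimes>\<^bsub>H\<^esub> u \<otimes>\<^bsub>H\<^esub> h) \<otimes>\<^bsub>H\<^esub> inv\<^bsub>H\<^esub> h = u"
      using uH h by (simp add: HG.m_assoc) (simp add: HG.m_assoc[symmetric])
    then have "inv\<^bsub>H\<^esub> h \<otimes>\<^bsub>H\<^esub> u \<otimes>\<^bsub>H\<^esub> h \<in> cj h U" using u uH h by (simp add: cj_def)
    moreover have "y = h \<otimes>\<^bsub>H\<^esub> (inv\<^bsub>H\<^esub> h \<otimes>\<^bsub>H\<^esub> u \<otimes>\<^bsub>H\<^esub> h)" using uH h u by (simp add: HG.m_assoc[symmetric])
    ultimately show "y \<in> h <#\<^bsub>H\<^esub> cj h U" by (auto simp: l_coset_def)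
  next
    fix y assume "y \<in> h <#\<^bsub>H\<^esub> cj h U"
    then obtain z where z: "z \<in> carrier H" "h \<otimes>\<^bsub>H\<^esub> z \<otimes>\<^bsub>H\<^esub> inv\<^bsub>H\<^esub> h \<in> U" "y = h \<otimes>\<^bsub>H\<^esub> z" by (auto simp: l_coset_def cj_def)
    have "y = (h \<otimes>\<^bsub>H\<^esub> z \<otimes>\<^bsub>H\<^esub> inv\<^bsub>H\<^esub> h) \<otimes>\<^bsub>H\<^esub> h" using z h by (simp add: HG.m_assoc)
    then show "y \<in> U #>\<^bsub>H\<^esub> h" using z by (auto simp: r_coset_def)
  qed
  have g: "good (cj h U)" unfolding U_eq by (rule good_cj_Hs[OF h one_G])
  show "U #>\<^bsub>H\<^esub> h \<in> sets \<mu>" "emeasure \<mu> (U #>\<^bsub>H\<^esub> h) < \<infinity>" unfolding e using lcoset_measure[OF g h] by auto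
  have "measure \<mu> (U #>\<^bsub>H\<^esub> h) = measure \<mu> (cj h U)" unfolding e using lcoset_measure[OF g h] by simp
  also have "\<dots> = measure \<mu> U" using unimodular[OF h] U_pos by (simp add: modular_def)
  finally show "measure \<mu> (U #>\<^bsub>H\<^esub> h) = measure \<mu> U" .
qed

end

section \<open>Vectors of unit norm in the two hyperbolic planes\<close>

context odd_unramified_extension
begin

definition elim :: "4 \<Rightarrow> (4 \<Rightarrow> 'e) \<Rightarrow> 'e^4^4" where
  "elim m c = (\<chi> l j. (if l = j then 1 else 0) - (if l = m then c j else 0))"

definition swap4 :: "4 \<Rightarrow> 4 \<Rightarrow> 'e^4^4" where
  "swap4 m p = (\<chi> l j. if l = (if j = m then p else if j = p then m else j) then 1 else 0)"

lemma mult_elim: "(A ** elim m c) $ l $ j = A $ l $ j - A $ l $ m * c j"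
proof -
  have "A $ l $ k * elim m c $ k $ j = (if k = j then A $ l $ k else 0) - (if k = m then A $ l $ k * c j else 0)" for k
    by (simp add: elim_def algebra_simps)
  then show ?thesis by (simp add: mult_entry sum_subtractf)
qed

lemma elim_GLO: "(\<And>j. c j \<in> idl 0) \<Longrightarrow> c m = 0 \<Longrightarrow> elim m c \<in> GLO"
proof -
  assume c: "\<And>j. c j \<in> idl 0" "c m = 0"
  have "elim m c ** elim m (\<lambda>j. - c j) = mat 1"
    using c(2) by (simp add: vec_eq_iff mult_elim) (simp add: elim_def mat_def)
  moreover have "intmat 0 (elim m c)" "intmat 0 (elim m (\<lambda>j. - c j))"
    using c(1) by (auto simp: intmat_def elim_def intro: idl_diff idl_add)
  ultimately show ?thesis unfolding GLO_def by blast
qed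

lemma mult_swap4: "(A ** swap4 m p) $ l $ j = A $ l $ (if j = m then p else if j = p then m else j)"
proof -
  have "A $ l $ k * swap4 m p $ k $ j = (if k = (if j = m then p else if j = p then m else j) then A $ l $ k else 0)" for k
    unfolding swap4_def by simp
  then show ?thesis unfolding mult_entry by simp
qed

lemma swap4_GLO: "swap4 m p \<in> GLO"
proof -
  have "swap4 m p ** swap4 m p = mat 1" unfolding vec_eq_iff mult_swap4 by (simp add: swap4_def mat_def)
  moreover have "intmat 0 (swap4 m p)" by (simp add: intmat_def swap4_def)
  ultimately show ?thesis unfolding GLO_def by blast
qed

text \<open>Column operations over O_E with an entry of least valuation as pivot. The clauses on
  vanishing rows and on columns outside \<open>S\<close> allow a second row to be cleared without
  undoing the first.\<close>

lemma clear_row: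
  fixes A :: "'e^4^4"
  assumes p: "p \<in> S"
  shows "\<exists>k\<in>GLO. (\<forall>j\<in>S - {p}. (A ** k) $ i $ j = 0) \<and>
    (\<forall>l. (\<forall>j\<in>S. A $ l $ j = 0) \<longrightarrow> (\<forall>j\<in>S. (A ** k) $ l $ j = 0)) \<and> (\<forall>l j. j \<notin> S \<longrightarrow> (A ** k) $ l $ j = A $ l $ j)"
proof (cases "\<forall>j\<in>S. A $ i $ j = 0")
  case True
  have "mat 1 \<in> (GLO :: ('e^4^4) set)" unfolding GLO_def by (simp add: exI[of _ "mat 1"])
  then show ?thesis using True by (intro bexI[of _ "mat 1"]) auto
next
  case False
  then have ne: "{j \<in> S. A $ i $ j \<noteq> 0} \<noteq> {}" by blast
  obtain m where "is_arg_min (\<lambda>j. v (A $ i $ j)) (\<lambda>j. j \<in> {j \<in> S. A $ i $ j \<noteq> 0}) m"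
    using ex_is_arg_min_if_finite[OF _ ne] by auto
  then have m: "m \<in> S" "A $ i $ m \<noteq> 0" "\<And>j. j \<in> S \<Longrightarrow> A $ i $ j \<noteq> 0 \<Longrightarrow> v (A $ i $ m) \<le> v (A $ i $ j)"
    unfolding is_arg_min_linorder by auto
  define c where "c j = (if j \<in> S - {m} then A $ i $ j / A $ i $ m else 0)" for j
  have c: "c j \<in> idl 0" for j using m(2) m(3)[of j] by (auto simp: c_def idl_divide_iff) (auto simp: idl_def)
  let ?k = "elim m c ** swap4 m p"
  have e: "(A ** ?k) $ l $ j = A $ l $ (if j = m then p else if j = p then m else j)
      - A $ l $ m * c (if j = m then p else if j = p then m else j)" for l j
    by (simp only: matrix_mul_assoc mult_swap4 mult_elim)
  have "?k \<in> GLO" using elim_GLO[of c m] swap4_GLO c by (auto intro: GLO_mult simp: c_def)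
  moreover have "(A ** ?k) $ i $ j = 0" if "j \<in> S - {p}" for j
    unfolding e c_def using that m(1,2) p by auto
  moreover have "(A ** ?k) $ l $ j = 0" if "\<forall>j\<in>S. A $ l $ j = 0" "j \<in> S" for l j
    unfolding e using that m(1) p by auto
  moreover have "(A ** ?k) $ l $ j = A $ l $ j" if "j \<notin> S" for l j
    unfolding e c_def using that m(1) p by auto
  ultimately show ?thesis by blast
qed

definition blk :: "'e^4^4 \<Rightarrow> 4 \<Rightarrow> 4 \<Rightarrow> 4 \<Rightarrow> 4 \<Rightarrow> 'e^2^2" where
  "blk A i i' j j' = vector [vector [A$i$j, A$i$j'], vector [A$i'$j, A$i'$j']]"

lemma blk_entry [simp]:
  "blk A i i' j j' $ 1 $ 1 = A$i$j" "blk A i i' j j' $ 1 $ 2 = A$i$j'"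
  "blk A i i' j j' $ 2 $ 1 = A$i'$j" "blk A i i' j j' $ 2 $ 2 = A$i'$j'"
  by (simp_all add: blk_def)

lemma intmat_blk: "intmat n A \<Longrightarrow> intmat n (blk A i i' j j')"
  by (simp add: intmat_def forall_2)

lemma det_cong_2:
  assumes "intmat 0 (A :: 'e^2^2)" "intmat 0 B" "intmat 1 (A - B)"
  shows "det A - det B \<in> idl 1"
proof -
  have i: "A$i$j \<in> idl 0" "B$i$j \<in> idl 0" "A$i$j - B$i$j \<in> idl 1" for i j
    using assms by (auto simp: intmat_def)
  have "(A$1$1 * A$2$2 - B$1$1 * B$2$2) - (A$1$2 * A$2$1 - B$1$2 * B$2$1) \<in> idl 1"
    by (rule idl_diff; rule idl_cong_mult) (rule i)+
  moreover have "det A - det B = (A$1$1 * A$2$2 - B$1$1 * B$2$2) - (A$1$2 * A$2$1 - B$1$2 * B$2$1)"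
    by (simp add: det_2)
  ultimately show ?thesis by simp
qed

text \<open>The value of the hermitian form \<open>J4\<close> at \<open>w\<close>.\<close>

definition hn :: "'e^4 \<Rightarrow> 'e" where
  "hn w = \<gamma> (w$1) * w$3 + \<gamma> (w$2) * w$4 + \<gamma> (w$3) * w$1 + \<gamma> (w$4) * w$2"

lemma hn_comb:
  assumes J': "J' = adj k ** J4 ** k"
  shows "hn (\<chi> i. k$i$1 * a + k$i$2 * b) =
    \<gamma> a * a * J'$1$1 + \<gamma> a * b * J'$1$2 + \<gamma> b * a * J'$2$1 + \<gamma> b * b * J'$2$2"
  unfolding J' by (simp add: hn_def mult_entry sum_4 J4_def gamma_add gamma_mult algebra_simps)

text \<open>Polarization. The coefficient pairs (1, 1) and (1, \<open>th\<close>) give the sum and,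
  because \<open>th\<close> is a skew unit, the difference of the off-diagonal entries; then 2 is
  divided out.\<close>

lemma isotropic_block:
  assumes J': "J' = adj k ** J4 ** k" and int: "intmat 0 J'"
    and iso: "\<And>a b. a \<in> idl 0 \<Longrightarrow> b \<in> idl 0 \<Longrightarrow> hn (\<chi> i. k$i$1 * a + k$i$2 * b) \<in> idl 1"
  shows "intmat 1 (blk J' 1 2 1 2)"
proof -
  note h = iso[unfolded hn_comb[OF J']]
  have thi: "th \<in> idl 0" using th(3) by (auto intro: idl_self)
  have d: "J'$1$1 \<in> idl 1" "J'$2$2 \<in> idl 1" using h[of 1 0] h[of 0 1] by simp_all
  have "J'$1$1 + J'$1$2 + J'$2$1 + J'$2$2 \<in> idl 1" using h[of 1 1] by simp
  from idl_diff[OF this idl_add[OF d]] have p: "J'$1$2 + J'$2$1 \<in> idl 1" by simp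
  have t: "J'$1$1 + th * J'$1$2 + (- th) * J'$2$1 + (- th) * th * J'$2$2 \<in> idl 1" using h[of 1 th] thi th by simp
  have "(- th) * th * J'$2$2 \<in> idl 1" using d(2) thi by (intro idl_mult0) (auto intro: idl_mult0)
  then have "J'$1$1 + (- th) * th * J'$2$2 \<in> idl 1" using d by (intro idl_add)
  from idl_diff[OF t this] have "th * (J'$1$2 - J'$2$1) \<in> idl 1" by (simp add: algebra_simps)
  then have m: "J'$1$2 - J'$2$1 \<in> idl 1" using th by (simp add: idl_mult_iff)
  have "2 * J'$1$2 \<in> idl 1" "2 * J'$2$1 \<in> idl 1" using idl_add[OF p m] idl_diff[OF p m] by simp_all
  then show ?thesis using d by (simp add: intmat_def forall_2)
qed

lemma H_sim_unit: "r \<in> carrier G \<Longrightarrow> (\<alpha>, \<beta>) \<in> Hs r \<Longrightarrow> is_sim J2 \<alpha> s \<Longrightarrow> v s = 0"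
proof -
  assume a: "r \<in> carrier G" "(\<alpha>, \<beta>) \<in> Hs r" "is_sim J2 \<alpha> s"
  then have "v (sim J4 (\<iota> (\<alpha>, \<beta>))) = 0" using good_Hs[OF a(1)] unfolding good_def Xb_def by blast
  moreover have "sim J4 (\<iota> (\<alpha>, \<beta>)) = s" using sim_iota sim_eq[OF herm_J2 a(3)] a(2) by (simp add: Hs_def)
  ultimately show ?thesis by simp
qed

text \<open>Without such a vector the reduced form vanishes on a stable plane. There
  \<open>h\<close> has determinant \<open>det \<alpha>\<close>, on the quotient
  \<open>det \<beta>\<close>, and the pairing of the two makes
  \<open>\<gamma> (det \<alpha>) * det \<beta>\<close> congruent to \<open>s * s\<close>, the norm
  of \<open>det \<alpha>\<close>; so the two determinants are congruent.\<close>

theorem unit_vector: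
  assumes r: "r \<in> carrier G" and h: "(\<alpha>, \<beta>) \<in> Hs r" and D: "\<nu> (\<alpha>, \<beta>) \<notin> D"
  shows "\<exists>w. (\<forall>i. w$i \<in> idl 0) \<and> (r *v w)$2 = 0 \<and> (r *v w)$4 = 0 \<and> hn w \<noteq> 0 \<and> v (hn w) = 0"
proof (rule ccontr)
  assume no: "\<not> ?thesis"
  \<comment> \<open>Two clearings put zeros into rows 2 and 4 of the first two columns of
    \<open>r ** k\<close>, so that these columns lie in the first plane.\<close>
  obtain k1 where k1: "k1 \<in> GLO" "\<forall>j\<in>UNIV - {4}. (r ** k1)$4$j = 0" using clear_row[of 4 UNIV r 4] by blast
  have "(3::4) \<in> {1,2,3}" by simp
  from clear_row[OF this, of "r ** k1" 2] obtain k2 where k2: "k2 \<in> GLO" "\<forall>j\<in>{1,2,3} - {3}. (r ** k1 ** k2)$2$j = 0"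
      "\<forall>l. (\<forall>j\<in>{1,2,3}. (r ** k1)$l$j = 0) \<longrightarrow> (\<forall>j\<in>{1,2,3}. (r ** k1 ** k2)$l$j = 0)"
    by (elim bexE conjE) (rule that)
  define k where "k = k1 ** k2"
  have kG: "k \<in> GLO" unfolding k_def using k1 k2 GLO_mult by blast
  define B where "B = r ** k"
  have B0: "B$2$1 = 0" "B$2$2 = 0" "B$4$1 = 0" "B$4$2 = 0"
    using k1(2) k2(2,3) unfolding B_def k_def by (simp_all add: matrix_mul_assoc)
  define kk where "kk = matrix_inv k"
  have kk: "intmat 0 k" "intmat 0 kk" "k ** kk = mat 1" "kk ** k = mat 1"
    using GLO_inv[OF kG] kG by (auto simp: kk_def GLO_def)
  define h' where "h' = matrix_inv r ** \<iota> (\<alpha>, \<beta>) ** r"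
  have h'K: "h' \<in> K" and hH: "(\<alpha>, \<beta>) \<in> carrier H" using h by (auto simp: Hs_def h'_def)
  have ri: "r ** matrix_inv r = mat 1" "matrix_inv r ** r = mat 1" using GU_inv_cancel[OF herm_J4 r] by auto
  define g where "g = kk ** h' ** k"
  have gi: "intmat 0 g" unfolding g_def using kk K_int[OF h'K] by (intro intmat_mult0)
  have kg: "k ** g = h' ** k"
    unfolding g_def by (metis kk(3) mat_one_mult(1) matrix_mul_assoc)
  have rh: "\<iota> (\<alpha>, \<beta>) ** r = r ** h'"
    unfolding h'_def by (metis ri(1) mat_one_mult(1) matrix_mul_assoc)
  have Bg: "\<iota> (\<alpha>, \<beta>) ** B = B ** g"
    unfolding B_def by (metis rh kg matrix_mul_assoc)
  define Z where "Z = kk ** matrix_inv r"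
  have BZ: "B ** Z = mat 1" unfolding B_def Z_def by (metis kk(3) ri(1) mat_one_mult(1) matrix_mul_assoc)
  have ZB: "Z ** B = mat 1" using BZ matrix_left_right_inverse by blast
  define P R where "P = blk B 1 3 1 2" "R = blk B 2 4 3 4"
  have "(B ** Z)$i$j = (mat 1 :: 'e^4^4)$i$j" "(Z ** B)$i$j = (mat 1 :: 'e^4^4)$i$j" for i j using BZ ZB by simp_all
  note e = this[unfolded mult_entry sum_4 mat_def]
  have RZ: "R ** blk Z 3 4 2 4 = mat 1"
    using e(1)[of 2 2] e(1)[of 2 4] e(1)[of 4 2] e(1)[of 4 4] B0
    by (simp add: mat2_cases P_R_def mult_entry sum_2 mat_def)
  have ZP: "blk Z 1 2 1 3 ** P = mat 1"
    using e(2)[of 1 1] e(2)[of 1 2] e(2)[of 2 1] e(2)[of 2 2] B0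
    by (simp add: mat2_cases P_R_def mult_entry sum_2 mat_def)
  have detPR: "det P \<noteq> 0" "det R \<noteq> 0"
    using arg_cong[OF ZP, of det] arg_cong[OF RZ, of det] by (auto simp: det_mul)
  have "(\<iota> (\<alpha>, \<beta>) ** B)$i$j = (B ** g)$i$j" for i j using Bg by simp
  note eg = this[unfolded mult_entry sum_4]
  \<comment> \<open>\<open>\<iota> (\<alpha>, \<beta>)\<close> preserves the first plane. As
    \<open>R\<close> is invertible, \<open>g\<close> becomes block upper triangular, with diagonal
    blocks conjugate to \<open>\<alpha>\<close> and \<open>\<beta>\<close>.\<close>
  have Rg: "R ** blk g 3 4 1 2 = mat 0"
    using eg[of 2 1] eg[of 2 2] eg[of 4 1] eg[of 4 2] B0
    by (simp add: mat2_cases P_R_def mult_entry sum_2 mat_def iota_entry)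
  have "blk Z 3 4 2 4 ** (R ** blk g 3 4 1 2) = mat 0" unfolding Rg by (simp add: mat2_cases mult_entry mat_def)
  then have "blk g 3 4 1 2 = mat 0"
    using RZ matrix_left_right_inverse[of R] by (simp add: matrix_mul_assoc)
  then have g0: "g$3$1 = 0" "g$3$2 = 0" "g$4$1 = 0" "g$4$2 = 0" by (simp_all add: mat2_cases mat_def)
  have "\<alpha> ** P = P ** blk g 1 2 1 2"
    using eg[of 1 1] eg[of 1 2] eg[of 3 1] eg[of 3 2] B0 g0
    by (simp add: mat2_cases P_R_def mult_entry sum_2 iota_entry)
  then have da: "det \<alpha> = det (blk g 1 2 1 2)" using detPR(1) by (metis det_mul mult.commute mult_cancel_left)
  have "\<beta> ** R = R ** blk g 3 4 3 4"
    using eg[of 2 3] eg[of 2 4] eg[of 4 3] eg[of 4 4] B0 g0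
    by (simp add: mat2_cases P_R_def mult_entry sum_2 iota_entry)
  then have db: "det \<beta> = det (blk g 3 4 3 4)" using detPR(2) by (metis det_mul mult.commute mult_cancel_left)
  define J' where "J' = adj k ** J4 ** k"
  have J'i: "intmat 0 J'" unfolding J'_def using kk by (intro intmat_mult0) auto
  have TL: "intmat 1 (blk J' 1 2 1 2)"
  proof (rule isotropic_block[OF J'_def J'i])
    fix a b assume ab: "a \<in> idl 0" "b \<in> idl 0"
    let ?w = "\<chi> i. k$i$1 * a + k$i$2 * b"
    have wi: "?w$i \<in> idl 0" for i using ab kk(1) by (auto simp: intmat_def intro!: idl_add idl_mult0)
    have "(r *v ?w)$i = B$i$1 * a + B$i$2 * b" for i
      unfolding B_def by (simp add: matrix_vector_mult_def mult_entry sum_4 algebra_simps)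
    then have "(r *v ?w)$2 = 0" "(r *v ?w)$4 = 0" using B0 by simp_all
    moreover have "hn ?w \<in> idl 0" unfolding hn_def by (intro idl_add idl_mult0) (simp_all only: idl_gamma wi)
    moreover have "\<not> (hn ?w \<noteq> 0 \<and> v (hn ?w) = 0)" using no wi calculation by blast
    ultimately show "hn ?w \<in> idl 1" unfolding idl_def by auto
  qed
  obtain s where s: "is_sim J2 \<alpha> s" "is_sim J2 \<beta> s" using hH H_iff by blast
  have vs: "v s = 0" and s0: "s \<noteq> 0" using H_sim_unit[OF r h s(1)] is_simD[OF s(1)] by auto
  obtain t where t: "is_sim J4 r t" using r GU_iff[OF herm_J4] by blast
  have "is_sim J4 h' (inverse t * s * t)"
    unfolding h'_def using is_sim_mult[OF is_sim_mult[OF is_sim_inv(1)[OF herm_J4 t]] t] s is_sim_iota by blast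
  moreover have "inverse t * s * t = s" using is_simD[OF t] by (simp add: field_simps)
  ultimately have h's: "adj h' ** J4 ** h' = mat s ** J4" using is_simD by metis
  have "adj g ** J' ** g = adj (k ** g) ** J4 ** (k ** g)" unfolding J'_def adj_mult by (simp only: matrix_mul_assoc)
  also have "\<dots> = adj k ** (adj h' ** J4 ** h') ** k" unfolding kg adj_mult by (simp only: matrix_mul_assoc)
  also have "\<dots> = mat s ** J'" unfolding h's J'_def by (metis mat_left_commute matrix_mul_assoc)
  finally have "(adj g ** J' ** g)$i$j = (mat s ** J')$i$j" for i j by simp
  note ej = this[unfolded mult_entry sum_4 adj_entry]
  define X where "X = blk J' 1 2 3 4"
  \<comment> \<open>The upper right block of the similitude equation for \<open>J'\<close>. The
    error term contains the isotropic block, hence vanishes modulo \<open>\<pi>\<close>: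
    \<open>X\<close> is an equivariant pairing.\<close>
  have "adj (blk g 1 2 1 2) ** X ** blk g 3 4 3 4 - mat s ** X =
      - (adj (blk g 1 2 1 2) ** blk J' 1 2 1 2 ** blk g 1 2 3 4)"
    using ej[of 1 3] ej[of 1 4] ej[of 2 3] ej[of 2 4] g0
    by (simp add: mat2_cases X_def mult_entry sum_2 mat_def algebra_simps)
  moreover have "intmat 1 (adj (blk g 1 2 1 2) ** blk J' 1 2 1 2 ** blk g 1 2 3 4)"
    by (rule intmat_mult0'[OF intmat_mult0[OF _ TL] intmat_blk[OF gi]]) (simp add: intmat_blk[OF gi])
  ultimately have cg: "intmat 1 (adj (blk g 1 2 1 2) ** X ** blk g 3 4 3 4 - mat s ** X)"
    by (simp add: intmat_def)
  have Xi: "intmat 0 X" unfolding X_def by (rule intmat_blk[OF J'i])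
  have i1: "intmat 0 (adj (blk g 1 2 1 2) ** X ** blk g 3 4 3 4)"
    using intmat_blk[OF gi] Xi by (intro intmat_mult0) simp_all
  have i2: "intmat 0 (mat s ** X)" using Xi s0 vs by (simp add: intmat_mat)
  have c1: "\<gamma> (det \<alpha>) * det X * det \<beta> - s * s * det X \<in> idl 1"
    using det_cong_2[OF i1 i2 cg] by (simp add: det_mul det_adj_2 det_mat_2 da db)
  \<comment> \<open>The inverse of \<open>J'\<close>. Its integrality shows that the pairing
    \<open>X\<close> is invertible modulo \<open>\<pi>\<close>, so that \<open>det X\<close> can be
    cancelled.\<close>
  define Y where "Y = kk ** J4 ** adj kk"
  have "Y ** J' = kk ** (J4 ** (adj (k ** kk) ** J4)) ** k"
    unfolding Y_def J'_def adj_mult by (simp only: matrix_mul_assoc)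
  also have "\<dots> = mat 1" using kk hermD(1)[OF herm_J4] by simp
  finally have "(Y ** J')$i$j = (mat 1 :: 'e^4^4)$i$j" for i j by simp
  note ey = this[unfolded mult_entry sum_4 mat_def]
  have Yi: "intmat 0 Y" unfolding Y_def using kk by (intro intmat_mult0) auto
  have J'h: "adj J' = J'" unfolding J'_def using hermD(2)[OF herm_J4] by (simp add: adj_mult matrix_mul_assoc)
  have gJ: "\<gamma> (J'$j$i) = J'$i$j" for i j using arg_cong[OF J'h, of "\<lambda>A. A$i$j"] by simp
  have "mat 1 - blk Y 1 2 3 4 ** adj X = blk Y 1 2 1 2 ** blk J' 1 2 1 2"
    using ey[of 1 1] ey[of 1 2] ey[of 2 1] ey[of 2 2]
    by (simp add: mat2_cases X_def mult_entry sum_2 mat_def gJ) (intro conjI; algebra)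
  then have "intmat 1 (mat 1 - blk Y 1 2 3 4 ** adj X)" using intmat_mult0[OF intmat_blk[OF Yi] TL] by simp
  then have "det (mat 1 :: 'e^2^2) - det (blk Y 1 2 3 4 ** adj X) \<in> idl 1"
    using intmat_blk[OF Yi] Xi by (intro det_cong_2 intmat_mult0) simp_all
  then have "1 - det (blk Y 1 2 3 4) * \<gamma> (det X) \<in> idl 1" by (simp add: det_mul det_adj_2)
  moreover have dX: "det A \<in> idl 0" if "intmat 0 A" for A :: "'e^2^2"
    using that by (auto simp: det_2 intmat_def intro!: idl_diff idl_mult0)
  have "\<gamma> (det X) \<notin> idl 1"
  proof
    assume "\<gamma> (det X) \<in> idl 1"
    then have "det (blk Y 1 2 3 4) * \<gamma> (det X) \<in> idl 1" using dX[OF intmat_blk[OF Yi]] by (intro idl_mult0)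
    then have "1 \<in> idl 1" using calculation by (metis diff_add_cancel idl_add)
    then show False by (simp add: idl_def)
  qed
  then have X0: "det X \<noteq> 0" "v (det X) = 0" using dX[OF Xi] by (auto simp: idl_def)
  note n = det_norm[of \<alpha>]
  have aG: "\<alpha> \<in> carrier (GU J2)" "sim J2 \<alpha> = s" using GU_I[OF herm_J2 s(1)] sim_eq[OF herm_J2 s(1)] by auto
  have n: "\<gamma> (det \<alpha>) * det \<alpha> = s * s" "det \<alpha> \<noteq> 0" using det_norm[OF aG(1)] aG(2) by auto
  have va: "v (det \<alpha>) = 0" using arg_cong[OF n(1), of v] n(2) s0 vs by (simp add: v_mult)
  have "\<gamma> (det \<alpha>) * det X * (det \<beta> - det \<alpha>) \<in> idl 1"
    using c1 unfolding n(1)[symmetric] by (simp add: algebra_simps)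
  then have "det \<beta> - det \<alpha> \<in> idl 1" using n(2) va X0 by (simp add: idl_mult_iff v_mult)
  then have "(det \<beta> - det \<alpha>) / det \<alpha> \<in> idl 1" using n(2) va by (simp add: idl_divide_iff)
  then have "\<nu> (\<alpha>, \<beta>) - 1 \<in> idl 1" using n(2) by (simp add: \<nu>_def diff_divide_distrib)
  then show False using D nu_in_C[OF hH] by (simp add: D_eq)
qed

lemma P12_mult: "(P12 ** A)$1$j = A$2$j" "(P12 ** A)$2$j = A$1$j" "(P12 ** A)$3$j = A$4$j" "(P12 ** A)$4$j = (A$3$j :: 'e)"
  by (simp_all add: P12_def mult_entry sum_4)

lemma P12_inv: "P12 ** P12 = (mat 1 :: 'e^4^4)"
  by (simp add: vec_eq_iff forall_4 P12_def mult_entry sum_4 mat_def)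

lemma P12_iota: "P12 ** \<iota> (\<alpha>, \<beta>) = \<iota> (\<beta>, \<alpha>) ** (P12 :: 'e^4^4)"
  by (simp add: vec_eq_iff forall_4 P12_def mult_entry sum_4 iota_entry)

lemma Hs_swap:
  assumes r: "r \<in> carrier G"
  shows "(\<beta>, \<alpha>) \<in> Hs (P12 ** r) \<longleftrightarrow> (\<alpha>, \<beta>) \<in> Hs r"
proof -
  let ?r = "P12 ** r"
  have ri: "matrix_inv r ** r = mat 1" "r ** matrix_inv r = mat 1" using GU_inv_cancel[OF herm_J4 r] by auto
  have "matrix_inv ?r = matrix_inv r ** P12"
  proof (rule matrix_inv_unique)
    have "?r ** (matrix_inv r ** P12) = P12 ** (r ** matrix_inv r) ** P12" by (simp only: matrix_mul_assoc)
    then show "?r ** (matrix_inv r ** P12) = mat 1" using ri P12_inv by simp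
  qed
  then have "matrix_inv ?r ** \<iota> (\<beta>, \<alpha>) ** ?r = matrix_inv r ** (P12 ** \<iota> (\<beta>, \<alpha>)) ** P12 ** r"
    by (simp only: matrix_mul_assoc)
  also have "\<dots> = matrix_inv r ** \<iota> (\<alpha>, \<beta>) ** (P12 ** P12) ** r"
    unfolding P12_iota by (simp only: matrix_mul_assoc)
  finally have "matrix_inv ?r ** \<iota> (\<beta>, \<alpha>) ** ?r = matrix_inv r ** \<iota> (\<alpha>, \<beta>) ** r" by (simp add: P12_inv)
  moreover have "(\<alpha>, \<beta>) \<in> carrier H \<longleftrightarrow> (\<beta>, \<alpha>) \<in> carrier H" using H_iff by auto
  ultimately show ?thesis by (simp add: Hs_def)
qed

text \<open>The second vector comes from \<open>unit_vector\<close> after \<open>P12\<close> has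
  exchanged the planes; this inverts \<open>\<nu>\<close>, and \<open>D\<close> is stable under
  inversion.\<close>

theorem unit_vectors:
  assumes r: "r \<in> carrier G" and h: "h \<in> Hs r" and D: "\<nu> h \<notin> D"
  obtains w1 w2 where "\<And>i. w1$i \<in> idl 0" "(r *v w1)$2 = 0" "(r *v w1)$4 = 0" "hn w1 \<noteq> 0" "v (hn w1) = 0"
    "\<And>i. w2$i \<in> idl 0" "(r *v w2)$1 = 0" "(r *v w2)$3 = 0" "hn w2 \<noteq> 0" "v (hn w2) = 0"
proof -
  obtain \<alpha> \<beta> where ab: "h = (\<alpha>, \<beta>)" by (cases h)
  let ?r = "P12 ** r"
  have r': "?r \<in> carrier G" using r P12_K K_G G_mult by blast
  have "(\<beta>, \<alpha>) \<in> Hs ?r" using h ab Hs_swap[OF r] by simp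
  moreover have "\<nu> (\<beta>, \<alpha>) \<notin> D"
  proof
    assume "\<nu> (\<beta>, \<alpha>) \<in> D"
    moreover have "\<nu> h = inverse (\<nu> (\<beta>, \<alpha>))" by (simp add: ab \<nu>_def)
    ultimately show False using D D_inverse by simp
  qed
  ultimately obtain w2 where w2: "\<forall>i. w2$i \<in> idl 0" "(?r *v w2)$2 = 0" "(?r *v w2)$4 = 0" "hn w2 \<noteq> 0" "v (hn w2) = 0"
    using unit_vector[OF r'] by blast
  have "(?r *v w2)$2 = (r *v w2)$1" "(?r *v w2)$4 = (r *v w2)$3" by (simp_all add: matrix_vector_mult_def P12_mult)
  moreover obtain w1 where "\<forall>i. w1$i \<in> idl 0" "(r *v w1)$2 = 0" "(r *v w1)$4 = 0" "hn w1 \<noteq> 0" "v (hn w1) = 0"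
    using unit_vector[OF r] h D ab by blast
  ultimately show thesis using that w2 by metis
qed

end

section \<open>Rank one projections and the tori they define\<close>

lemma divide_comb: "x * a / m * c + x * b / m * d = x * (a * c + b * d) / (m :: 'a::field)"
  by (simp add: add_divide_distrib algebra_simps)

context odd_unramified_extension
begin

lemma mat_add_right: "(A + B) ** X = A ** X + B ** (X :: 'e^'n^'m)"
  by (simp add: vec_eq_iff mult_entry distrib_right sum.distrib)

lemma GLO_intmat:
  assumes k: "k \<in> GLO"
  shows "intmat n (k ** A) \<longleftrightarrow> intmat n A" "intmat n (B ** k) \<longleftrightarrow> intmat n B"
  by (rule GLO_left_iff[OF _ k], rule intmat_mult0) (assumption+, rule GLO_right_iff[OF _ k], rule intmat_mult0')

lemma GLO_intmin:
  assumes k: "k \<in> GLO"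
  shows "intmin n (k ** A) \<longleftrightarrow> intmin n A"
  by (rule GLO_left_iff[OF _ k], rule intmin_mult_left)

definition n2 :: "'e^2 \<Rightarrow> 'e" where "n2 u = \<gamma> (u$1) * u$2 + \<gamma> (u$2) * u$1"

text \<open>The rank one operator that sends a vector to the multiple of \<open>a\<close> by its
  \<open>J2\<close>-product with \<open>b\<close>, divided by \<open>n\<close>.\<close>

definition op2 :: "'e^2 \<Rightarrow> 'e^2 \<Rightarrow> 'e \<Rightarrow> 'e^2^2" where
  "op2 a b n = vector [vector [a$1 * \<gamma> (b$2) / n, a$1 * \<gamma> (b$1) / n], vector [a$2 * \<gamma> (b$2) / n, a$2 * \<gamma> (b$1) / n]]"

lemma op2_entry [simp]:
  "op2 a b n $ 1 $ 1 = a$1 * \<gamma> (b$2) / n" "op2 a b n $ 1 $ 2 = a$1 * \<gamma> (b$1) / n"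
  "op2 a b n $ 2 $ 1 = a$2 * \<gamma> (b$2) / n" "op2 a b n $ 2 $ 2 = a$2 * \<gamma> (b$1) / n"
  by (simp_all add: op2_def)

lemma gamma_n2 [simp]: "\<gamma> (n2 u) = n2 u"
  by (simp add: n2_def gamma_add gamma_mult algebra_simps)

lemma vec2_mult: "((h :: 'e^2^2) *v u)$i = h$i$1 * u$1 + h$i$2 * u$2"
  by (simp add: matrix_vector_mult_def sum_2)

lemma is_sim_2:
  assumes "is_sim J2 h s"
  shows "\<gamma> (h$1$1) * h$2$1 + \<gamma> (h$2$1) * h$1$1 = 0" "\<gamma> (h$1$1) * h$2$2 + \<gamma> (h$2$1) * h$1$2 = s"
    "\<gamma> (h$1$2) * h$2$1 + \<gamma> (h$2$2) * h$1$1 = s" "\<gamma> (h$1$2) * h$2$2 + \<gamma> (h$2$2) * h$1$2 = 0"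
  using is_simD[OF assms] by (simp_all add: mat2_cases mult_entry sum_2 mat_def algebra_simps)

lemma n2_sim: "is_sim J2 h s \<Longrightarrow> n2 (h *v u) = s * n2 u"
  using is_sim_2[of h s] unfolding n2_def vec2_mult gamma_add gamma_mult by algebra

text \<open>A similitude with factor \<open>s\<close> multiplies the product with \<open>b\<close>
  by \<open>s\<close>, which the new denominator compensates.\<close>

lemma op2_conj:
  assumes h': "is_sim J2 h' s"
  shows "h ** op2 a b n ** matrix_inv h' = op2 (h *v a) (h' *v b) (s * n)"
proof -
  have s0: "s \<noteq> 0" using is_simD[OF h'] by blast
  have b: "\<gamma> ((h' *v b)$2) * h'$1$1 + \<gamma> ((h' *v b)$1) * h'$2$1 = s * \<gamma> (b$2)"
    "\<gamma> ((h' *v b)$2) * h'$1$2 + \<gamma> ((h' *v b)$1) * h'$2$2 = s * \<gamma> (b$1)"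
    using is_sim_2[OF h'] unfolding vec2_mult gamma_add gamma_mult by algebra+
  have c: "x * (s * y) / (s * n) = x * y / n" for x y using s0 by simp
  have "op2 (h *v a) (h' *v b) (s * n) ** h' = h ** op2 a b n"
    unfolding mat2_cases mult_entry sum_2 op2_entry divide_comb b c
    by (simp add: vec2_mult add_divide_distrib algebra_simps)
  then have "h ** op2 a b n ** matrix_inv h' = op2 (h *v a) (h' *v b) (s * n) ** (h' ** matrix_inv h')"
    by (simp only: matrix_mul_assoc)
  then show ?thesis using GU_inv_cancel[OF herm_J2 GU_I[OF herm_J2 h']] by simp
qed

text \<open>The orthogonal projection onto the line of \<open>u\<close>.\<close>

definition pr :: "'e^2 \<Rightarrow> 'e^2^2" where "pr u = op2 u u (n2 u)"

lemma pr_facts: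
  assumes "n2 u \<noteq> 0"
  shows "pr u$1$1 + pr u$2$2 = 1" "pr u$1$1 * pr u$2$2 = pr u$1$2 * pr u$2$1"
    "\<gamma> (pr u$1$1) = pr u$2$2" "\<gamma> (pr u$2$2) = pr u$1$1" "\<gamma> (pr u$1$2) = pr u$1$2" "\<gamma> (pr u$2$1) = pr u$2$1"
  using assms by (simp_all add: pr_def gamma_divide gamma_mult add_divide_distrib[symmetric])
    (simp_all add: n2_def algebra_simps)

text \<open>Acts by \<open>t\<close> on \<open>u\<close> and trivially on its orthogonal complement;
  for \<open>t\<close> in \<open>C\<close> this is a torus of isometries on which the determinant is
  the identity of \<open>C\<close>.\<close>

definition tor :: "'e^2 \<Rightarrow> 'e \<Rightarrow> 'e^2^2" where "tor u t = mat 1 + mat (t - 1) ** pr u"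

lemma tor_entry: "tor u t$1$1 = 1 + (t - 1) * pr u$1$1" "tor u t$1$2 = (t - 1) * pr u$1$2"
  "tor u t$2$1 = (t - 1) * pr u$2$1" "tor u t$2$2 = 1 + (t - 1) * pr u$2$2"
  by (simp_all add: tor_def) (simp_all add: mat_def)

lemma tor_mult: "n2 u \<noteq> 0 \<Longrightarrow> tor u s ** tor u t = tor u (s * t)"
  using pr_facts(1,2)[of u] unfolding mat2_cases mult_entry sum_2 tor_entry by algebra

lemma tor_one [simp]: "tor u 1 = mat 1"
  by (simp add: mat2_cases tor_entry mat_def)

lemma det_tor: "n2 u \<noteq> 0 \<Longrightarrow> det (tor u t) = t"
  using pr_facts(1,2)[of u] unfolding det_2 tor_entry by algebra

lemma is_sim_tor:
  assumes "n2 u \<noteq> 0" "t \<in> C" shows "is_sim J2 (tor u t) 1"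
proof -
  note f = pr_facts[OF assms(1)] and t = C_D(2)[OF assms(2)]
  have "adj (tor u t) ** J2 ** tor u t = J2"
    unfolding mat2_cases mult_entry sum_2 adj_entry J2_entry tor_entry gamma_add gamma_mult gamma_diff gamma_one f(3-6)
    using f(1,2) t by (intro conjI; algebra)
  then show ?thesis by (simp add: is_sim_iff)
qed

lemma tor_vec: "n2 u \<noteq> 0 \<Longrightarrow> (tor u t *v u)$i = t * u$i"
proof -
  assume n: "n2 u \<noteq> 0"
  have "\<forall>i. (tor u t *v u)$i = t * u$i"
    using n unfolding forall_2 vec2_mult tor_entry pr_def op2_entry by (simp add: field_simps) (simp add: n2_def algebra_simps)
  then show ?thesis by blast
qed

text \<open>Equivalently the projection preserves the lattice \<open>h^-1 O^2\<close>, which then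
  splits along \<open>u\<close>. The condition depends only on the lattice, by
  \<open>fixd_unit\<close>, and is invariant under the torus, by \<open>fixd_tor\<close>.\<close>

definition fixd :: "'e^2^2 \<Rightarrow> 'e^2 \<Rightarrow> bool" where
  "fixd h u \<longleftrightarrow> intmat 0 (h ** pr u ** matrix_inv h)"

lemma fixd_iff: "is_sim J2 h s \<Longrightarrow> fixd h u \<longleftrightarrow> intmat 0 (op2 (h *v u) (h *v u) (s * n2 u))"
  by (simp add: fixd_def pr_def op2_conj)

lemma fixd_tor:
  assumes "is_sim J2 h s" "n2 u \<noteq> 0" "t \<in> C"
  shows "fixd (h ** tor u t) u \<longleftrightarrow> fixd h u"
proof -
  have "is_sim J2 (h ** tor u t) (s * 1)" using is_sim_mult[OF assms(1) is_sim_tor[OF assms(2,3)]] .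
  moreover have "((h ** tor u t) *v u)$i = t * (h *v u)$i" for i
    unfolding matrix_vector_mul_assoc[symmetric] vec2_mult[of h] tor_vec[OF assms(2)] by (simp add: algebra_simps)
  then have "op2 ((h ** tor u t) *v u) ((h ** tor u t) *v u) m = op2 (h *v u) (h *v u) m" for m
    using C_D(2)[OF assms(3)] by (simp add: mat2_cases gamma_mult)
  ultimately show ?thesis using assms(1) by (simp add: fixd_iff)
qed

lemma fixd_unit:
  assumes k: "is_sim J2 k s" "k \<in> GLO" and h: "is_sim J2 h s'"
  shows "fixd (k ** h) u \<longleftrightarrow> fixd h u"
proof -
  have i: "k ** matrix_inv k = mat 1" "h ** matrix_inv h = mat 1"
    using GU_inv_cancel[OF herm_J2] GU_I[OF herm_J2] k(1) h by blast+
  have "matrix_inv (k ** h) = matrix_inv h ** matrix_inv k"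
    by (rule matrix_inv_unique) (metis i mat_one_mult(2) matrix_mul_assoc)
  then have "k ** h ** pr u ** matrix_inv (k ** h) = k ** (h ** pr u ** matrix_inv h) ** matrix_inv k"
    by (simp only: matrix_mul_assoc)
  then show ?thesis unfolding fixd_def
    by (simp add: GLO_intmat(1)[OF k(2)] GLO_intmat(2)[OF conjunct1[OF GLO_inv[OF k(2)]]])
qed

text \<open>The conjugated torus element is 1 plus \<open>t - 1\<close> times the conjugated
  projection, and \<open>t - 1\<close> is a unit for \<open>t\<close> outside
  \<open>D\<close>.\<close>

lemma fixd_stab:
  assumes h: "is_sim J2 h s" and t: "t \<in> C" "t \<notin> D" and i: "intmat 0 (h ** tor u t ** matrix_inv h)"
  shows "fixd h u"
proof -
  have hh: "h ** matrix_inv h = mat 1" using GU_inv_cancel[OF herm_J2 GU_I[OF herm_J2 h]] by blast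
  have "h ** tor u t ** matrix_inv h = h ** matrix_inv h + h ** (mat (t - 1) ** pr u) ** matrix_inv h"
    unfolding tor_def by (simp add: matrix_add_ldistrib mat_add_right)
  then have "h ** tor u t ** matrix_inv h = mat 1 + mat (t - 1) ** (h ** pr u ** matrix_inv h)"
    unfolding hh mat_left_commute by (simp only: matrix_mul_assoc)
  from intmat_diff[OF i intmat_one, unfolded this] have "intmat 0 (mat (t - 1) ** (h ** pr u ** matrix_inv h))" by simp
  moreover have "t - 1 \<noteq> 0 \<and> v (t - 1) = 0"
  proof -
    have "t - 1 \<in> idl 0" using C_D(3)[OF t(1)] by (intro idl_diff) (auto intro: idl_self)
    moreover have "t - 1 \<notin> idl 1" using t by (simp add: D_eq)
    ultimately show ?thesis by (auto simp: idl_def)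
  qed
  ultimately show ?thesis by (simp add: fixd_def intmat_mat)
qed

lemma op2_int_iff: "m \<noteq> 0 \<Longrightarrow> intmat 0 (op2 a a m) \<longleftrightarrow> (\<forall>i. a$i = 0 \<or> v m \<le> 2 * v (a$i))"
proof -
  assume m: "m \<noteq> 0"
  have e: "x * \<gamma> y / m \<in> idl 0 \<longleftrightarrow> x = 0 \<or> y = 0 \<or> v m \<le> v x + v y" for x y
    using m by (cases "x = 0"; cases "y = 0") (auto simp: idl_def v_mult v_divide)
  show ?thesis unfolding intmat_def forall_2 op2_entry e by auto
qed

text \<open>Integrality of \<open>op2 a a m\<close> says that each coordinate has at least half the
  valuation of \<open>m\<close>; a mixed entry adds two such bounds.\<close>

lemma op2_int_mixed:
  assumes "m \<noteq> 0" "m' \<noteq> 0" "v m = v m'" "intmat 0 (op2 a a m)" "intmat 0 (op2 b b m')"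
  shows "intmat 0 (op2 a b m')"
proof -
  have e: "x * \<gamma> y / m' \<in> idl 0 \<longleftrightarrow> x = 0 \<or> y = 0 \<or> v m' \<le> v x + v y" for x y
    using assms(2) by (cases "x = 0"; cases "y = 0") (auto simp: idl_def v_mult v_divide)
  have "a$i = 0 \<or> v m' \<le> 2 * v (a$i)" "b$i = 0 \<or> v m' \<le> 2 * v (b$i)" for i
    using assms op2_int_iff by auto
  note this[of 1] this[of 2]
  then show ?thesis unfolding intmat_def forall_2 op2_entry e by auto
qed

text \<open>For odd valuation the bound on the coordinates by one half improves by rounding up, and
  then \<open>n2 a\<close> would be more divisible than it is.\<close>

lemma op2_int_even:
  assumes n: "n2 a \<noteq> 0" and i: "intmat 0 (op2 a a (n2 a))" shows "even (v (n2 a))"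
proof (rule ccontr)
  assume o: "odd (v (n2 a))"
  have "a$i = 0 \<or> v (n2 a) + 1 \<le> 2 * v (a$i)" for i
  proof (cases "a$i = 0")
    case False
    then have "v (n2 a) \<le> 2 * v (a$i)" using op2_int_iff[OF n] i by blast
    moreover have "v (n2 a) \<noteq> 2 * v (a$i)" using o by auto
    ultimately show ?thesis by linarith
  qed simp
  note this[of 1] this[of 2]
  then have "\<gamma> (a$1) * a$2 \<in> idl (v (n2 a) + 1)" "\<gamma> (a$2) * a$1 \<in> idl (v (n2 a) + 1)"
    by (cases "a$1 = 0"; cases "a$2 = 0"; simp add: idl_def v_mult)+
  then have "n2 a \<in> idl (v (n2 a) + 1)" unfolding n2_def by (rule idl_add)
  then show False using n by (simp add: idl_def)
qed

lemma op2_int_unit: "n2 a \<noteq> 0 \<Longrightarrow> v (n2 a) = 0 \<Longrightarrow> intmat 0 (op2 a a (n2 a)) \<Longrightarrow> a$i \<in> idl 0"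
  using op2_int_iff[of "n2 a" a] by (auto simp: idl_def)

text \<open>The adjugate. It reverses products and turns the projection \<open>pr u\<close> into the
  complementary one, as \<open>aj_pr\<close> records.\<close>

definition aj :: "'e^2^2 \<Rightarrow> 'e^2^2" where
  "aj A = vector [vector [A$2$2, - A$1$2], vector [- A$2$1, A$1$1]]"

lemma aj_entry [simp]: "aj A$1$1 = A$2$2" "aj A$1$2 = - A$1$2" "aj A$2$1 = - A$2$1" "aj A$2$2 = A$1$1"
  by (simp_all add: aj_def)

lemma aj_mult: "aj (A ** B) = aj B ** aj A"
  by (simp add: mat2_cases mult_entry sum_2 algebra_simps)

lemma aj_inv: assumes "A ** B = mat 1" shows "aj A = mat (det A) ** B"
proof -
  have "aj A ** A = mat (det A)" by (simp add: mat2_cases mult_entry sum_2 mat_def det_2 algebra_simps)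
  then have "aj A ** (A ** B) = mat (det A) ** B" by (simp only: matrix_mul_assoc)
  then show ?thesis using assms by simp
qed

lemma aj_pr: "n2 u \<noteq> 0 \<Longrightarrow> aj (pr u) = mat 1 - pr u"
  using pr_facts(1)[of u] unfolding mat2_cases by (simp add: mat_def algebra_simps)

text \<open>Insert \<open>pr u\<close> and its complement between \<open>h\<close> and the inverse
  of \<open>h'\<close>. The first part is integral by \<open>op2_int_mixed\<close>; the second is,
  up to a unit, the adjugate of the first part for \<open>h\<close> and \<open>h'\<close>
  interchanged. This is why a single orbit of the centre survives both tori.\<close>

lemma fixd_unique:
  assumes h: "is_sim J2 h s" and h': "is_sim J2 h' s'" and vs: "v s = v s'" and n: "n2 u \<noteq> 0"
    and f: "fixd h u" "fixd h' u"
  shows "intmat 0 (h ** matrix_inv h')"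
proof -
  have s0: "s \<noteq> 0" "s' \<noteq> 0" using is_simD h h' by blast+
  have i: "h ** matrix_inv h = mat 1" "matrix_inv h ** h = mat 1" "h' ** matrix_inv h' = mat 1" "matrix_inv h' ** h' = mat 1"
    using GU_inv_cancel[OF herm_J2] GU_I[OF herm_J2] h h' by blast+
  define X X' where "X = h ** pr u ** matrix_inv h'" "X' = h' ** pr u ** matrix_inv h"
  have o: "intmat 0 (op2 (h *v u) (h *v u) (s * n2 u))" "intmat 0 (op2 (h' *v u) (h' *v u) (s' * n2 u))"
    using f fixd_iff[OF h] fixd_iff[OF h'] by auto
  have sn: "s * n2 u \<noteq> 0" "s' * n2 u \<noteq> 0" "v (s * n2 u) = v (s' * n2 u)" using s0 n vs by (auto simp: v_mult)
  have X: "intmat 0 X" unfolding X_X'_def pr_def op2_conj[OF h'] by (rule op2_int_mixed[OF sn o])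
  have X': "intmat 0 X'" unfolding X_X'_def pr_def op2_conj[OF h] by (rule op2_int_mixed[OF sn(2,1) sn(3)[symmetric] o(2,1)])
  have d: "det h \<noteq> 0" "det h' \<noteq> 0" "v (det h) = v s" "v (det h') = v s'"
  proof -
    have "det h \<noteq> 0 \<and> v (det h) = v s" if h: "is_sim J2 h s" "s \<noteq> 0" for h s
    proof -
      have n: "\<gamma> (det h) * det h = s * s" "det h \<noteq> 0"
        using det_norm[OF GU_I[OF herm_J2 h(1)]] sim_eq[OF herm_J2 h(1)] by simp_all
      have "v (\<gamma> (det h) * det h) = v (s * s)" by (simp only: n(1))
      then show ?thesis using h(2) n(2) by (simp add: v_mult)
    qed
    then show "det h \<noteq> 0" "det h' \<noteq> 0" "v (det h) = v s" "v (det h') = v s'" using h h' s0 by blast+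
  qed
  have di: "det (matrix_inv h) = inverse (det h)"
    using arg_cong[OF i(1), of det] d(1) by (simp add: det_mul inverse_unique)
  have "aj X' = aj (matrix_inv h) ** (aj (pr u) ** aj h')" unfolding X_X'_def aj_mult by simp
  also have "\<dots> = mat (det (matrix_inv h)) ** h ** ((mat 1 - pr u) ** (mat (det h') ** matrix_inv h'))"
    unfolding aj_inv[OF i(2)] aj_inv[OF i(3)] aj_pr[OF n] ..
  also have "\<dots> = mat (inverse (det h) * det h') ** (h ** (mat 1 - pr u) ** matrix_inv h')"
    unfolding di
    by (simp only: matrix_mul_assoc[symmetric] mat_left_commute[of h] mat_left_commute[of "mat 1 - pr u"] mat_mult_mat_assoc)
  finally have e: "aj X' = mat (inverse (det h) * det h') ** (h ** (mat 1 - pr u) ** matrix_inv h')" .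
  have "intmat 0 (aj X')" using X' by (simp add: intmat_def forall_2)
  then have "intmat 0 (h ** (mat 1 - pr u) ** matrix_inv h')"
    unfolding e using d vs by (simp add: intmat_mat v_mult v_inverse)
  from intmat_add[OF X this] have "intmat 0 (X + h ** (mat 1 - pr u) ** matrix_inv h')" by simp
  moreover have "X + h ** (mat 1 - pr u) ** matrix_inv h' = h ** matrix_inv h'"
    unfolding X_X'_def by (simp add: mat_diff_left mat_diff_right)
  ultimately show ?thesis by simp
qed

text \<open>The row vector of the functional given by the hermitian product with
  \<open>w\<close>.\<close>

definition cov :: "'e^4 \<Rightarrow> 4 \<Rightarrow> 'e" where "cov w j = (\<Sum>l\<in>UNIV. \<gamma> (w$l) * J4$l$j)"

lemma cov_entry: "cov w 1 = \<gamma> (w$3)" "cov w 2 = \<gamma> (w$4)" "cov w 3 = \<gamma> (w$1)" "cov w 4 = \<gamma> (w$2)"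
  by (simp_all add: cov_def sum_4 J4_def)

lemma cov_int: "(\<And>i. w$i \<in> idl 0) \<Longrightarrow> cov w j \<in> idl 0"
  by (auto simp: cov_def intro!: idl_sum idl_mult0 intmatD)

lemma vec4_mult: "((h :: 'e^4^4) *v u)$i = h$i$1 * u$1 + h$i$2 * u$2 + h$i$3 * u$3 + h$i$4 * u$4"
  by (simp add: matrix_vector_mult_def sum_4)

lemma cov_sim:
  assumes "is_sim J4 r s"
  shows "\<gamma> ((r *v w)$3) * r$1$j + \<gamma> ((r *v w)$4) * r$2$j + \<gamma> ((r *v w)$1) * r$3$j + \<gamma> ((r *v w)$2) * r$4$j = s * cov w j"
proof -
  have e: "(adj r ** J4 ** r)$l$j = s * J4$l$j" for l using is_simD[OF assms] by simp
  have "s * cov w j = (\<Sum>l\<in>UNIV. \<gamma> (w$l) * (adj r ** J4 ** r)$l$j)"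
    unfolding e cov_def by (simp add: sum_distrib_left mult.left_commute)
  also have "\<dots> = \<gamma> ((r *v w)$3) * r$1$j + \<gamma> ((r *v w)$4) * r$2$j + \<gamma> ((r *v w)$1) * r$3$j + \<gamma> ((r *v w)$2) * r$4$j"
    by (simp add: sum_4 mult_entry J4_def vec4_mult gamma_add gamma_mult algebra_simps)
  finally show ?thesis ..
qed

lemma hn_sim:
  assumes "is_sim J4 r s" shows "hn (r *v w) = s * hn w"
proof -
  let ?c = "\<lambda>j. \<gamma> ((r *v w)$3) * r$1$j + \<gamma> ((r *v w)$4) * r$2$j + \<gamma> ((r *v w)$1) * r$3$j + \<gamma> ((r *v w)$2) * r$4$j"
  have "hn (r *v w) = ?c 1 * w$1 + ?c 2 * w$2 + ?c 3 * w$3 + ?c 4 * w$4"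
    unfolding hn_def vec4_mult by algebra
  also have "\<dots> = s * hn w" unfolding cov_sim[OF assms] cov_entry hn_def by algebra
  finally show ?thesis .
qed

definition u13 :: "'e^4 \<Rightarrow> 'e^2" where "u13 x = vector [x$1, x$3]"
definition u24 :: "'e^4 \<Rightarrow> 'e^2" where "u24 x = vector [x$2, x$4]"

lemma u13_nth [simp]: "u13 x$1 = x$1" "u13 x$2 = x$3" and u24_nth [simp]: "u24 x$1 = x$2" "u24 x$2 = x$4"
  by (simp_all add: u13_def u24_def)

lemma n2_u13: "x$2 = 0 \<Longrightarrow> x$4 = 0 \<Longrightarrow> n2 (u13 x) = hn x" and n2_u24: "x$1 = 0 \<Longrightarrow> x$3 = 0 \<Longrightarrow> n2 (u24 x) = hn x"
  by (simp_all add: n2_def hn_def)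

text \<open>Pulled back by \<open>r\<close>, the projection onto the image of \<open>w\<close>
  becomes the projection \<open>W\<close> onto \<open>w\<close> itself, which is integral since
  \<open>w\<close> is and its norm is a unit.\<close>

lemma tor_Hs:
  assumes r: "r \<in> carrier G" and w: "\<And>i. w$i \<in> idl 0" "(r *v w)$2 = 0" "(r *v w)$4 = 0" "hn w \<noteq> 0" "v (hn w) = 0"
    and t: "t \<in> C"
  shows "(tor (u13 (r *v w)) t, mat 1) \<in> Hs r"
proof -
  define s where "s = sim J4 r"
  have s: "is_sim J4 r s" unfolding s_def by (rule GU_sim[OF herm_J4 r])
  have s0: "s \<noteq> 0" using is_simD[OF s] by blast
  define u where "u = u13 (r *v w)"
  have n: "n2 u = s * hn w" unfolding u_def n2_u13[OF w(2,3)] by (rule hn_sim[OF s])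
  then have n0: "n2 u \<noteq> 0" using s0 w by simp
  have u: "u$1 = (r *v w)$1" "u$2 = (r *v w)$3" by (simp_all add: u_def)
  define W :: "'e^4^4" where "W = (\<chi> i j. w$i * cov w j / hn w)"
  have W: "intmat 0 W" using w(1,4,5) cov_int[of w]
    by (auto simp: intmat_def W_def idl_divide_iff intro!: idl_mult0)
  have c: "s * cov w j = \<gamma> (u$2) * r$1$j + \<gamma> (u$1) * r$3$j" for j using cov_sim[OF s, of w j] w(2,3) u by simp
  have cn: "cov w j / hn w = (\<gamma> (u$2) * r$1$j + \<gamma> (u$1) * r$3$j) / n2 u" for j
    unfolding c[symmetric] n using s0 by simp
  have rW: "(r ** W)$i$j = (r *v w)$i * (cov w j / hn w)" for i j
    by (simp add: mult_entry sum_4 W_def vec4_mult algebra_simps add_divide_distrib)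
  have "\<iota> (tor u t, mat 1) ** r = r ** (mat 1 + mat (t - 1) ** W)"
  proof -
    have e1: "(r ** (mat 1 + mat (t - 1) ** W))$i$j = r$i$j + (t - 1) * (r ** W)$i$j" for i j
    proof -
      have "r ** (mat 1 + mat (t - 1) ** W) = r ** mat 1 + r ** (mat (t - 1) ** W)"
        by (rule matrix_add_ldistrib)
      then show ?thesis unfolding mat_left_commute by simp
    qed
    show ?thesis unfolding vec_eq_iff forall_4[where P = "\<lambda>i. \<forall>j. _ i j"] e1 rW cn
      by (simp add: mult_entry sum_4 iota_entry mat_def tor_entry pr_def u[symmetric] w(2,3) algebra_simps add_divide_distrib)
  qed
  then have "matrix_inv r ** (\<iota> (tor u t, mat 1) ** r) = matrix_inv r ** r ** (mat 1 + mat (t - 1) ** W)"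
    by (simp only: matrix_mul_assoc)
  then have e: "matrix_inv r ** \<iota> (tor u t, mat 1) ** r = mat 1 + mat (t - 1) ** W"
    using GU_inv_cancel(1)[OF herm_J4 r] by (simp only: matrix_mul_assoc mat_one_mult)
  have i: "is_sim J4 (\<iota> (tor u t, mat 1)) 1" unfolding is_sim_iota using is_sim_tor[OF n0 t] by simp
  have "is_sim J4 (matrix_inv r ** \<iota> (tor u t, mat 1) ** r) (inverse s * 1 * s)"
    by (rule is_sim_mult[OF is_sim_mult[OF is_sim_inv(1)[OF herm_J4 s] i] s])
  moreover have "t - 1 \<in> idl 0" using C_D(3)[OF t] by (intro idl_diff) (auto intro: idl_self)
  then have "intmat 0 (mat 1 + mat (t - 1) ** W)"
    using W intmat_one by (intro intmat_add) (auto simp: intmat_def intro!: idl_mult0)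
  ultimately have "matrix_inv r ** \<iota> (tor u t, mat 1) ** r \<in> K" using s0 e by (intro K_I) auto
  moreover have "(tor u t, mat 1) \<in> carrier H" using H_iff_iota GU_I[OF herm_J4 i] by blast
  ultimately show ?thesis by (simp add: Hs_def u_def)
qed

text \<open>In each plane the two rows of \<open>g\<close> are replaced by the functional of the
  integral image vector and by one annihilating it. Rows of the first kind are
  \<open>s * cov w\<close>, hence integral. Those of the second kind have an integral Gram matrix,
  whose 2 by 2 determinants are, up to units, norms of the minors of these two rows. So every minor
  contains an integral row or is itself integral.\<close>

lemma special_minors:
  assumes g: "g \<in> carrier G" "v (sim J4 g) = 0" "intmat (-1) g"
    and w1: "\<And>i. w1$i \<in> idl 0" "(g *v w1)$2 = 0" "(g *v w1)$4 = 0" "hn w1 \<noteq> 0" "v (hn w1) = 0"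
    and w2: "\<And>i. w2$i \<in> idl 0" "(g *v w2)$1 = 0" "(g *v w2)$3 = 0" "hn w2 \<noteq> 0" "v (hn w2) = 0"
    and i: "\<And>i. (g *v w1)$i \<in> idl 0" "\<And>i. (g *v w2)$i \<in> idl 0"
  shows "intmin (-1) g"
proof -
  define s where "s = sim J4 g"
  have s: "is_sim J4 g s" unfolding s_def by (rule GU_sim[OF herm_J4 g(1)])
  have s0: "s \<noteq> 0" "v s = 0" using is_simD[OF s] g by (auto simp: s_def)
  define x1 y1 x2 y2 where xy: "x1 = (g *v w1)$1" "y1 = (g *v w1)$3" "x2 = (g *v w2)$2" "y2 = (g *v w2)$4"
  have xyi: "x1 \<in> idl 0" "y1 \<in> idl 0" "x2 \<in> idl 0" "y2 \<in> idl 0" using i by (simp_all add: xy)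
  define m1 m2 where m: "m1 = \<gamma> x1 * y1 + \<gamma> y1 * x1" "m2 = \<gamma> x2 * y2 + \<gamma> y2 * x2"
  have mh: "m1 = s * hn w1" "m2 = s * hn w2"
    using hn_sim[OF s, of w1] hn_sim[OF s, of w2] w1(2,3) w2(2,3) by (simp_all add: hn_def m xy)
  have m0: "m1 \<noteq> 0" "v m1 = 0" "m2 \<noteq> 0" "v m2 = 0" using mh s0 w1 w2 by (simp_all add: v_mult)
  have gm: "\<gamma> m1 = m1" "\<gamma> m2 = m2" by (simp_all add: m gamma_add gamma_mult algebra_simps)
  \<comment> \<open>The first row is the functional of \<open>(x, y)\<close>, the second annihilates
    that vector. The only denominator of the inverse \<open>B'\<close> is the norm, a unit here, so
    this change of rows is in \<open>GLO\<close>.\<close>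
  define B :: "'e \<Rightarrow> 'e \<Rightarrow> 'e^2^2" where "B x y = vector [vector [\<gamma> y, \<gamma> x], vector [y, - x]]" for x y
  define B' :: "'e \<Rightarrow> 'e \<Rightarrow> 'e \<Rightarrow> 'e^2^2" where "B' x y n = vector [vector [x / n, \<gamma> x / n], vector [y / n, - \<gamma> y / n]]" for x y n
  have BB': "B x1 y1 ** B' x1 y1 m1 = mat 1" "B x2 y2 ** B' x2 y2 m2 = mat 1"
    using m0 by (simp_all add: mat2_cases mult_entry sum_2 mat_def B_def B'_def add_divide_distrib[symmetric])
      (simp_all add: m algebra_simps)
  have "intmat 0 (B x1 y1)" "intmat 0 (B x2 y2)" "intmat 0 (B' x1 y1 m1)" "intmat 0 (B' x2 y2 m2)"
    using xyi m0 by (simp_all add: intmat_def forall_2 B_def B'_def idl_divide_iff)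
  then have BG: "\<iota> (B x1 y1, B x2 y2) \<in> GLO"
    unfolding GLO_def using BB' by (auto simp: iota_mult intmat_iota iota_mat intro!: exI[of _ "\<iota> (B' x1 y1 m1, B' x2 y2 m2)"])
  define R where "R = \<iota> (B x1 y1, B x2 y2) ** g"
  have R: "R$1$j = \<gamma> y1 * g$1$j + \<gamma> x1 * g$3$j" "R$3$j = y1 * g$1$j - x1 * g$3$j"
    "R$2$j = \<gamma> y2 * g$2$j + \<gamma> x2 * g$4$j" "R$4$j = y2 * g$2$j - x2 * g$4$j" for j
    by (simp_all add: R_def mult_entry sum_4 iota_entry B_def)
  have R12: "R$1$j \<in> idl 0" "R$2$j \<in> idl 0" for j
  proof -
    have "R$1$j = s * cov w1 j" "R$2$j = s * cov w2 j"
      using cov_sim[OF s, of w1 j] cov_sim[OF s, of w2 j] w1(2,3) w2(2,3) by (simp_all add: R xy)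
    then show "R$1$j \<in> idl 0" "R$2$j \<in> idl 0" using s0 cov_int[OF w1(1)] cov_int[OF w2(1)] by (simp_all add: idl_mult_iff)
  qed
  have Ri: "intmat (-1) R" unfolding R_def using GLO_intmat(1)[OF BG] g(3) by blast
  define Nm where "Nm j k = \<gamma> (R$3$j) * R$3$k / m1 + \<gamma> (R$4$j) * R$4$k / m2" for j k
  have "Nm j k \<in> idl 0" for j k
  proof -
    have "\<gamma> (g$1$j) * g$3$k + \<gamma> (g$2$j) * g$4$k + \<gamma> (g$3$j) * g$1$k + \<gamma> (g$4$j) * g$2$k = (adj g ** J4 ** g)$j$k"
      by (simp add: mult_entry sum_4 J4_def algebra_simps)
    also have "\<dots> = s * J4$j$k" using is_simD[OF s] by simp
    finally have e: "\<gamma> (g$1$j) * g$3$k + \<gamma> (g$2$j) * g$4$k + \<gamma> (g$3$j) * g$1$k + \<gamma> (g$4$j) * g$2$k = s * J4$j$k" .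
    have "\<gamma> (R$1$j) * R$1$k - \<gamma> (R$3$j) * R$3$k = m1 * (\<gamma> (g$1$j) * g$3$k + \<gamma> (g$3$j) * g$1$k)"
      "\<gamma> (R$2$j) * R$2$k - \<gamma> (R$4$j) * R$4$k = m2 * (\<gamma> (g$2$j) * g$4$k + \<gamma> (g$4$j) * g$2$k)"
      unfolding R m gamma_add gamma_mult gamma_diff gamma_invol by algebra+
    then have "\<gamma> (R$1$j) * R$1$k / m1 - \<gamma> (R$3$j) * R$3$k / m1 = \<gamma> (g$1$j) * g$3$k + \<gamma> (g$3$j) * g$1$k"
      "\<gamma> (R$2$j) * R$2$k / m2 - \<gamma> (R$4$j) * R$4$k / m2 = \<gamma> (g$2$j) * g$4$k + \<gamma> (g$4$j) * g$2$k"
      using m0 by (simp_all add: diff_divide_distrib[symmetric])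
    then have "Nm j k = \<gamma> (R$1$j) * R$1$k / m1 + \<gamma> (R$2$j) * R$2$k / m2 - s * J4$j$k"
      unfolding Nm_def using e by algebra
    moreover have "\<gamma> (R$1$j) * R$1$k / m1 \<in> idl 0" "\<gamma> (R$2$j) * R$2$k / m2 \<in> idl 0" 
      using m0 R12 by (simp_all add: idl_divide_iff idl_mult0)
    moreover have "s * J4$j$k \<in> idl 0" using s0 intmatD[OF intmat_J(2)] by (simp add: idl_mult_iff)
    ultimately show ?thesis by (simp add: idl_add idl_diff)
  qed
  note Ni = this
  have R34: "minor R 3 4 j k \<in> idl 0" for j k
  proof -
    let ?m = "minor R 3 4 j k"
    have "Nm j j * Nm k k - Nm j k * Nm k j = \<gamma> ?m * ?m / (m1 * m2)"
      unfolding Nm_def minor_def gamma_diff gamma_mult using m0 by (simp add: field_simps) 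
    moreover have "Nm j j * Nm k k - Nm j k * Nm k j \<in> idl 0" using Ni by (intro idl_diff idl_mult0)
    ultimately have "\<gamma> ?m * ?m \<in> idl 0" using m0 by (simp add: idl_divide_iff v_mult)
    then show ?thesis by (cases "?m = 0") (auto simp: idl_def v_mult)
  qed
  have "intmin (-1) R"
    unfolding intmin_def
  proof (intro allI)
    fix a b j k
    have sw: "minor R a b j k = - minor R b a j k" for a b j k by (simp add: minor_def)
    have r12: "minor R a b j k \<in> idl (-1)" if "\<And>l. R$a$l \<in> idl 0" for a b j k
      unfolding minor_def using that intmatD[OF Ri] by (intro idl_diff idl_mult0)
    have r: "minor R 1 b j k \<in> idl (-1)" "minor R 2 b j k \<in> idl (-1)" for b j k using r12 R12 by blast+
    then have r': "minor R b 1 j k \<in> idl (-1)" "minor R b 2 j k \<in> idl (-1)" for b j k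
      by (subst sw, simp)+
    have r34: "minor R 3 4 j k \<in> idl (-1)" for j k by (rule idl_mono[OF R34]) simp
    then have r43: "minor R 4 3 j k \<in> idl (-1)" for j k by (subst sw, simp)
    have z: "minor R b b j k = 0" for b j k by (simp add: minor_def)
    show "minor R a b j k \<in> idl (-1)"
      using exhaust_4[of a] exhaust_4[of b] r r' r34 r43 z by auto
  qed
  then show ?thesis unfolding R_def using GLO_intmin[OF BG] by blast
qed

end

section \<open>Actions of C with small stabilizers\<close>

context odd_unramified_extension
begin

text \<open>The Cayley transform of \<open>b * th\<close>, for \<open>b\<close> in O_F, reaches
  every element of \<open>C\<close> outside the class of -1 and respects residue classes. The
  residue field gives \<open>q\<close> classes, and -1 the last one.\<close>

lemma C_reps:
  obtains R where "finite R" "card R = q + 1" "R \<subseteq> C" "\<And>t. t \<in> C \<Longrightarrow> \<exists>r\<in>R. t - r \<in> idl 1"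
    "\<And>r s. r \<in> R \<Longrightarrow> s \<in> R \<Longrightarrow> r - s \<in> idl 1 \<Longrightarrow> r = s"
proof -
  obtain B where B: "finite B" "card B = q" "B \<subseteq> F \<inter> idl 0" "\<And>x. x \<in> F \<Longrightarrow> x \<in> idl 0 \<Longrightarrow> \<exists>r\<in>B. x - r \<in> idl 1"
    "\<And>r s. r \<in> B \<Longrightarrow> s \<in> B \<Longrightarrow> r - s \<in> idl 1 \<Longrightarrow> r = s"
    using residue_reps by blast
  define k where "k b = (1 + b * th) / (1 - b * th)" for b
  have u: "1 - b * th \<noteq> 0 \<and> v (1 - b * th) = 0" if b: "b \<in> F" "b \<in> idl 0" for b
  proof -
    have "1 + (- b) * th \<in> idl 0" "1 + (- b) * th \<notin> idl 1"
      using F_th_idl_iff[of 1 "-b"] b F_minus by (auto simp: idl_def)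
    then show ?thesis by (auto simp: idl_def)
  qed
  have kC: "k b \<in> C" if b: "b \<in> F" "b \<in> idl 0" for b
  proof (rule C_I)
    have "1 + b * th \<noteq> 0" using u[of "-b"] b F_minus by simp
    moreover have "\<gamma> (k b) = (1 - b * th) / (1 + b * th)"
      using b by (simp add: k_def gamma_divide gamma_add gamma_diff gamma_mult gamma_fixes th)
    ultimately show "k b * \<gamma> (k b) = 1" using u[OF b] by (simp add: k_def)
  qed
  have kd: "k b - k c \<in> idl 1 \<longleftrightarrow> b - c \<in> idl 1" if b: "b \<in> F" "b \<in> idl 0" and c: "c \<in> F" "c \<in> idl 0" for b c
  proof -
    have "k b - k c = (2 * th * (b - c)) / ((1 - b * th) * (1 - c * th))"
      using u[OF b] u[OF c] by (simp add: k_def field_simps)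
    also have "\<dots> \<in> idl 1 \<longleftrightarrow> 2 * (th * (b - c)) \<in> idl 1"
      using u[OF b] u[OF c] by (subst idl_divide_iff) (auto simp: v_mult mult.assoc)
    also have "\<dots> \<longleftrightarrow> b - c \<in> idl 1" using th by (simp add: idl_mult_iff)
    finally show ?thesis .
  qed
  have km: "k b - (-1) \<notin> idl 1" if b: "b \<in> F" "b \<in> idl 0" for b
  proof -
    have "k b - (-1) = 2 / (1 - b * th)" using u[OF b] by (simp add: k_def field_simps)
    then show ?thesis using u[OF b] by (simp add: idl_divide_iff) (simp add: idl_def)
  qed
  have m1: "-1 \<in> C" by (rule C_I) (simp add: gamma_minus)
  have Bi: "b \<in> F" "b \<in> idl 0" if "b \<in> B" for b using B(3) that by auto
  show thesis
  proof (rule that[of "insert (-1) (k ` B)"])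
    show "finite (insert (-1) (k ` B))" using B by simp
    have "inj_on k B"
    proof (rule inj_onI)
      fix b c assume b: "b \<in> B" "c \<in> B" "k b = k c"
      then have "k b - k c \<in> idl 1" by simp
      then show "b = c" using kd[OF Bi Bi] b B(5) by blast
    qed
    moreover have "-1 \<notin> k ` B"
    proof
      assume "-1 \<in> k ` B"
      then obtain b where b: "b \<in> B" "k b = -1" by auto
      then show False using km[OF Bi[OF b(1)]] by simp
    qed
    ultimately show "card (insert (-1) (k ` B)) = q + 1" using B by (simp add: card_image)
    show "insert (-1) (k ` B) \<subseteq> C" using m1 kC Bi by auto
    fix t assume t: "t \<in> C"
    note tt = C_D[OF t]
    show "\<exists>r\<in>insert (-1) (k ` B). t - r \<in> idl 1"
    proof (cases "t + 1 \<in> idl 1")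
      case True then show ?thesis by simp
    next
      case False
      have "t + 1 \<in> idl 0" using tt(3) by (intro idl_add) (auto intro: idl_self)
      with False have t1: "t + 1 \<noteq> 0" "v (t + 1) = 0" by (auto simp: idl_def)
      define b where "b = (t - 1) / (t + 1) / th"
      have i: "inverse t - 1 = - (t - 1) / t" "inverse t + 1 = (t + 1) / t" using tt(1) by (simp_all add: field_simps)
      have "\<gamma> ((t - 1) / (t + 1)) = (inverse t - 1) / (inverse t + 1)"
        by (simp add: gamma_divide gamma_diff gamma_add tt(4))
      also have "\<dots> = - ((t - 1) / (t + 1))" unfolding i using tt(1) by (simp add: minus_divide_left)
      finally have bF: "b \<in> F" unfolding b_def using skew_F by blast
      have "t - 1 \<in> idl 0" using tt(3) by (intro idl_diff) (auto intro: idl_self)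
      then have b0: "b \<in> idl 0" using t1 th by (simp add: b_def idl_divide_iff v_mult)
      have bt: "b * th = (t - 1) / (t + 1)" using th by (simp add: b_def)
      have "1 + b * th = 2 * t / (t + 1)" "1 - b * th = 2 / (t + 1)" unfolding bt using t1(1) by (simp_all add: field_simps)
      then have "k b = t" using t1(1) by (simp add: k_def)
      moreover obtain c where "c \<in> B" "b - c \<in> idl 1" using B(4)[OF bF b0] by blast
      ultimately show ?thesis using kd[OF bF b0 Bi] by blast
    qed
  next
    fix r s assume rs: "r \<in> insert (-1) (k ` B)" "s \<in> insert (-1) (k ` B)" "r - s \<in> idl 1"
    have n: "k b - (-1) \<notin> idl 1" "(-1) - k b \<notin> idl 1" if "b \<in> B" for b
      using km[OF Bi[OF that]] idl_commute[of "k b" "-1"] by simp_all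
    show "r = s"
    proof (cases "r \<in> k ` B")
      case True
      then obtain b where b: "b \<in> B" "r = k b" by auto
      have "s \<noteq> -1" using n(1)[OF b(1)] rs(3) b(2) by auto
      then obtain d where d: "d \<in> B" "s = k d" using rs(2) by auto
      have "b - d \<in> idl 1" using kd[OF Bi[OF b(1)] Bi[OF d(1)]] rs(3) b(2) d(2) by simp
      then show ?thesis using B(5)[OF b(1) d(1)] b(2) d(2) by simp
    next
      case False
      then have r: "r = -1" using rs(1) by simp
      then have "s \<notin> k ` B" using n(2) rs(3) by auto
      then show ?thesis using rs(2) r by simp
    qed
  qed
qed

lemma C_translate: "s \<in> C \<Longrightarrow> s * x \<in> idl n \<longleftrightarrow> x \<in> idl n"
  using C_D(1,3)[of s] by (simp add: idl_mult_iff)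

text \<open>Since stabilizers lie in \<open>D\<close>, each point has a well-defined class in
  \<open>C\<close> modulo \<open>D\<close> relative to a base point of its orbit. This cuts
  \<open>Y\<close> into \<open>q + 1\<close> parts, permuted transitively by \<open>C\<close>, on
  which the invariant function has equal sums.\<close>

lemma free_orbit_sum:
  fixes \<alpha> :: "'e \<Rightarrow> 'b \<Rightarrow> 'b" and f :: "'b \<Rightarrow> real"
  assumes fin: "finite Y" and one: "\<And>y. y \<in> Y \<Longrightarrow> \<alpha> 1 y = y"
    and mult: "\<And>s t y. s \<in> C \<Longrightarrow> t \<in> C \<Longrightarrow> y \<in> Y \<Longrightarrow> \<alpha> s (\<alpha> t y) = \<alpha> (s * t) y"
    and closed: "\<And>t y. t \<in> C \<Longrightarrow> y \<in> Y \<Longrightarrow> \<alpha> t y \<in> Y"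
    and inv: "\<And>t y. t \<in> C \<Longrightarrow> y \<in> Y \<Longrightarrow> f (\<alpha> t y) = f y"
    and stab: "\<And>t y. t \<in> C \<Longrightarrow> y \<in> Y \<Longrightarrow> \<alpha> t y = y \<Longrightarrow> t \<in> D"
    and Zq: "\<And>y. y \<in> Y \<Longrightarrow> f y \<in> Zq"
  shows "\<exists>z\<in>Zq. sum f Y = (real q + 1) * z"
proof -
  obtain R where R: "finite R" "card R = q + 1" "R \<subseteq> C" "\<And>t. t \<in> C \<Longrightarrow> \<exists>r\<in>R. t - r \<in> idl 1"
    "\<And>r s. r \<in> R \<Longrightarrow> s \<in> R \<Longrightarrow> r - s \<in> idl 1 \<Longrightarrow> r = s"
    using C_reps by blast
  define orb where "orb y = (\<lambda>t. \<alpha> t y) ` C" for y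
  \<comment> \<open>Chosen from the orbit as a set, so that all its points share the base
    point.\<close>
  define rep where "rep y = (SOME z. z \<in> orb y)" for y
  have undo: "\<alpha> (inverse t) (\<alpha> t y) = y" "\<alpha> t (\<alpha> (inverse t) y) = y" if "t \<in> C" "y \<in> Y" for t y
    using mult[of "inverse t" t y] mult[of t "inverse t" y] that C_inverse C_D(1) one by simp_all
  have orb: "orb (\<alpha> t y) = orb y" if t: "t \<in> C" and y: "y \<in> Y" for t y
  proof (intro equalityI subsetI)
    fix z assume "z \<in> orb (\<alpha> t y)"
    then obtain s where "s \<in> C" "z = \<alpha> s (\<alpha> t y)" by (auto simp: orb_def)
    then show "z \<in> orb y" using mult t y C_mult by (auto simp: orb_def)
  next
    fix z assume "z \<in> orb y"
    then obtain s where s: "s \<in> C" "z = \<alpha> s y" by (auto simp: orb_def)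
    have st: "s * inverse t \<in> C" using s t C_mult C_inverse by blast
    have "s * inverse t * t = s" using C_D(1)[OF t] by (simp add: mult.assoc)
    then have "z = \<alpha> (s * inverse t) (\<alpha> t y)" unfolding mult[OF st t y] s(2) by (simp only:)
    with st show "z \<in> orb (\<alpha> t y)" unfolding orb_def by blast
  qed
  have rep: "rep y \<in> Y \<and> (\<exists>t\<in>C. \<alpha> t (rep y) = y)" if y: "y \<in> Y" for y
  proof -
    have "y \<in> orb y" unfolding orb_def by (rule image_eqI[of _ _ 1]) (simp_all add: one[OF y])
    then have "rep y \<in> orb y" unfolding rep_def by (rule someI)
    then obtain s where s: "s \<in> C" "rep y = \<alpha> s y" by (auto simp: orb_def)
    then have "\<alpha> (inverse s) (rep y) = y" using undo y by simp
    then show ?thesis using s closed y C_inverse by metis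
  qed
  have rep_inv: "rep (\<alpha> t y) = rep y" if "t \<in> C" "y \<in> Y" for t y
    unfolding rep_def orb[OF that] ..
  define P where "P r = {y \<in> Y. \<exists>t\<in>C. t - r \<in> idl 1 \<and> \<alpha> t (rep y) = y}" for r
  have U: "(\<Union>r\<in>R. P r) = Y"
  proof -
    have "\<exists>r\<in>R. y \<in> P r" if y: "y \<in> Y" for y
    proof -
      obtain t where "t \<in> C" "\<alpha> t (rep y) = y" using rep[OF y] by blast
      then show ?thesis using R(4)[of t] y unfolding P_def by blast
    qed
    then show ?thesis by (auto simp: P_def)
  qed
  have disj: "r = r'" if r: "r \<in> R" "r' \<in> R" "y \<in> P r" "y \<in> P r'" for r r' y
  proof -
    obtain t t' where t: "t \<in> C" "t - r \<in> idl 1" "\<alpha> t (rep y) = y" "t' \<in> C" "t' - r' \<in> idl 1" "\<alpha> t' (rep y) = y" "y \<in> Y"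
      using r by (auto simp: P_def)
    have ry: "rep y \<in> Y" using rep t by blast
    have "\<alpha> (inverse t * t') (rep y) = rep y"
      using mult[of "inverse t" t' "rep y"] undo[of t "rep y"] t ry C_inverse by simp
    then have "inverse t * t' \<in> D" using stab t ry C_mult C_inverse by blast
    then have "t * (inverse t * t' - 1) \<in> idl 1" using C_translate[OF t(1)] by (simp add: D_eq)
    then have "t' - t \<in> idl 1" using C_D(1)[OF t(1)] by (simp add: algebra_simps)
    then have "r' - r \<in> idl 1" using t(2,5) idl_commute idl_cong_trans by blast
    then show ?thesis using R(5) r by blast
  qed
  have shift: "\<alpha> (r' * inverse r) y \<in> P r'" if r: "r \<in> R" "r' \<in> R" "y \<in> P r" for r r' y
  proof -
    obtain t where t: "t \<in> C" "t - r \<in> idl 1" "\<alpha> t (rep y) = y" "y \<in> Y" using r by (auto simp: P_def)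
    have rC: "r \<in> C" "r' \<in> C" using r R by auto
    then have c: "r' * inverse r \<in> C" using C_mult C_inverse by blast
    have "r' * inverse r * (t - r) \<in> idl 1" using C_translate[OF c] t by blast
    then have "r' * inverse r * t - r' \<in> idl 1" using C_D(1)[OF rC(1)] by (simp add: algebra_simps)
    moreover have "\<alpha> (r' * inverse r * t) (rep (\<alpha> (r' * inverse r) y)) = \<alpha> (r' * inverse r) y"
      unfolding rep_inv[OF c t(4)] using mult[OF c t(1), of "rep y"] rep[OF t(4)] t(3) by simp
    ultimately show ?thesis using closed[OF c t(4)] C_mult[OF c t(1)] unfolding P_def by blast
  qed
  have eq: "sum f (P r) = sum f (P r')" if r: "r \<in> R" "r' \<in> R" for r r'
  proof (rule sum.reindex_bij_witness[of _ "\<alpha> (r * inverse r')" "\<alpha> (r' * inverse r)"])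
    have rC: "r \<in> C" "r' \<in> C" using r R by auto
    then have c: "r' * inverse r \<in> C" "r * inverse r' \<in> C" using C_mult C_inverse by blast+
    have PY: "P x \<subseteq> Y" for x by (auto simp: P_def)
    fix y assume y: "y \<in> P r"
    show "\<alpha> (r * inverse r') (\<alpha> (r' * inverse r) y) = y"
    proof -
      have p: "r * inverse r' * (r' * inverse r) = 1" using C_D(1)[OF rC(1)] C_D(1)[OF rC(2)] by (simp add: field_simps)
      have yY: "y \<in> Y" using y PY by blast
      show ?thesis unfolding mult[OF c(2,1) yY] p by (rule one[OF yY])
    qed
    show "\<alpha> (r' * inverse r) y \<in> P r'" using shift r y by blast
    show "f (\<alpha> (r' * inverse r) y) = f y" using inv[OF c(1)] y PY by auto
  next
    have rC: "r \<in> C" "r' \<in> C" using r R by auto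
    then have c: "r' * inverse r \<in> C" "r * inverse r' \<in> C" using C_mult C_inverse by blast+
    have PY: "P x \<subseteq> Y" for x by (auto simp: P_def)
    fix y assume y: "y \<in> P r'"
    show "\<alpha> (r' * inverse r) (\<alpha> (r * inverse r') y) = y"
    proof -
      have p: "r' * inverse r * (r * inverse r') = 1" using C_D(1)[OF rC(1)] C_D(1)[OF rC(2)] by (simp add: field_simps)
      have yY: "y \<in> Y" using y PY by blast
      show ?thesis unfolding mult[OF c(1,2) yY] p by (rule one[OF yY])
    qed
    show "\<alpha> (r * inverse r') y \<in> P r" using shift r y by blast
  qed
  obtain r0 where r0: "r0 \<in> R" using R(2) by (metis card.empty all_not_in_conv add_is_0 one_neq_zero)
  have "sum f Y = (\<Sum>r\<in>R. sum f (P r))"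
    unfolding U[symmetric] by (rule sum.UNION_disjoint) (use R(1) fin disj in \<open>auto simp: P_def\<close>)
  also have "\<dots> = (\<Sum>r\<in>R. sum f (P r0))" by (rule sum.cong[OF refl]) (rule eq[OF _ r0])
  also have "\<dots> = (real q + 1) * sum f (P r0)" using R(2) by simp
  finally show ?thesis using Zq by (intro bexI[of _ "sum f (P r0)"] Zq_sum) (auto simp: P_def)
qed

end

section \<open>Counting an H-orbit in two ways\<close>

context odd_unramified_haar
begin

interpretation HG: group H by (rule H_group)

text \<open>The values of \<open>\<nu>\<close> on \<open>Hs r\<close> fill \<open>C\<close>, so the
  cosets of \<open>HD r\<close> correspond to the \<open>q + 1\<close> residue classes of
  \<open>C\<close>.\<close>

lemma measure_Hs_HD:
  assumes r: "r \<in> carrier G" and onto: "\<And>t. t \<in> C \<Longrightarrow> \<exists>h\<in>Hs r. \<nu> h = t"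
  shows "measure \<mu> (Hs r) = (real q + 1) * measure \<mu> (HD r)"
proof -
  obtain R where R: "finite R" "card R = q + 1" "R \<subseteq> C" "\<And>t. t \<in> C \<Longrightarrow> \<exists>r\<in>R. t - r \<in> idl 1"
    "\<And>r s. r \<in> R \<Longrightarrow> s \<in> R \<Longrightarrow> r - s \<in> idl 1 \<Longrightarrow> r = s"
    using C_reps by blast
  have gV: "good (Hs r)" and gW: "good (HD r)" using good_Hs[OF r] good_HD[OF r] by auto
  note V = goodD(1)[OF gV] and W = goodD(1)[OF gW]
  have VH: "x \<in> carrier H" if "x \<in> Hs r" for x using goodD(2)[OF gV] that by blast
  obtain x where x: "\<And>c. c \<in> R \<Longrightarrow> x c \<in> Hs r \<and> \<nu> (x c) = c"
    using onto R(3) by (metis subsetD)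
  have "bij_betw (\<lambda>c. x c <#\<^bsub>H\<^esub> HD r) R ((\<lambda>h. h <#\<^bsub>H\<^esub> HD r) ` Hs r)"
    unfolding bij_betw_def
  proof (intro conjI inj_onI equalityI subsetI)
    fix c c' assume c: "c \<in> R" "c' \<in> R" "x c <#\<^bsub>H\<^esub> HD r = x c' <#\<^bsub>H\<^esub> HD r"
    have "x c \<otimes>\<^bsub>H\<^esub> \<one>\<^bsub>H\<^esub> \<in> x c <#\<^bsub>H\<^esub> HD r" using goodD(3)[OF gW] unfolding l_coset_def by blast
    then have "x c \<in> x c <#\<^bsub>H\<^esub> HD r" using x[OF c(1)] VH by simp
    then have "x c \<in> x c' <#\<^bsub>H\<^esub> HD r" using c(3) by simp
    then obtain d where d: "d \<in> HD r" "x c = x c' \<otimes>\<^bsub>H\<^esub> d" by (auto simp: l_coset_def)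
    then have e: "c = c' * \<nu> d" using x c nu_mult by metis
    have "\<nu> d - 1 \<in> idl 1" using d(1) by (simp add: HD_def D_eq)
    then have "c' * (\<nu> d - 1) \<in> idl 1" using C_translate R(3) c(2) by blast
    then have "c - c' \<in> idl 1" unfolding e by (simp add: algebra_simps)
    then show "c = c'" using R(5) c by blast
  next
    fix A assume "A \<in> (\<lambda>c. x c <#\<^bsub>H\<^esub> HD r) ` R"
    then show "A \<in> (\<lambda>h. h <#\<^bsub>H\<^esub> HD r) ` Hs r" using x by blast
  next
    fix A assume "A \<in> (\<lambda>h. h <#\<^bsub>H\<^esub> HD r) ` Hs r"
    then obtain y where y: "y \<in> Hs r" "A = y <#\<^bsub>H\<^esub> HD r" by blast
    obtain c where c: "c \<in> R" "\<nu> y - c \<in> idl 1" using R(4) nu_in_C VH y(1) by blast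
    have cC: "c \<in> C" using c R by auto
    have xc: "x c \<in> carrier H" "y \<in> carrier H" using VH x[OF c(1)] y(1) by auto
    let ?d = "inv\<^bsub>H\<^esub> (x c) \<otimes>\<^bsub>H\<^esub> y"
    have nd: "\<nu> ?d = inverse c * \<nu> y" using nu_mult nu_inv[OF xc(1)] x[OF c(1)] by simp
    have "inverse c * (\<nu> y - c) \<in> idl 1" using C_translate[OF C_inverse[OF cC]] c(2) by blast
    then have "\<nu> ?d \<in> D" unfolding D_eq nd using C_D(1)[OF cC] C_mult[OF C_inverse[OF cC] nu_in_C[OF xc(2)]] by (simp add: algebra_simps)
    moreover have "?d \<in> Hs r" using subgroup.m_closed[OF V subgroup.m_inv_closed[OF V]] x[OF c(1)] y(1) by blast
    ultimately have "?d \<in> HD r" by (simp add: HD_def)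
    moreover have "y = x c \<otimes>\<^bsub>H\<^esub> ?d" using xc by (simp add: HG.m_assoc[symmetric])
    ultimately have "y \<in> x c <#\<^bsub>H\<^esub> HD r" unfolding l_coset_def by blast
    then have "x c <#\<^bsub>H\<^esub> HD r = A" unfolding y(2) using HG.l_repr_independence[OF _ xc(1) W] by blast
    then show "A \<in> (\<lambda>c. x c <#\<^bsub>H\<^esub> HD r) ` R" using c(1) by blast
  qed
  then have "idx (Hs r) (HD r) = q + 1" unfolding idx_def using R(2) bij_betw_same_card by fastforce
  moreover have "HD r \<subseteq> Hs r" by (auto simp: HD_def)
  ultimately show ?thesis using measure_idx[OF gV gW] by simp
qed

text \<open>The index set of one count: right cosets of \<open>U\<close>. That of the other,
  \<open>orbK\<close>, consists of the cosets of \<open>K\<close> in the support that meet the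
  \<open>H\<close>-orbit of \<open>r\<close>. For bi-invariant \<open>f\<close> the choices made in
  \<open>valU\<close> and \<open>valK\<close> do not matter.\<close>

definition cosU :: "('e^4^4 \<Rightarrow> real) \<Rightarrow> 'e^4^4 \<Rightarrow> (('e^2^2) \<times> ('e^2^2)) set set" where
  "cosU f r = {U #>\<^bsub>H\<^esub> h | h. h \<in> carrier H \<and> f (\<iota> h ** r) \<noteq> 0}"

definition valU :: "('e^4^4 \<Rightarrow> real) \<Rightarrow> 'e^4^4 \<Rightarrow> (('e^2^2) \<times> ('e^2^2)) set \<Rightarrow> real" where
  "valU f r y = f (\<iota> (SOME h. h \<in> y) ** r)"

definition orbK :: "('e^4^4 \<Rightarrow> real) \<Rightarrow> 'e^4^4 \<Rightarrow> ('e^4^4) set set" where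
  "orbK f r = {A \<in> lc ` {g. f g \<noteq> 0}. \<exists>h\<in>carrier H. \<iota> h ** r \<in> A}"

definition valK :: "('e^4^4 \<Rightarrow> real) \<Rightarrow> ('e^4^4) set \<Rightarrow> real" where
  "valK f A = f (SOME g. g \<in> A)"

lemma biinv_right: "biinv f \<Longrightarrow> g \<in> carrier G \<Longrightarrow> k \<in> K \<Longrightarrow> f (g ** k) = f g"
  and biinv_left: "biinv f \<Longrightarrow> g \<in> carrier G \<Longrightarrow> k \<in> K \<Longrightarrow> f (k ** g) = f g"
  unfolding biinv_def using K_one by (metis mat_one_mult)+

lemma valK_eq: "biinv f \<Longrightarrow> g \<in> carrier G \<Longrightarrow> valK f (lc g) = f g"
proof -
  assume f: "biinv f" and g: "g \<in> carrier G"
  have "(SOME x. x \<in> lc g) \<in> lc g" using lc_self by (rule someI)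
  then obtain k where "k \<in> K" "(SOME x. x \<in> lc g) = g ** k" by (auto simp: lc_def)
  then show ?thesis using biinv_right f g by (simp add: valK_def)
qed

lemma U_left:
  assumes "biinv f" "r \<in> carrier G" "h \<in> carrier H" "x \<in> U #>\<^bsub>H\<^esub> h"
  shows "x \<in> carrier H" "f (\<iota> x ** r) = f (\<iota> h ** r)"
proof -
  obtain u where u: "u \<in> U" "x = u \<otimes>\<^bsub>H\<^esub> h" using assms(4) by (auto simp: r_coset_def)
  then have "u \<in> carrier H" "\<iota> u \<in> K" by (auto simp: U_def)
  then show "x \<in> carrier H" using u assms(3) by simp
  have "\<iota> x ** r = \<iota> u ** (\<iota> h ** r)" using u by (simp add: iota_hom matrix_mul_assoc)
  then show "f (\<iota> x ** r) = f (\<iota> h ** r)" using biinv_left[OF assms(1)] \<open>\<iota> u \<in> K\<close> G_mult iota_G assms by simp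
qed

lemma rcoset_self: "h \<in> carrier H \<Longrightarrow> h \<in> U #>\<^bsub>H\<^esub> h"
  using HG.rcos_self[OF _ goodD(1)[OF good_U]] .

lemma rcoset_eq: "h \<in> carrier H \<Longrightarrow> x \<in> U #>\<^bsub>H\<^esub> h \<Longrightarrow> U #>\<^bsub>H\<^esub> h = U #>\<^bsub>H\<^esub> x"
  using HG.repr_independence[OF _ _ goodD(1)[OF good_U]] by blast

lemma valU_eq: "biinv f \<Longrightarrow> r \<in> carrier G \<Longrightarrow> h \<in> carrier H \<Longrightarrow> valU f r (U #>\<^bsub>H\<^esub> h) = f (\<iota> h ** r)"
  unfolding valU_def by (rule U_left(2)) (auto intro: someI rcoset_self)

lemma Hs_iff:
  assumes r: "r \<in> carrier G" and h: "h \<in> carrier H" "h' \<in> carrier H"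
  shows "lc (\<iota> h ** r) = lc (\<iota> h' ** r) \<longleftrightarrow> h \<in> h' <#\<^bsub>H\<^esub> Hs r"
proof -
  let ?d = "inv\<^bsub>H\<^esub> h' \<otimes>\<^bsub>H\<^esub> h"
  have G: "\<iota> h \<in> carrier G" "\<iota> h' \<in> carrier G" using h iota_G by auto
  have "matrix_inv (\<iota> h' ** r) = matrix_inv r ** matrix_inv (\<iota> h')"
  proof (rule matrix_inv_unique)
    have "\<iota> h' ** r ** (matrix_inv r ** matrix_inv (\<iota> h')) = \<iota> h' ** (r ** matrix_inv r) ** matrix_inv (\<iota> h')"
      by (simp only: matrix_mul_assoc)
    then show "\<iota> h' ** r ** (matrix_inv r ** matrix_inv (\<iota> h')) = mat 1"
      using GU_inv_cancel[OF herm_J4 r] GU_inv_cancel[OF herm_J4 G(2)] by simp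
  qed
  then have e: "matrix_inv (\<iota> h' ** r) ** (\<iota> h ** r) = matrix_inv r ** \<iota> ?d ** r"
    using h by (simp add: iota_hom iota_inv matrix_mul_assoc)
  have "lc (\<iota> h ** r) = lc (\<iota> h' ** r) \<longleftrightarrow> \<iota> h ** r \<in> lc (\<iota> h' ** r)" by (rule lc_eq_iff)
  also have "\<dots> \<longleftrightarrow> ?d \<in> Hs r" using h unfolding lc_mem_iff[OF G_mult[OF G(2) r]] e by (simp add: Hs_def)
  also have "\<dots> \<longleftrightarrow> h \<in> h' <#\<^bsub>H\<^esub> Hs r"
  proof
    assume "?d \<in> Hs r"
    moreover have "h = h' \<otimes>\<^bsub>H\<^esub> ?d" using h by (simp add: HG.m_assoc[symmetric])
    ultimately show "h \<in> h' <#\<^bsub>H\<^esub> Hs r" unfolding l_coset_def by blast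
  next
    assume "h \<in> h' <#\<^bsub>H\<^esub> Hs r"
    then obtain d where d: "d \<in> Hs r" "h = h' \<otimes>\<^bsub>H\<^esub> d" by (auto simp: l_coset_def)
    moreover have "d \<in> carrier H" using d by (simp add: Hs_def)
    then have "?d = d" using d h by (simp add: HG.m_assoc[symmetric])
    ultimately show "?d \<in> Hs r" by simp
  qed
  finally show ?thesis .
qed

theorem double_count:
  assumes f: "biinv f" "\<And>g. g \<notin> carrier G \<Longrightarrow> f g = 0" "finite (lc ` {g. f g \<noteq> 0})" and r: "r \<in> carrier G"
  shows "finite (cosU f r)"
    "(\<Sum>A\<in>orbK f r. valK f A) * measure \<mu> (Hs r) = (\<Sum>y\<in>cosU f r. valU f r y) * measure \<mu> U"
proof -
  define T where "T A = {h \<in> carrier H. \<iota> h ** r \<in> A}" for A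
  have finA: "finite (orbK f r)" using f(3) by (simp add: orbK_def)
  have hr: "\<iota> h ** r \<in> carrier G" if "h \<in> carrier H" for h using that r iota_G G_mult by blast
  have lcA: "\<iota> h ** r \<in> A \<longleftrightarrow> A = lc (\<iota> h ** r)" if A: "A \<in> orbK f r" for A h
  proof -
    obtain g where "A = lc g" using A by (auto simp: orbK_def)
    then show ?thesis using lc_eq_iff by metis
  qed
  have TA: "T A \<in> sets \<mu> \<and> emeasure \<mu> (T A) < \<infinity> \<and> measure \<mu> (T A) = measure \<mu> (Hs r)" if A: "A \<in> orbK f r" for A
  proof -
    obtain h0 where h0: "h0 \<in> carrier H" "A = lc (\<iota> h0 ** r)" using A lcA[OF A] by (auto simp: orbK_def)
    have "T A = h0 <#\<^bsub>H\<^esub> Hs r"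
    proof (intro equalityI subsetI)
      fix h assume "h \<in> T A"
      then show "h \<in> h0 <#\<^bsub>H\<^esub> Hs r" using lcA[OF A, of h] Hs_iff[OF r _ h0(1), of h] h0 by (auto simp: T_def)
    next
      fix h assume h: "h \<in> h0 <#\<^bsub>H\<^esub> Hs r"
      then have "h \<in> carrier H" using HG.l_coset_subset_G[OF goodD(2)[OF good_Hs[OF r]] h0(1)] by blast
      then show "h \<in> T A" using lcA[OF A, of h] Hs_iff[OF r _ h0(1), of h] h0 h by (auto simp: T_def)
    qed
    then show ?thesis using lcoset_measure[OF good_Hs[OF r] h0(1)] by simp
  qed
  have memA: "lc (\<iota> h ** r) \<in> orbK f r" if "h \<in> carrier H" "f (\<iota> h ** r) \<noteq> 0" for h
    using that lc_self unfolding orbK_def by blast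
  have Ay: "y \<subseteq> (\<Union>A\<in>orbK f r. T A)" if y: "y \<in> cosU f r" for y
  proof
    fix x assume x: "x \<in> y"
    obtain h where h: "h \<in> carrier H" "f (\<iota> h ** r) \<noteq> 0" "y = U #>\<^bsub>H\<^esub> h" using y by (auto simp: cosU_def)
    then have "x \<in> carrier H" "f (\<iota> x ** r) \<noteq> 0" using U_left[OF f(1) r h(1)] x by auto
    then have "x \<in> T (lc (\<iota> x ** r))" "lc (\<iota> x ** r) \<in> orbK f r" using memA lc_self by (auto simp: T_def)
    then show "x \<in> (\<Union>A\<in>orbK f r. T A)" by blast
  qed
  have my: "y \<in> sets \<mu> \<and> emeasure \<mu> y < \<infinity> \<and> measure \<mu> y = measure \<mu> U" if "y \<in> cosU f r" for y
    using that rcoset_measure by (auto simp: cosU_def)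
  have ydisj: "x \<in> y \<longleftrightarrow> y = U #>\<^bsub>H\<^esub> x" if y: "y \<in> cosU f r" and x: "x \<in> carrier H" for x y
    using y rcoset_eq rcoset_self[OF x] unfolding cosU_def by blast
  have ysub: "y \<subseteq> carrier H" if "y \<in> cosU f r" for y using Ay[OF that] by (auto simp: T_def)
  define S where "S = (\<Union>A\<in>orbK f r. T A)"
  have S: "S \<in> sets \<mu>" "emeasure \<mu> S \<noteq> \<infinity>"
  proof -
    show "S \<in> sets \<mu>" unfolding S_def using TA finA by blast
    have "emeasure \<mu> S \<le> (\<Sum>A\<in>orbK f r. emeasure \<mu> (T A))"
      unfolding S_def using TA finA by (intro emeasure_subadditive_finite) auto
    also have "\<dots> < \<infinity>" using TA finA by simp
    finally show "emeasure \<mu> S \<noteq> \<infinity>" by simp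
  qed
  \<comment> \<open>Disjoint subsets of \<open>S\<close>, which has finite measure. That they all
    have the measure of \<open>U\<close> is unimodularity.\<close>
  have "card Y \<le> nat \<lfloor>measure \<mu> S / measure \<mu> U\<rfloor>" if Y: "Y \<subseteq> cosU f r" "finite Y" for Y
  proof -
    have "real (card Y) * measure \<mu> U = (\<Sum>y\<in>Y. measure \<mu> y)" using my Y(1) by (subst sum.cong[OF refl, of _ _ "\<lambda>_. measure \<mu> U"]) auto
    also have "\<dots> = measure \<mu> (\<Union>y\<in>Y. y)"
    proof (rule measure_finite_Union[OF Y(2), symmetric])
      show "(\<lambda>y. y) ` Y \<subseteq> sets \<mu>" using my Y by auto
      show "disjoint_family_on (\<lambda>y. y) Y" unfolding disjoint_family_on_def using ydisj ysub Y(1) by blast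
      show "emeasure \<mu> y \<noteq> \<infinity>" if "y \<in> Y" for y using my that Y(1) by (auto simp: less_top)
    qed
    also have "\<dots> \<le> measure \<mu> S"
    proof (rule measure_mono_fmeasurable)
      show "(\<Union>y\<in>Y. y) \<subseteq> S" using Ay Y(1) unfolding S_def by blast
      show "(\<Union>y\<in>Y. y) \<in> sets \<mu>" using my Y by (intro sets.finite_UN) auto
      show "S \<in> fmeasurable \<mu>" using S by (simp add: fmeasurable_def less_top)
    qed
    finally have "real (card Y) \<le> measure \<mu> S / measure \<mu> U" using U_pos by (simp add: pos_le_divide_eq)
    then show ?thesis by (simp add: le_nat_floor)
  qed
  then show fin: "finite (cosU f r)" using finite_if_finite_subsets_card_bdd by blast
  \<comment> \<open>One function of \<open>h\<close>, written first by left translates of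
    \<open>Hs r\<close> and then by right cosets of \<open>U\<close>.\<close>
  let ?\<phi> = "\<lambda>h. \<Sum>A\<in>orbK f r. valK f A * indicator (T A) h"
  let ?\<psi> = "\<lambda>h. \<Sum>y\<in>cosU f r. valU f r y * indicator y h"
  have b1: "has_bochner_integral \<mu> ?\<phi> (\<Sum>A\<in>orbK f r. valK f A * measure \<mu> (T A))"
    using TA by (intro has_bochner_integral_sum has_bochner_integral_mult_right has_bochner_integral_real_indicator) auto
  have b2: "has_bochner_integral \<mu> ?\<psi> (\<Sum>y\<in>cosU f r. valU f r y * measure \<mu> y)"
    using my by (intro has_bochner_integral_sum has_bochner_integral_mult_right has_bochner_integral_real_indicator) auto
  have "?\<phi> h = ?\<psi> h" if h: "h \<in> space \<mu>" for h
  proof -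
    have hH: "h \<in> carrier H" using h space_haar by simp
    have "?\<phi> h = (\<Sum>A\<in>orbK f r. if A = lc (\<iota> h ** r) then f (\<iota> h ** r) else 0)"
    proof (rule sum.cong[OF refl])
      fix A assume A: "A \<in> orbK f r"
      show "valK f A * indicator (T A) h = (if A = lc (\<iota> h ** r) then f (\<iota> h ** r) else 0)"
        using lcA[OF A, of h] valK_eq[OF f(1) hr[OF hH]] hH by (auto simp: T_def indicator_def)
    qed
    also have "\<dots> = f (\<iota> h ** r)" using finA memA[OF hH] by (auto simp: sum.delta)
    also have "\<dots> = (\<Sum>y\<in>cosU f r. if y = U #>\<^bsub>H\<^esub> h then f (\<iota> h ** r) else 0)"
    proof (cases "f (\<iota> h ** r) = 0")
      case False
      then have "U #>\<^bsub>H\<^esub> h \<in> cosU f r" using hH unfolding cosU_def by blast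
      then show ?thesis using fin by simp
    next
      case True
      show ?thesis unfolding True by (rule sum.neutral[symmetric]) simp
    qed
    also have "\<dots> = ?\<psi> h"
    proof (rule sum.cong[OF refl])
      fix y assume y: "y \<in> cosU f r"
      show "(if y = U #>\<^bsub>H\<^esub> h then f (\<iota> h ** r) else 0) = valU f r y * indicator y h"
        using ydisj[OF y hH] valU_eq[OF f(1) r hH] by (auto simp: indicator_def)
    qed
    finally show ?thesis .
  qed
  then have "has_bochner_integral \<mu> ?\<psi> (\<Sum>A\<in>orbK f r. valK f A * measure \<mu> (T A))"
    using b1 has_bochner_integral_cong[OF refl _ refl, of \<mu> ?\<phi> ?\<psi>] by simp
  then have "(\<Sum>A\<in>orbK f r. valK f A * measure \<mu> (T A)) = (\<Sum>y\<in>cosU f r. valU f r y * measure \<mu> y)"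
    using b2 has_bochner_integral_eq by blast
  moreover have "(\<Sum>A\<in>orbK f r. valK f A * measure \<mu> (T A)) = (\<Sum>A\<in>orbK f r. valK f A) * measure \<mu> (Hs r)"
    using TA by (simp add: sum_distrib_right)
  moreover have "(\<Sum>y\<in>cosU f r. valU f r y * measure \<mu> y) = (\<Sum>y\<in>cosU f r. valU f r y) * measure \<mu> U"
    using my by (simp add: sum_distrib_right)
  ultimately show "(\<Sum>A\<in>orbK f r. valK f A) * measure \<mu> (Hs r) = (\<Sum>y\<in>cosU f r. valU f r y) * measure \<mu> U" by simp
qed

end

section \<open>Divisibility of the sum over right cosets of U\<close>

context odd_unramified_haar
begin

interpretation HG: group H by (rule H_group)

lemma Hs_H: "h \<in> Hs r \<Longrightarrow> h \<in> carrier H"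
  by (simp add: Hs_def)

lemma biinv_Hs:
  assumes f: "biinv f" and r: "r \<in> carrier G" and h: "h \<in> carrier H" and s: "s \<in> Hs r"
  shows "f (\<iota> (h \<otimes>\<^bsub>H\<^esub> s) ** r) = f (\<iota> h ** r)"
proof -
  have "\<iota> h ** r ** (matrix_inv r ** \<iota> s ** r) = \<iota> h ** (r ** matrix_inv r) ** \<iota> s ** r" by (simp only: matrix_mul_assoc)
  then have "\<iota> (h \<otimes>\<^bsub>H\<^esub> s) ** r = (\<iota> h ** r) ** (matrix_inv r ** \<iota> s ** r)"
    using GU_inv_cancel[OF herm_J4 r] by (simp add: iota_hom)
  then show ?thesis using biinv_right[OF f G_mult[OF iota_G[OF h] r]] s by (simp add: Hs_def)
qed

text \<open>Elements of \<open>Hs r\<close> act on the right without changing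
  \<open>f (\<iota> h ** r)\<close>, since they move past \<open>r\<close> into \<open>K\<close>. A
  coset \<open>U h\<close> is fixed exactly when the conjugate by \<open>h\<close> lies in
  \<open>U\<close>, so \<open>free_orbit_sum\<close> applies.\<close>

lemma torus_sum:
  assumes f: "biinv f" "\<And>g. f g \<in> Zq" and r: "r \<in> carrier G" and Y: "Y \<subseteq> cosU f r" "finite Y"
    and \<sigma>: "\<And>t. t \<in> C \<Longrightarrow> \<sigma> t \<in> Hs r" "\<sigma> 1 = \<one>\<^bsub>H\<^esub>" "\<And>s t. \<sigma> s \<otimes>\<^bsub>H\<^esub> \<sigma> t = \<sigma> (s * t)"
    and closed: "\<And>h t. h \<in> carrier H \<Longrightarrow> t \<in> C \<Longrightarrow> U #>\<^bsub>H\<^esub> h \<in> Y \<Longrightarrow> U #>\<^bsub>H\<^esub> (h \<otimes>\<^bsub>H\<^esub> \<sigma> t) \<in> Y"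
    and stab: "\<And>h t. h \<in> carrier H \<Longrightarrow> t \<in> C \<Longrightarrow> U #>\<^bsub>H\<^esub> h \<in> Y \<Longrightarrow> h \<otimes>\<^bsub>H\<^esub> \<sigma> t \<otimes>\<^bsub>H\<^esub> inv\<^bsub>H\<^esub> h \<in> U \<Longrightarrow> t \<in> D"
  shows "\<exists>z\<in>Zq. sum (valU f r) Y = (real q + 1) * z"
proof (rule free_orbit_sum[where \<alpha> = "\<lambda>t y. y #>\<^bsub>H\<^esub> \<sigma> t", OF Y(2)])
  have UH: "U \<subseteq> carrier H" by (rule goodD(2)[OF good_U])
  have rep: "\<exists>h\<in>carrier H. y = U #>\<^bsub>H\<^esub> h" if "y \<in> Y" for y using that Y(1) by (auto simp: cosU_def)
  have sH: "\<sigma> t \<in> carrier H" if "t \<in> C" for t using \<sigma>(1)[OF that] Hs_H by blast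
  have act: "(U #>\<^bsub>H\<^esub> h) #>\<^bsub>H\<^esub> \<sigma> t = U #>\<^bsub>H\<^esub> (h \<otimes>\<^bsub>H\<^esub> \<sigma> t)" if "h \<in> carrier H" "t \<in> C" for h t
    using HG.coset_mult_assoc[OF UH that(1) sH[OF that(2)]] .
  fix y assume y: "y \<in> Y"
  obtain h where h: "h \<in> carrier H" "y = U #>\<^bsub>H\<^esub> h" using rep[OF y] by blast
  show "y #>\<^bsub>H\<^esub> \<sigma> 1 = y" using act[OF h(1) C_one] h \<sigma>(2) by simp
  show "valU f r y \<in> Zq" unfolding valU_def by (rule f(2))
  fix t assume t: "t \<in> C"
  show "y #>\<^bsub>H\<^esub> \<sigma> t \<in> Y" using act[OF h(1) t] closed[OF h(1) t] h y by simp
  show "valU f r (y #>\<^bsub>H\<^esub> \<sigma> t) = valU f r y"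
    using act[OF h(1) t] valU_eq[OF f(1) r] h sH[OF t] biinv_Hs[OF f(1) r h(1) \<sigma>(1)[OF t]] by simp
  { fix s assume s: "s \<in> C"
    show "(y #>\<^bsub>H\<^esub> \<sigma> t) #>\<^bsub>H\<^esub> \<sigma> s = y #>\<^bsub>H\<^esub> \<sigma> (s * t)"
      unfolding h(2) act[OF h(1) t] act[OF HG.m_closed[OF h(1) sH[OF t]] s] act[OF h(1) C_mult[OF s t]]
      using h sH[OF s] sH[OF t] \<sigma>(3)[of t s] by (simp add: HG.m_assoc mult.commute) }
  assume "y #>\<^bsub>H\<^esub> \<sigma> t = y"
  then have "h \<otimes>\<^bsub>H\<^esub> \<sigma> t \<in> U #>\<^bsub>H\<^esub> h" using act[OF h(1) t] h rcoset_self[of "h \<otimes>\<^bsub>H\<^esub> \<sigma> t"] sH[OF t] by simp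
  then obtain u where u: "u \<in> U" "h \<otimes>\<^bsub>H\<^esub> \<sigma> t = u \<otimes>\<^bsub>H\<^esub> h" by (auto simp: r_coset_def)
  have "u \<in> carrier H" using u UH by blast
  then have "h \<otimes>\<^bsub>H\<^esub> \<sigma> t \<otimes>\<^bsub>H\<^esub> inv\<^bsub>H\<^esub> h = u" unfolding u(2) using h by (simp add: HG.m_assoc)
  then show "t \<in> D" using stab[OF h(1) t] y h u(1) by simp
qed

definition zc :: "int \<Rightarrow> ('e^2^2) \<times> ('e^2^2)" where "zc k = (mat (\<pi> powi k), mat (\<pi> powi k))"

lemma zc_H: "zc k \<in> carrier H"
  unfolding zc_def by (rule centre_H) (simp_all add: F_powi)

lemma zc_iota: "\<iota> (zc k \<otimes>\<^bsub>H\<^esub> h) = sc k ** \<iota> h"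
  by (simp add: iota_hom zc_def iota_mat sc_def)

lemma fixd_mat:
  assumes c: "c \<noteq> 0" and h: "is_sim J2 h s" shows "fixd (mat c ** h) u \<longleftrightarrow> fixd h u"
proof -
  have hh: "h ** matrix_inv h = mat 1" using GU_inv_cancel[OF herm_J2 GU_I[OF herm_J2 h]] by blast
  have "matrix_inv (mat c ** h) = mat (inverse c) ** matrix_inv h"
  proof (rule matrix_inv_unique)
    have "mat c ** h ** (mat (inverse c) ** matrix_inv h) = mat c ** (mat (inverse c) ** (h ** matrix_inv h))"
      by (simp only: matrix_mul_assoc[symmetric] mat_left_commute[of h])
    then show "mat c ** h ** (mat (inverse c) ** matrix_inv h) = mat 1" using c by (simp add: hh mat_mult_mat)
  qed
  then have "mat c ** h ** pr u ** matrix_inv (mat c ** h) = mat c ** (mat (inverse c) ** (h ** pr u ** matrix_inv h))"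
    by (simp only: matrix_mul_assoc[symmetric] mat_left_commute[of h] mat_left_commute[of "pr u"])
  then show ?thesis using c by (simp add: fixd_def mat_mult_mat_assoc)
qed

lemma U_fst_snd: "u \<in> U \<Longrightarrow> intmat 0 (fst u) \<and> intmat 0 (snd u)"
  using K_int intmat_iota[of 0 "fst u" "snd u"] by (simp add: U_def)

lemma U_GLO:
  assumes "u \<in> U"
  shows "\<exists>s. is_sim J2 (fst u) s" "fst u \<in> GLO" "\<exists>s. is_sim J2 (snd u) s" "snd u \<in> GLO"
proof -
  obtain a b where ab: "u = (a, b)" by (cases u)
  have uH: "(a, b) \<in> carrier H" using assms ab by (simp add: U_def)
  then show "\<exists>s. is_sim J2 (fst u) s" "\<exists>s. is_sim J2 (snd u) s" using H_iff ab by auto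
  have "inv\<^bsub>H\<^esub> u \<in> U" using subgroup.m_inv_closed[OF goodD(1)[OF good_U] assms] .
  then have "intmat 0 (matrix_inv a)" "intmat 0 (matrix_inv b)" using U_fst_snd H_inv[OF uH] ab by fastforce+
  moreover have "intmat 0 a" "intmat 0 b" using U_fst_snd[OF assms] ab by auto
  moreover have "a ** matrix_inv a = mat 1" "b ** matrix_inv b = mat 1"
    using GU_inv_cancel[OF herm_J2] H_D[OF uH] by blast+
  ultimately show "fst u \<in> GLO" "snd u \<in> GLO" using ab unfolding GLO_def by auto
qed

lemma coset_fixd:
  assumes h: "h \<in> carrier H" and x: "x \<in> U #>\<^bsub>H\<^esub> h"
  shows "fixd (fst x) w \<longleftrightarrow> fixd (fst h) w" "fixd (snd x) w \<longleftrightarrow> fixd (snd h) w"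
proof -
  obtain u where u: "u \<in> U" "x = u \<otimes>\<^bsub>H\<^esub> h" using x by (auto simp: r_coset_def)
  have e: "fst x = fst u ** fst h" "snd x = snd u ** snd h" using u by (simp_all add: H_mult)
  obtain s where "is_sim J2 (fst h) s" "is_sim J2 (snd h) s" using h H_iff[of "fst h" "snd h"] by auto
  then show "fixd (fst x) w \<longleftrightarrow> fixd (fst h) w" "fixd (snd x) w \<longleftrightarrow> fixd (snd h) w"
    unfolding e using U_GLO[OF u(1)] fixd_unit by blast+
qed

text \<open>\<open>Y\<close>, \<open>Y1\<close> and \<open>Y2\<close> are cut out by integrality of
  no, the first, and both projections. Each torus leaves integrality of its own projection and the
  other component unchanged, so the differences are stable; there \<open>fixd_stab\<close> puts the
  stabilizers into \<open>D\<close>.\<close>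

theorem cosU_sum:
  assumes r: "r \<in> carrier G" and hx: "hx \<in> Hs r" "\<nu> hx \<notin> D" and c: "odd c"
  shows "\<exists>z\<in>Zq. sum (valU (htot c) r) (cosU (htot c) r) = (real q + 1) * z"
    "\<And>t. t \<in> C \<Longrightarrow> \<exists>h\<in>Hs r. \<nu> h = t"
proof -
  define f where "f = htot c"
  have f: "biinv f" "\<And>g. f g \<in> Zq" "\<And>g. g \<notin> carrier G \<Longrightarrow> f g = 0" "finite (lc ` {g. f g \<noteq> 0})"
    unfolding f_def using htot_biinv htot_Zq htot_outside htot_finite by blast+
  obtain w1 w2 where w1: "\<And>i. w1$i \<in> idl 0" "(r *v w1)$2 = 0" "(r *v w1)$4 = 0" "hn w1 \<noteq> 0" "v (hn w1) = 0"
    and w2: "\<And>i. w2$i \<in> idl 0" "(r *v w2)$1 = 0" "(r *v w2)$3 = 0" "hn w2 \<noteq> 0" "v (hn w2) = 0"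
    using unit_vectors[OF r hx] by metis
  define s where "s = sim J4 r"
  have s: "is_sim J4 r s" unfolding s_def by (rule GU_sim[OF herm_J4 r])
  have s0: "s \<noteq> 0" using is_simD[OF s] by blast
  define u1 u2 where u: "u1 = u13 (r *v w1)" "u2 = u24 (r *v w2)"
  have n: "n2 u1 = s * hn w1" "n2 u2 = s * hn w2"
    unfolding u using n2_u13[OF w1(2,3)] n2_u24[OF w2(2,3)] hn_sim[OF s] by simp_all
  have n0: "n2 u1 \<noteq> 0" "n2 u2 \<noteq> 0" and vn: "v (n2 u1) = v s" "v (n2 u2) = v s"
    using s0 w1(4,5) w2(4,5) by (simp_all add: n v_mult)
  define \<sigma>1 \<sigma>2 where \<sigma>: "\<sigma>1 t = (tor u1 t, mat 1 :: 'e^2^2)" "\<sigma>2 t = (mat 1 :: 'e^2^2, tor u2 t)" for t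
  have \<sigma>1: "\<sigma>1 t \<in> Hs r" if "t \<in> C" for t unfolding \<sigma> u by (rule tor_Hs[OF r w1 that])
  have \<sigma>2: "\<sigma>2 t \<in> Hs r" if "t \<in> C" for t
  proof -
    have P: "P12 ** r \<in> carrier G" using r P12_K K_G G_mult by blast
    have e: "((P12 ** r) *v w2)$1 = (r *v w2)$2" "((P12 ** r) *v w2)$2 = (r *v w2)$1"
      "((P12 ** r) *v w2)$3 = (r *v w2)$4" "((P12 ** r) *v w2)$4 = (r *v w2)$3"
      by (simp_all add: matrix_vector_mult_def P12_mult)
    have "u13 ((P12 ** r) *v w2) = u2" by (simp add: vec_eq_iff forall_2 u e)
    then have "(tor u2 t, mat 1) \<in> Hs (P12 ** r)" using tor_Hs[OF P w2(1) _ _ w2(4,5) that] e w2(2,3) by simp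
    then show ?thesis unfolding \<sigma> using Hs_swap[OF r] by blast
  qed
  \<comment> \<open>The second torus has determinant \<open>t\<close> in the second component and is
    trivial in the first, so it realizes every value of \<open>\<nu>\<close>.\<close>
  show "\<exists>h\<in>Hs r. \<nu> h = t" if "t \<in> C" for t
    using \<sigma>2[OF that] by (intro bexI[of _ "\<sigma>2 t"]) (simp_all add: \<sigma> \<nu>_def det_tor[OF n0(2)])
  define Y where "Y = cosU f r"
  have finY: "finite Y" unfolding Y_def by (rule double_count(1)[OF f(1,3,4) r])
  \<comment> \<open>By \<open>coset_fixd\<close> integrality of a projection is constant on right
    cosets of \<open>U\<close>, so one element of the coset decides.\<close>
  define Y1 where "Y1 = {y \<in> Y. \<exists>h\<in>y. fixd (fst h) u1}"
  define Y2 where "Y2 = {y \<in> Y1. \<exists>h\<in>y. fixd (snd h) u2}"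
  have Y1: "U #>\<^bsub>H\<^esub> h \<in> Y1 \<longleftrightarrow> U #>\<^bsub>H\<^esub> h \<in> Y \<and> fixd (fst h) u1"
    and Y2: "U #>\<^bsub>H\<^esub> h \<in> Y2 \<longleftrightarrow> U #>\<^bsub>H\<^esub> h \<in> Y1 \<and> fixd (snd h) u2" if "h \<in> carrier H" for h
    unfolding Y1_def Y2_def using coset_fixd[OF that] rcoset_self[OF that] by blast+
  have Ymem: "U #>\<^bsub>H\<^esub> h \<in> Y \<longleftrightarrow> f (\<iota> h ** r) \<noteq> 0" if h: "h \<in> carrier H" for h
  proof
    assume "U #>\<^bsub>H\<^esub> h \<in> Y"
    then obtain x where "x \<in> carrier H" "f (\<iota> x ** r) \<noteq> 0" "U #>\<^bsub>H\<^esub> h = U #>\<^bsub>H\<^esub> x" by (auto simp: Y_def cosU_def)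
    then show "f (\<iota> h ** r) \<noteq> 0" using U_left(2)[OF f(1) r, of x h] rcoset_self[OF h] by simp
  next
    assume "f (\<iota> h ** r) \<noteq> 0"
    then show "U #>\<^bsub>H\<^esub> h \<in> Y" using h unfolding Y_def cosU_def by blast
  qed
  have Yact: "U #>\<^bsub>H\<^esub> (h \<otimes>\<^bsub>H\<^esub> x) \<in> Y" if "h \<in> carrier H" "x \<in> Hs r" "U #>\<^bsub>H\<^esub> h \<in> Y" for h x
    using that Ymem biinv_Hs[OF f(1) r] Hs_H by simp
  have simh: "\<exists>t. is_sim J2 (fst h) t \<and> is_sim J2 (snd h) t" if "h \<in> carrier H" for h
    using that H_iff[of "fst h" "snd h"] by auto
  have conj_int: "intmat 0 (fst h ** fst x ** matrix_inv (fst h)) \<and> intmat 0 (snd h ** snd x ** matrix_inv (snd h))"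
    if "h \<in> carrier H" "h \<otimes>\<^bsub>H\<^esub> x \<otimes>\<^bsub>H\<^esub> inv\<^bsub>H\<^esub> h \<in> U" for h x
    using U_fst_snd[OF that(2)] H_inv[OF that(1)] by (simp add: H_mult)
  have "\<exists>z\<in>Zq. sum (valU f r) (Y - Y1) = (real q + 1) * z"
  proof (rule torus_sum[OF f(1,2) r, of _ \<sigma>1])
    show "Y - Y1 \<subseteq> cosU f r" "finite (Y - Y1)" using finY by (auto simp: Y_def)
    show "\<sigma>1 t \<in> Hs r" if "t \<in> C" for t by (rule \<sigma>1[OF that])
    show "\<sigma>1 1 = \<one>\<^bsub>H\<^esub>" by (simp add: \<sigma> H_one)
    show "\<sigma>1 x \<otimes>\<^bsub>H\<^esub> \<sigma>1 t = \<sigma>1 (x * t)" for x t by (simp add: \<sigma> H_mult tor_mult[OF n0(1)])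
    fix h t assume h: "h \<in> carrier H" "t \<in> C" "U #>\<^bsub>H\<^esub> h \<in> Y - Y1"
    have hs: "h \<otimes>\<^bsub>H\<^esub> \<sigma>1 t \<in> carrier H" using h(1) \<sigma>1[OF h(2)] Hs_H by blast
    obtain a where a: "is_sim J2 (fst h) a" using simh[OF h(1)] by blast
    have "fixd (fst (h \<otimes>\<^bsub>H\<^esub> \<sigma>1 t)) u1 \<longleftrightarrow> fixd (fst h) u1" using fixd_tor[OF a n0(1) h(2)] by (simp add: H_mult \<sigma>)
    then show "U #>\<^bsub>H\<^esub> (h \<otimes>\<^bsub>H\<^esub> \<sigma>1 t) \<in> Y - Y1" using Y1[OF hs] Y1[OF h(1)] Yact[OF h(1) \<sigma>1[OF h(2)]] h(3) by blast
    assume "h \<otimes>\<^bsub>H\<^esub> \<sigma>1 t \<otimes>\<^bsub>H\<^esub> inv\<^bsub>H\<^esub> h \<in> U"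
    from conjunct1[OF conj_int[OF h(1) this]] have "intmat 0 (fst h ** tor u1 t ** matrix_inv (fst h))" by (simp add: \<sigma>)
    then show "t \<in> D" using fixd_stab[OF a h(2)] Y1[OF h(1)] h(3) by blast
  qed
  then obtain z1 where z1: "z1 \<in> Zq" "sum (valU f r) (Y - Y1) = (real q + 1) * z1" by blast
  have "\<exists>z\<in>Zq. sum (valU f r) (Y1 - Y2) = (real q + 1) * z"
  proof (rule torus_sum[OF f(1,2) r, of _ \<sigma>2])
    show "Y1 - Y2 \<subseteq> cosU f r" "finite (Y1 - Y2)" using finY by (auto simp: Y_def Y1_def)
    show "\<sigma>2 t \<in> Hs r" if "t \<in> C" for t by (rule \<sigma>2[OF that])
    show "\<sigma>2 1 = \<one>\<^bsub>H\<^esub>" by (simp add: \<sigma> H_one)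
    show "\<sigma>2 x \<otimes>\<^bsub>H\<^esub> \<sigma>2 t = \<sigma>2 (x * t)" for x t by (simp add: \<sigma> H_mult tor_mult[OF n0(2)])
    fix h t assume h: "h \<in> carrier H" "t \<in> C" "U #>\<^bsub>H\<^esub> h \<in> Y1 - Y2"
    have hs: "h \<otimes>\<^bsub>H\<^esub> \<sigma>2 t \<in> carrier H" using h(1) \<sigma>2[OF h(2)] Hs_H by blast
    obtain a where a: "is_sim J2 (snd h) a" using simh[OF h(1)] by blast
    have "fixd (snd (h \<otimes>\<^bsub>H\<^esub> \<sigma>2 t)) u2 \<longleftrightarrow> fixd (snd h) u2" using fixd_tor[OF a n0(2) h(2)] by (simp add: H_mult \<sigma>)
    moreover have "fst (h \<otimes>\<^bsub>H\<^esub> \<sigma>2 t) = fst h" by (simp add: H_mult \<sigma>)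
    ultimately show "U #>\<^bsub>H\<^esub> (h \<otimes>\<^bsub>H\<^esub> \<sigma>2 t) \<in> Y1 - Y2"
      using Y1[OF hs] Y1[OF h(1)] Y2[OF hs] Y2[OF h(1)] Yact[OF h(1) \<sigma>2[OF h(2)]] h(3) by auto
    assume "h \<otimes>\<^bsub>H\<^esub> \<sigma>2 t \<otimes>\<^bsub>H\<^esub> inv\<^bsub>H\<^esub> h \<in> U"
    from conjunct2[OF conj_int[OF h(1) this]] have "intmat 0 (snd h ** tor u2 t ** matrix_inv (snd h))" by (simp add: \<sigma>)
    then show "t \<in> D" using fixd_stab[OF a h(2)] Y2[OF h(1)] h(3) by blast
  qed
  then obtain z2 where z2: "z2 \<in> Zq" "sum (valU f r) (Y1 - Y2) = (real q + 1) * z2" by blast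
  have "\<exists>z\<in>Zq. sum (valU f r) Y2 = (real q + 1) * z"
  proof (cases "Y2 = {}")
    case True
    then show ?thesis by (intro bexI[of _ 0]) auto
  next
    case False
    \<comment> \<open>The centre changes \<open>v t\<close> by even amounts only. This parity lets
      it carry one point of \<open>Y2\<close> to the similitude valuation of any other.\<close>
    have evn: "even (v t + v s)" if h: "h \<in> carrier H" "fixd (fst h) u1" "is_sim J2 (fst h) t" for h t
    proof -
      have t0: "t \<noteq> 0" using is_simD[OF h(3)] by blast
      have e: "n2 (fst h *v u1) = t * n2 u1" by (rule n2_sim[OF h(3)])
      then have "n2 (fst h *v u1) \<noteq> 0" "v (n2 (fst h *v u1)) = v t + v s" using t0 n0 vn by (simp_all add: v_mult)
      then show ?thesis using op2_int_even[of "fst h *v u1"] h(2) fixd_iff[OF h(3)] e by simp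
    qed
    obtain h1 where h1: "h1 \<in> carrier H" "fixd (fst h1) u1" "fixd (snd h1) u2"
    proof -
      obtain y where y: "y \<in> Y2" using False by blast
      then obtain h where "h \<in> carrier H" "y = U #>\<^bsub>H\<^esub> h" by (auto simp: Y2_def Y1_def Y_def cosU_def)
      then show thesis using that Y1 Y2 y by blast
    qed
    obtain t1 where t1: "is_sim J2 (fst h1) t1" "is_sim J2 (snd h1) t1" using simh[OF h1(1)] by blast
    obtain a where a: "v t1 + v s = 2 * a" using evn[OF h1(1,2) t1(1)] by blast
    \<comment> \<open>Normalized so that the images of both vectors have unit norm.\<close>
    define h0 where "h0 = zc (-a) \<otimes>\<^bsub>H\<^esub> h1"
    define t0 where "t0 = \<pi> powi (-a) * \<pi> powi (-a) * t1"
    have cF: "\<pi> powi k \<in> F" "\<pi> powi k \<noteq> 0" for k by (simp_all add: F_powi)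
    have zfst: "fst (zc k \<otimes>\<^bsub>H\<^esub> h) = mat (\<pi> powi k) ** fst h" "snd (zc k \<otimes>\<^bsub>H\<^esub> h) = mat (\<pi> powi k) ** snd h" for k h
      by (simp_all add: H_mult zc_def)
    have zsim: "is_sim J2 (fst (zc k \<otimes>\<^bsub>H\<^esub> h)) (\<pi> powi k * \<pi> powi k * t)" if "is_sim J2 (fst h) t" for k h t
      unfolding zfst by (rule is_sim_mult[OF is_sim_mat[OF cF] that])
    have zsim': "is_sim J2 (snd (zc k \<otimes>\<^bsub>H\<^esub> h)) (\<pi> powi k * \<pi> powi k * t)" if "is_sim J2 (snd h) t" for k h t
      unfolding zfst by (rule is_sim_mult[OF is_sim_mat[OF cF] that])
    have zfix: "fixd (fst (zc k \<otimes>\<^bsub>H\<^esub> h)) x \<longleftrightarrow> fixd (fst h) x" "fixd (snd (zc k \<otimes>\<^bsub>H\<^esub> h)) x \<longleftrightarrow> fixd (snd h) x"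
      if "h \<in> carrier H" for k h x
      unfolding zfst using simh[OF that] fixd_mat[OF cF(2)] by blast+
    have h0: "h0 \<in> carrier H" "fixd (fst h0) u1" "fixd (snd h0) u2" "is_sim J2 (fst h0) t0" "is_sim J2 (snd h0) t0"
      unfolding h0_def t0_def using zc_H h1 zfix[OF h1(1)] zsim[OF t1(1)] zsim'[OF t1(2)] by simp_all
    have t00: "t0 \<noteq> 0" "v t0 + v s = 0" using is_simD[OF t1(1)] a by (simp_all add: t0_def v_mult)
    define g where "g = \<iota> h0 ** r"
    have g: "g \<in> carrier G" unfolding g_def using G_mult[OF iota_G[OF h0(1)] r] .
    have "is_sim J4 (\<iota> h0) t0" using is_sim_iota[of "fst h0" "snd h0"] h0(4,5) by simp
    then have gs: "is_sim J4 g (t0 * s)" unfolding g_def by (rule is_sim_mult[OF _ s])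
    then have vg: "v (sim J4 g) = 0" using sim_eq[OF herm_J4 gs] t00 s0 by (simp add: v_mult)
    define H' where "H' k = zc k \<otimes>\<^bsub>H\<^esub> h0" for k
    have H': "H' k \<in> carrier H" "fixd (fst (H' k)) u1" "fixd (snd (H' k)) u2"
      "is_sim J2 (fst (H' k)) (\<pi> powi k * \<pi> powi k * t0)" "is_sim J2 (snd (H' k)) (\<pi> powi k * \<pi> powi k * t0)"
      "\<iota> (H' k) ** r = sc k ** g" for k
      unfolding H'_def using zc_H h0 zfix[OF h0(1)] zsim[OF h0(4)] zsim'[OF h0(5)]
      by (simp_all add: zc_iota g_def matrix_mul_assoc)
    have Y2_eq: "Y2 = (\<lambda>k. U #>\<^bsub>H\<^esub> H' (int k)) ` {k. k \<le> 4 \<and> f (sc (int k) ** g) \<noteq> 0}"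
    proof (intro equalityI subsetI)
      fix y assume y: "y \<in> Y2"
      then obtain h where h: "h \<in> carrier H" "y = U #>\<^bsub>H\<^esub> h" by (auto simp: Y2_def Y1_def Y_def cosU_def)
      have fh: "fixd (fst h) u1" "fixd (snd h) u2" "f (\<iota> h ** r) \<noteq> 0" using y h Y1 Y2 Ymem by blast+
      obtain t where t: "is_sim J2 (fst h) t" "is_sim J2 (snd h) t" using simh[OF h(1)] by blast
      obtain k where k: "v t + v s = 2 * k" using evn[OF h(1) fh(1) t(1)] by blast
      let ?t = "\<pi> powi k * \<pi> powi k * t0"
      have vt: "v t = v ?t" using k t00 by (simp add: v_mult)
      \<comment> \<open>Equal similitude valuations and integral projections in both planes:
        \<open>fixd_unique\<close> shows that the quotient is integral, hence in
        \<open>U\<close>.\<close>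
      have i: "intmat 0 (fst h ** matrix_inv (fst (H' k)))" "intmat 0 (snd h ** matrix_inv (snd (H' k)))"
        using fixd_unique[OF t(1) H'(4) vt n0(1) fh(1) H'(2)] fixd_unique[OF t(2) H'(5) vt n0(2) fh(2) H'(3)] by auto
      define d where "d = h \<otimes>\<^bsub>H\<^esub> inv\<^bsub>H\<^esub> (H' k)"
      have dH: "d \<in> carrier H" unfolding d_def using h H'(1) by simp
      have de: "d = (fst h ** matrix_inv (fst (H' k)), snd h ** matrix_inv (snd (H' k)))"
        unfolding d_def using H_inv[OF H'(1)] by (simp add: H_mult)
      have tt: "?t \<noteq> 0" using t00 by simp
      have "is_sim J2 (fst d) (t * inverse ?t)" "is_sim J2 (snd d) (t * inverse ?t)"
        unfolding de using is_sim_mult[OF t(1) is_sim_inv(1)[OF herm_J2 H'(4)[of k]]] is_sim_mult[OF t(2) is_sim_inv(1)[OF herm_J2 H'(5)[of k]]]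
        by simp_all
      then have "is_sim J4 (\<iota> d) (t * inverse ?t)" using is_sim_iota[of "fst d" "snd d"] by simp
      moreover have "v (t * inverse ?t) = 0" using vt tt is_simD[OF t(1)] v_inverse[OF tt] v_mult[of t "inverse ?t"] by simp
      moreover have "intmat 0 (\<iota> d)" using i unfolding de intmat_iota by simp
      ultimately have "\<iota> d \<in> K" by (rule K_I)
      then have dU: "d \<in> U" using dH by (simp add: U_def)
      have "h = d \<otimes>\<^bsub>H\<^esub> H' k" unfolding d_def using h H'(1) by (simp add: HG.m_assoc)
      then have "h \<in> U #>\<^bsub>H\<^esub> H' k" using dU unfolding r_coset_def by blast
      then have y': "y = U #>\<^bsub>H\<^esub> H' k" using rcoset_eq[OF H'(1)] h by metis
      then have f0: "f (sc k ** g) \<noteq> 0" using y Ymem[OF H'(1)] H'(6) unfolding Y2_def Y1_def by simp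
      then have "0 \<le> k" "k \<le> 4" using htot_sc_zero[OF g vg] unfolding f_def by force+
      then show "y \<in> (\<lambda>k. U #>\<^bsub>H\<^esub> H' (int k)) ` {k. k \<le> 4 \<and> f (sc (int k) ** g) \<noteq> 0}"
        using f0 y' by (intro image_eqI[of _ _ "nat k"]) auto
    next
      fix y assume "y \<in> (\<lambda>k. U #>\<^bsub>H\<^esub> H' (int k)) ` {k. k \<le> 4 \<and> f (sc (int k) ** g) \<noteq> 0}"
      then obtain k where k: "y = U #>\<^bsub>H\<^esub> H' (int k)" "f (sc (int k) ** g) \<noteq> 0" by blast
      then show "y \<in> Y2" unfolding k(1) Y2[OF H'(1)] Y1[OF H'(1)] Ymem[OF H'(1)] H'(6) using H'(2,3) by blast
    qed
    \<comment> \<open>Different powers of the centre give different similitude valuations, which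
      multiplication by \<open>U\<close> does not change.\<close>
    have inj: "inj_on (\<lambda>k. U #>\<^bsub>H\<^esub> H' (int k)) {k. k \<le> 4 \<and> f (sc (int k) ** g) \<noteq> 0}"
    proof (rule inj_onI)
      fix k l :: nat assume "U #>\<^bsub>H\<^esub> H' (int k) = U #>\<^bsub>H\<^esub> H' (int l)"
      then have "H' (int k) \<in> U #>\<^bsub>H\<^esub> H' (int l)" using rcoset_self[OF H'(1)] by blast
      then obtain x where x: "x \<in> U" "H' (int k) = x \<otimes>\<^bsub>H\<^esub> H' (int l)" unfolding r_coset_def by blast
      have xH: "x \<in> carrier H" "\<iota> x \<in> K" using x(1) by (simp_all add: U_def)
      obtain b where b: "is_sim J2 (fst x) b" "is_sim J2 (snd x) b" using simh[OF xH(1)] by blast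
      have sb: "is_sim J4 (\<iota> x) b" using is_sim_iota[of "fst x" "snd x"] b by simp
      have vb: "v b = 0" "b \<noteq> 0" using K_sim[OF xH(2)] sim_eq[OF herm_J4 sb] is_simD[OF sb] by simp_all
      have "fst (H' (int k)) = fst x ** fst (H' (int l))" using x(2) by (simp add: H_mult)
      then have "is_sim J2 (fst (H' (int k))) (b * (\<pi> powi int l * \<pi> powi int l * t0))"
        using is_sim_mult[OF b(1) H'(4)[of "int l"]] by (simp only:)
      then have "b * (\<pi> powi int l * \<pi> powi int l * t0) = \<pi> powi int k * \<pi> powi int k * t0"
        using is_sim_unique[OF herm_J2 _ H'(4)] by blast
      then have "v (b * (\<pi> powi int l * \<pi> powi int l * t0)) = v (\<pi> powi int k * \<pi> powi int k * t0)" by (simp only:)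
      then show "k = l" using vb t00 by (simp add: v_mult del: power_int_of_nat)
    qed
    have "sum (valU f r) Y2 = (\<Sum>k\<in>{k. k \<le> 4 \<and> f (sc (int k) ** g) \<noteq> 0}. f (sc (int k) ** g))"
      unfolding Y2_eq by (subst sum.reindex[OF inj]) (simp add: valU_eq[OF f(1) r H'(1)] H'(6))
    also have "\<dots> = (\<Sum>k\<le>4. f (sc (int k) ** g))"
      by (rule sum.mono_neutral_left) auto
    finally have sumY2: "sum (valU f r) Y2 = (\<Sum>k\<le>4. f (sc (int k) ** g))" .
    \<comment> \<open>By the normalization of \<open>h0\<close>, integrality of the projections
      makes the images of \<open>w1\<close> and \<open>w2\<close> integral, and
      \<open>special_minors\<close> then excludes the third type.\<close>
    have "g \<notin> BB 0 2"
    proof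
      assume "g \<in> BB 0 2"
      then have gi: "intmat (-1) g" "g \<notin> X1" "g \<in> Xb (-1) 0" by (auto simp: BB_iff Xb_def)
      obtain p q' where h0e: "h0 = (p, q')" by (cases h0)
      have gv: "(g *v w)$1 = p$1$1 * (r *v w)$1 + p$1$2 * (r *v w)$3" "(g *v w)$3 = p$2$1 * (r *v w)$1 + p$2$2 * (r *v w)$3"
        "(g *v w)$2 = q'$1$1 * (r *v w)$2 + q'$1$2 * (r *v w)$4" "(g *v w)$4 = q'$2$1 * (r *v w)$2 + q'$2$2 * (r *v w)$4" for w
        unfolding g_def h0e matrix_vector_mul_assoc[symmetric] by (simp_all add: vec4_mult[of "\<iota> (p, q')"] iota_entry)
      have e1: "(g *v w1)$1 = (p *v u1)$1" "(g *v w1)$3 = (p *v u1)$2" "(g *v w1)$2 = 0" "(g *v w1)$4 = 0"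
        and e2: "(g *v w2)$2 = (q' *v u2)$1" "(g *v w2)$4 = (q' *v u2)$2" "(g *v w2)$1 = 0" "(g *v w2)$3 = 0"
        unfolding gv by (simp_all add: w1(2,3) w2(2,3) vec2_mult u)
      have sp: "is_sim J2 p t0" "is_sim J2 q' t0" "fixd p u1" "fixd q' u2" using h0 h0e by auto
      have nn: "n2 (p *v u1) = t0 * n2 u1" "n2 (q' *v u2) = t0 * n2 u2" using n2_sim sp by auto
      have "(p *v u1)$i \<in> idl 0" for i
        using op2_int_unit[of "p *v u1" i] sp(3) fixd_iff[OF sp(1)] n0 vn t00 nn by (simp add: v_mult)
      moreover have "(q' *v u2)$i \<in> idl 0" for i
        using op2_int_unit[of "q' *v u2" i] sp(4) fixd_iff[OF sp(2)] n0 vn t00 nn by (simp add: v_mult)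
      ultimately have "(g *v w1)$i \<in> idl 0" "(g *v w2)$i \<in> idl 0" for i
        using exhaust_4[of i] e1 e2 by auto
      then have "intmin (-1) g"
        using special_minors[OF g vg gi(1) w1(1) e1(3,4) w1(4,5) w2(1) e2(3,4) w2(4,5)] by blast
      then show False using gi by (simp add: X1_def)
    qed
    then have "ceq (\<Sum>k\<le>4. f (sc (int k) ** g)) 0" unfolding f_def by (rule htot_centre_sum[OF g vg _ c])
    then show ?thesis unfolding sumY2 ceq_def by auto
  qed
  then obtain z3 where z3: "z3 \<in> Zq" "sum (valU f r) Y2 = (real q + 1) * z3" by blast
  have sub: "Y1 \<subseteq> Y" "Y2 \<subseteq> Y1" "finite Y1" using finY by (auto simp: Y1_def Y2_def)
  have "sum (valU f r) Y = (real q + 1) * (z1 + z2 + z3)"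
    using sum.subset_diff[OF sub(1) finY, of "valU f r"] sum.subset_diff[OF sub(2,3), of "valU f r"] z1 z2 z3
    by (simp add: algebra_simps)
  then show "\<exists>z\<in>Zq. sum (valU (htot c) r) (cosU (htot c) r) = (real q + 1) * z"
    using z1 z2 z3 Zq_add unfolding Y_def f_def by (intro bexI[of _ "z1 + z2 + z3"]) auto
qed

text \<open>If \<open>\<nu>\<close> leaves \<open>D\<close> on \<open>Hs r\<close>, the factor
  \<open>q + 1\<close> of the sum over right cosets cancels against the index of \<open>HD r\<close>
  in \<open>Hs r\<close>.\<close>

theorem degree_formula:
  assumes r: "r \<in> carrier G" and c: "odd c"
  shows "\<exists>y\<in>Zq. (\<Sum>A\<in>orbK (htot c) r. valK (htot c) A) = measure \<mu> U / measure \<mu> (HD r) * y"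
proof -
  have d: "(\<Sum>A\<in>orbK (htot c) r. valK (htot c) A) * measure \<mu> (Hs r)
      = sum (valU (htot c) r) (cosU (htot c) r) * measure \<mu> U"
    by (rule double_count(2)[OF htot_biinv htot_outside htot_finite r])
  have p: "0 < measure \<mu> (HD r)" by (rule good_measure_pos[OF good_HD[OF r]])
  show ?thesis
  proof (cases "\<forall>h\<in>Hs r. \<nu> h \<in> D")
    case True
    then have "HD r = Hs r" by (auto simp: HD_def)
    moreover have "sum (valU (htot c) r) (cosU (htot c) r) \<in> Zq"
      by (rule Zq_sum) (simp add: valU_def htot_Zq)
    ultimately show ?thesis using d p by (intro bexI[of _ "sum (valU (htot c) r) (cosU (htot c) r)"]) (simp_all add: field_simps)
  next
    case False
    then obtain hx where hx: "hx \<in> Hs r" "\<nu> hx \<notin> D" by blast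
    obtain z where z: "z \<in> Zq" "sum (valU (htot c) r) (cosU (htot c) r) = (real q + 1) * z"
      using cosU_sum(1)[OF r hx c] by blast
    have m: "measure \<mu> (Hs r) = (real q + 1) * measure \<mu> (HD r)"
      by (rule measure_Hs_HD[OF r cosU_sum(2)[OF r hx c]])
    have "(real q + 1) * ((\<Sum>A\<in>orbK (htot c) r. valK (htot c) A) * measure \<mu> (HD r)) = (real q + 1) * (z * measure \<mu> U)"
      using d unfolding m z(2) by (simp add: algebra_simps)
    then have "(\<Sum>A\<in>orbK (htot c) r. valK (htot c) A) * measure \<mu> (HD r) = z * measure \<mu> U"
      by (subst (asm) mult_left_cancel) (simp_all add: add_nonneg_eq_0_iff)
    then show ?thesis using z(1) p by (intro bexI[of _ z]) (simp_all add: field_simps)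
  qed
qed

end

section \<open>The zeta element\<close>

lemma rat_image_of_rat [simp]: "rat_image (real_of_rat x) = (of_rat x :: 'p::field_char_0)"
  by (simp add: rat_image_def the_inv_f_f inj_def)

lemma rat_image_add:
  assumes "x \<in> \<rat>" "y \<in> \<rat>"
  shows "rat_image (x + y) = (rat_image x + rat_image y :: 'p::field_char_0)"
proof -
  obtain a b where ab: "x = of_rat a" "y = of_rat b" using assms by (auto elim!: Rats_cases)
  have "x + y = real_of_rat (a + b)" by (simp add: ab of_rat_add)
  then have "rat_image (x + y) = (of_rat (a + b) :: 'p)" by (simp only: rat_image_of_rat)
  then show ?thesis by (simp add: ab of_rat_add)
qed

lemma rat_image_mult:
  assumes "x \<in> \<rat>" "y \<in> \<rat>"
  shows "rat_image (x * y) = (rat_image x * rat_image y :: 'p::field_char_0)"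
proof -
  obtain a b where ab: "x = of_rat a" "y = of_rat b" using assms by (auto elim!: Rats_cases)
  have "x * y = real_of_rat (a * b)" by (simp add: ab of_rat_mult)
  then have "rat_image (x * y) = (of_rat (a * b) :: 'p)" by (simp only: rat_image_of_rat)
  then show ?thesis by (simp add: ab of_rat_mult)
qed

lemma rat_image_0 [simp]: "rat_image 0 = (0 :: 'p::field_char_0)"
  using rat_image_of_rat[of 0] by simp

lemma rat_image_sum:
  assumes "\<And>i. i \<in> A \<Longrightarrow> f i \<in> \<rat>"
  shows "rat_image (sum f A) = (\<Sum>i\<in>A. rat_image (f i) :: 'p::field_char_0)"
proof -
  have "sum f A \<in> \<rat> \<and> rat_image (sum f A) = (\<Sum>i\<in>A. rat_image (f i) :: 'p)"
    using assms by (induction A rule: infinite_finite_induct) (simp_all add: rat_image_add)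
  then show ?thesis ..
qed

lemma sum_fun_eval: "(\<Sum>i\<in>A. F i) x = (\<Sum>i\<in>A. F i x :: 'p::field_char_0)"
  by (induction A rule: infinite_finite_induct) auto

context odd_unramified_haar
begin

interpretation HG: group H by (rule H_group)

definition tr :: "('e^2^2) \<times> ('e^2^2) \<Rightarrow> ('e^4^4) set \<Rightarrow> ('e^4^4) set" where
  "tr h A = (\<lambda>x. \<iota> h ** x) ` A"

lemma tr_lc: "h \<in> carrier H \<Longrightarrow> tr h (lc g) = lc (\<iota> h ** g)"
  unfolding tr_def by (rule lc_mult[OF iota_G])

lemma tr_tr: "tr h (tr h' A) = tr (h \<otimes>\<^bsub>H\<^esub> h') A"
  by (simp add: tr_def image_image iota_hom matrix_mul_assoc)

lemma tr_one: "tr \<one>\<^bsub>H\<^esub> A = A"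
  by (simp add: tr_def iota_one)

text \<open>Choosing from the orbit as a set yields the same coset for all cosets of one
  orbit.\<close>

definition orbit_rep :: "('e^4^4) set \<Rightarrow> ('e^4^4) set" where
  "orbit_rep A = (SOME B. B \<in> (\<lambda>h. tr h A) ` carrier H)"

lemma orbit_rep: obtains h where "h \<in> carrier H" "orbit_rep A = tr h A"
proof -
  have "tr \<one>\<^bsub>H\<^esub> A \<in> (\<lambda>h. tr h A) ` carrier H" by blast
  then have "orbit_rep A \<in> (\<lambda>h. tr h A) ` carrier H" unfolding orbit_rep_def by (rule someI)
  then show thesis using that by blast
qed

lemma orbit_rep_tr: "h \<in> carrier H \<Longrightarrow> orbit_rep (tr h A) = orbit_rep A"
proof -
  assume h: "h \<in> carrier H"
  have "(\<lambda>x. tr x (tr h A)) ` carrier H = (\<lambda>x. tr x A) ` carrier H"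
  proof (intro equalityI subsetI)
    fix B assume "B \<in> (\<lambda>x. tr x (tr h A)) ` carrier H"
    then obtain x where "x \<in> carrier H" "B = tr (x \<otimes>\<^bsub>H\<^esub> h) A" by (auto simp: tr_tr)
    then show "B \<in> (\<lambda>x. tr x A) ` carrier H" using h by blast
  next
    fix B assume "B \<in> (\<lambda>x. tr x A) ` carrier H"
    then obtain x where x: "x \<in> carrier H" "B = tr x A" by blast
    have "x \<otimes>\<^bsub>H\<^esub> inv\<^bsub>H\<^esub> h \<otimes>\<^bsub>H\<^esub> h = x" using x(1) h by (simp add: HG.m_assoc)
    then have "B = tr (x \<otimes>\<^bsub>H\<^esub> inv\<^bsub>H\<^esub> h) (tr h A)" using x by (simp add: tr_tr)
    then show "B \<in> (\<lambda>x. tr x (tr h A)) ` carrier H" using x(1) h by blast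
  qed
  then show ?thesis by (simp add: orbit_rep_def)
qed

text \<open>Identifies the cosets whose values are moved to \<open>lc r\<close> with the index set
  of the sum in \<open>degree_formula\<close>.\<close>

lemma fiber_orbK:
  assumes f: "\<And>g. g \<notin> carrier G \<Longrightarrow> f g = 0" and r: "r \<in> carrier G"
    and A0: "A0 \<in> lc ` {g. f g \<noteq> 0}" "r \<in> orbit_rep A0"
  shows "{A \<in> lc ` {g. f g \<noteq> 0}. r \<in> orbit_rep A} = orbK f r"
proof -
  have rep: "orbit_rep A = lc r \<and> (\<exists>h\<in>carrier H. A = tr h (lc r))" if A: "A \<in> lc ` {g. f g \<noteq> 0}" "r \<in> orbit_rep A" for A
  proof -
    obtain g where g: "A = lc g" using A by blast
    obtain h where h: "h \<in> carrier H" "orbit_rep A = tr h A" by (rule orbit_rep)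
    have "orbit_rep A = lc (\<iota> h ** g)" using h g tr_lc by simp
    then have e: "orbit_rep A = lc r" using A(2) lc_eq by metis
    have "A = tr (inv\<^bsub>H\<^esub> h) (tr h A)" using h(1) by (simp add: tr_tr tr_one)
    then have "A = tr (inv\<^bsub>H\<^esub> h) (lc r)" using e h(2) by simp
    then show ?thesis using e h(1) by blast
  qed
  show ?thesis
  proof (intro equalityI subsetI)
    fix A assume "A \<in> {A \<in> lc ` {g. f g \<noteq> 0}. r \<in> orbit_rep A}"
    then have A: "A \<in> lc ` {g. f g \<noteq> 0}" "r \<in> orbit_rep A" by auto
    obtain h where h: "h \<in> carrier H" "A = tr h (lc r)" using rep[OF A] by blast
    then have "\<iota> h ** r \<in> A" using tr_lc lc_self by simp
    then show "A \<in> orbK f r" using A h unfolding orbK_def by blast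
  next
    fix A assume A: "A \<in> orbK f r"
    then obtain h g where h: "h \<in> carrier H" "\<iota> h ** r \<in> A" "A = lc g" and A': "A \<in> lc ` {g. f g \<noteq> 0}"
      by (auto simp: orbK_def)
    then have "A = tr h (lc r)" using tr_lc[OF h(1)] lc_eq by metis
    also have "lc r = orbit_rep A0" using rep[OF A0] by simp
    finally have "orbit_rep A = orbit_rep (orbit_rep A0)" using orbit_rep_tr[OF h(1)] by simp
    also have "\<dots> = orbit_rep A0" by (metis orbit_rep orbit_rep_tr)
    finally show "A \<in> {A \<in> lc ` {g. f g \<noteq> 0}. r \<in> orbit_rep A}" using A' A0(2) by simp
  qed
qed

definition zeta_fun :: "('e^4^4 \<Rightarrow> real) \<Rightarrow> 'e^4^4 \<Rightarrow> 'p::field_char_0" where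
  "zeta_fun f g = (\<Sum>A\<in>lc ` {g. f g \<noteq> 0}. rat_image (valK f A) * (if g \<in> orbit_rep A then 1 else 0))"

lemma coset_mem_right: "g \<in> carrier G \<Longrightarrow> k \<in> K \<Longrightarrow> g ** k \<in> lc x \<longleftrightarrow> g \<in> lc x"
proof -
  assume "g \<in> carrier G" "k \<in> K"
  then have "lc (g ** k) = lc g" using lc_eq[of "g ** k" g] by (auto simp: lc_def)
  then show ?thesis using lc_eq_iff by metis
qed

lemma orbit_rep_lc: "A = lc g \<Longrightarrow> \<exists>x. orbit_rep A = lc x"
  by (rule orbit_rep[of A]) (metis tr_lc)

lemma indicator_inv_functions:
  "x \<in> carrier G \<Longrightarrow> ext_C (\<lambda>g. if g \<in> lc x then 1 else 0 :: 'p::field_char_0) \<in> inv_functions"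
proof (rule ext_C_inv_functions)
  fix g k assume "g \<in> carrier G" "k \<in> K"
  then show "(if g ** k \<in> lc x then 1 else 0) = (if g \<in> lc x then 1 else 0 :: 'p)" using coset_mem_right by simp
next
  have "lc ` {g \<in> carrier G. (if g \<in> lc x then 1 else 0 :: 'p) \<noteq> 0} \<subseteq> {lc x}" using lc_eq by (auto split: if_splits)
  then show "finite (lc ` {g \<in> carrier G. (if g \<in> lc x then 1 else 0 :: 'p) \<noteq> 0})" by (rule finite_subset) simp
qed

lemma zeta_fun_inv_functions:
  assumes f: "finite (lc ` {g. f g \<noteq> 0})"
  shows "ext_C (zeta_fun f :: _ \<Rightarrow> 'p::field_char_0) \<in> inv_functions"
proof (rule ext_C_inv_functions)
  fix g k assume gk: "g \<in> carrier G" "k \<in> K"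
  show "zeta_fun f (g ** k) = (zeta_fun f g :: 'p)"
    unfolding zeta_fun_def
  proof (rule sum.cong[OF refl])
    fix A assume "A \<in> lc ` {g. f g \<noteq> 0}"
    then obtain x where "orbit_rep A = lc x" using orbit_rep_lc by blast
    then show "rat_image (valK f A) * (if g ** k \<in> orbit_rep A then 1 else 0) = (rat_image (valK f A) * (if g \<in> orbit_rep A then 1 else 0) :: 'p)"
      using coset_mem_right[OF gk] by simp
  qed
next
  have "lc ` {g \<in> carrier G. (zeta_fun f g :: 'p) \<noteq> 0} \<subseteq> orbit_rep ` (lc ` {g. f g \<noteq> 0})"
  proof
    fix B assume "B \<in> lc ` {g \<in> carrier G. (zeta_fun f g :: 'p) \<noteq> 0}"
    then obtain g where g: "B = lc g" "(zeta_fun f g :: 'p) \<noteq> 0" by blast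
    from g(2) obtain A where A: "A \<in> lc ` {g. f g \<noteq> 0}" "g \<in> orbit_rep A"
      unfolding zeta_fun_def by (rule sum.not_neutral_contains_not_neutral) (auto split: if_splits)
    obtain x where "orbit_rep A = lc x" using A(1) orbit_rep_lc by blast
    then have "B = orbit_rep A" using A(2) g(1) lc_eq by metis
    then show "B \<in> orbit_rep ` (lc ` {g. f g \<noteq> 0})" using A(1) by blast
  qed
  then show "finite (lc ` {g \<in> carrier G. (zeta_fun f g :: 'p) \<noteq> 0})" using f finite_subset by blast
qed

lemma hecke_poly_Zq: "k \<le> 4 \<Longrightarrow> hecke_poly c k g \<in> Zq"
  by (simp add: hecke_poly_eq ftab_def hq_Zq)

lemma hecke_tilde_eq: "(hecke_tilde c :: _ \<Rightarrow> 'p::field_char_0) = ext_C (\<lambda>g. rat_image (htot c g))"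
proof (rule ext)
  fix x :: "('e^4^4) \<times> 'e"
  obtain g t where x: "x = (g, t)" by (cases x)
  have "(\<Sum>k\<le>4. rat_image (hecke_poly c k g)) = (rat_image (htot c g) :: 'p)"
    unfolding htot_def by (rule rat_image_sum[symmetric]) (simp add: Zq_Rats hecke_poly_Zq)
  then show "(hecke_tilde c x :: 'p) = ext_C (\<lambda>g. rat_image (htot c g)) x"
    using htot_outside[of g c] by (simp add: x hecke_tilde_def ext_C_def degree_S_bc)
qed

lemma module_fun: "module (\<lambda>(a :: 'p::field_char_0) (\<xi> :: ('e^4^4) \<times> 'e \<Rightarrow> 'p) g. a * \<xi> g)"
  by unfold_locales (auto simp: fun_eq_iff algebra_simps)

lemma H_act_indicator:
  assumes h: "h \<in> carrier H" and x: "x \<in> carrier G"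
  shows "H_act h (ext_C (\<lambda>g. if g \<in> lc x then 1 else 0 :: 'p::field_char_0)) = ext_C (\<lambda>g. if g \<in> tr h (lc x) then 1 else 0)"
proof (rule ext)
  fix y :: "('e^4^4) \<times> 'e"
  obtain g t where y: "y = (g, t)" by (cases y)
  have hi: "inv\<^bsub>H\<^esub> h \<in> carrier H" using h by simp
  have "\<iota> (inv\<^bsub>H\<^esub> h) ** g \<in> lc x \<longleftrightarrow> g \<in> tr h (lc x)"
  proof
    assume "\<iota> (inv\<^bsub>H\<^esub> h) ** g \<in> lc x"
    then have "\<iota> h ** (\<iota> (inv\<^bsub>H\<^esub> h) ** g) \<in> tr h (lc x)" by (auto simp: tr_def)
    then show "g \<in> tr h (lc x)" using h by (simp add: matrix_mul_assoc iota_one flip: iota_hom)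
  next
    assume "g \<in> tr h (lc x)"
    then obtain z where "z \<in> lc x" "g = \<iota> h ** z" by (auto simp: tr_def)
    then show "\<iota> (inv\<^bsub>H\<^esub> h) ** g \<in> lc x" using h by (simp add: matrix_mul_assoc iota_one flip: iota_hom)
  qed
  then show "H_act h (ext_C (\<lambda>g. if g \<in> lc x then 1 else 0 :: 'p)) y = ext_C (\<lambda>g. if g \<in> tr h (lc x) then 1 else 0) y"
    using nu_in_C[OF hi] C_mult G_mult[OF iota_G[OF hi]]
    by (auto simp: y H_act_def Gt_carrier \<iota>t_def Gt_mult ext_C_def)
qed

text \<open>Both functions are combinations of coset indicators with the same coefficients, and
  moving a coset to its representative by \<open>h\<close> changes its indicator
  \<open>\<xi>\<close> by \<open>H_act h \<xi> - \<xi>\<close>.\<close>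

lemma zeta_fun_coinv:
  assumes f: "biinv f" "\<And>g. g \<notin> carrier G \<Longrightarrow> f g = 0" "finite (lc ` {g. f g \<noteq> 0})"
  shows "ext_C (zeta_fun f) - ext_C (\<lambda>g. rat_image (f g)) \<in> (coinv_kernel :: (('e^4^4) \<times> 'e \<Rightarrow> 'p::field_char_0) set)"
proof -
  interpret M: module "\<lambda>(a :: 'p) (\<xi> :: ('e^4^4) \<times> 'e \<Rightarrow> 'p) g. a * \<xi> g" by (rule module_fun)
  let ?S = "lc ` {g. f g \<noteq> 0}"
  let ?\<delta> = "\<lambda>A. ext_C (\<lambda>g. if g \<in> A then 1 else 0 :: 'p)"
  have SG: "\<exists>x\<in>carrier G. A = lc x" if "A \<in> ?S" for A using that f(2) by blast
  have e: "rat_image (f g) = (\<Sum>A\<in>?S. rat_image (valK f A) * (if g \<in> A then 1 else 0 :: 'p))" for g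
  proof -
    have "(\<Sum>A\<in>?S. rat_image (valK f A) * (if g \<in> A then 1 else 0 :: 'p)) = (\<Sum>A\<in>?S. if A = lc g then rat_image (f g) else 0)"
    proof (rule sum.cong[OF refl])
      fix A assume A: "A \<in> ?S"
      then obtain x where x: "x \<in> carrier G" "A = lc x" using SG by blast
      have m: "g \<in> A \<longleftrightarrow> A = lc g" using x(2) lc_eq_iff by metis
      have "valK f A = f g" if "A = lc g"
      proof -
        have "g \<in> carrier G" using that x lc_self lc_sub_G by blast
        then show ?thesis using valK_eq[OF f(1)] that by simp
      qed
      then show "rat_image (valK f A) * (if g \<in> A then 1 else 0) = (if A = lc g then rat_image (f g) else 0 :: 'p)"
        using m by auto
    qed
    also have "\<dots> = rat_image (f g)"
    proof (cases "f g = 0")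
      case False
      then have "lc g \<in> ?S" by blast
      then show ?thesis using f(3) by simp
    next
      case True
      show ?thesis unfolding True rat_image_0 by (rule sum.neutral) simp
    qed
    finally show ?thesis ..
  qed
  have "ext_C (zeta_fun f) - ext_C (\<lambda>g. rat_image (f g)) =
      (\<Sum>A\<in>?S. (\<lambda>y. rat_image (valK f A) * (?\<delta> (orbit_rep A) - ?\<delta> A) y))"
  proof (rule ext)
    fix y :: "('e^4^4) \<times> 'e"
    show "(ext_C (zeta_fun f) - ext_C (\<lambda>g. rat_image (f g))) y =
      (\<Sum>A\<in>?S. (\<lambda>y. rat_image (valK f A) * (?\<delta> (orbit_rep A) - ?\<delta> A) y)) y"
    proof (cases "fst y \<in> carrier G \<and> snd y \<in> C")
      case True
      then show ?thesis unfolding sum_fun_eval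
        by (cases y) (simp add: ext_C_def e zeta_fun_def sum_subtractf right_diff_distrib)
    next
      case False
      then have "ext_C z y = 0" for z :: "_ \<Rightarrow> 'p" by (cases y) (auto simp: ext_C_def)
      then show ?thesis unfolding sum_fun_eval by simp
    qed
  qed
  also have "\<dots> \<in> coinv_kernel"
    unfolding coinv_kernel_def
  proof (rule M.span_sum, rule M.span_scale, rule M.span_base)
    fix A assume "A \<in> ?S"
    then obtain x where x: "x \<in> carrier G" "A = lc x" using SG by blast
    obtain h where h: "h \<in> carrier H" "orbit_rep A = tr h A" by (rule orbit_rep)
    have "?\<delta> (orbit_rep A) - ?\<delta> A = H_act h (?\<delta> A) - ?\<delta> A"
      unfolding x(2) H_act_indicator[OF h(1) x(1)] h(2)[unfolded x(2)] ..
    moreover have "?\<delta> A \<in> inv_functions" unfolding x(2) by (rule indicator_inv_functions[OF x(1)])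
    ultimately show "?\<delta> (orbit_rep A) - ?\<delta> A \<in> {H_act h \<xi> - \<xi> | h \<xi>. h \<in> carrier H \<and> \<xi> \<in> inv_functions}"
      using h(1) by blast
  qed
  finally show ?thesis .
qed

lemma rat_image_coefficient:
  assumes R: "coefficient_ring R" and x: "x \<in> Zq"
  shows "(rat_image x :: 'p::field_char_0) \<in> R"
proof -
  have one: "1 \<in> R" and diff: "\<And>x y. x \<in> R \<Longrightarrow> y \<in> R \<Longrightarrow> x - y \<in> R" and mult: "\<And>x y. x \<in> R \<Longrightarrow> y \<in> R \<Longrightarrow> x * y \<in> R"
    and iq: "inverse (of_nat q) \<in> R" using R by (auto simp: coefficient_ring_def)
  have zero: "0 \<in> R" using diff[OF one one] by simp
  have minus: "- x \<in> R" if "x \<in> R" for x using diff[OF zero that] by simp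
  have add: "x + y \<in> R" if "x \<in> R" "y \<in> R" for x y using diff[OF that(1) minus[OF that(2)]] by simp
  have nat: "of_nat n \<in> R" for n by (induction n) (simp_all add: zero one add)
  have int: "of_int a \<in> R" for a by (cases a rule: int_cases2) (simp_all add: nat minus)
  have pow: "inverse (of_nat q) ^ n \<in> R" for n by (induction n) (simp_all add: one mult iq)
  obtain a n where "x = of_int a / real q ^ n" using x by (auto simp: Zq_def)
  then have "x = real_of_rat (of_int a * inverse (of_nat q) ^ n)"
    by (simp add: of_rat_mult of_rat_power of_rat_inverse divide_inverse power_inverse)
  then have "rat_image x = (of_rat (of_int a * inverse (of_nat q) ^ n) :: 'p)" by (simp only: rat_image_of_rat)
  then show ?thesis using mult[OF int pow] by (simp add: of_rat_mult of_rat_power of_rat_inverse)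
qed

text \<open>Both measures are integer multiples of that of the intersection. This is needed because
  \<open>rat_image\<close> is meaningful only on rational numbers.\<close>

lemma measure_ratio_rat:
  assumes V: "good V" and W: "good W" shows "measure \<mu> V / measure \<mu> W \<in> \<rat>"
proof -
  have I: "good (V \<inter> W)" by (rule good_Int[OF V W])
  have "measure \<mu> V = real (idx V (V \<inter> W)) * measure \<mu> (V \<inter> W)" "measure \<mu> W = real (idx W (V \<inter> W)) * measure \<mu> (V \<inter> W)"
    using measure_idx[OF V I] measure_idx[OF W I] by auto
  then have "measure \<mu> V / measure \<mu> W = real (idx V (V \<inter> W)) / real (idx W (V \<inter> W))"
    using good_measure_pos[OF I] by simp
  then show ?thesis by simp
qed

theorem zeta_element_exists:
  assumes R: "coefficient_ring (R :: 'p::field_char_0 set)" and c: "odd c"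
  shows "zeta_element \<mu> R 1 (hecke_tilde c) Lt (ext_C (zeta_fun (htot c)))"
  unfolding zeta_element_def
proof (intro conjI ballI)
  let ?f = "htot c"
  note f = htot_biinv[of c] htot_outside[of _ c] htot_finite[of c]
  show "ext_C (zeta_fun ?f) \<in> inv_functions" by (rule zeta_fun_inv_functions[OF f(3)])
  have "(\<lambda>g. hecke_tilde c g * 1) = (ext_C (\<lambda>g. rat_image (htot c g)) :: _ \<Rightarrow> 'p)" by (simp add: hecke_tilde_eq)
  then show "ext_C (zeta_fun ?f) - (\<lambda>g. hecke_tilde c g * (1 :: 'p)) \<in> coinv_kernel"
    using zeta_fun_coinv[OF f] by simp
  fix x assume x: "x \<in> carrier Gt"
  obtain r t where rt: "x = (r, t)" "r \<in> carrier G" "t \<in> C" using x by (cases x) (auto simp: Gt_carrier)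
  have GtG: "group Gt" unfolding Gt_def using DirProd_group[OF GU_group[OF herm_J4]] T_group comm_group.axioms(2) by blast
  have z: "ext_C (zeta_fun ?f) x = (zeta_fun ?f r :: 'p)" using rt by (simp add: ext_C_def)
  show "\<exists>Vxs. (\<forall>(V, y)\<in>set Vxs. compact_open_subgroup V \<and>
      \<iota>t ` V \<subseteq> (x <#\<^bsub>Gt\<^esub> Lt) #>\<^bsub>Gt\<^esub> inv\<^bsub>Gt\<^esub> x \<and> y \<in> R) \<and>
      ext_C (zeta_fun ?f) x = (\<Sum>(V, y)\<leftarrow>Vxs. rat_image (measure \<mu> U / measure \<mu> V) * y)"
  proof (cases "\<exists>A\<in>lc ` {g. ?f g \<noteq> 0}. r \<in> orbit_rep A")
    case False
    then have "zeta_fun ?f r = (0 :: 'p)" unfolding zeta_fun_def by (intro sum.neutral) auto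
    \<comment> \<open>Off the chosen representatives the value is 0, given by the empty sum.\<close>
    then show ?thesis using z by (intro exI[of _ "[]"]) simp
  next
    case True
    then obtain A0 where A0: "A0 \<in> lc ` {g. ?f g \<noteq> 0}" "r \<in> orbit_rep A0" by blast
    note fib = fiber_orbK[OF f(2) rt(2) A0]
    obtain y where y: "y \<in> Zq" "(\<Sum>A\<in>orbK ?f r. valK ?f A) = measure \<mu> U / measure \<mu> (HD r) * y"
      using degree_formula[OF rt(2) c] by blast
    have "zeta_fun ?f r = (\<Sum>A\<in>lc ` {g. ?f g \<noteq> 0}. if r \<in> orbit_rep A then rat_image (valK ?f A) else 0 :: 'p)"
      unfolding zeta_fun_def by (intro sum.cong) auto
    also have "\<dots> = (\<Sum>A\<in>{A \<in> lc ` {g. ?f g \<noteq> 0}. r \<in> orbit_rep A}. rat_image (valK ?f A))"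
      by (rule sum.inter_filter[OF f(3), symmetric])
    also have "\<dots> = (\<Sum>A\<in>orbK ?f r. rat_image (valK ?f A))" by (rule sum.cong[OF fib refl])
    also have "\<dots> = rat_image (\<Sum>A\<in>orbK ?f r. valK ?f A)"
      by (rule rat_image_sum[symmetric]) (simp add: valK_def Zq_Rats htot_Zq)
    also have "\<dots> = rat_image (measure \<mu> U / measure \<mu> (HD r)) * rat_image y"
      unfolding y(2) by (rule rat_image_mult[OF measure_ratio_rat[OF good_U good_HD[OF rt(2)]] Zq_Rats[OF y(1)]])
    finally have "ext_C (zeta_fun ?f) x = rat_image (measure \<mu> U / measure \<mu> (HD r)) * (rat_image y :: 'p)" unfolding z .
    \<comment> \<open>In the first factor, conjugation by \<open>x\<close> carries the stabilizer
      into \<open>K\<close>. The second factor is commutative, so there conjugation does nothing and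
      \<open>\<nu> h\<close> itself must lie in \<open>D\<close>; this dictates the choice of
      \<open>HD r\<close>.\<close>
    moreover have "\<iota>t ` HD r \<subseteq> (x <#\<^bsub>Gt\<^esub> Lt) #>\<^bsub>Gt\<^esub> inv\<^bsub>Gt\<^esub> x"
    proof (rule image_subsetI)
      fix h assume "h \<in> HD r"
      then have h: "h \<in> Hs r" "\<nu> h \<in> D" by (auto simp: HD_def)
      have hH: "h \<in> carrier H" "matrix_inv r ** \<iota> h ** r \<in> K" using h(1) by (simp_all add: Hs_def)
      let ?k = "(matrix_inv r ** \<iota> h ** r, \<nu> h)"
      have kL: "?k \<in> Lt" using hH(2) h(2) by (simp add: Lt_def)
      have hG: "\<iota>t h \<in> carrier Gt" using iota_G[OF hH(1)] nu_in_C[OF hH(1)] by (simp add: Gt_carrier \<iota>t_def)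
      have "r ** (matrix_inv r ** \<iota> h ** r) = r ** matrix_inv r ** \<iota> h ** r" by (simp only: matrix_mul_assoc)
      then have "x \<otimes>\<^bsub>Gt\<^esub> ?k = \<iota>t h \<otimes>\<^bsub>Gt\<^esub> x"
        using GU_inv_cancel[OF herm_J4 rt(2)] by (simp add: rt(1) Gt_mult \<iota>t_def mult.commute)
      then have "\<iota>t h \<otimes>\<^bsub>Gt\<^esub> x \<in> x <#\<^bsub>Gt\<^esub> Lt" using kL unfolding l_coset_def by blast
      moreover have "\<iota>t h = (\<iota>t h \<otimes>\<^bsub>Gt\<^esub> x) \<otimes>\<^bsub>Gt\<^esub> inv\<^bsub>Gt\<^esub> x"
        using group.inv_solve_right'[OF GtG] hG x GtG by (simp add: group.is_monoid monoid.m_assoc group.r_inv monoid.r_one group.inv_closed)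
      ultimately show "\<iota>t h \<in> (x <#\<^bsub>Gt\<^esub> Lt) #>\<^bsub>Gt\<^esub> inv\<^bsub>Gt\<^esub> x" unfolding r_coset_def by blast
    qed
    moreover have "compact_open_subgroup (HD r)" by (rule good_compact_open[OF good_HD[OF rt(2)]])
    ultimately show ?thesis using rat_image_coefficient[OF R y(1)]
      by (intro exI[of _ "[(HD r, rat_image y)]"]) simp
  qed
qed

end

theorem theorem8p4p1:
  fixes F :: "'e::field_char_0 set" and v :: "'e \<Rightarrow> int"
    and \<gamma> :: "'e \<Rightarrow> 'e" and \<pi> :: 'e
    and \<O> :: "'p::field_char_0 set"
    and \<mu> :: "(('e^2^2) \<times> ('e^2^2)) measure"
  assumes "unramified_quadratic_extension F v \<gamma> \<pi>"
    and "gu4_data.coefficient_ring F v \<O>"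
    and "left_haar_measure (gu4_data.H_top F v \<gamma>) (gu4_data.H F \<gamma>) \<mu>"
    and "2 \<in> val_units F v"
  shows "\<forall>c::int. odd c \<longrightarrow>
    (\<exists>\<zeta>. gu4_data.zeta_element F v \<gamma> \<mu> \<O> 1 (gu4_data.hecke_tilde F v \<gamma> \<pi> c)
       (gu4_data.Lt F v \<gamma> \<pi>) \<zeta>)"
proof -
  interpret unramified_quadratic_extension F v \<gamma> \<pi> by (rule assms(1))
  interpret odd_unramified_haar F v \<gamma> \<pi> \<mu> by unfold_locales (use assms in auto)
  show ?thesis using zeta_element_exists[OF assms(2)] by blast
qed

end
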